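(* Let $\Omega\subset\mathbb R^n$ be a bounded open set with Lipschitz boundary, let $\alpha>0$, let $E$ be a compact subset of $\Omega$ with boundary of class $C^{1,1}$, and let $g:=1_E$ be its characteristic function. Let $\psi:\overline\Omega\to\mathbb R^n$ be a Lipschitz vectorfield which agrees on $\partial E$ with the inner unit normal of $\partial E$, is supported on a neighbourhood of $\partial E$ which is relatively compact in $\Omega$, and satisfies $|\psi|\le1$ everywhere. If $$\beta>\beta_0:=\max\Big\{\tfrac1{16}\|\operatorname{div}\psi\|_\infty+\tfrac1{128},\ 16\,\alpha\,\|\operatorname{div}\psi\|_\infty+64\,\alpha^2\Big\},$$ then $u:=g$ is the unique absolute minimizer on $SBV(\Omega)$ of the Mumford–Shah functional $$F(v):=\int_{\Omega}|\nabla v|^2\,dx+\alpha\,\mathcal H^{n-1}(Sv)+\beta\int_\Omega(v-g)^2\,dx .$$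
   Context: An absolute minimizer of $F$ is a function $u\in SBV(\Omega)$ with $F(u)\le F(v)$ for all $v\in SBV(\Omega)$; uniqueness is meant up to equality almost everywhere. The boundary of $E$ being of class $C^{1,1}$ means that, near each point of $\partial E$, $E$ is (in suitable orthonormal coordinates) the closed subgraph of a $C^{1,1}$ function. For $v\in BV(\Omega)$: $Sv$ is the set of points of $\Omega$ where $v$ has no approximate limit, where $v$ has approximate limit $a$ at $x$ if $\lim_{r\to0}r^{-n}\int_{B(x,r)}|v(y)-a|\,dy=0$; $\nabla v$ is the approximate gradient (density of $Dv$ with respect to Lebesgue measure $\mathcal L^n$). $SBV(\Omega)$ is the space of $v\in BV(\Omega)$ such that $Dv=\nabla v\cdot\mathcal L^n+(v^+-v^-)\nu_v\cdot\mathcal H^{n-1}\llcorner Sv$, with $v^\pm$ the approximate one-sided limits on $Sv$ and $\nu_v$ the approximate unit normal to $Sv$ pointing from the side of $v^-$ to that of $v^+$. *)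

theory Defs
  imports "HOL-Analysis.Analysis" "HOL-Probability.Essential_Supremum"
begin

section \<open>Hausdorff measure\<close>

text \<open>The constant is normalised so that the \<open>k\<close>-dimensional measure of a \<open>k\<close>-dimensional unit ball
  is \<open>unit_ball_vol k\<close>. The empty set is treated separately so that for \<open>k = 0\<close>, where \<open>0 ^ 0 = 1\<close>,
  one gets the counting measure. Boundedness is required because \<open>diameter\<close> is only meaningful
  for bounded sets.\<close>

definition hausdorff_pre :: "nat \<Rightarrow> real \<Rightarrow> 'a::euclidean_space set \<Rightarrow> ennreal" where
  "hausdorff_pre k \<delta> A =
    (INF C \<in> {C :: nat \<Rightarrow> 'a set. A \<subseteq> (\<Union>i. C i) \<and> (\<forall>i. bounded (C i) \<and> diameter (C i) \<le> \<delta>)}.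
      (\<Sum>i. if C i = {} then 0
           else ennreal (unit_ball_vol (real k) * (diameter (C i) / 2) ^ k)))"

definition hausdorff_outer :: "nat \<Rightarrow> 'a::euclidean_space set \<Rightarrow> ennreal" where
  "hausdorff_outer k A = (SUP \<delta>\<in>{0<..}. hausdorff_pre k \<delta> A)"

definition hausdorff_measure :: "nat \<Rightarrow> 'a::euclidean_space measure" where
  "hausdorff_measure k = measure_of UNIV (sets borel) (hausdorff_outer k)"


section \<open>Regularity of boundaries\<close>

text \<open>A function of the coordinates orthogonal to the unit vector \<open>\<nu>\<close>, viewed as a function on the
  whole space that is constant along \<open>\<nu>\<close>. In orthonormal coordinates whose last axis is \<open>\<nu>\<close>, the
  closed subgraph of \<open>\<gamma>\<close> is then the set of all \<open>x\<close> with \<open>x \<bullet> \<nu> \<le> \<gamma> x\<close>.\<close>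

definition graph_function :: "'a::euclidean_space \<Rightarrow> ('a \<Rightarrow> real) \<Rightarrow> bool" where
  "graph_function \<nu> \<gamma> \<longleftrightarrow> norm \<nu> = 1 \<and> (\<forall>x t. \<gamma> (x + t *\<^sub>R \<nu>) = \<gamma> x)"

definition lipschitz_boundary :: "'a::euclidean_space set \<Rightarrow> bool" where
  "lipschitz_boundary \<Omega> \<longleftrightarrow>
    (\<forall>p\<in>frontier \<Omega>. \<exists>r>0. \<exists>\<nu> \<gamma> L. graph_function \<nu> \<gamma> \<and> L-lipschitz_on UNIV \<gamma> \<and>
      \<Omega> \<inter> ball p r = {x \<in> ball p r. x \<bullet> \<nu> < \<gamma> x})"

definition C11_function :: "('a::euclidean_space \<Rightarrow> real) \<Rightarrow> bool" where
  "C11_function \<gamma> \<longleftrightarrow> (\<exists>D L. (\<forall>x. GDERIV \<gamma> x :> D x) \<and> L-lipschitz_on UNIV D)"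

definition C11_chart ::
  "'a::euclidean_space set \<Rightarrow> 'a \<Rightarrow> real \<Rightarrow> 'a \<Rightarrow> ('a \<Rightarrow> real) \<Rightarrow> bool" where
  "C11_chart E p r \<nu> \<gamma> \<longleftrightarrow> r > 0 \<and> graph_function \<nu> \<gamma> \<and> C11_function \<gamma> \<and>
      E \<inter> ball p r = {x \<in> ball p r. x \<bullet> \<nu> \<le> \<gamma> x}"

definition C11_boundary :: "'a::euclidean_space set \<Rightarrow> bool" where
  "C11_boundary E \<longleftrightarrow> (\<forall>p\<in>frontier E. \<exists>r \<nu> \<gamma>. C11_chart E p r \<nu> \<gamma>)"

text \<open>Near \<open>p\<close> the set \<open>E\<close> is the sublevel set \<open>x \<bullet> \<nu> - \<gamma> x \<le> 0\<close>, whose defining function has the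
  non-vanishing gradient \<open>\<nu> - w\<close>; the inner normal is the opposite direction, normalised by \<open>sgn\<close>.
  The result does not depend on the chart.\<close>

definition inner_unit_normal :: "'a::euclidean_space set \<Rightarrow> 'a \<Rightarrow> 'a \<Rightarrow> bool" where
  "inner_unit_normal E p N \<longleftrightarrow> p \<in> frontier E \<and>
    (\<exists>r \<nu> \<gamma> w. C11_chart E p r \<nu> \<gamma> \<and> (GDERIV \<gamma> p :> w) \<and> N = sgn (w - \<nu>))"


section \<open>Divergence and the essential supremum norm\<close>

text \<open>For Lipschitz fields the derivative exists almost everywhere, and only this is used.\<close>

definition divergence :: "('a::euclidean_space \<Rightarrow> 'a) \<Rightarrow> 'a \<Rightarrow> real" where
  "divergence \<phi> x = (\<Sum>b\<in>Basis. frechet_derivative \<phi> (at x) b \<bullet> b)"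

definition Linf_norm :: "'a measure \<Rightarrow> ('a \<Rightarrow> real) \<Rightarrow> ennreal" where
  "Linf_norm M f = esssup M (\<lambda>x. ennreal \<bar>f x\<bar>)"


section \<open>Approximate limits and jumps\<close>

definition approx_limit :: "('a::euclidean_space \<Rightarrow> real) \<Rightarrow> 'a \<Rightarrow> real \<Rightarrow> bool" where
  "approx_limit v x a \<longleftrightarrow>
    ((\<lambda>r. (LINT y:ball x r|lebesgue. \<bar>v y - a\<bar>) / r ^ DIM('a)) \<longlongrightarrow> 0) (at_right 0)"

definition singular_set :: "'a::euclidean_space set \<Rightarrow> ('a \<Rightarrow> real) \<Rightarrow> 'a set" where
  "singular_set \<Omega> v = {x \<in> \<Omega>. \<not> (\<exists>a. approx_limit v x a)}"

definition approx_halfspace_limit ::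
  "('a::euclidean_space \<Rightarrow> real) \<Rightarrow> 'a \<Rightarrow> 'a \<Rightarrow> real \<Rightarrow> bool" where
  "approx_halfspace_limit v x \<nu> a \<longleftrightarrow>
    ((\<lambda>r. (LINT y:{y \<in> ball x r. (y - x) \<bullet> \<nu> > 0}|lebesgue. \<bar>v y - a\<bar>) / r ^ DIM('a))
      \<longlongrightarrow> 0) (at_right 0)"

text \<open>\<open>a\<close> and \<open>b\<close> are the one-sided limits \<open>v\<^sup>+\<close> and \<open>v\<^sup>-\<close>, and \<open>\<nu>\<close> points from the side of \<open>v\<^sup>-\<close> to
  that of \<open>v\<^sup>+\<close>.\<close>

definition approx_jump ::
  "('a::euclidean_space \<Rightarrow> real) \<Rightarrow> 'a \<Rightarrow> real \<Rightarrow> real \<Rightarrow> 'a \<Rightarrow> bool" where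
  "approx_jump v x a b \<nu> \<longleftrightarrow> norm \<nu> = 1 \<and>
    approx_halfspace_limit v x \<nu> a \<and> approx_halfspace_limit v x (- \<nu>) b"

text \<open>The vector \<open>(v\<^sup>+ - v\<^sup>-) \<nu>\<close>: the triple is unique up to replacing \<open>(a, b, \<nu>)\<close> by \<open>(b, a, - \<nu>)\<close>,
  which leaves this vector unchanged. For a function of bounded variation the triple exists at
  almost every point of the singular set, with respect to the Hausdorff measure of codimension one.\<close>

definition jump_vector :: "('a::euclidean_space \<Rightarrow> real) \<Rightarrow> 'a \<Rightarrow> 'a" where
  "jump_vector v x =
    (if \<exists>a b \<nu>. approx_jump v x a b \<nu>
     then (THE w. \<exists>a b \<nu>. approx_jump v x a b \<nu> \<and> w = (a - b) *\<^sub>R \<nu>) else 0)"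


section \<open>Functions of bounded variation\<close>

definition test_field :: "'a::euclidean_space set \<Rightarrow> ('a \<Rightarrow> 'a) \<Rightarrow> bool" where
  "test_field \<Omega> \<phi> \<longleftrightarrow>
    (\<exists>\<phi>' :: 'a \<Rightarrow> 'a \<Rightarrow>\<^sub>L 'a. (\<forall>x. (\<phi> has_derivative blinfun_apply (\<phi>' x)) (at x)) \<and>
      continuous_on UNIV \<phi>') \<and>
    compact (closure {x. \<phi> x \<noteq> 0}) \<and> closure {x. \<phi> x \<noteq> 0} \<subseteq> \<Omega>"

text \<open>The distributional derivative of \<open>v\<close> on \<open>\<Omega>\<close> is the finite vector measure \<open>\<sigma> \<cdot> \<mu>\<close>, given by its
  polar decomposition.\<close>

definition polar_derivative ::
  "'a::euclidean_space set \<Rightarrow> ('a \<Rightarrow> real) \<Rightarrow> 'a measure \<Rightarrow> ('a \<Rightarrow> 'a) \<Rightarrow> bool" where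
  "polar_derivative \<Omega> v \<mu> \<sigma> \<longleftrightarrow>
    finite_measure \<mu> \<and> space \<mu> = \<Omega> \<and> sets \<mu> = sets (restrict_space borel \<Omega>) \<and>
    \<sigma> \<in> borel_measurable \<mu> \<and> (AE x in \<mu>. norm (\<sigma> x) = 1) \<and>
    (\<forall>\<phi>. test_field \<Omega> \<phi> \<longrightarrow>
      (LINT x|lebesgue_on \<Omega>. v x * divergence \<phi> x) = - (LINT x|\<mu>. \<phi> x \<bullet> \<sigma> x))"

definition BV :: "'a::euclidean_space set \<Rightarrow> ('a \<Rightarrow> real) set" where
  "BV \<Omega> = {v. integrable (lebesgue_on \<Omega>) v \<and> (\<exists>\<mu> \<sigma>. polar_derivative \<Omega> v \<mu> \<sigma>)}"

definition distr_deriv ::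
  "'a::euclidean_space set \<Rightarrow> ('a \<Rightarrow> real) \<Rightarrow> 'a set \<Rightarrow> 'a" where
  "distr_deriv \<Omega> v B = (THE d. \<exists>\<mu> \<sigma>. polar_derivative \<Omega> v \<mu> \<sigma> \<and> d = (LINT x:B|\<mu>. \<sigma> x))"

text \<open>\<open>w\<close> is the density of the absolutely continuous part in the Lebesgue decomposition of the
  vector measure \<open>D\<close> on \<open>\<Omega>\<close>; the singular part is carried by the null set \<open>N\<close>.\<close>

definition abs_cont_density ::
  "'a::euclidean_space set \<Rightarrow> ('a set \<Rightarrow> 'a) \<Rightarrow> ('a \<Rightarrow> 'a) \<Rightarrow> bool" where
  "abs_cont_density \<Omega> D w \<longleftrightarrow> integrable (lebesgue_on \<Omega>) w \<and>
    (\<exists>N\<in>null_sets lborel. \<forall>B\<in>sets borel. B \<subseteq> \<Omega> \<longrightarrow> D (B - N) = (LINT x:B|lebesgue. w x))"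

definition approx_gradient ::
  "'a::euclidean_space set \<Rightarrow> ('a \<Rightarrow> real) \<Rightarrow> 'a \<Rightarrow> 'a" where
  "approx_gradient \<Omega> v = (SOME w. abs_cont_density \<Omega> (distr_deriv \<Omega> v) w)"

definition SBV :: "'a::euclidean_space set \<Rightarrow> ('a \<Rightarrow> real) set" where
  "SBV \<Omega> = {v \<in> BV \<Omega>.
    set_integrable (hausdorff_measure (DIM('a) - 1)) (singular_set \<Omega> v) (jump_vector v) \<and>
    (\<forall>B\<in>sets borel. B \<subseteq> \<Omega> \<longrightarrow>
      distr_deriv \<Omega> v B = (LINT x:B|lebesgue. approx_gradient \<Omega> v x) +
        (LINT x:(B \<inter> singular_set \<Omega> v)|hausdorff_measure (DIM('a) - 1). jump_vector v x))}"


section \<open>The Mumford--Shah functional\<close>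

definition mumford_shah ::
  "'a::euclidean_space set \<Rightarrow> real \<Rightarrow> real \<Rightarrow> ('a \<Rightarrow> real) \<Rightarrow> ('a \<Rightarrow> real) \<Rightarrow> ennreal" where
  "mumford_shah \<Omega> \<alpha> \<beta> g v =
    (\<integral>\<^sup>+x. ennreal ((norm (approx_gradient \<Omega> v x))\<^sup>2) \<partial>lebesgue_on \<Omega>) +
    ennreal \<alpha> * hausdorff_outer (DIM('a) - 1) (singular_set \<Omega> v) +
    ennreal \<beta> * (\<integral>\<^sup>+x. ennreal ((v x - g x)\<^sup>2) \<partial>lebesgue_on \<Omega>)"

definition absolute_minimizer ::
  "('a::euclidean_space \<Rightarrow> real) set \<Rightarrow> (('a \<Rightarrow> real) \<Rightarrow> ennreal) \<Rightarrow> ('a \<Rightarrow> real) \<Rightarrow> bool" where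
  "absolute_minimizer X F u \<longleftrightarrow> u \<in> X \<and> (\<forall>v\<in>X. F u \<le> F v)"

end

theory Submission
  imports Defs "HOL-Probability.Probability"
begin

text \<open>
  The proof is a calibration argument. Let \<open>h\<close> be the smooth step \<open>3 t\<^sup>2 - 2 t\<^sup>3\<close>, continued by 0 and 1, and let \<open>v\<close> be in
  \<open>SBV\<close>. For a compactly supported field \<open>\<phi>\<close> with \<open>\<bar>\<phi>\<bar> \<le> 1\<close>, the integral of \<open>- h(v) div \<phi>\<close> is at most that of
  \<open>h'(v) \<phi> \<bullet> grad v\<close> plus the Hausdorff measure of \<open>Sv\<close>, because \<open>h(v)\<close> jumps by at most 1. This holds with the sharp
  constant since, by the isodiametric inequality, a compact set has smooth cut-offs whose total decrease in a given
  direction is not much larger than its Hausdorff measure. Let \<open>\<phi>\<close> be a mollification of \<open>\<psi>\<close>; Rademacher's theorem bounds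
  its divergence by that of \<open>\<psi>\<close>, and by the Gauss--Green formula the integral of \<open>- g div \<phi>\<close> tends to the Hausdorff measure
  of the boundary of \<open>E\<close>. As \<open>h\<close> is flat at the values 0 and 1 of \<open>g\<close>, both \<open>\<bar>h(v) - g\<bar>\<close> and \<open>h'(v)\<^sup>2\<close> are bounded by
  multiples of \<open>(v - g)\<^sup>2\<close>, so that the fidelity term pays for replacing \<open>h(v)\<close> by \<open>g\<close> and for the
  AM--GM estimate of \<open>h'(v) \<phi> \<bullet> grad v\<close>. Hence \<open>F(v) \<ge> F(g) + \<kappa> \<integral>(v - g)\<^sup>2\<close> with \<open>\<kappa> > 0\<close>.\<close>

text \<open>The obstacle is the jump part. Mollifying \<open>v\<close> bounds the contribution of
  the singular part of \<open>Dv\<close> only by 3/2, the Lipschitz constant of the step, times its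
  mass, and that mass is not controlled by the Hausdorff measure of \<open>Sv\<close>. Instead the
  field is split into pieces \<open>eta c\<close> with constant vectors \<open>c\<close>, where
  \<open>eta\<close> cuts off compact parts of the jump set, and a remainder that is small on the
  singular part, so that the factor 3/2 does no harm. For a piece \<open>eta c\<close> only 0 <= h
  <= 1 matters. Perimeter and Hausdorff measure of the boundary of \<open>E\<close> must agree
  exactly, because F(g) contains the latter and Gauss-Green the former. One inequality comes from
  blow-ups and Vitali's covering lemma; the other is the calibration inequality once more, applied
  to the indicator of \<open>E\<close> itself. Blow-ups involve no coordinates and thus also
  identify the normals of different charts and the jump directions. The resulting constant is 3
  \<alpha> d + 9 \<alpha>^2 with d the sup norm of the divergence: 3 from h(t) <= 3 t^2, and 9 =
  36/4 from h'(t)^2 <= 36 t^2 and AM-GM.\<close>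

section \<open>The smooth step\<close>

lemma DERIV_zero_if_quadratic:
 fixes F :: "real => real"
 assumes "!!y. \<bar>F y - F x\<bar> <= C * (y - x)\<^sup>2"
 shows "(F has_real_derivative 0) (at x)"
proof -
 have "((%y. (F y - F x) / (y - x)) \<longlongrightarrow> 0) (at x)"
 proof (rule tendsto_rabs_zero_cancel, rule tendsto_sandwich)
 show "\<forall>\<^sub>F y in at x. 0 <= \<bar>(F y - F x) / (y - x)\<bar>" by simp
 show "\<forall>\<^sub>F y in at x. \<bar>(F y - F x) / (y - x)\<bar> <= C * \<bar>y - x\<bar>"
 proof (rule eventually_at_filter[THEN iffD2], rule always_eventually, intro allI impI)
  fix y assume "y ~= x"
  hence "0 < \<bar>y - x\<bar>" by simp
  moreover have "\<bar>F y - F x\<bar> <= (C * \<bar>y - x\<bar>) * \<bar>y - x\<bar>"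
  using assms[of y] by (simp add: power2_eq_square mult.assoc abs_mult_self_eq)
  ultimately show "\<bar>(F y - F x) / (y - x)\<bar> <= C * \<bar>y - x\<bar>"
  by (simp add: abs_divide divide_le_eq)
 qed
 show "((%y. C * \<bar>y - x\<bar>) \<longlongrightarrow> 0) (at x)"
  by (auto intro!: tendsto_eq_intros)
 qed auto
 thus ?thesis by (simp add: has_field_derivative_iff)
qed

definition smoothstep :: "real => real" where
 "smoothstep t = (if t <= 0 then 0 else if 1 <= t then 1 else 3 * t\<^sup>2 - 2 * t ^ 3)"

text \<open>Clamping the argument, instead of distinguishing cases, makes continuity immediate; the
  polynomial vanishes at both ends of the unit interval.\<close>

definition smoothstep_deriv :: "real => real" where
 "smoothstep_deriv t = 6 * max 0 (min 1 t) * (1 - max 0 (min 1 t))"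

text \<open>The graph is symmetric about its midpoint. Every estimate at the value 0 therefore
  yields the one at the value 1, and the datum takes both values.\<close>

lemma smoothstep_reflect: "smoothstep (1 - t) = 1 - smoothstep t"
 by (auto simp: smoothstep_def power2_eq_square power3_eq_cube algebra_simps)

lemma smoothstep_deriv_reflect: "smoothstep_deriv (1 - t) = smoothstep_deriv t"
 by (auto simp: smoothstep_deriv_def max_def min_def algebra_simps)

lemma smoothstep_nonneg: "0 <= smoothstep t"
proof (cases "0 < t & t < 1")
 case True
 hence "0 <= t\<^sup>2 * (3 - 2 * t)" by (intro mult_nonneg_nonneg) auto
 with True show ?thesis
 by (auto simp: smoothstep_def power2_eq_square power3_eq_cube algebra_simps)
qed (auto simp: smoothstep_def)

lemma smoothstep_le_1: "smoothstep t <= 1"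
 using smoothstep_nonneg[of "1 - t"] by (simp add: smoothstep_reflect)

lemma smoothstep_le_square: "smoothstep t <= 3 * t\<^sup>2"
proof (cases "1 <= t")
 case True
 hence "1 <= t\<^sup>2" by simp
 moreover have "smoothstep t = 1" using True by (simp add: smoothstep_def)
 ultimately show ?thesis by linarith
qed (auto simp: smoothstep_def zero_le_power)

lemma smoothstep_deriv_nonneg: "0 <= smoothstep_deriv t"
 by (auto simp: smoothstep_deriv_def max_def min_def)

text \<open>The maximum is attained at the midpoint, whence the square in the proof. This 3/2 is the
  factor of the singular part in \<open>chain_rule_bound\<close>.\<close>

lemma smoothstep_deriv_le: "smoothstep_deriv t <= 3/2"
proof -
 define c where "c = max 0 (min 1 t)"
 have "0 <= 6 * (c - 1/2)\<^sup>2" by simp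
 thus ?thesis unfolding smoothstep_deriv_def c_def[symmetric]
 by (simp add: power2_eq_square algebra_simps)
qed

lemma smoothstep_deriv_le_square: "(smoothstep_deriv t)\<^sup>2 <= 36 * t\<^sup>2"
proof -
 have "smoothstep_deriv t <= 6 * \<bar>t\<bar>"
 unfolding smoothstep_deriv_def
 by (cases "t <= 0"; cases "1 <= t"; auto simp: max_def min_def mult_left_le)
 hence "(smoothstep_deriv t)\<^sup>2 <= (6 * \<bar>t\<bar>)\<^sup>2"
 using smoothstep_deriv_nonneg by (intro power_mono)
 thus ?thesis by (simp add: power_mult_distrib)
qed

lemma continuous_smoothstep_deriv: "continuous_on S smoothstep_deriv"
 unfolding smoothstep_deriv_def by (intro continuous_intros)

lemma smoothstep_has_deriv: "(smoothstep has_real_derivative smoothstep_deriv t) (at t)"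
proof -
 have 0: "(smoothstep has_real_derivative 0) (at 0)"
 using smoothstep_le_square smoothstep_nonneg
 by (intro DERIV_zero_if_quadratic[where C=3]) (auto simp: smoothstep_def[of 0])
 have 1: "(smoothstep has_real_derivative 0) (at 1)"
 proof (intro DERIV_zero_if_quadratic[where C=3])
 fix y :: real
 have "\<bar>smoothstep y - smoothstep 1\<bar> = smoothstep (1 - y)"
  using smoothstep_le_1[of y] by (simp add: smoothstep_reflect smoothstep_def[of 1])
 also have "... <= 3 * (1 - y)\<^sup>2" by (rule smoothstep_le_square)
 finally show "\<bar>smoothstep y - smoothstep 1\<bar> <= 3 * (y - 1)\<^sup>2"
  by (simp add: power2_commute)
 qed
 consider "t < 0" | "t = 0" | "0 < t" "t < 1" | "t = 1" | "1 < t" by linarith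
 thus ?thesis
 proof cases
 case 1
 have "(smoothstep has_real_derivative 0) (at t)"
  by (rule has_field_derivative_transform_within_open[of "%_. 0" _ _ "{..<0}"])
  (use 1 in \<open>auto simp: smoothstep_def\<close>)
 with 1 show ?thesis by (simp add: smoothstep_deriv_def)
 next
 case 3
 have "(smoothstep has_real_derivative 6 * t - 6 * t\<^sup>2) (at t)"
  by (rule has_field_derivative_transform_within_open[of "%t. 3 * t\<^sup>2 - 2 * t ^ 3" _ _ "{0<..<1}"])
  (use 3 in \<open>auto simp: smoothstep_def intro!: derivative_eq_intros\<close>)
 with 3 show ?thesis by (simp add: smoothstep_deriv_def power2_eq_square algebra_simps)
 next
 case 5
 have "(smoothstep has_real_derivative 0) (at t)"
  by (rule has_field_derivative_transform_within_open[of "%_. 1" _ _ "{1<..}"])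
  (use 5 in \<open>auto simp: smoothstep_def\<close>)
 with 5 show ?thesis by (simp add: smoothstep_deriv_def)
 qed (use 0 1 in \<open>auto simp: smoothstep_deriv_def\<close>)
qed

lemma continuous_smoothstep: "continuous_on S smoothstep"
 using DERIV_isCont smoothstep_has_deriv continuous_at_imp_continuous_on by blast

section \<open>Continuously differentiable functions, test fields and cut-offs\<close>

text \<open>Continuity of the derivative is tested in each fixed direction, which in finite
  dimension amounts to continuity in the operator norm. Derivatives stay plain functions in this
  way; \<open>test_fieldI\<close> and \<open>test_fieldE\<close> translate to and from the bounded
  linear maps of \<open>test_field\<close>.\<close>

definition c1_deriv :: "('a::euclidean_space => 'b::euclidean_space) => ('a => 'a => 'b) => bool" where
 "c1_deriv ph ph' \<longleftrightarrow> (ALL x. (ph has_derivative ph' x) (at x)) & (ALL h. continuous_on UNIV (%x. ph' x h))"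

lemma c1_deriv_has_derivative: "c1_deriv ph ph' ==> (ph has_derivative ph' x) (at x)"
 by (simp add: c1_deriv_def)

lemma c1_deriv_continuous_deriv: "c1_deriv ph ph' ==> continuous_on S (%x. ph' x h)"
 by (auto simp: c1_deriv_def intro: continuous_on_subset)

lemma c1_deriv_linear: "c1_deriv ph ph' ==> linear (ph' x)"
 using c1_deriv_has_derivative has_derivative_linear by blast

lemma c1_deriv_continuous: "c1_deriv ph ph' ==> continuous_on S ph"
 by (intro continuous_at_imp_continuous_on ballI)
 (rule has_derivative_continuous[OF c1_deriv_has_derivative])

lemma c1_deriv_const: "c1_deriv (%_. c) (%_ _. 0)"
 by (simp add: c1_deriv_def)

lemma c1_deriv_measurable: "c1_deriv f f' ==> f : borel_measurable borel"
 by (rule borel_measurable_continuous_onI[OF c1_deriv_continuous])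

lemma c1_deriv_add:
 "c1_deriv f f' ==> c1_deriv g g' ==> c1_deriv (%x. f x + g x) (%x h. f' x h + g' x h)"
 by (auto simp: c1_deriv_def intro!: derivative_intros continuous_intros)

lemma c1_deriv_diff:
 "c1_deriv f f' ==> c1_deriv g g' ==> c1_deriv (%x. f x - g x) (%x h. f' x h - g' x h)"
 by (auto simp: c1_deriv_def intro!: derivative_intros continuous_intros)

lemma c1_deriv_scaleR:
 assumes "c1_deriv f f'" "c1_deriv g g'"
 shows "c1_deriv (%x. f x *\<^sub>R g x) (%x h. f x *\<^sub>R g' x h + f' x h *\<^sub>R g x)"
 using assms c1_deriv_continuous[OF assms(1)] c1_deriv_continuous[OF assms(2)]
 by (auto simp: c1_deriv_def intro!: derivative_eq_intros continuous_intros)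

lemma c1_deriv_mult:
 fixes f g :: "_ => real"
 assumes "c1_deriv f f'" "c1_deriv g g'"
 shows "c1_deriv (%x. f x * g x) (%x h. f x * g' x h + f' x h * g x)"
 using c1_deriv_scaleR[OF assms] by simp

lemma c1_deriv_inner_const:
 assumes "c1_deriv f f'"
 shows "c1_deriv (%x. f x \<bullet> c) (%x h. f' x h \<bullet> c)"
 using assms by (auto simp: c1_deriv_def intro!: derivative_intros continuous_intros)

lemma c1_deriv_bounded_linear: "bounded_linear f ==> c1_deriv f (%_. f)"
 by (auto simp: c1_deriv_def bounded_linear_imp_has_derivative)

lemma c1_deriv_sum:
 "finite I ==> (!!i. i : I ==> c1_deriv (f i) (f' i)) ==>
 c1_deriv (%x. \<Sum>i\<in>I. f i x) (%x h. \<Sum>i\<in>I. f' i x h)"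
 by (auto simp: c1_deriv_def intro!: derivative_intros continuous_intros)

lemma c1_deriv_compose_real:
 fixes f :: "'a::euclidean_space => real"
 assumes f: "c1_deriv f f'" and s: "!!t. (s has_real_derivative s' t) (at t)" "continuous_on UNIV s'"
 shows "c1_deriv (%x. s (f x)) (%x h. s' (f x) * f' x h)"
proof -
 have "((%x. s (f x)) has_derivative (%h. s' (f x) * f' x h)) (at x)" for x
 using has_derivative_compose[OF c1_deriv_has_derivative[OF f, of x]
  s(1)[of "f x", THEN has_field_derivative_imp_has_derivative]] .
 moreover have "continuous_on UNIV (%x. s' (f x))"
 using continuous_on_compose2[OF s(2) c1_deriv_continuous[OF f]] by auto
 ultimately show ?thesis
 using f by (auto simp: c1_deriv_def intro!: continuous_intros)
qed

lemma c1_deriv_compose: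
 assumes f: "c1_deriv f f'" and g: "c1_deriv g g'"
 shows "c1_deriv (%x. g (f x)) (%x h. g' (f x) (f' x h))"
proof -
 have "((%x. g (f x)) has_derivative (%h. g' (f x) (f' x h))) (at x)" for x
 using has_derivative_compose[OF c1_deriv_has_derivative[OF f, of x]
  c1_deriv_has_derivative[OF g, of "f x"]] .
 moreover have "continuous_on UNIV (%x. g' (f x) (f' x h))" for h
 proof -
 \<comment> \<open>Here the direction itself moves with \<open>x\<close>, whereas continuity is
   known for fixed directions only; hence the expansion in the basis.\<close>
 have "g' (f x) (f' x h) = (\<Sum>b\<in>Basis. (f' x h \<bullet> b) *\<^sub>R g' (f x) b)" for x
 proof -
  have "g' (f x) (f' x h) = g' (f x) (\<Sum>b\<in>Basis. (f' x h \<bullet> b) *\<^sub>R b)"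
  by (simp add: euclidean_representation)
  thus ?thesis
  by (simp add: linear_sum[OF c1_deriv_linear[OF g]] linear_scale[OF c1_deriv_linear[OF g]])
 qed
 moreover have "continuous_on UNIV (%x. g' (f x) b)" for b
  using continuous_on_compose2[OF c1_deriv_continuous_deriv[OF g] c1_deriv_continuous[OF f]] by auto
 ultimately show ?thesis
  using c1_deriv_continuous_deriv[OF f] by (auto intro!: continuous_intros)
 qed
 ultimately show ?thesis by (auto simp: c1_deriv_def)
qed

lemma has_derivative_zero_off_closed:
 assumes "(f has_derivative f') (at x)" "closed K" "!!x. x ~: K ==> f x = 0" "x ~: K"
 shows "f' = (%_. 0)"
proof -
 have "((%_. 0) has_derivative f') (at x)"
 by (rule has_derivative_transform_within_open[OF assms(1), of "- K"]) (use assms in auto)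
 thus ?thesis using has_derivative_unique has_derivative_const by blast
qed

lemma c1_deriv_zero_off_closed:
 assumes "c1_deriv f f'" "closed K" "!!x. x ~: K ==> f x = 0" "x ~: K"
 shows "f' x h = 0"
 using has_derivative_zero_off_closed[OF c1_deriv_has_derivative[OF assms(1)] assms(2-)] by simp

lemma bounded_compact_support:
 fixes f :: "'a::euclidean_space => 'b::real_normed_vector"
 assumes "continuous_on UNIV f" "compact K" "!!x. x ~: K ==> f x = 0"
 obtains M where "0 < M" "!!x. norm (f x) <= M"
proof -
 have "bounded (f ` K)"
 by (intro compact_imp_bounded compact_continuous_image continuous_on_subset[OF assms(1)] assms(2)) auto
 then obtain M where M: "0 < M" "!!x. x : K ==> norm (f x) <= M"
 by (auto simp: bounded_pos)
 hence "norm (f x) <= M" for x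
 by (cases "x : K") (use M assms in auto)
 with M that show ?thesis by blast
qed

lemma integrable_compact_support:
 fixes f :: "'a::euclidean_space => 'b::{banach,second_countable_topology}"
 assumes "continuous_on UNIV f" "compact K" "!!x. x ~: K ==> f x = 0"
 shows "integrable lborel f"
proof -
 have "integrable lborel (%x. indicator K x *\<^sub>R f x)"
 using borel_integrable_compact[OF assms(2) continuous_on_subset[OF assms(1)]]
 by (simp add: set_integrable_def indicator_def if_distrib cong: if_cong)
 moreover have "(%x. indicator K x *\<^sub>R f x) = f"
 using assms(3) by (auto simp: fun_eq_iff indicator_def)
 ultimately show ?thesis by simp
qed

text \<open>\<open>K\<close> may be any compact set off which the field vanishes; this is easier to
  provide than the exact support.\<close>

lemma test_fieldI:
 assumes "c1_deriv ph ph'" "compact K" "K <= Om" "!!x. x ~: K ==> ph x = 0"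
 shows "test_field Om ph"
proof -
 define D where "D x = Blinfun (ph' x)" for x
 have bl: "bounded_linear (ph' x)" for x
 using c1_deriv_has_derivative[OF assms(1)] has_derivative_bounded_linear by blast
 hence D: "blinfun_apply (D x) = ph' x" for x
 by (simp add: D_def bounded_linear_Blinfun_apply)
 have "continuous_on UNIV D"
 by (rule continuous_on_blinfun_componentwise) (use assms(1) in \<open>auto simp: D c1_deriv_def\<close>)
 moreover have "closure {x. ph x ~= 0} <= K"
 using assms by (intro closure_minimal) (auto intro: compact_imp_closed)
 ultimately show ?thesis
 unfolding test_field_def using assms D c1_deriv_has_derivative[OF assms(1)]
 by (metis (no_types, lifting) closed_closure compact_Int_closed inf.absorb_iff2 order_trans)
qed

lemma test_fieldE:
 assumes "test_field Om ph"
 obtains ph' K where "c1_deriv ph ph'" "compact K" "K <= Om" "!!x. x ~: K ==> ph x = 0"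
proof -
 obtain D where D: "!!x. (ph has_derivative blinfun_apply (D x)) (at x)" "continuous_on UNIV D"
 and K: "compact (closure {x. ph x ~= 0})" "closure {x. ph x ~= 0} <= Om"
 using assms by (auto simp: test_field_def)
 have "c1_deriv ph (%x. blinfun_apply (D x))"
 using D by (auto simp: c1_deriv_def intro!: continuous_intros)
 moreover have "x ~: closure {x. ph x ~= 0} ==> ph x = 0" for x
 using closure_subset[of "{x. ph x ~= 0}"] by blast
 ultimately show thesis using that K by blast
qed

lemma divergence_c1_deriv:
 "c1_deriv ph ph' ==> divergence ph x = (\<Sum>b\<in>Basis. ph' x b \<bullet> b)"
 unfolding divergence_def using c1_deriv_has_derivative frechet_derivative_at by metis

lemma linear_eq_sum_Basis:
 fixes f :: "'a::euclidean_space => real"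
 assumes "linear f"
 shows "f c = (\<Sum>b\<in>Basis. f b * (c \<bullet> b))"
proof -
 have "f c = f (\<Sum>b\<in>Basis. (c \<bullet> b) *\<^sub>R b)" by (simp add: euclidean_representation)
 also have "... = (\<Sum>b\<in>Basis. f b * (c \<bullet> b))"
 using assms by (simp add: linear_sum linear_scale mult.commute)
 finally show ?thesis .
qed

lemma divergence_scaleR:
 fixes eta :: "'a::euclidean_space => real" and ph :: "'a => 'a"
 assumes "c1_deriv eta eta'" "c1_deriv ph ph'"
 shows "divergence (%x. eta x *\<^sub>R ph x) x = eta x * divergence ph x + eta' x (ph x)"
 using linear_eq_sum_Basis[OF c1_deriv_linear[OF assms(1)], of x "ph x"]
 by (simp add: divergence_c1_deriv[OF c1_deriv_scaleR[OF assms]] divergence_c1_deriv[OF assms(2)]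
  inner_add_left sum.distrib sum_distrib_left)

lemma divergence_scaleR_const:
 fixes eta :: "'a::euclidean_space => real"
 assumes "c1_deriv eta eta'"
 shows "divergence (%x. eta x *\<^sub>R c) x = eta' x c"
proof -
 have "divergence (%_. c) x = 0"
 using divergence_c1_deriv[OF c1_deriv_const[of c]] by simp
 thus ?thesis using divergence_scaleR[OF assms c1_deriv_const] by simp
qed

lemma divergence_zero_off_closed:
 assumes "c1_deriv ph ph'" "closed K" "!!x. x ~: K ==> ph x = 0" "x ~: K"
 shows "divergence ph x = 0"
 using c1_deriv_zero_off_closed[OF assms] divergence_c1_deriv[OF assms(1)] by simp

lemma continuous_divergence:
 "c1_deriv ph ph' ==> continuous_on S (divergence ph)"
 by (simp add: divergence_c1_deriv c1_deriv_continuous_deriv continuous_intros cong: continuous_on_cong)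

text \<open>The function is 1 - (1 - eta1) (1 - eta2). It stays between 0 and 1, equals 1 where one
  of the two does, and in its derivative the old derivatives carry factors between 0 and 1.\<close>

lemma c1_cutoff_union:
 fixes eta1 eta2 :: "'a::euclidean_space => real"
 assumes "c1_deriv eta1 eta1'" "c1_deriv eta2 eta2'"
 shows "c1_deriv (%x. eta1 x + eta2 x - eta1 x * eta2 x)
 (%x h. eta1' x h * (1 - eta2 x) + eta2' x h * (1 - eta1 x))"
 using c1_deriv_diff[OF c1_deriv_add[OF assms] c1_deriv_mult[OF assms]]
 by (simp add: algebra_simps c1_deriv_def)

lemma cutoff_union_bounds:
 fixes a b :: real
 assumes "0 <= a" "a <= 1" "0 <= b" "b <= 1"
 shows "0 <= a + b - a * b" "a + b - a * b <= 1"
proof -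
 have "0 <= a + b * (1 - a)" using assms by simp
 thus "0 <= a + b - a * b" by (simp add: algebra_simps)
 have "0 <= (1 - a) * (1 - b)" using assms by simp
 thus "a + b - a * b <= 1" by (simp add: algebra_simps)
qed

lemma c1_bump_ball:
 fixes p :: "'a::euclidean_space"
 assumes "0 < r" "r < R"
 obtains eta :: "'a => real" and eta' where "c1_deriv eta eta'" "!!x. 0 <= eta x" "!!x. eta x <= 1"
 "!!x. x : cball p r ==> eta x = 1" "!!x. x ~: ball p R ==> eta x = 0"
proof -
 have rR: "0 < R\<^sup>2 - r\<^sup>2" using assms by (simp add: power_strict_mono)
 \<comment> \<open>Affine in the squared distance, hence differentiable at the centre as well; at
   least 1 on the inner ball and at most 0 off the outer one.\<close>
 define q where "q x = (R\<^sup>2 - (x - p) \<bullet> (x - p)) / (R\<^sup>2 - r\<^sup>2)" for x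
 have q: "c1_deriv q (%x h. - (2 * ((x - p) \<bullet> h)) / (R\<^sup>2 - r\<^sup>2))"
 unfolding c1_deriv_def q_def using rR
 by (auto intro!: derivative_eq_intros continuous_intros simp: inner_commute divide_inverse)
 define eta where "eta x = smoothstep (q x)" for x
 note c1 = c1_deriv_compose_real[OF q smoothstep_has_deriv continuous_smoothstep_deriv, folded eta_def]
 show thesis
 proof (rule that[OF c1])
 show "eta x = 1" if "x : cball p r" for x
 proof -
  have "norm (x - p) <= r" using that by (simp add: dist_norm norm_minus_commute)
  hence "(x - p) \<bullet> (x - p) <= r\<^sup>2"
  by (metis norm_ge_zero power2_norm_eq_inner power_mono)
  hence "1 <= q x" using rR by (simp add: q_def)
  thus ?thesis by (simp add: eta_def smoothstep_def)
 qed
 show "eta x = 0" if "x ~: ball p R" for x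
 proof -
  have "R <= norm (x - p)" using that by (simp add: dist_norm norm_minus_commute)
  hence "R\<^sup>2 <= (x - p) \<bullet> (x - p)"
  using assms by (metis less_eq_real_def order.trans power2_norm_eq_inner power_mono)
  hence "q x <= 0" using rR by (simp add: q_def divide_le_0_iff)
  thus ?thesis by (simp add: eta_def smoothstep_def)
 qed
 qed (auto simp: eta_def smoothstep_nonneg smoothstep_le_1)
qed

text \<open>Bumps on small balls are combined by \<open>c1_cutoff_union\<close>. Asking for the
  value 1 on an open set \<open>V\<close>, and not just on \<open>K\<close>, is what allows
  compactness to reduce the union to finitely many balls.\<close>

lemma c1_cutoff:
 fixes K U :: "'a::euclidean_space set"
 assumes "compact K" "open U" "K <= U"
 obtains eta :: "'a => real" and eta' C V where "c1_deriv eta eta'" "!!x. 0 <= eta x" "!!x. eta x <= 1"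
 "open V" "K <= V" "!!x. x : V ==> eta x = 1" "compact C" "C <= U" "!!x. x ~: C ==> eta x = 0"
proof -
 define P where "P V \<longleftrightarrow> (EX (eta :: 'a => real) eta' C. c1_deriv eta eta' & (ALL x. 0 <= eta x & eta x <= 1) & open V &
  (ALL x:V. eta x = 1) & compact C & C <= U & (ALL x. x ~: C --> eta x = 0))" for V
 have P0: "P {}"
 unfolding P_def
 by (rule exI[of _ "%_. 0"], rule exI[of _ "%_ _. 0"], rule exI[of _ "{}"]) (simp add: c1_deriv_const)
 have PU: "P (V Un W)" if VW: "P V" "P W" for V W
 proof -
 obtain eta1 eta1' C1 where 1: "c1_deriv eta1 eta1'" "!!x. 0 <= eta1 x & eta1 x <= (1::real)" "open V"
  "!!x. x\<in>V ==> eta1 x = 1" "compact C1" "C1 <= U" "!!x. x ~: C1 ==> eta1 x = 0"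
  using VW(1) unfolding P_def by blast
 obtain eta2 eta2' C2 where 2: "c1_deriv eta2 eta2'" "!!x. 0 <= eta2 x & eta2 x <= (1::real)" "open W"
  "!!x. x\<in>W ==> eta2 x = 1" "compact C2" "C2 <= U" "!!x. x ~: C2 ==> eta2 x = 0"
  using VW(2) unfolding P_def by blast
 show ?thesis unfolding P_def
  apply (rule exI[of _ "%x. eta1 x + eta2 x - eta1 x * eta2 x"], rule exI, rule exI[of _ "C1 Un C2"])
  apply (intro conjI)
    apply (rule c1_cutoff_union[OF 1(1) 2(1)])
  using 1 2 cutoff_union_bounds by (auto simp: compact_Un open_Un)
 qed
 have "EX V. x : V & P V" if xK: "x : K" for x
 proof -
 obtain R where R: "0 < R" "cball x R <= U"
  using open_contains_cball_eq[OF assms(2)] subsetD[OF assms(3) xK] by metis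
 obtain eta :: "'a => real" and eta' where "c1_deriv eta eta'" "!!x. 0 <= eta x" "!!x. eta x <= 1"
 "!!y. y : cball x (R/2) ==> eta y = 1" "!!y. y ~: ball x R ==> eta y = 0"
  by (rule c1_bump_ball[of "R/2" R x]) (use R in simp, use R in simp, rule that)
 hence "P (ball x (R/2))"
  unfolding P_def using R
  by (intro exI[of _ eta] exI[of _ eta'] exI[of _ "cball x R"]) (auto simp: dist_norm)
 thus ?thesis using R by (intro exI[of _ "ball x (R/2)"]) auto
 qed
 then obtain V where V: "!!x. x : K ==> x : V x & P (V x)" by metis
 have Vopen: "x : K ==> open (V x)" for x using V unfolding P_def by blast
 obtain D where D: "D <= K" "finite D" "K <= (\<Union>x\<in>D. V x)"
 by (rule compactE_image[OF assms(1), of K V]) (use Vopen V in auto)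
 have "P (\<Union>x\<in>D. V x)"
 using D(2,1) by (induction rule: finite_induct) (auto simp: P0 intro!: PU dest: V)
 thus thesis
 unfolding P_def
 proof (elim exE conjE)
 fix eta :: "'a => real" and eta' C
 assume *: "c1_deriv eta eta'" "ALL x. 0 <= eta x & eta x <= 1" "open (\<Union>x\<in>D. V x)"
  "ALL x:(\<Union>x\<in>D. V x). eta x = 1" "compact C" "C <= U" "ALL x. x ~: C --> eta x = 0"
 show thesis
  by (rule that[OF *(1) _ _ *(3) D(3) _ *(5,6)]) (use * in auto)
 qed
qed

section \<open>Translations and integrals of directional derivatives\<close>

lemma nn_integral_lborel_shift:
 fixes c :: "'a::euclidean_space"
 assumes "f : borel_measurable borel"
 shows "(\<integral>\<^sup>+x. f (x + c) \<partial>lborel) = (\<integral>\<^sup>+x. f x \<partial>lborel)"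
proof -
 have "(\<integral>\<^sup>+x. f x \<partial>lborel) = (\<integral>\<^sup>+x. f x \<partial>distr lborel borel ((+) c))"
 by (simp add: lborel_distr_plus)
 also have "... = (\<integral>\<^sup>+x. f (c + x) \<partial>lborel)"
 using assms by (subst nn_integral_distr) auto
 finally show ?thesis by (simp add: add.commute)
qed

lemma integral_lborel_shift:
 fixes c :: "'a::euclidean_space" and f :: "'a => 'b::{banach,second_countable_topology}"
 assumes "f : borel_measurable borel"
 shows "(LBINT x. f (x + c)) = (LBINT x. f x)"
proof -
 have "(LBINT x. f x) = (LINT x|distr lborel borel ((+) c). f x)"
 by (simp add: lborel_distr_plus)
 also have "... = (LBINT x. f (c + x))"
 using assms by (subst integral_distr) auto
 finally show ?thesis by (simp add: add.commute)
qed

lemma integrable_lborel_shift: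
 fixes c :: "'a::euclidean_space" and f :: "'a => 'b::{banach,second_countable_topology}"
 assumes "integrable lborel f"
 shows "integrable lborel (%x. f (x + c))"
proof -
 have "integrable (distr lborel borel ((+) c)) f"
 using assms by (simp add: lborel_distr_plus)
 thus ?thesis
 using borel_measurable_integrable[OF assms] by (subst (asm) integrable_distr_eq) (auto simp: add.commute)
qed

lemma c1_deriv_line:
 fixes Phi :: "'a::euclidean_space => real"
 assumes c1: "c1_deriv Phi Phi'"
 shows "((%s. Phi (x + s *\<^sub>R e)) has_real_derivative Phi' (x + s *\<^sub>R e) e) (at s)"
proof -
 have "((%s. x + s *\<^sub>R e) has_derivative (%s. s *\<^sub>R e)) (at s)"
 by (auto intro!: derivative_eq_intros)
 from has_derivative_compose[OF this c1_deriv_has_derivative[OF c1]] show ?thesis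
 by (simp add: has_field_derivative_def linear_scale[OF c1_deriv_linear[OF c1]] mult_commute_abs)
qed

lemma inverse_Suc_at_0: "filterlim (%k. 1 / real (Suc k)) (at 0) sequentially"
 using LIMSEQ_inverse_real_of_nat by (auto simp: filterlim_at inverse_eq_divide)

text \<open>Only \<open>Phi\<close> is differentiated, so \<open>f\<close> may be any bounded Borel
  function. It will be the indicator of a set invariant along \<open>e\<close>, and later a
  Lipschitz function.\<close>

lemma difference_quotient_tendsto:
 fixes Phi :: "'a::euclidean_space => real"
 assumes c1: "c1_deriv Phi Phi'" and K: "compact K" "!!x. x ~: K ==> Phi x = 0"
 and f: "f : borel_measurable borel" "!!x. \<bar>f x\<bar> <= B"
 shows "(%k. LBINT x. f x * ((Phi (x + (1 / real (Suc k)) *\<^sub>R e) - Phi x) / (1 / real (Suc k)))) \<longlonglongrightarrow> (LBINT x. f x * Phi' x e)"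
proof -
 have zero: "Phi' x e = 0" if "x ~: K" for x
 using c1_deriv_zero_off_closed[OF c1 compact_imp_closed[OF K(1)] K(2) that] .
 obtain M where M: "0 < M" "!!x. \<bar>Phi' x e\<bar> <= M"
 using bounded_compact_support[OF c1_deriv_continuous_deriv[OF c1] K(1) zero]
 by (metis real_norm_def)
 \<comment> \<open>The points from which \<open>K\<close> is reached by adding \<open>s e\<close>
   with s between 0 and 1. By the mean value theorem all quotients vanish off this compact set, so
   one integrable majorant serves for all \<open>k\<close>.\<close>
 define K1 where "K1 = (%(x, t). x + t *\<^sub>R e) ` (K \<times> {-1..0})"
 have K1: "compact K1" unfolding K1_def
 by (intro compact_continuous_image compact_Times K compact_Icc)
  (auto simp: case_prod_unfold intro!: continuous_intros)
 define q where "q k x = (Phi (x + (1 / real (Suc k)) *\<^sub>R e) - Phi x) / (1 / real (Suc k))" for k x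
 have qM: "\<bar>q k x\<bar> <= M * indicator K1 x" for k x
 proof -
 define h where "h = 1 / real (Suc k)"
 have h: "0 < h" "h <= 1" by (auto simp: h_def)
 obtain s where s: "0 < s" "s < h" "Phi (x + h *\<^sub>R e) - Phi (x + 0 *\<^sub>R e) = (h - 0) * Phi' (x + s *\<^sub>R e) e"
  using MVT2[OF h(1) c1_deriv_line[OF c1, of x e]] by auto
 hence q: "q k x = Phi' (x + s *\<^sub>R e) e" unfolding q_def h_def[symmetric] using h by simp
 show ?thesis
 proof (cases "x + s *\<^sub>R e : K")
  case True
  have "x = (%(x, t). x + t *\<^sub>R e) (x + s *\<^sub>R e, -s)" by simp
  moreover have "(x + s *\<^sub>R e, -s) : K \<times> {-1..0}" using True s h by auto
  ultimately have "x : K1" unfolding K1_def by blast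
  thus ?thesis using M q by simp
 next
  case False
  thus ?thesis using q zero M by simp
 qed
 qed
 have [measurable]: "Phi : borel_measurable borel" "f : borel_measurable borel" "(%x. Phi' x e) : borel_measurable borel"
 using f(1) by (auto intro!: borel_measurable_continuous_onI c1_deriv_continuous[OF c1] c1_deriv_continuous_deriv[OF c1])
 have "(%k. LBINT x. f x * q k x) \<longlonglongrightarrow> (LBINT x. f x * Phi' x e)"
 proof (rule integral_dominated_convergence[where w = "%x. B * (M * indicator K1 x)"])
 show "integrable lborel (%x. B * (M * indicator K1 x))"
  using K1 by (auto intro!: integrable_mult_right integrable_real_indicator
   simp: borel_compact emeasure_compact_finite[unfolded infinity_ennreal_def])
 show "AE x in lborel. (%k. f x * q k x) \<longlonglongrightarrow> f x * Phi' x e"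
 proof (rule AE_I2, rule tendsto_mult_left)
  fix x
  have "((%h. (Phi (x + h *\<^sub>R e) - Phi x) / h) \<longlongrightarrow> Phi' x e) (at 0)"
  using c1_deriv_line[OF c1, of x e 0] by (simp add: DERIV_def)
  thus "(%k. q k x) \<longlonglongrightarrow> Phi' x e" unfolding q_def by (rule filterlim_compose[OF _ inverse_Suc_at_0])
 qed
 show "(%x. f x * q k x) : borel_measurable lborel" for k unfolding q_def by measurable
 show "AE x in lborel. norm (f x * q k x) <= B * (M * indicator K1 x)" for k
  using f(2) order_trans[OF abs_ge_zero f(2)] unfolding real_norm_def abs_mult by (intro AE_I2 mult_mono qM) auto
 qed measurable
 thus ?thesis by (simp only: q_def)
qed

text \<open>Translation invariance makes the integrals of the difference quotients vanish.\<close>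

lemma integral_directional_deriv_zero:
 fixes Phi :: "'a::euclidean_space => real"
 assumes c1: "c1_deriv Phi Phi'" and K: "compact K" "!!x. x ~: K ==> Phi x = 0"
 and A: "A : sets borel" "!!x t. x + t *\<^sub>R e : A \<longleftrightarrow> x : A"
 shows "(LBINT x. indicator A x * Phi' x e) = 0"
proof -
 have cont: "continuous_on UNIV Phi" using c1_deriv_continuous[OF c1] .
 hence [measurable]: "Phi : borel_measurable borel" by (rule borel_measurable_continuous_onI)
 have [measurable]: "A : sets borel" by fact
 have int: "integrable lborel Phi" using integrable_compact_support[OF cont K] .
 have iA: "integrable lborel (%x. indicator A x * f x)" if "integrable lborel f" for f :: "'a => real"
 using integrable_mult_indicator[OF _ that, of A] by simp
 have q0: "(LBINT x. indicator A x * ((Phi (x + h *\<^sub>R e) - Phi x) / h)) = 0" for h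
 proof -
 have "indicator A (x + h *\<^sub>R e) = (indicator A x :: real)" for x using A(2) by (simp add: indicator_def)
 hence "(LBINT x. indicator A x * Phi (x + h *\<^sub>R e)) = (LBINT x. indicator A x * Phi x)"
  using integral_lborel_shift[of "%x. indicator A x * Phi x" "h *\<^sub>R e"] by simp
 thus ?thesis
  using iA[OF int] iA[OF integrable_lborel_shift[OF int, of "h *\<^sub>R e"]]
  by (simp add: algebra_simps diff_divide_distrib Bochner_Integration.integral_diff)
 qed
 have "(%_. 0) \<longlonglongrightarrow> (LBINT x. indicator A x * Phi' x e)"
 using difference_quotient_tendsto[OF c1 K, of "indicat_real A" 1 e] unfolding q0 by simp
 thus ?thesis by (simp add: LIMSEQ_const_iff)
qed

lemma integral_divergence_zero:
 fixes Phi :: "'a::euclidean_space => 'a"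
 assumes "c1_deriv Phi Phi'" "compact K" "!!x. x ~: K ==> Phi x = 0"
 shows "(LBINT x. divergence Phi x) = 0"
proof -
 have i: "integrable lborel (%x. Phi' x b \<bullet> b)" for b
 using c1_deriv_continuous_deriv[OF assms(1)]
  c1_deriv_zero_off_closed[OF assms(1) compact_imp_closed[OF assms(2)] assms(3)]
 by (intro integrable_compact_support[OF _ assms(2)]) (auto intro!: continuous_intros)
 have "(LBINT x. Phi' x b \<bullet> b) = 0" for b
 using integral_directional_deriv_zero[OF c1_deriv_inner_const[OF assms(1), of b] assms(2), of UNIV b] assms(3)
 by simp
 thus ?thesis
 using i by (simp add: divergence_c1_deriv[OF assms(1)])
qed

section \<open>Lebesgue measure on a hyperplane\<close>

definition proj_along :: "'a::euclidean_space => 'a => 'a" where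
 "proj_along e x = x - (x \<bullet> e) *\<^sub>R e"

text \<open>For a unit vector \<open>e\<close> this is Lebesgue measure on the hyperplane orthogonal to \<open>e\<close>: the hyperplane
 is thickened to a slab of height one.\<close>

definition slab :: "'a::euclidean_space => 'a measure" where
 "slab e = distr (density lborel (indicator {x. 0 <= x \<bullet> e & x \<bullet> e < 1})) borel (proj_along e)"

lemma sets_slab_measure [measurable_cong, simp]: "sets (slab e) = sets borel"
 by (simp add: slab_def)

lemma space_slab_measure [simp]: "space (slab e) = UNIV"
 by (simp add: slab_def)

lemma proj_along_measurable [measurable]: "proj_along e : borel_measurable borel"
 unfolding proj_along_def by measurable

lemma continuous_proj_along: "continuous_on S (proj_along e)"
 unfolding proj_along_def by (intro continuous_intros)

lemma proj_along_inner_self: "norm e = 1 ==> proj_along e x \<bullet> e = 0"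
 by (simp add: proj_along_def inner_diff_left norm_eq_1)

lemma proj_along_id: "x \<bullet> e = 0 ==> proj_along e x = x"
 by (simp add: proj_along_def)

lemma proj_along_shift: "norm e = 1 ==> proj_along e (x + t *\<^sub>R e) = proj_along e x"
 by (simp add: proj_along_def inner_add_left norm_eq_1 algebra_simps)

lemma proj_along_diff: "proj_along e (x - y) = proj_along e x - proj_along e y"
 by (simp add: proj_along_def inner_diff_left algebra_simps)

lemma norm_proj_along: 
 assumes "norm e = 1" shows "(norm x)\<^sup>2 = (norm (proj_along e x))\<^sup>2 + (x \<bullet> e)\<^sup>2"
proof -
 have "e \<bullet> e = 1" using assms by (simp add: norm_eq_1)
 hence "proj_along e x \<bullet> proj_along e x = x \<bullet> x - (x \<bullet> e)\<^sup>2"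
 by (simp only: proj_along_def inner_diff_left inner_diff_right inner_scaleR_left inner_scaleR_right
  inner_commute[of e x]) (simp add: power2_eq_square)
 thus ?thesis by (simp only: power2_norm_eq_inner)
qed

lemma norm_proj_along_le: "norm e = 1 ==> norm (proj_along e x) <= norm x"
 using norm_proj_along[of e x] by (metis le_add_same_cancel1 norm_ge_zero power2_le_imp_le zero_le_power2)

lemma slab_set_measurable [measurable]: "{x::'a::euclidean_space. 0 <= x \<bullet> e & x \<bullet> e < 1} : sets borel"
 by measurable

lemma slab_cylinder_measurable:
 fixes e :: "'a::euclidean_space"
 assumes [measurable]: "A : sets borel" "I : sets borel"
 shows "{x. proj_along e x : A & x \<bullet> e : I} : sets borel"
 by measurable

lemma nn_integral_slab_measure:
 assumes [measurable]: "F : borel_measurable borel"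
 shows "(\<integral>\<^sup>+y. F y \<partial>slab e)
 = (\<integral>\<^sup>+x. indicator {x. 0 <= x \<bullet> e & x \<bullet> e < 1} x * F (proj_along e x) \<partial>lborel)"
 unfolding slab_def
 by (subst nn_integral_distr) (auto simp: nn_integral_density)

lemma AE_slab_measure: "norm e = 1 ==> AE y in slab e. y \<bullet> e = 0"
 unfolding slab_def
 by (subst AE_distr_iff) (auto simp: proj_along_inner_self)

text \<open>After exchanging the integrals and translating along \<open>e\<close>, each point
  \<open>x\<close> is weighted by the length of the set of \<open>t\<close> for which
  \<open>x - t e\<close> lies in the slab of height one, and this length is 1. No coordinates have
  to be chosen.\<close>

lemma nn_integral_slab_fubini:
 fixes e :: "'a::euclidean_space"
 assumes e: "norm e = 1" and [measurable]: "F : borel_measurable borel"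
 shows "(\<integral>\<^sup>+x. F x \<partial>lborel) = (\<integral>\<^sup>+y. (\<integral>\<^sup>+t. F (y + t *\<^sub>R e) \<partial>lborel) \<partial>slab e)"
proof -
 define I where "I = (indicator {x. 0 <= x \<bullet> e & x \<bullet> e < 1} :: 'a => ennreal)"
 have [measurable]: "I : borel_measurable borel" unfolding I_def by measurable
 have shift: "(\<integral>\<^sup>+t. F (proj_along e x + t *\<^sub>R e) \<partial>lborel) = (\<integral>\<^sup>+t. F (x + t *\<^sub>R e) \<partial>lborel)" for x
 using nn_integral_lborel_shift[of "%t. F (x + t *\<^sub>R e)" "- (x \<bullet> e)"]
 by (simp add: proj_along_def algebra_simps)
 have inner: "(\<integral>\<^sup>+t. I (x - t *\<^sub>R e) \<partial>lborel) = 1" for x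
 proof -
 have "I (x - t *\<^sub>R e) = indicator {x \<bullet> e - 1 <.. x \<bullet> e} t" for t
  using e by (auto simp: I_def indicator_def inner_diff_left norm_eq_1)
 thus ?thesis by simp
 qed
 have "(\<integral>\<^sup>+y. (\<integral>\<^sup>+t. F (y + t *\<^sub>R e) \<partial>lborel) \<partial>slab e)
  = (\<integral>\<^sup>+x. I x * (\<integral>\<^sup>+t. F (x + t *\<^sub>R e) \<partial>lborel) \<partial>lborel)"
 by (subst nn_integral_slab_measure) (auto simp: shift I_def)
 also have "... = (\<integral>\<^sup>+x. (\<integral>\<^sup>+t. I x * F (x + t *\<^sub>R e) \<partial>lborel) \<partial>lborel)"
 by (simp add: nn_integral_cmult)
 also have "... = (\<integral>\<^sup>+t. (\<integral>\<^sup>+x. I x * F (x + t *\<^sub>R e) \<partial>lborel) \<partial>lborel)"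
 by (rule lborel_pair.Fubini'[symmetric]) measurable
 also have "... = (\<integral>\<^sup>+t. (\<integral>\<^sup>+x. I (x - t *\<^sub>R e) * F x \<partial>lborel) \<partial>lborel)"
 proof (rule nn_integral_cong)
 fix t
 show "(\<integral>\<^sup>+x. I x * F (x + t *\<^sub>R e) \<partial>lborel) = (\<integral>\<^sup>+x. I (x - t *\<^sub>R e) * F x \<partial>lborel)"
  using nn_integral_lborel_shift[of "%x. I (x - t *\<^sub>R e) * F x" "t *\<^sub>R e"] by simp
 qed
 also have "... = (\<integral>\<^sup>+x. (\<integral>\<^sup>+t. I (x - t *\<^sub>R e) * F x \<partial>lborel) \<partial>lborel)"
 by (rule lborel_pair.Fubini') measurable
 also have "... = (\<integral>\<^sup>+x. F x \<partial>lborel)"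
 by (simp add: nn_integral_multc inner)
 finally show ?thesis by simp
qed

lemma nn_integral_slab_product:
 fixes e :: "'a::euclidean_space"
 assumes e: "norm e = 1" and [measurable]: "F : borel_measurable borel" "q : borel_measurable borel"
 shows "(\<integral>\<^sup>+x. F (proj_along e x) * q (x \<bullet> e) \<partial>lborel) = (\<integral>\<^sup>+y. F y \<partial>slab e) * (\<integral>\<^sup>+t. q t \<partial>lborel)"
proof -
 have "(\<integral>\<^sup>+x. F (proj_along e x) * q (x \<bullet> e) \<partial>lborel)
  = (\<integral>\<^sup>+y. (\<integral>\<^sup>+t. F (proj_along e (y + t *\<^sub>R e)) * q ((y + t *\<^sub>R e) \<bullet> e) \<partial>lborel) \<partial>slab e)"
 by (rule nn_integral_slab_fubini[OF e]) measurable
 also have "... = (\<integral>\<^sup>+y. F y * (\<integral>\<^sup>+t. q t \<partial>lborel) \<partial>slab e)"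
 proof (rule nn_integral_cong_AE)
 show "AE y in slab e. (\<integral>\<^sup>+t. F (proj_along e (y + t *\<^sub>R e)) * q ((y + t *\<^sub>R e) \<bullet> e) \<partial>lborel)
  = F y * (\<integral>\<^sup>+t. q t \<partial>lborel)"
  using AE_slab_measure[OF e]
 proof eventually_elim
  case (elim y)
  have "F (proj_along e (y + t *\<^sub>R e)) * q ((y + t *\<^sub>R e) \<bullet> e) = F y * q t" for t
  using e elim by (simp add: proj_along_shift proj_along_id inner_add_left norm_eq_1)
  thus ?case by (simp add: nn_integral_cmult)
 qed
 qed
 also have "... = (\<integral>\<^sup>+y. F y \<partial>slab e) * (\<integral>\<^sup>+t. q t \<partial>lborel)"
 by (rule nn_integral_multc) measurable
 finally show ?thesis .
qed

lemma emeasure_slab_product: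
 fixes e :: "'a::euclidean_space"
 assumes e: "norm e = 1" and [measurable]: "A : sets borel" "I : sets borel"
 shows "emeasure lborel {x. proj_along e x : A & x \<bullet> e : I} = emeasure (slab e) A * emeasure lborel I"
proof -
 have "emeasure lborel {x. proj_along e x : A & x \<bullet> e : I}
  = (\<integral>\<^sup>+x. indicator {x. proj_along e x : A & x \<bullet> e : I} x \<partial>lborel)"
 by (subst nn_integral_indicator) auto
 also have "... = (\<integral>\<^sup>+x. indicator A (proj_along e x) * indicator I (x \<bullet> e) \<partial>lborel)"
 by (intro nn_integral_cong) (auto simp: indicator_def)
 also have "... = emeasure (slab e) A * emeasure lborel I"
 by (subst nn_integral_slab_product[OF e]) auto
 finally show ?thesis .
qed

lemma emeasure_slab_measure:
 fixes e :: "'a::euclidean_space"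
 assumes e: "norm e = 1" and [measurable]: "A : sets borel"
 shows "emeasure (slab e) A = emeasure lborel {x. proj_along e x : A & x \<bullet> e : {0..<1}}"
 using emeasure_slab_product[OF e assms(2), of "{0..<1}"] by simp

lemma emeasure_slab_measure_bounded:
 fixes e :: "'a::euclidean_space"
 assumes e: "norm e = 1" and [measurable]: "A : sets borel" and "bounded A"
 shows "emeasure (slab e) A < \<infinity>"
proof -
 obtain B where B: "!!x. x : A ==> norm x <= B" using \<open>bounded A\<close> by (auto simp: bounded_iff)
 have "norm x <= B + 1" if "proj_along e x : A" "x \<bullet> e : {0..<1}" for x
 proof -
 have "x = proj_along e x + (x \<bullet> e) *\<^sub>R e" by (simp add: proj_along_def)
 hence "norm x <= norm (proj_along e x) + norm ((x \<bullet> e) *\<^sub>R e)" by (metis norm_triangle_ineq)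
 thus ?thesis using B[OF that(1)] that(2) e by auto
 qed
 hence "{x. proj_along e x : A & x \<bullet> e : {0..<1}} <= cball 0 (B + 1)" by auto
 hence "emeasure lborel {x. proj_along e x : A & x \<bullet> e : {0..<1}} <= emeasure lborel (cball (0::'a) (B + 1))"
 by (intro emeasure_mono) auto
 also have "... < \<infinity>" using emeasure_bounded_finite[of "cball (0::'a) (B + 1)"] by simp
 finally show ?thesis using emeasure_slab_measure[OF e assms(2)] by simp
qed

lemma sigma_finite_slab_measure:
 fixes e :: "'a::euclidean_space"
 assumes "norm e = 1" shows "sigma_finite_measure (slab e)"
proof
 show "EX A. countable A & A <= sets (slab e) & \<Union> A = space (slab e) &
  (ALL a:A. emeasure (slab e) a ~= \<infinity>)"
 using real_arch_simple emeasure_slab_measure_bounded[OF assms]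
 by (intro exI[of _ "range (%n::nat. cball 0 (real n))"]) (auto simp: less_top)
qed

lemma nn_integral_lborel_scale:
 fixes f :: "'a::euclidean_space => ennreal"
 assumes [measurable]: "f : borel_measurable borel" and c: "0 < c"
 shows "(\<integral>\<^sup>+x. f x \<partial>lborel) = ennreal (c ^ DIM('a)) * (\<integral>\<^sup>+x. f (c *\<^sub>R x) \<partial>lborel)"
proof -
 have "(\<integral>\<^sup>+x. f x \<partial>lborel) = (\<integral>\<^sup>+x. f x \<partial>density (distr lborel borel (%x. 0 + c *\<^sub>R x)) (%_. \<bar>c\<bar>^DIM('a)))"
 using lborel_affine[of c "0::'a"] c by simp
 also have "... = ennreal (c ^ DIM('a)) * (\<integral>\<^sup>+x. f (c *\<^sub>R x) \<partial>lborel)"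
 using c by (subst nn_integral_density) (auto simp: nn_integral_distr nn_integral_cmult)
 finally show ?thesis .
qed

text \<open>Rescaling turns the slab of height 1 into one of height \<open>1/r\<close>, which takes
  away one of the powers of \<open>r\<close> in the change of volume.\<close>

lemma emeasure_slab_cball_scale:
 fixes e :: "'a::euclidean_space"
 assumes e: "norm e = 1" and r: "0 < r"
 shows "emeasure (slab e) (cball 0 r) = ennreal (r ^ (DIM('a) - 1)) * emeasure (slab e) (cball 0 1)"
proof -
 have "emeasure (slab e) (cball 0 r) = (\<integral>\<^sup>+x. indicator {x. proj_along e x : cball 0 r & x \<bullet> e : {0..<1}} x \<partial>lborel)"
 by (subst emeasure_slab_measure[OF e]) auto
 also have "... = ennreal (r ^ DIM('a)) * (\<integral>\<^sup>+x. indicator {x. proj_along e x : cball 0 r & x \<bullet> e : {0..<1}} (r *\<^sub>R x) \<partial>lborel)"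
 by (rule nn_integral_lborel_scale[OF _ r]) (intro borel_measurable_indicator slab_cylinder_measurable; simp)
 also have "(\<integral>\<^sup>+x. indicator {x. proj_along e x : cball 0 r & x \<bullet> e : {0..<1}} (r *\<^sub>R x) \<partial>lborel)
  = (\<integral>\<^sup>+x. indicator {x. proj_along e x : cball 0 1 & x \<bullet> e : {0..<1/r}} x \<partial>lborel)"
 proof (intro nn_integral_cong)
 fix x
 have "proj_along e (r *\<^sub>R x) = r *\<^sub>R proj_along e x" by (simp add: proj_along_def algebra_simps)
 thus "indicator {x. proj_along e x : cball 0 r & x \<bullet> e : {0..<1}} (r *\<^sub>R x)
  = (indicator {x. proj_along e x : cball 0 1 & x \<bullet> e : {0..<1/r}} x :: ennreal)"
  using r by (auto simp: indicator_def zero_le_mult_iff field_simps)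
 qed
 also have "... = emeasure (slab e) (cball 0 1) * emeasure lborel {0..<1/r}"
 by (subst emeasure_slab_product[OF e, symmetric]) auto
 also have "emeasure lborel {0..<1/r} = ennreal (1/r)" using r by simp
 also have "ennreal (r ^ DIM('a)) * (emeasure (slab e) (cball 0 1) * ennreal (1/r))
  = (ennreal (r ^ DIM('a)) * ennreal (1/r)) * emeasure (slab e) (cball 0 1)"
 by (simp add: ac_simps)
 also have "ennreal (r ^ DIM('a)) * ennreal (1/r) = ennreal (r ^ (DIM('a) - 1))"
 using r DIM_positive[where 'a='a] 
 by (simp add: ennreal_mult[symmetric] power_diff_conv_inverse divide_inverse)
 finally show ?thesis .
qed

text \<open>The recursion between ball volumes in consecutive dimensions: the Beta value is the
  integral of (1 - t^2)^((n-1)/2) over [-1, 1].\<close>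

lemma unit_ball_vol_Beta:
 assumes "0 < n"
 shows "unit_ball_vol (real n) = unit_ball_vol (real (n - 1)) * Beta (1/2) (real (n - 1) / 2 + 1)"
proof -
 define m where "m = n - 1"
 have n: "real n = real m + 1" using assms by (simp add: m_def)
 have g: "Gamma (real m / 2 + 1) ~= 0" "Gamma (real m / 2 + 1/2 + 1) ~= 0"
 by (simp_all add: Gamma_real_pos order_less_imp_not_eq2)
 have "Beta (1/2) (real m / 2 + 1) = sqrt pi * Gamma (real m / 2 + 1) / Gamma (real m / 2 + 1/2 + 1)"
 by (simp add: Beta_def Gamma_one_half_real add.commute add.left_commute)
 moreover have "pi powr (real m / 2 + 1/2) = pi powr (real m / 2) * sqrt pi"
 by (simp add: powr_add powr_half_sqrt)
 ultimately show ?thesis using g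
 unfolding unit_ball_vol_def n m_def[symmetric] by (simp add: add_divide_distrib)
qed

text \<open>Slicing the full-dimensional unit ball orthogonally to \<open>e\<close> expresses its
  volume as the unknown constant \<open>ka\<close> times a Beta value; comparison with
  \<open>unit_ball_vol_Beta\<close> determines \<open>ka\<close>. This shows that the slab measure
  carries the normalisation of Hausdorff measure, without identifying the hyperplane with a space of
  lower dimension.\<close>

lemma emeasure_slab_cball:
 fixes e :: "'a::euclidean_space"
 assumes e: "norm e = 1" and r: "0 < r"
 shows "emeasure (slab e) (cball 0 r) = ennreal (unit_ball_vol (real (DIM('a) - 1)) * r ^ (DIM('a) - 1))"
proof -
 define n where "n = DIM('a)"
 have n: "0 < n" by (simp add: n_def)
 define ka where "ka = emeasure (slab e) (cball 0 1)"
 have [measurable]: "cball (0::'a) 1 : sets borel" by simp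
 interpret S: sigma_finite_measure "slab e" by (rule sigma_finite_slab_measure[OF e])
 interpret P: pair_sigma_finite "slab e" "lborel :: real measure" ..
 \<comment> \<open>The values 1 and -1 are left out because the scaling formula needs a positive
   radius; two points do not affect the integral over \<open>t\<close>.\<close>
 have slice: "(\<integral>\<^sup>+y. indicator (cball 0 1) (y + t *\<^sub>R e) \<partial>slab e)
  = ka * ennreal (indicator {-1..1} t * sqrt (1 - t\<^sup>2) ^ (n - 1))" if "t ~= 1" "t ~= -1" for t
 proof -
 have iff: "norm (y + t *\<^sub>R e) <= 1 \<longleftrightarrow> (norm y)\<^sup>2 <= 1 - t\<^sup>2" if "y \<bullet> e = 0" for y
 proof -
  have "(norm (y + t *\<^sub>R e))\<^sup>2 = (norm y)\<^sup>2 + t\<^sup>2"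
  using norm_proj_along[OF e, of "y + t *\<^sub>R e"] that e
  by (simp add: proj_along_shift proj_along_id inner_add_left norm_eq_1)
  moreover have "norm (y + t *\<^sub>R e) <= 1 \<longleftrightarrow> (norm (y + t *\<^sub>R e))\<^sup>2 <= 1"
  by (metis abs_norm_cancel abs_square_le_1)
  ultimately show ?thesis by auto
 qed
 show ?thesis
 proof (cases "-1 < t & t < 1")
  case True
  hence pos: "0 < 1 - t\<^sup>2" by (simp add: abs_square_less_1 abs_less_iff)
  have "(\<integral>\<^sup>+y. indicator (cball 0 1) (y + t *\<^sub>R e) \<partial>slab e)
   = (\<integral>\<^sup>+y. indicator (cball 0 (sqrt (1 - t\<^sup>2))) y \<partial>slab e)"
  proof (rule nn_integral_cong_AE)
  have sq: "(norm y)\<^sup>2 <= 1 - t\<^sup>2 \<longleftrightarrow> norm y <= sqrt (1 - t\<^sup>2)" for y :: 'a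
  proof
   assume "norm y <= sqrt (1 - t\<^sup>2)"
   hence "(norm y)\<^sup>2 <= (sqrt (1 - t\<^sup>2))\<^sup>2" by (rule power_mono) simp
   thus "(norm y)\<^sup>2 <= 1 - t\<^sup>2" using pos by simp
  qed (rule real_le_rsqrt)
  show "AE y in slab e. indicator (cball 0 1) (y + t *\<^sub>R e)
   = (indicator (cball 0 (sqrt (1 - t\<^sup>2))) y :: ennreal)"
   using AE_slab_measure[OF e]
  proof eventually_elim
   case (elim y)
   show ?case using iff[OF elim] sq[of y] by (simp add: indicator_def)
  qed
  qed
  also have "... = emeasure (slab e) (cball 0 (sqrt (1 - t\<^sup>2)))" by simp
  also have "... = ennreal (sqrt (1 - t\<^sup>2) ^ (n - 1)) * ka"
  using emeasure_slab_cball_scale[OF e, of "sqrt (1 - t\<^sup>2)"] pos by (simp add: n_def ka_def)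
  finally show ?thesis using True by (simp add: mult.commute)
 next
  case False
  hence "1 < \<bar>t\<bar>" using that by linarith
  hence "1 < \<bar>t\<bar>\<^sup>2" by (rule one_less_power) simp
  hence "1 < t\<^sup>2" by simp
  hence "AE y in slab e. indicator (cball 0 1) (y + t *\<^sub>R e) = (0::ennreal)"
  proof -
  have "\<not> (norm y)\<^sup>2 <= 1 - t\<^sup>2" for y :: 'a using \<open>1 < t\<^sup>2\<close> by (smt (verit) zero_le_power2)
  thus ?thesis
   using AE_slab_measure[OF e] by (auto simp: indicator_def iff elim!: eventually_mono)
  qed
  hence "(\<integral>\<^sup>+y. indicator (cball 0 1) (y + t *\<^sub>R e) \<partial>slab e) = 0"
  by (subst nn_integral_0_iff_AE) auto
  thus ?thesis using False that by (auto simp: indicator_def)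
 qed
 qed
 have "ennreal (unit_ball_vol (real n)) = emeasure lborel (cball (0::'a) 1)"
 by (subst emeasure_cball) (auto simp: n_def)
 also have "... = (\<integral>\<^sup>+x. indicator (cball (0::'a) 1) x \<partial>lborel)" by simp
 also have "... = (\<integral>\<^sup>+y. (\<integral>\<^sup>+t. indicator (cball 0 1) (y + t *\<^sub>R e) \<partial>lborel) \<partial>slab e)"
 by (rule nn_integral_slab_fubini[OF e]) measurable
 also have "... = (\<integral>\<^sup>+t. (\<integral>\<^sup>+y. indicator (cball 0 1) (y + t *\<^sub>R e) \<partial>slab e) \<partial>lborel)"
 by (rule P.Fubini'[symmetric]) measurable
 also have "... = (\<integral>\<^sup>+t. ka * ennreal (indicator {-1..1} t * sqrt (1 - t\<^sup>2) ^ (n - 1)) \<partial>lborel)"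
 using AE_lborel_singleton[of "1::real"] AE_lborel_singleton[of "-1::real"]
 by (intro nn_integral_cong_AE, eventually_elim) (simp add: slice)
 also have "... = ka * ennreal (Beta (1/2) (real (n - 1) / 2 + 1))"
 by (subst nn_integral_cmult) (auto simp: emeasure_cball_aux_integral)
 finally have 1: "ennreal (unit_ball_vol (real n)) = ka * ennreal (Beta (1/2) (real (n - 1) / 2 + 1))" .
 define be where "be = Beta (1/2) (real (n - 1) / 2 + 1)"
 have be: "0 < be"
 by (auto simp: be_def Beta_def intro!: divide_pos_pos mult_pos_pos Gamma_real_pos)
 have "ka * ennreal be = ennreal (unit_ball_vol (real (n - 1))) * ennreal be"
 unfolding 1[folded be_def, symmetric] unit_ball_vol_Beta[OF n, folded be_def]
 using be by (intro ennreal_mult) auto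
 hence "ka = ennreal (unit_ball_vol (real (n - 1)))"
 using be mult_divide_eq_ennreal[of "ennreal be" ka]
  mult_divide_eq_ennreal[of "ennreal be" "ennreal (unit_ball_vol (real (n - 1)))"] by simp
 thus ?thesis
 using emeasure_slab_cball_scale[OF e r] r
 by (simp add: ka_def[symmetric] n_def[symmetric] ennreal_mult[symmetric] mult.commute)
qed

section \<open>Steiner symmetrization and the isodiametric inequality\<close>

text \<open>Steiner symmetrization along a unit vector \<open>b\<close>: on each line parallel to
  \<open>b\<close> the set is replaced by a centred open interval of the same length. The strict
  inequality keeps empty fibres empty.\<close>

definition steiner :: "'a::euclidean_space => 'a set => 'a set" where
 "steiner b S = {y. ennreal (2 * \<bar>y \<bullet> b\<bar>) < emeasure lborel {t. proj_along b y + t *\<^sub>R b : S}}"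

lemma fibre_measure_eq:
 assumes [measurable]: "S : sets borel"
 shows "emeasure lborel {t. proj_along b y + t *\<^sub>R b : S}
 = (\<integral>\<^sup>+t. indicator S (proj_along b y + t *\<^sub>R b) \<partial>lborel)"
proof -
 have "(\<integral>\<^sup>+t. indicator S (proj_along b y + t *\<^sub>R b) \<partial>lborel)
 = (\<integral>\<^sup>+t. indicator {t. proj_along b y + t *\<^sub>R b : S} t \<partial>lborel)"
 by (intro nn_integral_cong) (auto simp: indicator_def)
 thus ?thesis by simp
qed

lemma steiner_measurable [measurable]:
 assumes [measurable]: "S : sets borel"
 shows "steiner b S : sets borel"
 unfolding steiner_def fibre_measure_eq[OF assms] by measurable

lemma emeasure_steiner:
 fixes b :: "'a::euclidean_space"
 assumes [measurable]: "S : sets borel" and b: "norm b = 1"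
 shows "emeasure lborel (steiner b S) = emeasure lborel S"
proof -
 have len: "(\<integral>\<^sup>+t. indicator (steiner b S) (y + t *\<^sub>R b) \<partial>lborel) = (\<integral>\<^sup>+t. indicator S (y + t *\<^sub>R b) \<partial>lborel)"
 if y: "y \<bullet> b = 0" for y
 proof -
 define l where "l = emeasure lborel {t. y + t *\<^sub>R b : S}"
 have l: "l = (\<integral>\<^sup>+t. indicator S (y + t *\<^sub>R b) \<partial>lborel)"
  using fibre_measure_eq[OF assms(1), of b y] y by (simp add: proj_along_id l_def)
 have st: "y + t *\<^sub>R b : steiner b S \<longleftrightarrow> ennreal (2 * \<bar>t\<bar>) < l" for t
  using y b by (simp add: steiner_def proj_along_shift proj_along_id l_def inner_add_left norm_eq_1)
 have "(\<integral>\<^sup>+t. indicator (steiner b S) (y + t *\<^sub>R b) \<partial>lborel) = (\<integral>\<^sup>+t. indicator {t. ennreal (2 * \<bar>t\<bar>) < l} t \<partial>lborel)"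
  by (intro nn_integral_cong) (auto simp: indicator_def st)
 also have "... = emeasure lborel {t. ennreal (2 * \<bar>t\<bar>) < l}" by (subst nn_integral_indicator) auto
 also have "... = l"
 proof (cases l)
  case (real r)
  have "{t. ennreal (2 * \<bar>t\<bar>) < l} = {-r/2<..<r/2}"
  using real by (auto simp: ennreal_less_iff abs_less_iff)
  thus ?thesis using real by simp
 next
  case top
  hence "{t. ennreal (2 * \<bar>t\<bar>) < l} = UNIV" by auto
  thus ?thesis using top by simp
 qed
 finally show ?thesis using l by simp
 qed
 have "emeasure lborel (steiner b S) = (\<integral>\<^sup>+y. (\<integral>\<^sup>+t. indicator (steiner b S) (y + t *\<^sub>R b) \<partial>lborel) \<partial>slab b)"
 by (subst nn_integral_slab_fubini[OF b, symmetric]) auto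
 also have "... = (\<integral>\<^sup>+y. (\<integral>\<^sup>+t. indicator S (y + t *\<^sub>R b) \<partial>lborel) \<partial>slab b)"
 using AE_slab_measure[OF b] by (intro nn_integral_cong_AE, eventually_elim) (rule len)
 also have "... = emeasure lborel S"
 by (subst nn_integral_slab_fubini[OF b, symmetric]) auto
 finally show ?thesis .
qed

text \<open>If all mutual distances were below |a - b|, the differences Sup X - Inf Y and Sup Y -
  Inf X would both be at most |a - b|. Their sum is the sum of the lengths of the convex hulls,
  which exceeds 2|a| + 2|b|.\<close>

lemma steiner_spread:
 fixes X Y :: "real set"
 assumes X: "ennreal (2 * \<bar>a\<bar>) < emeasure lborel X" "X : sets borel"
 and Y: "ennreal (2 * \<bar>b\<bar>) < emeasure lborel Y" "Y : sets borel"
 shows "EX s:X. EX t:Y. \<bar>a - b\<bar> <= \<bar>s - t\<bar>"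
proof (rule ccontr)
 assume *: "\<not> ?thesis"
 hence less: "\<bar>s - t\<bar> < \<bar>a - b\<bar>" if "s : X" "t : Y" for s t using that by (meson linorder_not_less)
 have ne: "X ~= {}" "Y ~= {}" using X Y by auto
 then obtain x0 y0 where x0: "x0 : X" and y0: "y0 : Y" by auto
 have "x <= y0 + \<bar>a - b\<bar>" "y0 - \<bar>a - b\<bar> <= x" if "x : X" for x
 using less[OF that y0] by linarith+
 hence bX: "bdd_above X" "bdd_below X" by (meson bdd_aboveI bdd_belowI)+
 have "y <= x0 + \<bar>a - b\<bar>" "x0 - \<bar>a - b\<bar> <= y" if "y : Y" for y
 using less[OF x0 that] by linarith+
 hence bY: "bdd_above Y" "bdd_below Y" by (meson bdd_aboveI bdd_belowI)+
 have len: "c < Sup Z - Inf Z" if "ennreal c < emeasure lborel Z" "bdd_above Z" "bdd_below Z" "Z ~= {}" "0 <= c"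
 for Z :: "real set" and c
 proof -
 have "Z <= {Inf Z .. Sup Z}" using that by (auto intro: cInf_lower cSup_upper)
 hence "emeasure lborel Z <= emeasure lborel {Inf Z .. Sup Z}" by (intro emeasure_mono) auto
 also have "... = ennreal (Sup Z - Inf Z)" using cInf_le_cSup[OF that(4,2,3)] by simp
 finally show ?thesis using that by (metis ennreal_less_iff order_less_le_trans)
 qed
 have 1: "Sup X - Inf Y <= \<bar>a - b\<bar>"
 proof -
 have "Sup X <= t + \<bar>a - b\<bar>" if "t : Y" for t
  using less[OF _ that] ne by (intro cSup_least) (auto simp: abs_less_iff algebra_simps dest!: less[OF _ that])
 hence "Sup X - \<bar>a - b\<bar> <= Inf Y" using ne by (intro cInf_greatest) (auto simp: algebra_simps)
 thus ?thesis by simp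
 qed
 have 2: "Sup Y - Inf X <= \<bar>a - b\<bar>"
 proof -
 have "Sup Y <= s + \<bar>a - b\<bar>" if "s : X" for s
  using less[OF that] ne by (intro cSup_least) (auto simp: abs_less_iff algebra_simps dest!: less[OF that])
 hence "Sup Y - \<bar>a - b\<bar> <= Inf X" using ne by (intro cInf_greatest) (auto simp: algebra_simps)
 thus ?thesis by simp
 qed
 show False using len[OF X(1) bX ne(1)] len[OF Y(1) bY ne(2)] 1 2 by linarith
qed

lemma norm_proj_along_orthogonal:
 assumes e: "norm e = 1" and b: "norm b = 1" and eb: "b \<bullet> e = 0"
 shows "(norm (proj_along e x))\<^sup>2 = (norm (proj_along e (proj_along b x)))\<^sup>2 + (x \<bullet> b)\<^sup>2"
proof -
 have "proj_along b (proj_along e x) = proj_along e (proj_along b x)" "proj_along e x \<bullet> b = x \<bullet> b"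
 using eb by (simp_all add: proj_along_def inner_diff_left inner_commute algebra_simps)
 thus ?thesis using norm_proj_along[OF b, of "proj_along e x"] by simp
qed

text \<open>For two points of the symmetrized set, \<open>steiner_spread\<close> finds two points of
  \<open>S\<close> on the same fibres whose separation along \<open>b\<close> is at least as large;
  the components orthogonal to \<open>b\<close> are unchanged. Only the diameter seen after
  projecting along \<open>e\<close> is controlled, which is all that a hyperplane set needs.\<close>

lemma steiner_diameter:
 assumes e: "norm e = 1" and b: "norm b = 1" and eb: "b \<bullet> e = 0" and [measurable]: "S : sets borel"
 and S: "!!x y. x : S ==> y : S ==> norm (proj_along e (x - y)) <= d"
 and x: "x : steiner b S" and y: "y : steiner b S"
 shows "norm (proj_along e (x - y)) <= d"
proof -
 obtain s t where s: "proj_along b x + s *\<^sub>R b : S" and t: "proj_along b y + t *\<^sub>R b : S"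
 and st: "\<bar>x \<bullet> b - y \<bullet> b\<bar> <= \<bar>s - t\<bar>"
 using steiner_spread[of "x \<bullet> b" "{t. proj_along b x + t *\<^sub>R b : S}" "y \<bullet> b" "{t. proj_along b y + t *\<^sub>R b : S}"] x y
 unfolding steiner_def by auto
 define z where "z = proj_along b x + s *\<^sub>R b - (proj_along b y + t *\<^sub>R b)"
 have z: "z = proj_along b (x - y) + (s - t) *\<^sub>R b" by (simp add: z_def proj_along_diff algebra_simps)
 have zb: "z \<bullet> b = s - t" "proj_along b z = proj_along b (x - y)"
 using b proj_along_inner_self[OF b, of "x - y"]
 by (simp_all add: z inner_add_left norm_eq_1 proj_along_shift[OF b] proj_along_id)
 have "((x - y) \<bullet> b)\<^sup>2 <= (s - t)\<^sup>2" using st by (simp add: inner_diff_left abs_le_square_iff)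
 hence "(norm (proj_along e (x - y)))\<^sup>2 <= (norm (proj_along e z))\<^sup>2"
 using norm_proj_along_orthogonal[OF e b eb, of "x - y"] norm_proj_along_orthogonal[OF e b eb, of z]
 by (simp add: zb)
 hence "norm (proj_along e (x - y)) <= norm (proj_along e z)" by (simp add: power2_le_iff_abs_le)
 also have "... <= d" unfolding z_def using S[OF s t] .
 finally show ?thesis .
qed

lemma steiner_fibre_point:
 assumes "y : steiner b S"
 obtains t where "proj_along b y + t *\<^sub>R b : S"
proof -
 have "{t. proj_along b y + t *\<^sub>R b : S} ~= {}"
 using assms unfolding steiner_def by force
 thus thesis using that by auto
qed

lemma steiner_reflect_self:
 assumes b: "norm b = 1" and "y : steiner b S"
 shows "y - (2 * (y \<bullet> b)) *\<^sub>R b : steiner b S"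
proof -
 have "proj_along b (y - (2 * (y \<bullet> b)) *\<^sub>R b) = proj_along b y"
 using proj_along_shift[OF b, of y "- (2 * (y \<bullet> b))"] by simp
 moreover have "(y - (2 * (y \<bullet> b)) *\<^sub>R b) \<bullet> b = - (y \<bullet> b)"
 using b by (simp add: inner_diff_left norm_eq_1)
 ultimately show ?thesis using assms(2) by (simp add: steiner_def)
qed

text \<open>The reflection orthogonal to \<open>c\<close> maps fibres along \<open>b\<close> to
  fibres along \<open>b\<close> of the same length. Hence a symmetrization in an orthogonal
  direction keeps the symmetries gained before.\<close>

lemma steiner_reflect_other:
 assumes bc: "b \<bullet> c = 0" and c: "norm c = 1" 
 and S: "!!y. y : S ==> y - (2 * (y \<bullet> c)) *\<^sub>R c : S" and y: "y : steiner b S"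
 shows "y - (2 * (y \<bullet> c)) *\<^sub>R c : steiner b S"
proof -
 define r where "r y = y - (2 * (y \<bullet> c)) *\<^sub>R c" for y
 have rr: "r (r y) = y" for y using c by (simp add: r_def inner_diff_left norm_eq_1 algebra_simps)
 have "proj_along b (r y) + t *\<^sub>R b = r (proj_along b y + t *\<^sub>R b)" for t
 using bc by (simp add: r_def proj_along_def inner_diff_left inner_add_left inner_commute[of c b] algebra_simps)
 moreover have "r z : S \<longleftrightarrow> z : S" for z using S rr unfolding r_def by metis
 moreover have "r y \<bullet> b = y \<bullet> b" using bc by (simp add: r_def inner_diff_left inner_commute[of c b])
 ultimately show ?thesis using y unfolding steiner_def r_def[symmetric] by simp
qed

text \<open>All directions are orthogonal to \<open>e\<close>, so the heights
  \<open>x \<bullet> e\<close> are untouched and the set remains in the slab; orthogonality among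
  the directions accumulates the symmetries.\<close>

lemma iterated_steiner:
 fixes e :: "'a::euclidean_space"
 assumes e: "norm e = 1" and B: "finite B" "pairwise orthogonal B" "!!b. b : B ==> norm b = 1 & b \<bullet> e = 0"
 and S: "S : sets borel" "!!x y. x : S ==> y : S ==> norm (proj_along e (x - y)) <= d"
  "!!x. x : S ==> x \<bullet> e : I"
 shows "EX T:sets borel. emeasure lborel T = emeasure lborel S &
  (ALL x:T. ALL y:T. norm (proj_along e (x - y)) <= d) & (ALL x:T. x \<bullet> e : I) &
  (ALL b:B. ALL y:T. y - (2 * (y \<bullet> b)) *\<^sub>R b : T)"
 using B
proof (induction rule: finite_induct)
 case empty
 thus ?case using S by (intro bexI[of _ S]) auto
next
 case (insert b B)
 obtain T where T: "T : sets borel" "emeasure lborel T = emeasure lborel S"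
  "!!x y. x : T ==> y : T ==> norm (proj_along e (x - y)) <= d" "!!x. x : T ==> x \<bullet> e : I"
  "!!b y. b : B ==> y : T ==> y - (2 * (y \<bullet> b)) *\<^sub>R b : T"
 using insert by (auto simp: pairwise_insert)
 have b: "norm b = 1" "b \<bullet> e = 0" using insert by auto
 have orth: "b \<bullet> c = 0" if "c : B" for c
 using insert that by (auto simp: pairwise_insert orthogonal_def)
 show ?case
 proof (intro bexI[of _ "steiner b T"] conjI ballI)
 show "emeasure lborel (steiner b T) = emeasure lborel S"
  using emeasure_steiner[OF T(1) b(1)] T(2) by simp
 show "norm (proj_along e (x - y)) <= d" if "x : steiner b T" "y : steiner b T" for x y
  using steiner_diameter[OF e b T(1,3) that] .
 show "x \<bullet> e : I" if x: "x : steiner b T" for x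
 proof -
  obtain t where "proj_along b x + t *\<^sub>R b : T" using steiner_fibre_point[OF x] .
  from T(4)[OF this] show ?thesis using b by (simp add: proj_along_def inner_diff_left inner_add_left)
 qed
 show "y - (2 * (y \<bullet> c)) *\<^sub>R c : steiner b T" if c: "c : insert b B" and y: "y : steiner b T" for c y
 proof (cases "c = b")
  case True thus ?thesis using steiner_reflect_self[OF b(1) y] by simp
 next
  case False
  hence "c : B" "norm c = 1" using c insert by auto
  thus ?thesis using steiner_reflect_other[OF orth _ T(5) y] by blast
 qed
 show "steiner b T : sets borel" using steiner_measurable[OF T(1)] .
 qed
qed

text \<open>Composing the reflections of an orthonormal family gives the point reflection in its
  span: the later ones do not change the component that an earlier one reads off.\<close>

lemma reflect_all:
 assumes "finite B" "pairwise orthogonal B" "!!b. b : B ==> norm b = 1"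
 and "!!b y. b : B ==> y : T ==> y - (2 * (y \<bullet> b)) *\<^sub>R b : T" and "y : T"
 shows "y - (\<Sum>b\<in>B. (2 * (y \<bullet> b)) *\<^sub>R b) : T"
 using assms(1-4)
proof (induction rule: finite_induct)
 case empty thus ?case using assms(5) by simp
next
 case (insert b B)
 define z where "z = y - (\<Sum>b\<in>B. (2 * (y \<bullet> b)) *\<^sub>R b)"
 have "z : T" unfolding z_def using insert by (auto simp: pairwise_insert)
 moreover have "z \<bullet> b = y \<bullet> b"
 proof -
 have "(\<Sum>c\<in>B. (2 * (y \<bullet> c)) *\<^sub>R c) \<bullet> b = (\<Sum>c\<in>B. 2 * (y \<bullet> c) * (c \<bullet> b))"
  by (simp add: inner_sum_left)
 also have "... = 0"
  using insert by (intro sum.neutral) (auto simp: pairwise_insert orthogonal_def)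
 finally show ?thesis by (simp add: z_def inner_diff_left)
 qed
 ultimately have "z - (2 * (y \<bullet> b)) *\<^sub>R b : T" using insert.prems(3)[of b z] by simp
 thus ?case using insert by (simp add: z_def algebra_simps)
qed

text \<open>The isodiametric inequality on a hyperplane, by successive Steiner symmetrizations.\<close>

lemma isodiametric_slab:
 fixes e :: "'a::euclidean_space"
 assumes e: "norm e = 1" and A [measurable]: "A : sets borel" and d: "0 < d"
 and diam: "!!x y. x : A ==> y : A ==> dist x y <= d"
 shows "emeasure (slab e) A <= ennreal (unit_ball_vol (real (DIM('a) - 1)) * (d / 2) ^ (DIM('a) - 1))"
proof -
 \<comment> \<open>The set in the hyperplane is thickened, so that symmetrization can use Lebesgue
   measure on the whole space.\<close>
 define S where "S = {x. proj_along e x : A & x \<bullet> e : {0..<1}}"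
 have S: "S : sets borel" unfolding S_def by measurable
 obtain C where C: "e : C" "pairwise orthogonal C" "!!x. x : C ==> norm x = 1"
 "independent C" "card C = DIM('a)" "span C = UNIV"
 using vector_in_orthonormal_basis[OF e] by metis
 have fC: "finite C" using C(4) independent_imp_finite by blast
 define B where "B = C - {e}"
 have B: "finite B" "pairwise orthogonal B" "!!b. b : B ==> norm b = 1 & b \<bullet> e = 0"
 using fC C pairwise_subset[of _ C] unfolding B_def
 by (auto simp: pairwise_def orthogonal_def)
 obtain T where T: "T : sets borel" "emeasure lborel T = emeasure lborel S"
  "!!x y. x : T ==> y : T ==> norm (proj_along e (x - y)) <= d" "!!x. x : T ==> x \<bullet> e : {0..<1}"
  "!!b y. b : B ==> y : T ==> y - (2 * (y \<bullet> b)) *\<^sub>R b : T"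
 using iterated_steiner[OF e B S, of d "{0..<1}"] diam
 unfolding S_def by (auto simp: proj_along_diff dist_norm)
 have "norm (proj_along e y) <= d / 2" if y: "y : T" for y
 proof -
 define p where "p = proj_along e y"
 have "(\<Sum>b\<in>C. (y \<bullet> b) *\<^sub>R b) = y"
  using orthonormal_basis_expand[OF C(2,3) _ fC, of y] C(6) by simp
 hence "(\<Sum>b\<in>B. (y \<bullet> b) *\<^sub>R b) = p"
  using fC C(1) by (simp add: B_def p_def proj_along_def sum_diff1)
 hence "(\<Sum>b\<in>B. (2 * (y \<bullet> b)) *\<^sub>R b) = 2 *\<^sub>R p"
  using scaleR_sum_right[of 2 "%b. (y \<bullet> b) *\<^sub>R b" B] by simp
 \<comment> \<open>The projections of \<open>y\<close> and of its mirror image are \<open>p\<close>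
   and \<open>- p\<close>, at distance 2 |p|. Symmetry thus converts the bound on the diameter into
   containment in a cylinder of radius \<open>d / 2\<close>.\<close>
 hence "y - 2 *\<^sub>R p : T" using reflect_all[OF B(1,2) _ T(5) y] B(3) by auto
 from T(3)[OF y this] have "norm (proj_along e (2 *\<^sub>R p)) <= d" by simp
 moreover have "proj_along e (2 *\<^sub>R p) = 2 *\<^sub>R p"
  using proj_along_inner_self[OF e, of y] by (simp add: proj_along_id p_def)
 ultimately show ?thesis by (simp add: p_def)
 qed
 hence "T <= {x. proj_along e x : cball 0 (d/2) & x \<bullet> e : {0..<1}}" using T(4) by auto
 hence "emeasure lborel T <= emeasure lborel {x. proj_along e x : cball 0 (d/2) & x \<bullet> e : {0..<1}}"
 by (intro emeasure_mono) auto
 also have "... = emeasure (slab e) (cball 0 (d/2))"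
 by (subst emeasure_slab_measure[OF e]) auto
 also have "... = ennreal (unit_ball_vol (real (DIM('a) - 1)) * (d / 2) ^ (DIM('a) - 1))"
 using emeasure_slab_cball[OF e, of "d/2"] d by simp
 finally show ?thesis using T(2) emeasure_slab_measure[OF e A] by (simp add: S_def)
qed

section \<open>Hausdorff measure on Borel sets\<close>

definition hausdorff_cost :: "nat => 'a::euclidean_space set => ennreal" where
 "hausdorff_cost k C = (if C = {} then 0 else ennreal (unit_ball_vol (real k) * (diameter C / 2) ^ k))"

definition delta_cover :: "real => 'a::euclidean_space set => (nat => 'a set) => bool" where
 "delta_cover de A C \<longleftrightarrow> A <= (\<Union>i. C i) & (ALL i. bounded (C i) & diameter (C i) <= de)"

lemma hausdorff_pre_alt:
 "hausdorff_pre k de A = (INF C\<in>{C. delta_cover de A C}. (\<Sum>i. hausdorff_cost k (C i)))"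
 by (simp add: hausdorff_pre_def delta_cover_def hausdorff_cost_def)

lemma hausdorff_pre_le: "delta_cover de A C ==> hausdorff_pre k de A <= (\<Sum>i. hausdorff_cost k (C i))"
 unfolding hausdorff_pre_alt by (rule INF_lower) simp

lemma hausdorff_pre_approx:
 assumes "hausdorff_pre k de A < x"
 obtains C where "delta_cover de A C" "(\<Sum>i. hausdorff_cost k (C i)) < x"
 using assms unfolding hausdorff_pre_alt by (auto simp: INF_less_iff)

lemma delta_cover_mono: "A <= B ==> de <= de' ==> delta_cover de B C ==> delta_cover de' A C"
 unfolding delta_cover_def by (meson order_trans)

lemma hausdorff_pre_mono: "A <= B ==> hausdorff_pre k de A <= hausdorff_pre k de B"
 unfolding hausdorff_pre_alt by (rule INF_superset_mono) (auto intro: delta_cover_mono)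

lemma hausdorff_pre_antimono: "de <= de' ==> hausdorff_pre k de' A <= hausdorff_pre k de A"
 unfolding hausdorff_pre_alt by (rule INF_superset_mono) (auto intro: delta_cover_mono)

lemma hausdorff_pre_empty: "0 < de ==> hausdorff_pre k de {} = 0"
 using hausdorff_pre_le[of de "{}" "%_. {}" k] by (simp add: delta_cover_def hausdorff_cost_def)

lemma hausdorff_pre_le_outer: "0 < de ==> hausdorff_pre k de A <= hausdorff_outer k A"
 unfolding hausdorff_outer_def by (rule SUP_upper) simp

lemma hausdorff_outer_mono: "A <= B ==> hausdorff_outer k A <= hausdorff_outer k B"
 unfolding hausdorff_outer_def by (rule SUP_mono') (rule hausdorff_pre_mono)

lemma hausdorff_outer_empty: "hausdorff_outer k {} = 0"
 unfolding hausdorff_outer_def by (simp add: hausdorff_pre_empty)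

lemma ennreal_less_add_pos: "x < \<infinity> ==> 0 < e ==> x < x + ennreal e"
 by (cases x) (auto simp: ennreal_plus[symmetric] ennreal_less_iff simp del: ennreal_plus)

lemma hausdorff_pre_subadditive:
 assumes de: "0 < de"
 shows "hausdorff_pre k de (\<Union>i. A i) <= (\<Sum>i. hausdorff_pre k de (A i))"
proof (cases "(\<Sum>i. hausdorff_pre k de (A i)) = \<infinity>")
 case False
 have fin: "hausdorff_pre k de (A i) < \<infinity>" for i
 using False by (metis ennreal_suminf_lessD infinity_ennreal_def less_top)
 show ?thesis
 proof (rule ennreal_le_epsilon)
 fix e :: real assume e: "0 < e"
 have "EX C. delta_cover de (A i) C & (\<Sum>j. hausdorff_cost k (C j)) < hausdorff_pre k de (A i) + ennreal (e * (1/2)^Suc i)" for i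
 proof -
  have "hausdorff_pre k de (A i) < hausdorff_pre k de (A i) + ennreal (e * (1/2)^Suc i)"
  using fin[of i] e by (intro ennreal_less_add_pos) auto
  thus ?thesis using hausdorff_pre_approx by metis
 qed
 then obtain C where C: "!!i. delta_cover de (A i) (C i)"
  "!!i. (\<Sum>j. hausdorff_cost k (C i j)) < hausdorff_pre k de (A i) + ennreal (e * (1/2)^Suc i)" by metis
 define D where "D n = (case prod_decode n of (i, j) => C i j)" for n
 have "delta_cover de (\<Union>i. A i) D"
  unfolding delta_cover_def
 proof (intro conjI allI)
  show "(\<Union>i. A i) <= (\<Union>n. D n)"
  proof
  fix x assume "x : (\<Union>i. A i)"
  then obtain i j where "x : C i j" using C(1) unfolding delta_cover_def by blast
  hence "x : D (prod_encode (i, j))" by (simp add: D_def)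
  thus "x : (\<Union>n. D n)" by blast
  qed
  show "bounded (D n)" "diameter (D n) <= de" for n
  using C(1) unfolding delta_cover_def D_def by (auto split: prod.splits)
 qed
 hence "hausdorff_pre k de (\<Union>i. A i) <= (\<Sum>n. hausdorff_cost k (D n))" by (rule hausdorff_pre_le)
 also have "... = (\<Sum>i. \<Sum>j. hausdorff_cost k (C i j))"
  using suminf_ennreal_2dimen[of "%i. \<Sum>j. hausdorff_cost k (C i j)" "%(i, j). hausdorff_cost k (C i j)"]
  by (simp add: D_def case_prod_unfold comp_def)
 also have "... <= (\<Sum>i. hausdorff_pre k de (A i) + ennreal (e * (1/2)^Suc i))"
  by (intro suminf_le less_imp_le[OF C(2)]) auto
 also have "... = (\<Sum>i. hausdorff_pre k de (A i)) + (\<Sum>i. ennreal (e * (1/2)^Suc i))"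
  by (rule suminf_add[symmetric]) auto
 also have "(\<Sum>i. ennreal (e * (1/2)^Suc i)) = ennreal e"
 proof -
  have "(%i. e * (1/2)^Suc i) sums (e * 1)" using power_half_series by (rule sums_mult)
  thus ?thesis using e by (subst suminf_ennreal2) (auto simp: sums_iff)
 qed
 finally show "hausdorff_pre k de (\<Union>i. A i) <= (\<Sum>i. hausdorff_pre k de (A i)) + ennreal e" .
 qed
qed simp

lemma hausdorff_outer_subadditive: "hausdorff_outer k (\<Union>i. A i) <= (\<Sum>i. hausdorff_outer k (A i))"
 unfolding hausdorff_outer_def[of k "\<Union>i. A i"]
proof (rule SUP_least)
 fix de :: real assume "de : {0<..}"
 hence de: "0 < de" by simp
 have "hausdorff_pre k de (\<Union>i. A i) <= (\<Sum>i. hausdorff_pre k de (A i))"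
 by (rule hausdorff_pre_subadditive[OF de])
 also have "... <= (\<Sum>i. hausdorff_outer k (A i))"
 by (intro suminf_le hausdorff_pre_le_outer de) auto
 finally show "hausdorff_pre k de (\<Union>i. A i) <= (\<Sum>i. hausdorff_outer k (A i))" .
qed

lemma hausdorff_outer_Un: "hausdorff_outer k (A Un B) <= hausdorff_outer k A + hausdorff_outer k B"
proof -
 have U: "A Un B = (\<Union>i::nat. if i = 0 then A else if i = 1 then B else {})"
 by (auto split: if_splits)
 have "hausdorff_outer k (A Un B) <= (\<Sum>i::nat. hausdorff_outer k (if i = 0 then A else if i = 1 then B else {}))"
 unfolding U by (rule hausdorff_outer_subadditive)
 also have "... = (\<Sum>i<2::nat. hausdorff_outer k (if i = 0 then A else if i = 1 then B else {}))"
 by (rule suminf_finite) (auto simp: hausdorff_outer_empty)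
 also have "... = hausdorff_outer k A + hausdorff_outer k B" by (simp add: numeral_2_eq_2)
 finally show ?thesis .
qed

text \<open>A set of diameter at most \<open>de\<close> cannot meet both \<open>A\<close> and
  \<open>B\<close>. A cover of the union therefore splits into two covers with no set counted
  twice.\<close>

lemma hausdorff_pre_separated:
 assumes sep: "!!x y. x : A ==> y : B ==> de < dist x y"
 shows "hausdorff_pre k de A + hausdorff_pre k de B <= hausdorff_pre k de (A Un B)"
 unfolding hausdorff_pre_alt[of k de "A Un B"]
proof (rule INF_greatest)
 fix C assume "C : {C. delta_cover de (A Un B) C}"
 hence C: "A Un B <= (\<Union>i. C i)" "!!i. bounded (C i)" "!!i. diameter (C i) <= de" by (auto simp: delta_cover_def)
 have d0: "0 <= de" using C(3)[of 0] diameter_ge_0[OF C(2)[of 0]] by linarith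
 define CA where "CA i = (if C i Int A = {} then {} else C i)" for i
 define CB where "CB i = (if C i Int B = {} then {} else C i)" for i
 have "delta_cover de A CA" "delta_cover de B CB"
 using C d0 unfolding delta_cover_def CA_def CB_def by (auto; blast)+
 hence "hausdorff_pre k de A + hausdorff_pre k de B <= (\<Sum>i. hausdorff_cost k (CA i)) + (\<Sum>i. hausdorff_cost k (CB i))"
 by (intro add_mono hausdorff_pre_le)
 also have "... = (\<Sum>i. hausdorff_cost k (CA i) + hausdorff_cost k (CB i))"
 by (rule suminf_add) auto
 also have "... <= (\<Sum>i. hausdorff_cost k (C i))"
 proof (intro suminf_le)
 fix i
 have "C i Int A = {} \<or> C i Int B = {}"
 proof (rule ccontr)
  assume "\<not> ?thesis"
  then obtain x y where xy: "x : C i" "x : A" "y : C i" "y : B" by blast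
  have "dist x y <= diameter (C i)" using diameter_bounded_bound[OF C(2)] xy by blast
  thus False using sep[OF xy(2,4)] C(3)[of i] by linarith
 qed
 thus "hausdorff_cost k (CA i) + hausdorff_cost k (CB i) <= hausdorff_cost k (C i)"
  by (auto simp: CA_def CB_def hausdorff_cost_def)
 qed auto
 finally show "hausdorff_pre k de A + hausdorff_pre k de B <= (\<Sum>i. hausdorff_cost k (C i))" .
qed

lemma hausdorff_outer_separated:
 assumes rho: "0 < rho" and sep: "!!x y. x : A ==> y : B ==> rho <= dist x y"
 shows "hausdorff_outer k A + hausdorff_outer k B <= hausdorff_outer k (A Un B)"
proof -
 have pre: "hausdorff_pre k de1 A + hausdorff_pre k de2 B <= hausdorff_outer k (A Un B)" if "0 < de1" "0 < de2" for de1 de2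
 proof -
 define de where "de = min (min de1 de2) (rho/2)"
 have de: "0 < de" "de <= de1" "de <= de2" "de < rho" using that rho by (auto simp: de_def)
 have "hausdorff_pre k de1 A + hausdorff_pre k de2 B <= hausdorff_pre k de A + hausdorff_pre k de B"
  using de by (intro add_mono hausdorff_pre_antimono)
 also have "... <= hausdorff_pre k de (A Un B)"
  using sep de(4) by (intro hausdorff_pre_separated) (meson less_le_trans)
 also have "... <= hausdorff_outer k (A Un B)" using de(1) by (rule hausdorff_pre_le_outer)
 finally show ?thesis .
 qed
 have "hausdorff_outer k A + hausdorff_pre k de2 B <= hausdorff_outer k (A Un B)" if "0 < de2" for de2
 proof -
 have "hausdorff_outer k A + hausdorff_pre k de2 B = (SUP de1\<in>{0<..}. hausdorff_pre k de1 A + hausdorff_pre k de2 B)"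
  unfolding hausdorff_outer_def by (rule ennreal_SUP_add_left[symmetric]) (auto intro: exI[of _ 1])
 also have "... <= hausdorff_outer k (A Un B)" using pre that by (intro SUP_least) auto
 finally show ?thesis .
 qed
 moreover have "hausdorff_outer k A + hausdorff_outer k B = (SUP de2\<in>{0<..}. hausdorff_outer k A + hausdorff_pre k de2 B)"
 unfolding hausdorff_outer_def[of k B] by (rule ennreal_SUP_add_right) (auto intro: exI[of _ 1])
 ultimately show ?thesis by (auto intro!: SUP_least)
qed

lemma hausdorff_outer_sum_separated:
 fixes R :: "nat => 'a::euclidean_space set"
 assumes "!!n. 0 < rho n" and "!!m n x y. m < n ==> x : R m ==> y : R n ==> rho n <= dist x y"
 shows "(\<Sum>j<N. hausdorff_outer k (R j)) <= hausdorff_outer k (\<Union>j<N. R j)"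
proof (induction N)
 case 0 thus ?case by (simp add: hausdorff_outer_empty)
next
 case (Suc N)
 have "(\<Sum>j<Suc N. hausdorff_outer k (R j)) <= hausdorff_outer k (\<Union>j<N. R j) + hausdorff_outer k (R N)"
 using Suc by (simp add: add_right_mono)
 also have "... <= hausdorff_outer k ((\<Union>j<N. R j) Un R N)"
 using assms by (intro hausdorff_outer_separated[of "rho N"]) auto
 also have "(\<Union>j<N. R j) Un R N = (\<Union>j<Suc N. R j)" by (auto simp: less_Suc_eq)
 finally show ?case .
qed

lemma suminf_tail_ennreal:
 fixes f :: "nat => ennreal"
 assumes fin: "(\<Sum>i. f i) < \<infinity>" and e: "0 < (e::real)"
 shows "EX n. (\<Sum>i. f (i + n)) <= ennreal e"
proof -
 define r where "r i = enn2real (f i)" for i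
 have fr: "f i = ennreal (r i)" and r0: "0 <= r i" for i
 using ennreal_suminf_lessD[OF fin, of i] by (auto simp: r_def)
 have sm: "summable r"
 using fin fr r0 by (intro summable_suminf_not_top) (auto simp: less_top)
 obtain N where N: "!!n. N <= n ==> norm (\<Sum>i. r (i + n)) < e"
 using suminf_exist_split[OF e sm] by blast
 have "(\<Sum>i. f (i + N)) = ennreal (\<Sum>i. r (i + N))"
 unfolding fr by (rule suminf_ennreal2) (use r0 sm summable_ignore_initial_segment in auto)
 also have "... <= ennreal e" using N[of N] by (intro ennreal_leI) auto
 finally show ?thesis by blast
qed

text \<open>Caratheodory's argument for metric outer measures. The part \<open>Tn n\<close> keeps a
  positive distance from \<open>F\<close>; the rest of \<open>T - F\<close> lies in the shells
  \<open>R i\<close> with \<open>i\<close> at least \<open>n\<close>. Shells of equal parity are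
  separated from each other, so the measures of all shells are summable and the tail is
  negligible.\<close>

lemma hausdorff_outer_closed_split:
 fixes F T :: "'a::euclidean_space set"
 assumes F: "closed F" "F ~= {}" and fin: "hausdorff_outer k T < \<infinity>"
 shows "hausdorff_outer k (T Int F) + hausdorff_outer k (T - F) <= hausdorff_outer k T"
proof -
 define d where "d x = infdist x F" for x
 define Tn where "Tn n = {x\<in>T. 1 / real (Suc n) <= d x}" for n
 define R where "R n = {x\<in>T. 1 / real (Suc (Suc n)) <= d x & d x < 1 / real (Suc n)}" for n
 have d_lip: "d x <= d y + dist x y" for x y unfolding d_def by (rule infdist_triangle)
 have dpos: "0 < d x" if "x ~: F" for x
 using that F in_closed_iff_infdist_zero infdist_nonneg unfolding d_def by (metis less_eq_real_def)
 have sep1: "hausdorff_outer k (T Int F) + hausdorff_outer k (Tn n) <= hausdorff_outer k T" for n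
 proof -
 have "hausdorff_outer k (T Int F) + hausdorff_outer k (Tn n) <= hausdorff_outer k ((T Int F) Un Tn n)"
 proof (rule hausdorff_outer_separated[of "1 / real (Suc n)"])
  fix x y assume "x : T Int F" "y : Tn n"
  hence "d x = 0" "1 / real (Suc n) <= d y" by (auto simp: d_def Tn_def)
  thus "1 / real (Suc n) <= dist x y" using d_lip[of y x] by (simp add: dist_commute)
 qed auto
 also have "... <= hausdorff_outer k T" by (rule hausdorff_outer_mono) (auto simp: Tn_def)
 finally show ?thesis .
 qed
 have Rsum: "(\<Sum>j<N. hausdorff_outer k (R (2 * j + c))) <= hausdorff_outer k T" for N c
 proof -
 define rho where "rho n = 1 / real (2 * n + c) - 1 / real (Suc (2 * n + c))" for n
 \<comment> \<open>For \<open>2 * n + c = 0\<close> the convention 1/0 = 0 would make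
   \<open>rho n\<close> negative. That index is never the larger of two, so any positive value will
   do.\<close>
 define rho' where "rho' n = (if 2 * n + c = 0 then 1 else rho n)" for n
 have "(\<Sum>j<N. hausdorff_outer k (R (2 * j + c))) <= hausdorff_outer k (\<Union>j<N. R (2 * j + c))"
 proof (rule hausdorff_outer_sum_separated[of rho'])
  show "0 < rho' n" for n by (auto simp: rho'_def rho_def field_simps)
  fix m n x y assume mn: "m < n" and x: "x : R (2 * m + c)" and y: "y : R (2 * n + c)"
  have le: "Suc (Suc (2 * m + c)) <= 2 * n + c" using mn by simp
  have "1 / real (2 * n + c) <= 1 / real (Suc (Suc (2 * m + c)))"
  using le by (intro divide_left_mono) (auto simp del: of_nat_Suc of_nat_add of_nat_mult)
  also have "... <= d x" using x by (simp add: R_def)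
  finally have "1 / real (2 * n + c) <= d x" .
  moreover have "d y < 1 / real (Suc (2 * n + c))" using y by (simp add: R_def)
  ultimately have "rho n <= dist x y" using d_lip[of x y] by (simp add: rho_def)
  thus "rho' n <= dist x y" using mn by (simp add: rho'_def)
 qed
 also have "... <= hausdorff_outer k T" by (rule hausdorff_outer_mono) (auto simp: R_def)
 finally show ?thesis .
 qed
 have "(\<Sum>j. hausdorff_outer k (R j)) <= hausdorff_outer k T + hausdorff_outer k T"
 proof (rule suminf_le_const)
 fix N
 have "(\<Sum>j<N. hausdorff_outer k (R j)) <= (\<Sum>j<2*N. hausdorff_outer k (R j))"
  by (rule sum_mono2) auto
 also have "... = (\<Sum>j<N. hausdorff_outer k (R (2 * j))) + (\<Sum>j<N. hausdorff_outer k (R (2 * j + 1)))"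
  by (induction N) (auto simp: ac_simps)
 also have "... <= hausdorff_outer k T + hausdorff_outer k T"
  using Rsum[of 0 N] Rsum[of 1 N] by (intro add_mono) auto
 finally show "(\<Sum>j<N. hausdorff_outer k (R j)) <= hausdorff_outer k T + hausdorff_outer k T" .
 qed auto
 also have "... < \<infinity>" using fin by simp
 finally have Rfin: "(\<Sum>j. hausdorff_outer k (R j)) < \<infinity>" .
 show ?thesis
 proof (rule ennreal_le_epsilon)
 fix e :: real assume e: "0 < e"
 obtain n where n: "(\<Sum>i. hausdorff_outer k (R (i + n))) <= ennreal e"
  using suminf_tail_ennreal[OF Rfin e] by blast
 have "T - F <= Tn n Un (\<Union>i. R (i + n))"
 proof
  fix x assume x: "x : T - F"
  show "x : Tn n Un (\<Union>i. R (i + n))"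
  proof (cases "1 / real (Suc n) <= d x")
  case True thus ?thesis using x by (simp add: Tn_def)
  next
  case False
  have "0 < d x" using dpos x by blast
  then obtain m0 where m0: "1 / real (Suc m0) < d x" using nat_approx_posE by blast
  define m where "m = (LEAST m. 1 / real (Suc m) <= d x)"
  have m: "1 / real (Suc m) <= d x" unfolding m_def by (rule LeastI[of _ m0]) (use m0 in simp)
  have least: "d x < 1 / real (Suc j)" if "j < m" for j
   using not_less_Least[of j "%m. 1 / real (Suc m) <= d x"] that unfolding m_def by simp
  have "n < m"
  proof (rule ccontr)
   assume "\<not> n < m"
   hence "1 / real (Suc n) <= 1 / real (Suc m)" by (intro divide_left_mono) auto
   thus False using m False by linarith
  qed
  hence "x : R (m - 1)" using m least[of "m - 1"] x by (simp add: R_def)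
  moreover have "m - 1 = (m - 1 - n) + n" using \<open>n < m\<close> by simp
  ultimately show ?thesis by (metis UN_I UNIV_I UnI2)
  qed
 qed
 hence "hausdorff_outer k (T - F) <= hausdorff_outer k (Tn n Un (\<Union>i. R (i + n)))" by (rule hausdorff_outer_mono)
 also have "... <= hausdorff_outer k (Tn n) + hausdorff_outer k (\<Union>i. R (i + n))" by (rule hausdorff_outer_Un)
 also have "... <= hausdorff_outer k (Tn n) + (\<Sum>i. hausdorff_outer k (R (i + n)))"
  by (intro add_left_mono hausdorff_outer_subadditive)
 also have "... <= hausdorff_outer k (Tn n) + ennreal e" using n by (rule add_left_mono)
 finally have "hausdorff_outer k (T Int F) + hausdorff_outer k (T - F)
  <= hausdorff_outer k (T Int F) + (hausdorff_outer k (Tn n) + ennreal e)" by (rule add_left_mono)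
 also have "... <= hausdorff_outer k T + ennreal e"
  using add_right_mono[OF sep1[of n], of "ennreal e"] by (simp add: add.assoc)
 finally show "hausdorff_outer k (T Int F) + hausdorff_outer k (T - F) <= hausdorff_outer k T + ennreal e" .
 qed
qed

lemma measure_space_hausdorff:
 "measure_space UNIV (lambda_system UNIV (Pow UNIV) (hausdorff_outer k :: 'a::euclidean_space set => ennreal)) (hausdorff_outer k)"
proof -
 have "outer_measure_space (Pow UNIV) (hausdorff_outer k :: 'a set => ennreal)"
 by (auto simp: outer_measure_space_def positive_def increasing_def countably_subadditive_def hausdorff_outer_empty
  intro: hausdorff_outer_mono hausdorff_outer_subadditive)
 thus ?thesis
 using sigma_algebra.caratheodory_lemma[OF sigma_algebra_Pow] by blast
qed

lemma sets_borel_subset_hausdorff_lambda: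
 "sets (borel :: 'a::euclidean_space measure) <= lambda_system UNIV (Pow UNIV) (hausdorff_outer k)"
proof -
 let ?L = "lambda_system UNIV (Pow UNIV) (hausdorff_outer k :: 'a set => ennreal)"
 interpret L: sigma_algebra UNIV ?L using measure_space_hausdorff by (auto simp: measure_space_def)
 have "closed F ==> F : ?L" for F :: "'a set"
 proof (cases "F = {}")
 case False
 assume F: "closed F"
 have "hausdorff_outer k (T Int F) + hausdorff_outer k (T - F) = hausdorff_outer k T" for T :: "'a set"
 proof (rule antisym)
  show "hausdorff_outer k (T Int F) + hausdorff_outer k (T - F) <= hausdorff_outer k T"
  using hausdorff_outer_closed_split[OF F False, of k T] by (cases "hausdorff_outer k T < \<infinity>") (auto simp: not_less top_unique)
  have "T = (T Int F) Un (T - F)" by auto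
  thus "hausdorff_outer k T <= hausdorff_outer k (T Int F) + hausdorff_outer k (T - F)"
  using hausdorff_outer_Un[of k "T Int F" "T - F"] by simp
 qed
 thus ?thesis unfolding algebra.lambda_system_eq[OF algebra_Pow] by blast
 next
 case True
 thus ?thesis using L.empty_sets by metis
 qed
 hence "sigma_sets UNIV (Collect closed) <= ?L" by (intro L.sigma_sets_subset) auto
 thus ?thesis by (simp add: borel_eq_closed)
qed

lemma sets_hausdorff_measure [simp, measurable_cong]: "sets (hausdorff_measure k) = sets borel"
 unfolding hausdorff_measure_def by (subst sets_measure_of) (auto simp: sets.sigma_sets_eq[of borel, simplified])

lemma space_hausdorff_measure [simp]: "space (hausdorff_measure k) = UNIV"
 unfolding hausdorff_measure_def by (subst space_measure_of) auto

text \<open>\<open>measure_of\<close> takes the prescribed values only if they are countably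
  additive on the given sets; Caratheodory's theorem supplies this on the lambda system, which
  contains all Borel sets.\<close>

lemma emeasure_hausdorff_measure:
 fixes A :: "'a::euclidean_space set"
 assumes "A : sets borel"
 shows "emeasure (hausdorff_measure k) A = hausdorff_outer k A"
 unfolding hausdorff_measure_def
proof (rule emeasure_measure_of_sigma)
 show "sigma_algebra UNIV (sets (borel :: 'a measure))"
 using sets.sigma_algebra_axioms[of "borel :: 'a measure"] by simp
 show "positive (sets borel) (hausdorff_outer k :: 'a set => ennreal)"
 by (simp add: positive_def hausdorff_outer_empty)
 have "countably_additive (lambda_system UNIV (Pow UNIV) (hausdorff_outer k)) (hausdorff_outer k :: 'a set => ennreal)"
 using measure_space_hausdorff by (auto simp: measure_space_def)
 thus "countably_additive (sets borel) (hausdorff_outer k :: 'a set => ennreal)"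
 unfolding countably_additive_def using sets_borel_subset_hausdorff_lambda by blast
qed fact

section \<open>Cut-offs whose total decrease is paid for by Hausdorff measure\<close>

lemma nn_integral_smoothstep_deriv:
 assumes "0 < s"
 shows "(\<integral>\<^sup>+t. ennreal (smoothstep_deriv ((b - t) / s) / s) \<partial>lborel) = 1"
proof -
 have z: "smoothstep_deriv ((b - t) / s) = 0" if "t ~: {b - s..b}" for t
 proof -
 have "(b - t) / s <= 0 \<or> 1 <= (b - t) / s"
  using that assms by (auto simp: field_simps)
 thus ?thesis by (auto simp: smoothstep_deriv_def)
 qed
 have "(\<integral>\<^sup>+t. ennreal (smoothstep_deriv ((b - t) / s) / s) \<partial>lborel)
  = (\<integral>\<^sup>+t. ennreal (smoothstep_deriv ((b - t) / s) / s) * indicator {b - s..b} t \<partial>lborel)"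
 using z by (intro nn_integral_cong) (auto simp: indicator_def)
 also have "... = ennreal ((%t. - smoothstep ((b - t) / s)) b - (%t. - smoothstep ((b - t) / s)) (b - s))"
 proof (rule nn_integral_FTC_Icc)
 show "(%t. smoothstep_deriv ((b - t) / s) / s) : borel_measurable borel"
  using assms by (intro borel_measurable_continuous_onI continuous_intros
   continuous_on_compose2[OF continuous_smoothstep_deriv[of UNIV]]) auto
 show "((%t. - smoothstep ((b - t) / s)) has_real_derivative smoothstep_deriv ((b - x) / s) / s) (at x)" for x
 proof -
  have "((%t. (b - t) / s) has_real_derivative - 1 / s) (at x)"
  using assms by (auto intro!: derivative_eq_intros)
  from DERIV_minus[OF DERIV_chain2[OF smoothstep_has_deriv this]] show ?thesis by simp
 qed
 qed (use assms smoothstep_deriv_nonneg in auto)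
 also have "... = 1" using assms by (simp add: smoothstep_def)
 finally show ?thesis .
qed

text \<open>The cut-off is the product of a cut-off \<open>ze\<close> of the projection of
  \<open>C\<close> and a plateau \<open>ta\<close> in the height. Differentiation along
  \<open>e\<close> acts on \<open>ta\<close> alone, and the falling flank of \<open>ta\<close> has
  total decrease one. What remains is the slab measure of a neighbourhood of the projection, bounded
  by the isodiametric inequality. The margin \<open>s\<close> pays for the passage to an open
  neighbourhood.\<close>

lemma cylinder_cutoff:
 fixes C :: "'a::euclidean_space set"
 assumes e: "norm e = 1" and C: "bounded C" "c : C" "diameter C <= de / 2" and de: "0 < de" and s: "0 < s" "s <= de / 2"
 obtains eta :: "'a => real" and eta' W S where "c1_deriv eta eta'" "!!x. 0 <= eta x" "!!x. eta x <= 1"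
 "open W" "C <= W" "!!x. x : W ==> eta x = 1" "compact S" "S <= ball c (4 * de)" "!!x. x ~: S ==> eta x = 0"
 "(\<integral>\<^sup>+x. ennreal (- eta' x e) \<partial>lborel)
  <= ennreal (unit_ball_vol (real (DIM('a) - 1)) * ((diameter C + s) / 2) ^ (DIM('a) - 1))"
proof -
 define d where "d = diameter C"
 have d0: "0 <= d" unfolding d_def by (rule diameter_ge_0[OF C(1)])
 define A where "A = closure (proj_along e ` C)"
 have Cd: "dist x y <= d" if "x : C" "y : C" for x y
 unfolding d_def using diameter_bounded_bound[OF C(1) that] .
 have Pd: "dist (proj_along e x) (proj_along e y) <= dist x y" for x y
 using norm_proj_along_le[OF e, of "x - y"] by (simp add: dist_norm proj_along_diff)
 have bP: "bounded (proj_along e ` C)"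
 by (rule bounded_subset[OF bounded_cball[of "proj_along e c" d]]) (use order_trans[OF Pd Cd[OF C(2)]] in auto)
 have A: "compact A" unfolding A_def using bP by (simp add: compact_closure)
 define U where "U = (\<Union>x\<in>proj_along e ` C. ball x (s/2))"
 have AU: "A <= U"
 proof
 fix y assume "y : A"
 then obtain x where "x : proj_along e ` C" "dist x y < s/2"
  unfolding A_def using closure_approachable s(1) by (metis half_gt_zero)
 thus "y : U" by (auto simp: U_def)
 qed
 have Ud: "dist x y <= d + s" if xy: "x : U" "y : U" for x y
 proof -
 obtain x' y' where x': "x' : C" "dist (proj_along e x') x < s/2" and y': "y' : C" "dist (proj_along e y') y < s/2"
  using xy by (auto simp: U_def)
 have "dist (proj_along e x') (proj_along e y') <= d" using Pd[of x' y'] Cd[OF x'(1) y'(1)] by linarith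
 thus ?thesis using x'(2) y'(2)
  dist_triangle[of x y "proj_along e x'"] dist_triangle[of "proj_along e x'" y "proj_along e y'"]
  by (simp add: dist_commute)
 qed
 have oU: "open U" by (auto simp: U_def)
 obtain ze :: "'a => real" and ze' Z V where ze: "c1_deriv ze ze'" "!!x. 0 <= ze x" "!!x. ze x <= 1"
 "open V" "A <= V" "!!x. x : V ==> ze x = 1" "compact Z" "Z <= U" "!!x. x ~: Z ==> ze x = 0"
 by (rule c1_cutoff[OF A oU AU]) (rule that)
 define m where "m = c \<bullet> e"
 \<comment> \<open>\<open>f\<close> is the rising and \<open>g\<close> the falling flank of the
   plateau, each over an interval of length \<open>de\<close>; both equal 1 at heights within
   \<open>de\<close> of \<open>m\<close>, where \<open>C\<close> lies.\<close>
 define f where "f t = smoothstep ((t - (m - 2 * de)) / de)" for t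
 define g where "g t = smoothstep ((m + 2 * de - t) / de)" for t
 define f' where "f' t = smoothstep_deriv ((t - (m - 2 * de)) / de) / de" for t
 define g' where "g' t = smoothstep_deriv ((m + 2 * de - t) / de) / de" for t
 have fd: "(f has_real_derivative f' t) (at t)" for t
 proof -
 have "((%t. (t - (m - 2 * de)) / de) has_real_derivative 1 / de) (at t)" using de by (auto intro!: derivative_eq_intros)
 from DERIV_chain2[OF smoothstep_has_deriv this] show ?thesis unfolding f_def f'_def by simp
 qed
 have gd: "(g has_real_derivative - g' t) (at t)" for t
 proof -
 have "((%t. (m + 2 * de - t) / de) has_real_derivative - 1 / de) (at t)" using de by (auto intro!: derivative_eq_intros)
 from DERIV_chain2[OF smoothstep_has_deriv this] show ?thesis unfolding g_def g'_def by simp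
 qed
 have cont: "continuous_on UNIV f'" "continuous_on UNIV g'"
 unfolding f'_def g'_def using de
 by (auto intro!: continuous_intros continuous_on_compose2[OF continuous_smoothstep_deriv[of UNIV]])
 have cfg: "continuous_on UNIV f" "continuous_on UNIV g"
 using fd gd by (meson DERIV_isCont continuous_at_imp_continuous_on)+
 define ta where "ta t = f t * g t" for t
 define ta' where "ta' t = f' t * g t - f t * g' t" for t
 have tad: "(ta has_real_derivative ta' t) (at t)" for t
 unfolding ta_def ta'_def using DERIV_mult[OF fd gd, of t] by (simp add: algebra_simps)
 have tac: "continuous_on UNIV ta'" unfolding ta'_def using cont cfg by (intro continuous_intros)
 have nn: "0 <= f t" "f t <= 1" "0 <= g t" "g t <= 1" "0 <= f' t" "0 <= g' t" for t
 unfolding f_def g_def f'_def g'_def using de by (auto simp: smoothstep_nonneg smoothstep_le_1 smoothstep_deriv_nonneg)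
 have ta1: "ta t = 1" if "\<bar>t - m\<bar> <= de" for t
 proof -
 have "1 <= (t - (m - 2 * de)) / de" "1 <= (m + 2 * de - t) / de" using that de by (auto simp: field_simps)
 thus ?thesis by (simp add: ta_def f_def g_def smoothstep_def)
 qed
 have ta0: "ta t = 0" if "\<not> \<bar>t - m\<bar> <= 2 * de" for t
 proof -
 have "(t - (m - 2 * de)) / de <= 0 \<or> (m + 2 * de - t) / de <= 0"
  using that de by (auto simp: field_simps abs_le_iff)
 thus ?thesis by (auto simp: ta_def f_def g_def smoothstep_def)
 qed
 \<comment> \<open>The rising flank enters with the favourable sign and is dropped.\<close>
 have taneg: "- ta' t <= g' t" for t
 proof -
 have "f t * g' t <= 1 * g' t" "0 <= f' t * g t" using nn[of t] mult_right_mono[of "f t" 1 "g' t"] by auto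
 thus ?thesis by (simp add: ta'_def)
 qed
 define eta where "eta x = ze (proj_along e x) * ta (x \<bullet> e)" for x
 have bl: "bounded_linear (proj_along e)"
 unfolding proj_along_def by (intro bounded_linear_intros)
 have c1a: "c1_deriv (%x. ze (proj_along e x)) (%x h. ze' (proj_along e x) (proj_along e h))"
 by (rule c1_deriv_compose[OF c1_deriv_bounded_linear[OF bl] ze(1)])
 have c1b: "c1_deriv (%x. ta (x \<bullet> e)) (%x h. ta' (x \<bullet> e) * (h \<bullet> e))"
 by (rule c1_deriv_compose_real[OF c1_deriv_bounded_linear tad tac]) (rule bounded_linear_inner_left)
 define eta' where "eta' x h = ze (proj_along e x) * (ta' (x \<bullet> e) * (h \<bullet> e))
  + ze' (proj_along e x) (proj_along e h) * ta (x \<bullet> e)" for x h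
 have c1: "c1_deriv eta eta'"
 using c1_deriv_mult[OF c1a c1b] unfolding eta_def[abs_def] eta'_def[abs_def] .
 have "proj_along e e = 0" using e by (simp add: proj_along_def norm_eq_1)
 hence etae: "eta' x e = ze (proj_along e x) * ta' (x \<bullet> e)" for x
 using e linear_0[OF c1_deriv_linear[OF ze(1)]] by (simp add: eta'_def norm_eq_1)
 define W where "W = {x. proj_along e x : V} Int {x. \<bar>x \<bullet> e - m\<bar> < de}"
 define S where "S = {x. proj_along e x : Z} Int {x. \<bar>x \<bullet> e - m\<bar> <= 2 * de}"
 have Sball: "S <= ball c (4 * de)"
 proof
 fix x assume x: "x : S"
 have "proj_along e x : U" using x ze(8) by (auto simp: S_def)
 moreover have "proj_along e c : U" using C(2) s(1) by (auto simp: U_def intro!: bexI[of _ c])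
 ultimately have "dist (proj_along e x) (proj_along e c) <= d + s" by (rule Ud)
 also have "d + s <= de" using C(3) s(2) by (simp add: d_def)
 finally have 1: "norm (proj_along e (x - c)) <= de" by (simp add: dist_norm proj_along_diff)
 have "x - c = proj_along e (x - c) + ((x - c) \<bullet> e) *\<^sub>R e" by (simp add: proj_along_def)
 hence "norm (x - c) <= norm (proj_along e (x - c)) + \<bar>(x - c) \<bullet> e\<bar>"
  using e norm_triangle_ineq[of "proj_along e (x - c)" "((x - c) \<bullet> e) *\<^sub>R e"] by simp
 also have "... <= de + 2 * de" using 1 x by (intro add_mono) (auto simp: S_def m_def inner_diff_left)
 finally show "x : ball c (4 * de)" using de by (simp add: dist_norm norm_minus_commute)
 qed
 show thesis
 proof (rule that[OF c1])
 show "0 <= eta x" "eta x <= 1" for x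
  using ze(2,3) nn by (auto simp: eta_def ta_def mult_le_one)
 show "open W"
 proof -
  have "open {x. \<bar>x \<bullet> e - m\<bar> < de}" by (intro open_Collect_less continuous_intros)
  moreover have "open {x. proj_along e x : V}"
  using open_vimage[OF ze(4) continuous_proj_along] by (simp add: vimage_def)
  ultimately show ?thesis unfolding W_def by (intro open_Int)
 qed
 show "C <= W"
 proof
  fix x assume x: "x : C"
  have "proj_along e x : A" unfolding A_def by (rule subsetD[OF closure_subset imageI[OF x]])
  moreover have "\<bar>x \<bullet> e - m\<bar> <= norm (x - c)"
  using Cauchy_Schwarz_ineq2[of "x - c" e] e by (simp add: m_def inner_diff_left)
  moreover have "norm (x - c) <= de / 2" using Cd[OF x C(2)] C(3) by (simp add: dist_norm d_def)
  ultimately show "x : W" using ze(5) de by (auto simp: W_def)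
 qed
 show "eta x = 1" if "x : W" for x using that ze(6) ta1 by (auto simp: W_def eta_def)
 show "compact S"
 proof (rule compact_eq_bounded_closed[THEN iffD2], intro conjI)
  show "bounded S" using Sball bounded_ball bounded_subset by blast
  show "closed S"
  unfolding S_def using compact_imp_closed[OF ze(7)] continuous_proj_along[of UNIV e]
  by (intro closed_Int) (auto simp: continuous_on_closed_vimage[of UNIV] vimage_def intro!: closed_Collect_le continuous_intros)
 qed
 show "S <= ball c (4 * de)" by (rule Sball)
 show "eta x = 0" if "x ~: S" for x using that ze(9) ta0 by (auto simp: S_def eta_def)
 have m1: "(%x. ennreal (ze x)) : borel_measurable borel" "(%t. ennreal (g' t)) : borel_measurable borel"
  using c1_deriv_measurable[OF ze(1)] borel_measurable_continuous_onI[OF cont(2)] by measurable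
 have "(\<integral>\<^sup>+x. ennreal (- eta' x e) \<partial>lborel) <= (\<integral>\<^sup>+x. ennreal (ze (proj_along e x)) * ennreal (g' (x \<bullet> e)) \<partial>lborel)"
 proof (rule nn_integral_mono)
  fix x
  have "- eta' x e = ze (proj_along e x) * (- ta' (x \<bullet> e))" by (simp add: etae)
  also have "... <= ze (proj_along e x) * g' (x \<bullet> e)" using taneg ze(2) by (intro mult_left_mono)
  finally show "ennreal (- eta' x e) <= ennreal (ze (proj_along e x)) * ennreal (g' (x \<bullet> e))"
  using ze(2) nn by (simp add: ennreal_mult[symmetric] ennreal_leI)
 qed
 also have "... = (\<integral>\<^sup>+y. ennreal (ze y) \<partial>slab e) * (\<integral>\<^sup>+t. ennreal (g' t) \<partial>lborel)"
  by (rule nn_integral_slab_product[OF e m1])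
 also have "(\<integral>\<^sup>+t. ennreal (g' t) \<partial>lborel) = 1"
  unfolding g'_def using nn_integral_smoothstep_deriv[OF de, of "m + 2 * de"] by simp
 also have "(\<integral>\<^sup>+y. ennreal (ze y) \<partial>slab e) <= (\<integral>\<^sup>+y. indicator U y \<partial>slab e)"
 proof (rule nn_integral_mono)
  fix y show "ennreal (ze y) <= indicator U y"
  proof (cases "y : U")
  case False
  hence "y ~: Z" using ze(8) by blast
  thus ?thesis by (simp add: ze(9))
  qed (use ze(3)[of y] in \<open>simp add: ennreal_le_1\<close>)
 qed
 also have "... = emeasure (slab e) U" using oU by (subst nn_integral_indicator) auto
 also have "... <= ennreal (unit_ball_vol (real (DIM('a) - 1)) * ((d + s) / 2) ^ (DIM('a) - 1))"
  using oU d0 s(1) Ud by (intro isodiametric_slab[OF e]) auto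
 finally show "(\<integral>\<^sup>+x. ennreal (- eta' x e) \<partial>lborel)
  <= ennreal (unit_ball_vol (real (DIM('a) - 1)) * ((diameter C + s) / 2) ^ (DIM('a) - 1))"
  by (simp add: d_def mult_right_mono)
 qed
qed

definition cutoff_between where
 "cutoff_between W S B e th th' \<longleftrightarrow> c1_deriv th th' & (ALL x. 0 <= th x & th x <= 1) & (ALL x:W. th x = 1) &
 (ALL x. x ~: S --> th x = 0) & (\<integral>\<^sup>+x. ennreal (- th' x e) \<partial>lborel) <= B"

text \<open>In the derivative of the union the old derivatives are multiplied by numbers between 0
  and 1, so the negative part is at most the sum of the negative parts. Total decrease is therefore
  subadditive, like the cost of a cover.\<close>

lemma cutoff_between_union:
 assumes "cutoff_between W S B e th th'" "cutoff_between W2 S2 B2 e eta eta'"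
 shows "cutoff_between (W Un W2) (S Un S2) (B + B2) e (%x. th x + eta x - th x * eta x)
 (%x h. th' x h * (1 - eta x) + eta' x h * (1 - th x))"
proof -
 have t: "c1_deriv th th'" "!!x. 0 <= th x & th x <= 1" "!!x. x : W ==> th x = 1" "!!x. x ~: S ==> th x = 0"
 "(\<integral>\<^sup>+x. ennreal (- th' x e) \<partial>lborel) <= B" using assms(1) by (auto simp: cutoff_between_def)
 have h: "c1_deriv eta eta'" "!!x. 0 <= eta x & eta x <= 1" "!!x. x : W2 ==> eta x = 1" "!!x. x ~: S2 ==> eta x = 0"
 "(\<integral>\<^sup>+x. ennreal (- eta' x e) \<partial>lborel) <= B2" using assms(2) by (auto simp: cutoff_between_def)
 have m: "(%x. ennreal (- f' x e)) : borel_measurable borel" if "c1_deriv f f'" for f :: "'a => real" and f'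
 using borel_measurable_continuous_onI[OF c1_deriv_continuous_deriv[OF that]] by measurable
 have "(\<integral>\<^sup>+x. ennreal (- (th' x e * (1 - eta x) + eta' x e * (1 - th x))) \<partial>lborel)
  <= (\<integral>\<^sup>+x. ennreal (- th' x e) + ennreal (- eta' x e) \<partial>lborel)"
 proof (rule nn_integral_mono)
 fix x
 have a: "- (a * t) <= max 0 (- a)" if "0 <= t" "t <= 1" for a t :: real
 proof (cases "0 <= a")
  case False
  hence "(- a) * t <= (- a) * 1" using that by (intro mult_left_mono) auto
  thus ?thesis by simp
 qed (use that in simp)
 have "- (th' x e * (1 - eta x) + eta' x e * (1 - th x)) <= max 0 (- th' x e) + max 0 (- eta' x e)"
  using a[of "1 - eta x" "th' x e"] a[of "1 - th x" "eta' x e"] h(2)[of x] t(2)[of x] by simp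
 hence "ennreal (- (th' x e * (1 - eta x) + eta' x e * (1 - th x))) <= ennreal (max 0 (- th' x e) + max 0 (- eta' x e))"
  by (rule ennreal_leI)
 also have "... = ennreal (max 0 (- th' x e)) + ennreal (max 0 (- eta' x e))" by (rule ennreal_plus) auto
 finally show "ennreal (- (th' x e * (1 - eta x) + eta' x e * (1 - th x))) <= ennreal (- th' x e) + ennreal (- eta' x e)"
  by simp
 qed
 also have "... = (\<integral>\<^sup>+x. ennreal (- th' x e) \<partial>lborel) + (\<integral>\<^sup>+x. ennreal (- eta' x e) \<partial>lborel)"
 using m[OF h(1)] m[OF t(1)] by (intro nn_integral_add) auto
 also have "... <= B + B2" using t(5) h(5) by (rule add_mono)
 finally have le: "(\<integral>\<^sup>+x. ennreal (- (th' x e * (1 - eta x) + eta' x e * (1 - th x))) \<partial>lborel) <= B + B2" .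
 show ?thesis
 unfolding cutoff_between_def
 proof (intro conjI)
 show "ALL x. 0 <= th x + eta x - th x * eta x & th x + eta x - th x * eta x <= 1"
  using cutoff_union_bounds t(2) h(2) by blast
 show "ALL x:W Un W2. th x + eta x - th x * eta x = 1" using t(3) h(3) by auto
 qed (use t(4) h(4) le c1_cutoff_union[OF t(1) h(1)] in auto)
qed

lemma finite_union_cutoff:
 assumes "finite I" "!!i. i : I ==> EX th th'. cutoff_between (W i) (S i) (B i) e th th'"
 shows "EX th th'. cutoff_between (\<Union>i\<in>I. W i) (\<Union>i\<in>I. S i) (\<Sum>i\<in>I. B i) e th th'"
 using assms
proof (induction rule: finite_induct)
 case empty
 show ?case
 by (rule exI[of _ "%_. 0"], rule exI[of _ "%_ _. 0"]) (simp add: c1_deriv_const cutoff_between_def)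
next
 case (insert i I)
 obtain th th' where 1: "cutoff_between (\<Union>i\<in>I. W i) (\<Union>i\<in>I. S i) (\<Sum>i\<in>I. B i) e th th'"
 using insert by auto
 obtain eta eta' where 2: "cutoff_between (W i) (S i) (B i) e eta eta'" using insert.prems[of i] by blast
 show ?case using cutoff_between_union[OF 2 1] insert.hyps by auto
qed

lemma power_increase_small:
 fixes om d :: real
 assumes "0 < ep" "0 < s0"
 obtains s where "0 < s" "s <= s0" "om * ((d + s) / 2) ^ k <= om * (d / 2) ^ k + ep"
proof -
 have "((%s. om * ((d + s) / 2) ^ k) \<longlongrightarrow> om * ((d + 0) / 2) ^ k) (at_right 0)"
 by (intro tendsto_intros) (auto intro: tendsto_ident_at)
 hence "\<forall>\<^sub>F s in at_right 0. om * ((d + s) / 2) ^ k < om * (d / 2) ^ k + ep"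
 using assms(1) by (intro order_tendstoD(2)) auto
 moreover have "\<forall>\<^sub>F s in at_right 0. s : {0<..<s0}"
 using assms(2) by (rule eventually_at_right_real)
 ultimately have "\<forall>\<^sub>F s in at_right 0. s : {0<..<s0} & om * ((d + s) / 2) ^ k < om * (d / 2) ^ k + ep"
 by eventually_elim auto
 then obtain s where "s : {0<..<s0}" "om * ((d + s) / 2) ^ k < om * (d / 2) ^ k + ep"
 using eventually_happens[of _ "at_right (0::real)"] by (auto simp: trivial_limit_at_right_real)
 thus thesis by (intro that[of s]) auto
qed

text \<open>Cover \<open>K\<close> by thin cylinders in direction \<open>e\<close>. Along every line in direction \<open>e\<close> the cut-off of a
 cylinder decreases from 1 to 0 once, so that the isodiametric inequality bounds its total decrease.\<close>

lemma hausdorff_cutoff: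
 fixes K :: "'a::euclidean_space set"
 assumes K: "compact K" "hausdorff_outer (DIM('a) - 1) K < \<infinity>" and e: "norm e = 1" and rho: "0 < rho" and ep: "0 < ep"
 obtains eta :: "'a => real" and eta' S where "c1_deriv eta eta'" "!!x. 0 <= eta x" "!!x. eta x <= 1"
 "!!x. x : K ==> eta x = 1" "compact S" "S <= (\<Union>k\<in>K. ball k rho)" "!!x. x ~: S ==> eta x = 0"
 "(\<integral>\<^sup>+x. ennreal (- eta' x e) \<partial>lborel) <= hausdorff_outer (DIM('a) - 1) K + ennreal ep"
proof -
 define n1 where "n1 = DIM('a) - 1"
 \<comment> \<open>\<open>cylinder_cutoff\<close> places supports in balls of radius
   \<open>4 * de\<close>.\<close>
 define de where "de = rho / 4"
 have de: "0 < de" using rho by (simp add: de_def)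
 have "hausdorff_pre n1 (de/2) K <= hausdorff_outer n1 K" using de by (intro hausdorff_pre_le_outer) auto
 also have "... < hausdorff_outer n1 K + ennreal (ep/2)"
 using K(2) ep by (intro ennreal_less_add_pos) (auto simp: n1_def)
 finally obtain C where C: "delta_cover (de/2) K C" "(\<Sum>i. hausdorff_cost n1 (C i)) < hausdorff_outer n1 K + ennreal (ep/2)"
 by (rule hausdorff_pre_approx)
 \<comment> \<open>Members of the cover that miss \<open>K\<close> are discarded. Each remaining one
   contains a point of \<open>K\<close>, which serves as centre and keeps the support in the
   \<open>rho\<close>-neighbourhood of \<open>K\<close>.\<close>
 define J where "J = {i. C i Int K ~= {}}"
 define ep' where "ep' i = ep/2 * (1/2)^Suc i" for i :: nat
 have "EX W S. open W & C i <= W & compact S & S <= (\<Union>k\<in>K. ball k rho) &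
  (EX eta eta'. cutoff_between W S (hausdorff_cost n1 (C i) + ennreal (ep' i)) e eta eta')" if i: "i : J" for i
 proof -
 obtain c where c: "c : C i" "c : K" using i by (auto simp: J_def)
 have Ci: "bounded (C i)" "diameter (C i) <= de/2" using C(1) by (auto simp: delta_cover_def)
 obtain s where s: "0 < s" "s <= de/2"
  "unit_ball_vol (real n1) * ((diameter (C i) + s) / 2) ^ n1 <= unit_ball_vol (real n1) * (diameter (C i) / 2) ^ n1 + ep' i"
  by (rule power_increase_small[of "ep' i" "de/2" "unit_ball_vol (real n1)" "diameter (C i)" n1])
  (use de ep in \<open>simp add: ep'_def\<close>, use de in simp, rule that)
 obtain eta :: "'a => real" and eta' W S where eta: "c1_deriv eta eta'" "!!x. 0 <= eta x" "!!x. eta x <= 1"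
  "open W" "C i <= W" "!!x. x : W ==> eta x = 1" "compact S" "S <= ball c (4 * de)" "!!x. x ~: S ==> eta x = 0"
  "(\<integral>\<^sup>+x. ennreal (- eta' x e) \<partial>lborel)
  <= ennreal (unit_ball_vol (real (DIM('a) - 1)) * ((diameter (C i) + s) / 2) ^ (DIM('a) - 1))"
  by (rule cylinder_cutoff[OF e Ci(1) c(1) Ci(2) de s(1,2)]) (rule that)
 have "(\<integral>\<^sup>+x. ennreal (- eta' x e) \<partial>lborel) <= ennreal (unit_ball_vol (real n1) * (diameter (C i) / 2) ^ n1 + ep' i)"
  using eta(10) s(3) unfolding n1_def[symmetric] by (meson ennreal_leI order_trans)
 also have "... = hausdorff_cost n1 (C i) + ennreal (ep' i)"
  using c(1) ep diameter_ge_0[OF Ci(1)] by (auto simp: hausdorff_cost_def ep'_def)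
 finally have le: "(\<integral>\<^sup>+x. ennreal (- eta' x e) \<partial>lborel) <= hausdorff_cost n1 (C i) + ennreal (ep' i)" .
 have "S <= (\<Union>k\<in>K. ball k rho)" using eta(8) c(2) by (auto simp: de_def)
 moreover have "cutoff_between W S (hausdorff_cost n1 (C i) + ennreal (ep' i)) e eta eta'"
  using eta(1-3,6,9) le by (auto simp: cutoff_between_def)
 ultimately show ?thesis using eta(4,5,7) by blast
 qed
 then obtain W S where eta: "!!i. i : J ==> open (W i)" "!!i. i : J ==> C i <= W i" "!!i. i : J ==> compact (S i)"
 "!!i. i : J ==> S i <= (\<Union>k\<in>K. ball k rho)"
 "!!i. i : J ==> EX eta eta'. cutoff_between (W i) (S i) (hausdorff_cost n1 (C i) + ennreal (ep' i)) e eta eta'"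
 by metis
 have "K <= (\<Union>i\<in>J. W i)"
 proof
 fix x assume "x : K"
 then obtain i where "x : C i" using C(1) by (auto simp: delta_cover_def)
 hence "i : J" using \<open>x : K\<close> by (auto simp: J_def)
 thus "x : (\<Union>i\<in>J. W i)" using eta(2) \<open>x : C i\<close> by blast
 qed
 \<comment> \<open>The cut-offs are 1 on open sets containing the members of the cover, so
   compactness leaves a finite union, which is again continuously differentiable. Its bound is a
   partial sum of the series for the whole cover.\<close>
 then obtain I where I: "I <= J" "finite I" "K <= (\<Union>i\<in>I. W i)"
 using compactE_image[OF K(1), of J W] eta(1) by metis
 obtain th th' where th: "cutoff_between (\<Union>i\<in>I. W i) (\<Union>i\<in>I. S i) (\<Sum>i\<in>I. hausdorff_cost n1 (C i) + ennreal (ep' i)) e th th'"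
 using finite_union_cutoff[OF I(2), of W S "%i. hausdorff_cost n1 (C i) + ennreal (ep' i)" e] eta(5) I(1) by blast
 have "(\<Sum>i\<in>I. hausdorff_cost n1 (C i) + ennreal (ep' i))
  <= (\<Sum>i. hausdorff_cost n1 (C i) + ennreal (ep' i))"
 using I(2) by (intro sum_le_suminf) auto
 also have "... = (\<Sum>i. hausdorff_cost n1 (C i)) + (\<Sum>i. ennreal (ep' i))" by (rule suminf_add[symmetric]) auto
 also have "(\<Sum>i. ennreal (ep' i)) = ennreal (ep/2)"
 proof -
 have "ep' sums (ep/2 * 1)" unfolding ep'_def using power_half_series by (rule sums_mult)
 thus ?thesis using ep by (subst suminf_ennreal2) (auto simp: sums_iff ep'_def)
 qed
 also have "(\<Sum>i. hausdorff_cost n1 (C i)) + ennreal (ep/2) <= hausdorff_outer n1 K + ennreal (ep/2) + ennreal (ep/2)"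
 using C(2) by (intro add_right_mono) auto
 also have "... = hausdorff_outer n1 K + ennreal ep" using ep by (simp add: add.assoc ennreal_plus[symmetric] del: ennreal_plus)
 finally have le: "(\<integral>\<^sup>+x. ennreal (- th' x e) \<partial>lborel) <= hausdorff_outer n1 K + ennreal ep"
 using th order_trans unfolding cutoff_between_def by blast
 show thesis
 proof (rule that)
 show "c1_deriv th th'" using th by (simp add: cutoff_between_def)
 show "compact (\<Union>i\<in>I. S i)" using I eta(3) by (intro compact_UN) auto
 show "(\<Union>i\<in>I. S i) <= (\<Union>k\<in>K. ball k rho)" using I(1) eta(4) by blast
 show "th x = 1" if "x : K" for x using th I(3) that unfolding cutoff_between_def by blast
 show "th x = 0" if "x ~: (\<Union>i\<in>I. S i)" for x using th that unfolding cutoff_between_def by blast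
 show "0 <= th x" "th x <= 1" for x using th by (simp_all add: cutoff_between_def)
 qed (use le in \<open>simp add: n1_def\<close>)
qed

section \<open>Representation of BV functions and uniqueness of the derivative measure\<close>

lemma inner_regular_finite:
 fixes M :: "'a::euclidean_space measure"
 assumes M: "finite_measure M" "sets M = sets borel" and B: "B : sets borel" and e: "0 < e"
 obtains K where "compact K" "K <= B" "measure M (B - K) < e"
proof -
 interpret finite_measure M by fact
 have "emeasure M B = (SUP K\<in>{K. K <= B & compact K}. emeasure M K)"
 by (rule inner_regular[OF M(2) _ B]) (simp add: emeasure_eq_measure)
 note calculation = this
 have "EX K. K <= B & compact K & measure M B - e < measure M K"
 \<comment> \<open>If the mass is small the empty set suffices; otherwise
   \<open>measure M B - e\<close> is nonnegative and survives the embedding into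
   \<open>ennreal\<close>.\<close>
 proof (cases "measure M B < e")
 case True
 thus ?thesis by (intro exI[of _ "{}"]) auto
 next
 case False
 hence "ennreal (measure M B - e) < emeasure M B"
  using e by (simp add: emeasure_eq_measure ennreal_less_iff)
 then obtain K where "K <= B" "compact K" "ennreal (measure M B - e) < emeasure M K"
  unfolding calculation by (auto simp: less_SUP_iff)
 thus ?thesis using False by (auto simp: emeasure_eq_measure ennreal_less_iff)
 qed
 then obtain K where K: "K <= B" "compact K" "measure M B - e < measure M K" by blast
 have "measure M (B - K) = measure M B - measure M K"
 using K(1,2) B M(2) by (intro finite_measure_Diff) (auto simp: borel_compact)
 thus thesis using that[OF K(2,1)] K(3) by simp
qed

text \<open>Among the Lebesgue null sets, \<open>N\<close> has maximal \<open>M\<close>-measure; a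
  null set charged by the remainder could be joined to \<open>N\<close> and would exceed the
  maximum. So the remainder is absolutely continuous and Radon-Nikodym applies.\<close>

lemma lebesgue_decomposition:
 fixes M :: "'a::euclidean_space measure"
 assumes M: "finite_measure M" "sets M = sets borel"
 obtains N k where "N : null_sets lborel" "k : borel_measurable borel" "!!x. 0 <= k x" "integrable lborel k"
 "density M (indicator (- N)) = density lborel (%x. ennreal (k x))"
proof -
 interpret finite_measure M by fact
 note [measurable_cong] = M(2)
 have spM: "space M = UNIV" using sets_eq_imp_space_eq[OF M(2)] by simp
 define m where "m = (SUP N\<in>null_sets lborel. emeasure M N)"
 have "null_sets (lborel :: 'a measure) ~= {}" by auto
 then obtain h :: "nat => ennreal" where h: "range h <= emeasure M ` null_sets lborel" "m = Sup (range h)"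
 unfolding m_def using ennreal_SUP_countable_SUP[of "null_sets lborel" "emeasure M"] by metis
 hence "ALL n. EX A. A : null_sets lborel & h n = emeasure M A" by blast
 then obtain f where "ALL n. f n : null_sets lborel & h n = emeasure M (f n)" by metis
 with h have f: "!!n. f n : null_sets lborel" "m = (SUP n. emeasure M (f n))" by auto
 define N where "N = (\<Union>n. f n)"
 have N: "N : null_sets lborel" unfolding N_def using f(1) by (rule null_sets_UN)
 hence [measurable]: "N : sets borel" by (auto simp: null_sets_def)
 have mN: "emeasure M N = m"
 proof (rule antisym)
 show "emeasure M N <= m" unfolding m_def using N by (rule SUP_upper)
 show "m <= emeasure M N" unfolding f(2)
 proof (rule SUP_least)
  fix n show "emeasure M (f n) <= emeasure M N"
  by (rule emeasure_mono) (use \<open>N : sets borel\<close> in \<open>auto simp: N_def M(2)\<close>)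
 qed
 qed
 define M' where "M' = density M (indicator (- N))"
 have ac: "absolutely_continuous lborel M'"
 unfolding absolutely_continuous_def
 proof
 fix A assume A: "A : null_sets (lborel :: 'a measure)"
 hence [measurable]: "A : sets borel" by (auto simp: null_sets_def)
 have "emeasure M (N Un A) <= m" unfolding m_def using N A by (intro SUP_upper) auto
 moreover have "emeasure M (N Un A) = emeasure M N + emeasure M (A - N)"
  by (subst plus_emeasure) (auto simp: M(2))
 ultimately have "emeasure M N + emeasure M (A - N) <= emeasure M N + 0" by (simp add: mN)
 hence "emeasure M (A - N) = 0"
  by (simp add: emeasure_eq_measure ennreal_plus[symmetric] measure_le_0_iff del: ennreal_plus)
 moreover have "emeasure M' A = emeasure M (A - N)"
 proof -
  have "indicator (- N) x * indicator A x = (indicator (A - N) x :: ennreal)" for x by (auto simp: indicator_def)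
  thus ?thesis
  unfolding M'_def by (subst emeasure_density) (auto simp: M(2))
 qed
 ultimately show "A : null_sets M'" by (auto simp: null_sets_def M'_def M(2))
 qed
 obtain g where g: "g : borel_measurable lborel" "density lborel g = M'"
 using sigma_finite_measure.Radon_Nikodym[OF sigma_finite_lborel ac] by (auto simp: M'_def M(2))
 hence [measurable]: "g : borel_measurable borel" by simp
 have "(\<integral>\<^sup>+x. g x \<partial>lborel) = emeasure M' UNIV"
 unfolding g(2)[symmetric] by (subst emeasure_density) auto
 also have "... <= emeasure M UNIV"
 proof -
 have "emeasure M' UNIV = (\<integral>\<^sup>+x. indicator (- N) x * indicator UNIV x \<partial>M)"
  unfolding M'_def by (subst emeasure_density) (auto simp: M(2))
 also have "... = emeasure M (- N)" by (simp add: M(2))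
 also have "... <= emeasure M UNIV" by (rule emeasure_mono) (auto simp: M(2))
 finally show ?thesis .
 qed
 also have "... < \<infinity>" by (simp add: emeasure_eq_measure)
 finally have fin: "(\<integral>\<^sup>+x. g x \<partial>lborel) < \<infinity>" .
 define k where "k x = enn2real (g x)" for x
 have km[measurable]: "k : borel_measurable borel" unfolding k_def by measurable
 have "AE x in lborel. g x ~= \<infinity>" using fin by (intro nn_integral_PInf_AE) auto
 hence gk: "AE x in lborel. g x = ennreal (k x)"
 by eventually_elim (simp add: k_def less_top)
 have dens: "density lborel g = density lborel (%x. ennreal (k x))"
 by (rule density_cong) (use gk in auto)
 have "integrable lborel k"
 proof (rule integrableI_bounded)
 have "(\<integral>\<^sup>+x. ennreal (norm (k x)) \<partial>lborel) = (\<integral>\<^sup>+x. g x \<partial>lborel)"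
  using gk by (intro nn_integral_cong_AE) (auto simp: k_def elim!: eventually_mono)
 thus "(\<integral>\<^sup>+x. ennreal (norm (k x)) \<partial>lborel) < \<infinity>" using fin by simp
 qed simp
 thus thesis using that[of N k] N km g(2) dens by (auto simp: k_def M'_def)
qed

text \<open>A function of bounded variation in the form used from here on: a Borel representative
  extended by zero, and a polar decomposition of its derivative on the whole space. Subspace
  measures and completions no longer occur.\<close>

locale bv_rep =
 fixes Om :: "'a::euclidean_space set" and v :: "'a => real" and M :: "'a measure" and s :: "'a => 'a"
 assumes open_dom: "open Om" and v_int: "integrable lborel v" and v_off: "!!x. x ~: Om ==> v x = 0"
 and M_fin: "finite_measure M" and M_sets: "sets M = sets borel" and M_off: "emeasure M (- Om) = 0"
 and s_meas: "s : borel_measurable borel" and s_off: "!!x. x ~: Om ==> s x = 0"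
 and s_unit: "AE x in M. norm (s x) = 1"
 and by_parts: "!!ph. test_field Om ph ==> (LBINT x. v x * divergence ph x) = - (LINT x|M. ph x \<bullet> s x)"
begin

sublocale finite_measure M by (rule M_fin)

lemma space_M: "space M = UNIV" using sets_eq_imp_space_eq[OF M_sets] by simp

lemma borel_measurable_M: "f : borel_measurable borel ==> f : borel_measurable M"
 using M_sets by (simp cong: measurable_cong_sets)

lemma integrable_bounded_M:
 fixes f :: "'a => 'b::{banach,second_countable_topology}"
 assumes "f : borel_measurable borel" "!!x. norm (f x) <= B"
 shows "integrable M f"
 using assms by (intro integrable_const_bound[of _ B]) (auto intro: borel_measurable_M)

lemma integrable_scale_s:
 assumes "f : borel_measurable borel" "!!x. \<bar>f x\<bar> <= B"
 shows "integrable M (%x. f x *\<^sub>R s x)"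
proof (rule integrable_const_bound[of _ B])
 show "AE x in M. norm (f x *\<^sub>R s x) <= B" using s_unit assms(2) by (auto elim!: eventually_mono)
 show "(%x. f x *\<^sub>R s x) : borel_measurable M"
 using assms(1) s_meas by (intro borel_measurable_M) auto
qed

end

lemma cutoff_sequence:
 fixes K U :: "'a::euclidean_space set"
 assumes K: "compact K" and U: "open U" "K <= U"
 obtains eta :: "nat => 'a => real" and eta' C where "!!n. c1_deriv (eta n) (eta' n)" "!!n x. 0 <= eta n x & eta n x <= 1"
 "!!n x. x : K ==> eta n x = 1" "!!n. compact (C n)" "!!n. C n <= U" "!!n x. x ~: C n ==> eta n x = 0"
 "!!x. (%n. eta n x) \<longlonglongrightarrow> indicator K x"
proof -
 define V where "V n = U Int (\<Union>x\<in>K. ball x (1 / real (Suc n)))" for n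
 define Q where "Q n = (%(eta :: 'a => real, eta', C). c1_deriv eta eta' & (ALL x. 0 <= eta x & eta x <= 1) & (ALL x:K. eta x = 1) &
 compact C & C <= V n & (ALL x. x ~: C --> eta x = 0))" for n :: nat
 have "EX p. Q n p" for n
 proof -
 have V: "open (V n)" unfolding V_def using U(1) by (intro open_Int open_UN) auto
 have KV: "K <= V n" using U(2) by (force simp: V_def)
 obtain eta :: "'a => real" and eta' C W where "c1_deriv eta eta'" "!!x. 0 <= eta x" "!!x. eta x <= 1"
  "open W" "K <= W" "!!x. x : W ==> eta x = 1" "compact C" "C <= V n" "!!x. x ~: C ==> eta x = 0"
  by (rule c1_cutoff[OF K V KV]) (rule that)
 hence "Q n (eta, eta', C)" by (auto simp: Q_def)
 thus ?thesis by blast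
 qed
 then obtain p where p: "!!n. Q n (p n)" by metis
 define eta where "eta n = fst (p n)" for n
 define eta' where "eta' n = fst (snd (p n))" for n
 define C where "C n = snd (snd (p n))" for n
 have Q: "c1_deriv (eta n) (eta' n)" "!!x. 0 <= eta n x & eta n x <= 1" "!!x. x : K ==> eta n x = 1"
 "compact (C n)" "C n <= V n" "!!x. x ~: C n ==> eta n x = 0" for n
 using p[of n] by (auto simp: Q_def eta_def eta'_def C_def case_prod_unfold)
 have lim: "(%n. eta n x) \<longlonglongrightarrow> indicator K x" for x
 proof (cases "x : K")
 case True thus ?thesis using Q(3) by simp
 next
 case False
 obtain e where e: "0 < e" "!!y. y : K ==> e <= dist x y"
  using separate_point_closed[OF compact_imp_closed[OF K] False] by blast
 obtain N where N: "1 / real (Suc N) < e" using nat_approx_posE[OF e(1)] by blast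
 have "eta n x = 0" if "N <= n" for n
 proof -
  have "1 / real (Suc n) <= 1 / real (Suc N)" using that by (intro divide_left_mono) auto
  hence "x ~: V n" using e(2) N by (force simp: V_def dist_commute)
  thus ?thesis using Q(5,6) by blast
 qed
 hence "eventually (%n. eta n x = 0) sequentially" by (auto simp: eventually_sequentially)
 thus ?thesis using False by (simp add: tendsto_eventually)
 qed
 show thesis by (rule that[of eta eta' C]) (use Q lim in \<open>auto simp: V_def\<close>)
qed

lemma test_field_scaleR_const:
 fixes eta :: "'a::euclidean_space => real"
 assumes "c1_deriv eta eta'" "compact C" "C <= Om" "!!x. x ~: C ==> eta x = 0"
 shows "test_field Om (%x. eta x *\<^sub>R e)"
 using test_fieldI[OF c1_deriv_scaleR[OF assms(1) c1_deriv_const[of e]] assms(2,3)] assms(4) by simp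

text \<open>Cut-offs converging to the indicator of \<open>K\<close>, multiplied by a constant
  vector, are test fields. The left side of the integration by parts depends on \<open>v\<close>
  alone, so in the limit the vector measure of \<open>K\<close> does too.\<close>

lemma bv_rep_compact_unique:
 assumes "bv_rep Om v M s" "bv_rep Om v M' s'" and K: "compact K" "K <= Om"
 shows "(LINT x|M. indicator K x *\<^sub>R s x) = (LINT x|M'. indicator K x *\<^sub>R s' x)"
proof (rule euclidean_eqI)
 fix e :: 'a assume "e : Basis"
 interpret A: bv_rep Om v M s by fact
 interpret B: bv_rep Om v M' s' by fact
 have Ks: "K : sets borel" using K(1) by (simp add: borel_compact)
 obtain eta :: "nat => 'a => real" and eta' C where eta: "!!n. c1_deriv (eta n) (eta' n)" "!!n x. 0 <= eta n x & eta n x <= 1"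
 "!!n x. x : K ==> eta n x = 1" "!!n. compact (C n)" "!!n. C n <= Om" "!!n x. x ~: C n ==> eta n x = 0"
 "!!x. (%n. eta n x) \<longlonglongrightarrow> indicator K x"
 by (rule cutoff_sequence[OF K(1) A.open_dom K(2)]) (rule that)
 have m: "eta n : borel_measurable borel" for n
 by (rule c1_deriv_measurable[OF eta(1)])
 have lim: "(%n. LINT x|P. (eta n x *\<^sub>R e) \<bullet> t x) \<longlonglongrightarrow> (LINT x|P. (indicator K x *\<^sub>R e) \<bullet> t x)"
 if "bv_rep Om v P t" for P t
 proof -
 interpret P: bv_rep Om v P t by fact
 show ?thesis
 proof (rule integral_dominated_convergence[where w = "%_. norm e"])
  show "AE x in P. (%n. (eta n x *\<^sub>R e) \<bullet> t x) \<longlonglongrightarrow> (indicator K x *\<^sub>R e) \<bullet> t x"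
  using eta(7) by (auto intro!: tendsto_intros)
  show "AE x in P. norm ((eta n x *\<^sub>R e) \<bullet> t x) <= norm e" for n
  using P.s_unit
  proof eventually_elim
  case (elim x)
  have "norm ((eta n x *\<^sub>R e) \<bullet> t x) <= norm (eta n x *\<^sub>R e) * norm (t x)"
   unfolding real_norm_def by (rule Cauchy_Schwarz_ineq2)
  also have "... <= norm e" using elim eta(2)[of n x] by (simp add: mult_left_le_one_le)
  finally show ?case .
  qed
  show "(%x. (eta n x *\<^sub>R e) \<bullet> t x) : borel_measurable P" for n
  by (intro P.borel_measurable_M borel_measurable_inner borel_measurable_scaleR m P.s_meas borel_measurable_const)
  show "(%x. (indicator K x *\<^sub>R e) \<bullet> t x) : borel_measurable P"
  by (intro P.borel_measurable_M borel_measurable_inner borel_measurable_scaleR borel_measurable_indicator Ks P.s_meas borel_measurable_const)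
 qed (simp add: P.integrable_const)
 qed
 have "(LINT x|M. (eta n x *\<^sub>R e) \<bullet> s x) = (LINT x|M'. (eta n x *\<^sub>R e) \<bullet> s' x)" for n
 using A.by_parts[OF test_field_scaleR_const[OF eta(1)[of n] eta(4)[of n] eta(5)[of n] eta(6), of e]]
  B.by_parts[OF test_field_scaleR_const[OF eta(1)[of n] eta(4)[of n] eta(5)[of n] eta(6), of e]] by simp
 hence "(LINT x|M. (indicator K x *\<^sub>R e) \<bullet> s x) = (LINT x|M'. (indicator K x *\<^sub>R e) \<bullet> s' x)"
 using LIMSEQ_unique[OF lim[OF assms(1)]] lim[OF assms(2)] by simp
 moreover have "integrable M (%x. indicator K x *\<^sub>R s x)" "integrable M' (%x. indicator K x *\<^sub>R s' x)"
 using Ks by (intro A.integrable_scale_s[of _ 1] B.integrable_scale_s[of _ 1]; simp add: indicator_def)+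
 ultimately show "(LINT x|M. indicator K x *\<^sub>R s x) \<bullet> e = (LINT x|M'. indicator K x *\<^sub>R s' x) \<bullet> e"
 by (simp add: integral_inner_left[symmetric] inner_commute[of e])
qed

lemma (in bv_rep) integral_compact_approx:
 assumes "B : sets borel" "K : sets borel" "K <= B"
 shows "norm ((LINT x|M. indicator B x *\<^sub>R s x) - (LINT x|M. indicator K x *\<^sub>R s x)) <= measure M (B - K)"
proof -
 have i: "integrable M (%x. indicator A x *\<^sub>R s x)" if "A : sets borel" for A
 using that by (intro integrable_scale_s[of _ 1]) (auto simp: indicator_def)
 have "(LINT x|M. indicator B x *\<^sub>R s x) - (LINT x|M. indicator K x *\<^sub>R s x) = (LINT x|M. indicator (B - K) x *\<^sub>R s x)"
 proof -
 have "indicator B x *\<^sub>R s x - indicator K x *\<^sub>R s x = indicator (B - K) x *\<^sub>R s x" for x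
  using assms(3) by (auto simp: indicator_def)
 thus ?thesis using Bochner_Integration.integral_diff[OF i[OF assms(1)] i[OF assms(2)]] by simp
 qed
 also have "norm ... <= (LINT x|M. norm (indicator (B - K) x *\<^sub>R s x))" by (rule integral_norm_bound)
 also have "... <= (LINT x|M. indicator (B - K) x)"
 proof (rule integral_mono_AE)
 show "integrable M (%x. norm (indicator (B - K) x *\<^sub>R s x))" using i[of "B - K"] assms by (intro integrable_norm) auto
 show "integrable M (indicator (B - K) :: 'a => real)" using assms by (intro integrable_bounded_M[of _ 1]) (auto simp: indicator_def)
 show "AE x in M. norm (indicator (B - K) x *\<^sub>R s x) <= indicator (B - K) x"
  using s_unit by eventually_elim (auto simp: indicator_def)
 qed
 also have "... = measure M (B - K)" using assms by (simp add: M_sets)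
 finally show ?thesis .
qed

text \<open>Inner regularity of both measures, with one common compact set, passes from compact to
  Borel sets. This is what makes the definite description in \<open>distr_deriv\<close>
  meaningful.\<close>

lemma bv_rep_unique:
 assumes A: "bv_rep Om v M s" and B: "bv_rep Om v M' s'" and S: "S : sets borel" "S <= Om"
 shows "(LINT x|M. indicator S x *\<^sub>R s x) = (LINT x|M'. indicator S x *\<^sub>R s' x)"
proof -
 interpret A: bv_rep Om v M s by fact
 interpret B: bv_rep Om v M' s' by fact
 have "norm ((LINT x|M. indicator S x *\<^sub>R s x) - (LINT x|M'. indicator S x *\<^sub>R s' x)) <= 0 + e" if e: "0 < e" for e
 proof -
 obtain K1 where K1: "compact K1" "K1 <= S" "measure M (S - K1) < e/2"
  by (rule inner_regular_finite[OF A.M_fin A.M_sets S(1), of "e/2"]) (use e in simp, rule that)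
 obtain K2 where K2: "compact K2" "K2 <= S" "measure M' (S - K2) < e/2"
  by (rule inner_regular_finite[OF B.M_fin B.M_sets S(1), of "e/2"]) (use e in simp, rule that)
 define K where "K = K1 Un K2"
 have K: "compact K" "K <= S" using K1 K2 by (auto simp: K_def compact_Un)
 have Ks: "K : sets borel" "K1 : sets borel" "K2 : sets borel" using K(1) K1(1) K2(1) by (auto simp: borel_compact)
 have "measure M (S - K) <= measure M (S - K1)" "measure M' (S - K) <= measure M' (S - K2)"
  using S Ks by (auto intro!: A.finite_measure_mono B.finite_measure_mono simp: K_def A.M_sets B.M_sets)
 hence "norm ((LINT x|M. indicator S x *\<^sub>R s x) - (LINT x|M. indicator K x *\<^sub>R s x)) < e/2"
  "norm ((LINT x|M'. indicator S x *\<^sub>R s' x) - (LINT x|M'. indicator K x *\<^sub>R s' x)) < e/2"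
  using A.integral_compact_approx[OF S(1) Ks(1) K(2)] B.integral_compact_approx[OF S(1) Ks(1) K(2)] K1(3) K2(3) by linarith+
 moreover have "(LINT x|M. indicator K x *\<^sub>R s x) = (LINT x|M'. indicator K x *\<^sub>R s' x)"
  using K S(2) by (intro bv_rep_compact_unique[OF A B]) auto
 ultimately show ?thesis
  by (smt (verit) field_sum_of_halves norm_minus_commute norm_triangle_ineq4 diff_diff_eq2 diff_add_cancel add_diff_cancel)
 qed
 hence "norm ((LINT x|M. indicator S x *\<^sub>R s x) - (LINT x|M'. indicator S x *\<^sub>R s' x)) <= 0"
 by (rule field_le_epsilon)
 thus ?thesis by simp
qed

text \<open>A function in \<open>BV\<close> is only Lebesgue measurable on \<open>Om\<close>.
  Convolution and Fubini arguments are carried out with a Borel version.\<close>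

lemma lborel_representative:
 fixes v :: "'a::euclidean_space => real"
 assumes Om: "Om : sets borel" and v: "integrable (lebesgue_on Om) v"
 obtains v0 where "integrable lborel v0" "!!x. x ~: Om ==> v0 x = 0" "AE x in lebesgue_on Om. v x = v0 x"
proof -
 have i: "integrable lebesgue (%x. indicator Om x *\<^sub>R v x)"
 using v Om by (subst (asm) integrable_restrict_space) auto
 hence m: "(%x. indicator Om x *\<^sub>R v x) : borel_measurable (completion lborel)" by (rule borel_measurable_integrable)
 obtain g where g: "g : borel_measurable lborel" "AE x in lborel. indicator Om x *\<^sub>R v x = g x"
 using completion_ex_borel_measurable_real[OF m] by blast
 define v0 where "v0 x = indicator Om x * g x" for x
 have m0: "v0 : borel_measurable borel" unfolding v0_def using g(1) Om by measurable
 have ae: "AE x in lebesgue. indicator Om x *\<^sub>R v x = v0 x"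
 using AE_completion[OF g(2)] by eventually_elim (auto simp: v0_def indicator_def)
 have "integrable lebesgue v0"
 using i by (rule integrable_cong_AE_imp) (use m0 ae in \<open>auto intro: measurable_completion elim!: eventually_mono\<close>)
 hence "integrable lborel v0" using m0 by (subst (asm) integrable_completion) auto
 moreover have "AE x in lebesgue_on Om. v x = v0 x"
 using Om by (subst AE_restrict_space_iff) (use ae in \<open>auto elim!: eventually_mono simp: indicator_def\<close>)
 ultimately show thesis using that[of v0] by (auto simp: v0_def)
qed

lemma integral_lebesgue_on_lborel:
 fixes f :: "'a::euclidean_space => 'b::{banach,second_countable_topology}"
 assumes "Om : sets borel" "f : borel_measurable borel" "!!x. x ~: Om ==> f x = 0"
 shows "(LINT x|lebesgue_on Om. f x) = (LBINT x. f x)"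
proof -
 have "(LINT x|lebesgue_on Om. f x) = (LINT x|lebesgue. indicator Om x *\<^sub>R f x)"
 using assms(1) by (subst integral_restrict_space) auto
 also have "(%x. indicator Om x *\<^sub>R f x) = f" using assms(3) by (auto simp: indicator_def)
 also have "(LINT x|lebesgue. f x) = (LBINT x. f x)" using assms(2) by (intro integral_completion) auto
 finally show ?thesis .
qed

text \<open>The measure of the polar decomposition lives on the subspace \<open>Om\<close>; it is extended by zero.\<close>

definition ext_measure :: "'a::euclidean_space measure => 'a measure" where
 "ext_measure mu = distr mu borel (%x. x)"

lemma polar_derivative_bv_rep:
 fixes v v0 :: "'a::euclidean_space => real"
 assumes Om: "open Om" and p: "polar_derivative Om v mu sg"
 and v0: "integrable lborel v0" "!!x. x ~: Om ==> v0 x = 0" "AE x in lebesgue_on Om. v x = v0 x"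
 and vi: "v : borel_measurable (lebesgue_on Om)"
 shows "bv_rep Om v0 (ext_measure mu) (%x. indicator Om x *\<^sub>R sg x)"
 and "B : sets borel ==> B <= Om ==> (LINT x:B|mu. sg x) = (LINT x|ext_measure mu. indicator B x *\<^sub>R (indicator Om x *\<^sub>R sg x))"
proof -
 have mu: "finite_measure mu" "space mu = Om" "sets mu = sets (restrict_space borel Om)"
 "sg : borel_measurable mu" "AE x in mu. norm (sg x) = 1"
 "!!ph. test_field Om ph ==> (LINT x|lebesgue_on Om. v x * divergence ph x) = - (LINT x|mu. ph x \<bullet> sg x)"
 using p unfolding polar_derivative_def by auto
 interpret mu: finite_measure mu by fact
 have Oms: "Om : sets borel" using Om by simp
 have id: "(%x. x) : measurable mu borel"
 using measurable_restrict_space1[OF measurable_ident, of borel Om] mu(3) by (simp add: id_def cong: measurable_cong_sets)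
 have sgr: "sg : borel_measurable (restrict_space borel Om)" using mu(3,4) by (simp cong: measurable_cong_sets)
 have sm: "(%x. indicator Om x *\<^sub>R sg x) : borel_measurable borel"
 using sgr Oms by (subst (asm) borel_measurable_restrict_space_iff) (auto simp: mult.commute)
 have sets: "sets (ext_measure mu) = sets borel" by (simp add: ext_measure_def)
 have int: "(LINT x|ext_measure mu. f x) = (LINT x|mu. f x)" if "f : borel_measurable borel" for f :: "'a => 'b::{banach,second_countable_topology}"
 unfolding ext_measure_def using id that by (rule integral_distr)
 show "bv_rep Om v0 (ext_measure mu) (%x. indicator Om x *\<^sub>R sg x)"
 proof (rule bv_rep.intro)
 show "finite_measure (ext_measure mu)" unfolding ext_measure_def by (rule mu.finite_measure_distr[OF id])
 show "sets (ext_measure mu) = sets borel" by fact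
 show "emeasure (ext_measure mu) (- Om) = 0"
  unfolding ext_measure_def using Oms by (subst emeasure_distr[OF id]) (auto simp: mu(2))
 show "AE x in ext_measure mu. norm (indicator Om x *\<^sub>R sg x) = 1"
  unfolding ext_measure_def
 proof (subst AE_distr_iff[OF id])
  show "{x : space borel. norm (indicator Om x *\<^sub>R sg x) = 1} : sets borel" using sm by measurable
  show "AE x in mu. norm (indicator Om x *\<^sub>R sg x) = 1"
  using mu(5) AE_space[of mu] by eventually_elim (simp add: mu(2))
 qed
 fix ph assume t: "test_field Om ph"
 obtain ph' K where ph: "c1_deriv ph ph'" "compact K" "K <= Om" "!!x. x ~: K ==> ph x = 0"
  by (rule test_fieldE[OF t]) (rule that)
 have dm: "divergence ph : borel_measurable borel"
  by (rule borel_measurable_continuous_onI[OF continuous_divergence[OF ph(1)]])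
 have phm: "ph : borel_measurable borel"
  by (rule c1_deriv_measurable[OF ph(1)])
 have v0m: "v0 : borel_measurable borel" using v0(1) by auto
 have dl: "divergence ph : borel_measurable (lebesgue_on Om)" "v0 : borel_measurable (lebesgue_on Om)"
  using dm v0m by (auto intro!: measurable_restrict_space1 measurable_completion)
 have "(LBINT x. v0 x * divergence ph x) = (LINT x|lebesgue_on Om. v0 x * divergence ph x)"
  using Oms v0m dm v0(2) by (intro integral_lebesgue_on_lborel[symmetric]) auto
 also have "... = (LINT x|lebesgue_on Om. v x * divergence ph x)"
  using dl vi v0(3) by (intro integral_cong_AE) (auto elim!: eventually_mono)
 also have "... = - (LINT x|mu. ph x \<bullet> sg x)" using mu(6)[OF t] .
 also have "(LINT x|mu. ph x \<bullet> sg x) = (LINT x|mu. ph x \<bullet> (indicator Om x *\<^sub>R sg x))"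
  by (intro Bochner_Integration.integral_cong) (auto simp: mu(2))
 also have "... = (LINT x|ext_measure mu. ph x \<bullet> (indicator Om x *\<^sub>R sg x))"
  using phm sm by (intro int[symmetric]) measurable
 finally show "(LBINT x. v0 x * divergence ph x) = - (LINT x|ext_measure mu. ph x \<bullet> (indicator Om x *\<^sub>R sg x))" .
 qed (use Om v0 sm in auto)
 show "(LINT x:B|mu. sg x) = (LINT x|ext_measure mu. indicator B x *\<^sub>R (indicator Om x *\<^sub>R sg x))" if "B : sets borel" "B <= Om"
 unfolding set_lebesgue_integral_def int[OF borel_measurable_scaleR[OF borel_measurable_indicator[OF that(1)] sm]]
 by (rule Bochner_Integration.integral_cong) (auto simp: mu(2))
qed

lemma distr_deriv_eq:
 fixes v v0 :: "'a::euclidean_space => real"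
 assumes Om: "open Om" and p: "polar_derivative Om v mu sg"
 and v0: "integrable lborel v0" "!!x. x ~: Om ==> v0 x = 0" "AE x in lebesgue_on Om. v x = v0 x"
 and vi: "v : borel_measurable (lebesgue_on Om)"
 and B: "B : sets borel" "B <= Om"
 shows "distr_deriv Om v B = (LINT x|ext_measure mu. indicator B x *\<^sub>R (indicator Om x *\<^sub>R sg x))"
 unfolding distr_deriv_def
proof (rule the_equality)
 note pr = polar_derivative_bv_rep[OF Om _ v0 vi]
 show "EX mu' sg'. polar_derivative Om v mu' sg' & (LINT x|ext_measure mu. indicator B x *\<^sub>R (indicator Om x *\<^sub>R sg x)) = (LINT x:B|mu'. sg' x)"
 using p pr(2)[OF p _ B] by metis
 fix d assume "EX mu' sg'. polar_derivative Om v mu' sg' & d = (LINT x:B|mu'. sg' x)"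
 then obtain mu' sg' where q: "polar_derivative Om v mu' sg'" "d = (LINT x:B|mu'. sg' x)" by blast
 thus "d = (LINT x|ext_measure mu. indicator B x *\<^sub>R (indicator Om x *\<^sub>R sg x))"
 using pr(2)[OF q(1) _ B] bv_rep_unique[OF pr(1)[OF p] pr(1)[OF q(1)] B] by simp
qed

section \<open>Mollification\<close>

lemma uniform_compact_support:
 fixes f :: "'a::euclidean_space => 'b::real_normed_vector"
 assumes f: "continuous_on UNIV f" and K: "compact K" "!!x. x ~: K ==> f x = 0" and e: "0 < e"
 obtains d where "0 < d" "!!x y. dist x y < d ==> norm (f x - f y) < e"
proof -
 obtain R where R: "K <= ball 0 R" using bounded_subset_ballD[OF compact_imp_bounded[OF K(1)]] by blast
 have "uniformly_continuous_on (cball 0 (R + 1)) f"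
 by (intro compact_uniformly_continuous continuous_on_subset[OF f]) auto
 then obtain d where d: "0 < d" "!!x y. x : cball 0 (R + 1) ==> y : cball 0 (R + 1) ==> dist y x < d ==> dist (f y) (f x) < e"
 using e unfolding uniformly_continuous_on_def by meson
 have "norm (f x - f y) < e" if xy: "dist x y < min d 1" for x y
 proof (cases "x : K \<or> y : K")
 case True
 have "norm x < R + 1" "norm y < R + 1"
  using True xy R norm_triangle_ineq2[of x y] norm_triangle_ineq2[of y x]
  by (auto simp: dist_norm norm_minus_commute subset_iff)
 thus ?thesis using d(2)[of y x] xy by (auto simp: dist_norm)
 qed (use K(2) e in auto)
 thus thesis using that[of "min d 1"] d(1) by auto
qed

text \<open>The bound is uniform in the base point \<open>z\<close>, since the partial derivatives
  have compact support and are uniformly continuous. Differentiating a convolution with a merely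
  integrable function relies on this uniformity.\<close>

lemma c1_uniform_remainder:
 fixes rho :: "'a::euclidean_space => real"
 assumes c1: "c1_deriv rho rho'" and K: "compact K" "!!x. x ~: K ==> rho x = 0" and e: "0 < e"
 obtains d where "0 < d" "!!z h. norm h < d ==> \<bar>rho (z + h) - rho z - rho' z h\<bar> <= e * norm h"
proof -
 have z: "rho' x b = 0" if "x ~: K" for x b
 using c1_deriv_zero_off_closed[OF c1 compact_imp_closed[OF K(1)] K(2) that] .
 define n where "n = real DIM('a)"
 have n: "0 < n" by (simp add: n_def)
 have "EX d>0. ALL x y. dist x y < d --> norm (rho' x b - rho' y b) < e / n" for b
 by (rule uniform_compact_support[OF c1_deriv_continuous_deriv[OF c1, of UNIV b] K(1) z, of "e / n"])
  (use e n in auto)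
 then obtain d where d: "!!b. 0 < d b" "!!b x y. dist x y < d b ==> \<bar>rho' x b - rho' y b\<bar> < e / n" by (metis real_norm_def)
 define D where "D = Min (d ` Basis)"
 have D: "0 < D" "!!b. b : Basis ==> D <= d b" using d(1) by (auto simp: D_def)
 have "\<bar>rho (z + h) - rho z - rho' z h\<bar> <= e * norm h" if h: "norm h < D" for z h
 proof -
 obtain t where t: "0 < t" "t < 1" "rho (z + 1 *\<^sub>R h) - rho (z + 0 *\<^sub>R h) = (1 - 0) * rho' (z + t *\<^sub>R h) h"
  using MVT2[of 0 1 "%s. rho (z + s *\<^sub>R h)" "%s. rho' (z + s *\<^sub>R h) h"] c1_deriv_line[OF c1] by auto
 have "\<bar>rho' (z + t *\<^sub>R h) b - rho' z b\<bar> <= e / n" if "b : Basis" for b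
 proof -
  have "norm (t *\<^sub>R h) <= norm h" using t by (simp add: mult_left_le_one_le)
  hence "dist (z + t *\<^sub>R h) z < d b" using D(2)[OF that] h by (simp add: dist_norm)
  thus ?thesis using d(2) by (simp add: less_imp_le)
 qed
 hence "(\<Sum>b\<in>Basis. \<bar>(rho' (z + t *\<^sub>R h) b - rho' z b) * (h \<bullet> b)\<bar>) <= (\<Sum>b\<in>(Basis::'a set). e / n * norm h)"
  unfolding abs_mult using e n by (intro sum_mono mult_mono) (auto simp: Basis_le_norm)
 also have "... = e * norm h" using n by (simp add: n_def)
 finally have S: "(\<Sum>b\<in>Basis. \<bar>(rho' (z + t *\<^sub>R h) b - rho' z b) * (h \<bullet> b)\<bar>) <= e * norm h" .
 have "rho (z + h) - rho z - rho' z h = rho' (z + t *\<^sub>R h) h - rho' z h" using t(3) by simp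
 also have "... = (\<Sum>b\<in>Basis. (rho' (z + t *\<^sub>R h) b - rho' z b) * (h \<bullet> b))"
  using linear_eq_sum_Basis[OF c1_deriv_linear[OF c1], of "z + t *\<^sub>R h" h] linear_eq_sum_Basis[OF c1_deriv_linear[OF c1], of z h]
  by (simp add: sum_subtractf left_diff_distrib)
 finally show ?thesis using S sum_abs[of "%b. (rho' (z + t *\<^sub>R h) b - rho' z b) * (h \<bullet> b)" Basis] by linarith
 qed
 thus thesis using that D(1) by blast
qed

lemma integrable_bounded_times:
 fixes v :: "'a::euclidean_space => real"
 assumes v: "integrable lborel v" and r: "r : borel_measurable borel" "!!x. \<bar>r x\<bar> <= B"
 shows "integrable lborel (%x. r x * v x)"
proof (rule Bochner_Integration.integrable_bound[of _ "%x. B * \<bar>v x\<bar>"])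
 show "integrable lborel (%x. B * \<bar>v x\<bar>)" using v by (intro integrable_mult_right integrable_abs)
 show "(%x. r x * v x) : borel_measurable lborel" using v r(1) by measurable
 have "0 <= B" using r(2)[of undefined] by linarith
 thus "AE x in lborel. norm (r x * v x) <= norm (B * \<bar>v x\<bar>)"
 using r(2) by (auto simp: abs_mult intro!: mult_right_mono)
qed

lemma integral_bounded_times_le:
 fixes v :: "'a::euclidean_space => real"
 assumes v: "integrable lborel v" and r: "r : borel_measurable borel" "!!x. \<bar>r x\<bar> <= B"
 shows "\<bar>LBINT x. r x * v x\<bar> <= B * (LBINT x. \<bar>v x\<bar>)"
proof -
 have "norm (LBINT x. r x * v x) <= (LBINT x. B * \<bar>v x\<bar>)"
 by (rule Bochner_Integration.integral_norm_bound_integral[OF integrable_bounded_times[OF v r]])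
  (use v r(2) in \<open>auto simp: abs_mult intro!: mult_right_mono\<close>)
 thus ?thesis by simp
qed

text \<open>The first order remainder of \<open>rho\<close> is small uniformly in the base point, so
  its integral against \<open>v\<close> is at most that bound times the L1 norm of
  \<open>v\<close>.\<close>

lemma convolution_c1_deriv:
 fixes rho v :: "'a::euclidean_space => real"
 assumes c1: "c1_deriv rho rho'" and K: "compact K" "!!x. x ~: K ==> rho x = 0" and v: "integrable lborel v"
 shows "c1_deriv (%x. LBINT y. rho (x - y) * v y) (%x h. \<integral>y. rho' (x - y) h * v y \<partial>lborel)"
proof -
 have z: "rho' x b = 0" if "x ~: K" for x b
 using c1_deriv_zero_off_closed[OF c1 compact_imp_closed[OF K(1)] K(2) that] .
 \<comment> \<open>One is added to the L1 norm so that it can be divided by.\<close>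
 define V where "V = (LBINT y. \<bar>v y\<bar>) + 1"
 have V: "0 < V" "(LBINT y. \<bar>v y\<bar>) <= V" by (auto simp: V_def add_nonneg_pos)
 have m: "(%y. rho (x - y)) : borel_measurable borel" "(%y. rho' (x - y) h) : borel_measurable borel" for x h
 proof -
 have c: "continuous_on UNIV (%y. x - y)" by (intro continuous_intros)
 show "(%y. rho (x - y)) : borel_measurable borel" "(%y. rho' (x - y) h) : borel_measurable borel"
  using continuous_on_compose2[OF c1_deriv_continuous[OF c1, of UNIV] c]
  continuous_on_compose2[OF c1_deriv_continuous_deriv[OF c1, of UNIV h] c]
  by (auto intro!: borel_measurable_continuous_onI)
 qed
 obtain B where B: "!!x. \<bar>rho x\<bar> <= B"
 by (rule bounded_compact_support[OF c1_deriv_continuous[OF c1] K]) auto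
 have B': "EX B. ALL x. \<bar>rho' x h\<bar> <= B" for h
 by (rule bounded_compact_support[OF c1_deriv_continuous_deriv[OF c1, of UNIV h] K(1) z]) auto
 have i: "integrable lborel (%y. rho (x - y) * v y)" for x
 using integrable_bounded_times[OF v m(1)] B by blast
 have i': "integrable lborel (%y. rho' (x - y) h * v y)" for x h
 using integrable_bounded_times[OF v m(2)] B' by meson
 have lin: "linear (rho' x)" for x by (rule c1_deriv_linear[OF c1])
 define D where "D x h = (LBINT y. rho' (x - y) h * v y)" for x h
 have Dlin: "linear (D x)" for x
 proof (rule linearI)
 show "D x (a + b) = D x a + D x b" for a b
  unfolding D_def using i' by (simp add: linear_add[OF lin] distrib_right Bochner_Integration.integral_add)
 show "D x (c *\<^sub>R a) = c *\<^sub>R D x a" for c a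
  unfolding D_def by (simp add: linear_scale[OF lin] mult.assoc)
 qed
 have "((%x. LBINT y. rho (x - y) * v y) has_derivative D x) (at x)" for x
 unfolding has_derivative_at_alt
 proof (intro conjI allI impI)
 show "bounded_linear (D x)" using Dlin by (rule linear_conv_bounded_linear[THEN iffD1])
 fix e :: real assume e: "0 < e"
 obtain d where d: "0 < d" "!!z h. norm h < d ==> \<bar>rho (z + h) - rho z - rho' z h\<bar> <= e / V * norm h"
  by (rule c1_uniform_remainder[OF c1 K, of "e / V"]) (assumption, use e V in simp, rule that)
 show "EX d>0. ALL x'. norm (x' - x) < d -->
  norm ((LBINT y. rho (x' - y) * v y) - (LBINT y. rho (x - y) * v y) - D x (x' - x)) <= e * norm (x' - x)"
 proof (intro exI[of _ d] conjI allI impI d(1))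
  fix x' assume x': "norm (x' - x) < d"
  have eq: "(LBINT y. rho (x' - y) * v y) - (LBINT y. rho (x - y) * v y) - D x (x' - x)
   = (LBINT y. (rho (x' - y) - rho (x - y) - rho' (x - y) (x' - x)) * v y)"
  unfolding D_def using i i' by (simp add: left_diff_distrib Bochner_Integration.integral_diff)
  have "\<bar>LBINT y. (rho (x' - y) - rho (x - y) - rho' (x - y) (x' - x)) * v y\<bar> <= e / V * norm (x' - x) * (LBINT y. \<bar>v y\<bar>)"
  proof (rule integral_bounded_times_le[OF v])
  show "\<bar>rho (x' - y) - rho (x - y) - rho' (x - y) (x' - x)\<bar> <= e / V * norm (x' - x)" for y
   using d(2)[OF x', of "x - y"] by (simp add: algebra_simps)
  qed (intro borel_measurable_diff m)
  also have "... <= e / V * norm (x' - x) * V" using V e by (intro mult_left_mono) auto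
  also have "... = e * norm (x' - x)" using V by simp
  finally show "norm ((LBINT y. rho (x' - y) * v y) - (LBINT y. rho (x - y) * v y) - D x (x' - x)) <= e * norm (x' - x)"
  unfolding eq real_norm_def .
 qed
 qed
 moreover have "continuous_on UNIV (%x. D x h)" for h
 unfolding continuous_on_iff
 proof (intro ballI allI impI)
 fix x and e :: real assume e: "0 < e"
 obtain d where d: "0 < d" "!!x y. dist x y < d ==> norm (rho' x h - rho' y h) < e / (2 * V)"
  by (rule uniform_compact_support[OF c1_deriv_continuous_deriv[OF c1, of UNIV h] K(1) z, of "e / (2 * V)"])
  (assumption, use e V in simp, rule that)
 show "EX d>0. ALL x':UNIV. dist x' x < d --> dist (D x' h) (D x h) < e"
 proof (intro exI[of _ d] conjI ballI impI d(1))
  fix x' assume x': "dist x' x < d"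
  have eq: "D x' h - D x h = (LBINT y. (rho' (x' - y) h - rho' (x - y) h) * v y)"
  unfolding D_def using i' by (simp add: left_diff_distrib Bochner_Integration.integral_diff)
  have "\<bar>LBINT y. (rho' (x' - y) h - rho' (x - y) h) * v y\<bar> <= e / (2 * V) * (LBINT y. \<bar>v y\<bar>)"
  proof (rule integral_bounded_times_le[OF v])
  show "\<bar>rho' (x' - y) h - rho' (x - y) h\<bar> <= e / (2 * V)" for y
   using d(2)[of "x' - y" "x - y"] x' by (simp add: dist_norm less_imp_le)
  qed (intro borel_measurable_diff m)
  also have "... <= e / (2 * V) * V" using V e by (intro mult_left_mono) auto
  also have "... < e" using V e by simp
  finally show "dist (D x' h) (D x h) < e" by (simp add: dist_norm eq)
 qed
 qed
 ultimately have "c1_deriv (%x. LBINT y. rho (x - y) * v y) D" by (simp add: c1_deriv_def)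
 moreover have "(%x h. \<integral>y. rho' (x - y) h * v y \<partial>lborel) = D" by (simp add: D_def fun_eq_iff)
 ultimately show ?thesis by simp
qed

lemma mollifier_exists:
 assumes e: "0 < e"
 obtains rho :: "'a::euclidean_space => real" and rho' where "c1_deriv rho rho'" "!!x. 0 <= rho x" "!!x. x ~: ball 0 e ==> rho x = 0"
 "(LBINT x. rho x) = 1" "integrable lborel rho"
proof -
 obtain eta :: "'a => real" and eta' where eta: "c1_deriv eta eta'" "!!x. 0 <= eta x" "!!x. eta x <= 1"
 "!!x. x : cball 0 (e/2) ==> eta x = 1" "!!x. x ~: ball 0 e ==> eta x = 0"
 by (rule c1_bump_ball[of "e/2" e 0]) (use e in simp, use e in simp, rule that)
 have i: "integrable lborel eta"
 by (rule integrable_compact_support[OF c1_deriv_continuous[OF eta(1)] compact_cball[of 0 e]]) (use eta(5) in auto)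
 define c where "c = (LBINT x. eta x)"
 have "0 < measure lborel (cball (0::'a) (e/2))" using content_cball_pos[of "e/2" "0::'a"] e by simp
 also have "... = (LBINT x. indicator (cball (0::'a) (e/2)) x)" by simp
 also have "... <= c" unfolding c_def
 proof (rule integral_mono[OF _ i])
 show "integrable lborel (indicator (cball (0::'a) (e/2)) :: 'a => real)"
  using emeasure_bounded_finite[of "cball (0::'a) (e/2)"] by (intro integrable_real_indicator) auto
 show "indicator (cball (0::'a) (e/2)) x <= eta x" for x using eta(2,4) by (auto simp: indicator_def)
 qed
 finally have c: "0 < c" .
 have "c1_deriv (%x. inverse c * eta x) (%x h. inverse c * eta' x h + 0 * eta x)"
 using c1_deriv_mult[OF c1_deriv_const[of "inverse c"] eta(1)] .
 thus thesis
 by (rule that) (use eta c i in \<open>auto simp: c_def[symmetric]\<close>)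
qed

lemma lborel_reflect:
 fixes f :: "'a::euclidean_space => 'b::{banach,second_countable_topology}"
 assumes "f : borel_measurable borel"
 shows "(LBINT y. f (x - y)) = (LBINT y. f y)" "integrable lborel (%y. f (x - y)) \<longleftrightarrow> integrable lborel f"
proof -
 have eq: "lborel = distr lborel borel (%y. x - y)" using lborel_affine[of "-1" x] by (simp add: density_1)
 show "(LBINT y. f (x - y)) = (LBINT y. f y)" using assms by (subst (2) eq, subst integral_distr) auto
 show "integrable lborel (%y. f (x - y)) \<longleftrightarrow> integrable lborel f" using assms by (subst (2) eq, subst integrable_distr_eq) auto
qed

lemma mollify_uniform:
 fixes g :: "'a::euclidean_space => 'b::{banach,second_countable_topology}"
 assumes rho: "!!x. 0 <= rho x" "!!x. x ~: ball 0 d ==> rho x = 0" "integrable lborel rho" "(LBINT x. rho x) = 1"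
 and g: "continuous_on UNIV g" "!!x. norm (g x) <= B"
 shows "integrable lborel (%y. rho (x - y) *\<^sub>R g y)" "norm (LBINT y. rho (x - y) *\<^sub>R g y) <= B"
 "(!!y. dist y x < d ==> norm (g y - g x) <= e) ==> norm ((LBINT y. rho (x - y) *\<^sub>R g y) - g x) <= e"
proof -
 have [measurable]: "rho : borel_measurable borel" "g : borel_measurable borel" using rho(3) borel_measurable_continuous_onI[OF g(1)] by auto
 have sh: "integrable lborel (%y. rho (x - y))" "(LBINT y. rho (x - y)) = 1" using rho(3,4) lborel_reflect[of rho x] by auto
 have "0 <= B" using g(2)[of 0] norm_ge_zero order_trans by blast
 hence bd: "norm (rho (x - y) *\<^sub>R g y) <= B * rho (x - y)" for y using g(2)[of y] rho(1)[of "x - y"] by (simp add: mult.commute mult_right_mono)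
 show i: "integrable lborel (%y. rho (x - y) *\<^sub>R g y)"
 by (rule Bochner_Integration.integrable_bound[of _ "%y. B * rho (x - y)"]) (use sh bd in \<open>auto intro: order_trans[OF _ abs_ge_self]\<close>)
 show "norm (LBINT y. rho (x - y) *\<^sub>R g y) <= B"
 using Bochner_Integration.integral_norm_bound_integral[OF i, of "%y. B * rho (x - y)"] bd sh by simp
 assume e: "!!y. dist y x < d ==> norm (g y - g x) <= e"
 have "(LBINT y. rho (x - y) *\<^sub>R g y) - g x = (LBINT y. rho (x - y) *\<^sub>R g y - rho (x - y) *\<^sub>R g x)"
 using i sh by (subst Bochner_Integration.integral_diff) auto
 also have "norm ... <= (LBINT y. rho (x - y) * e)"
 proof (rule Bochner_Integration.integral_norm_bound_integral)
 fix y :: 'a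
 show "norm (rho (x - y) *\<^sub>R g y - rho (x - y) *\<^sub>R g x) <= rho (x - y) * e"
  using e[of y] rho(1)[of "x - y"] rho(2)[of "x - y"]
  by (cases "dist y x < d") (auto simp: dist_norm norm_minus_commute scaleR_diff_right[symmetric] mult_left_mono)
 qed (use i sh in auto)
 finally show "norm ((LBINT y. rho (x - y) *\<^sub>R g y) - g x) <= e" using sh by simp
qed

lemma mollify_contraction:
 fixes f :: "'a::euclidean_space => 'b::{banach,second_countable_topology}"
 assumes f: "integrable lborel f" and rho: "!!x. 0 <= rho x" "integrable lborel rho" "(LBINT x. rho x) = 1"
 shows "integrable lborel (%x. LBINT y. rho (x - y) *\<^sub>R f y)" (is "integrable _ ?F")
 "(LBINT x. norm (LBINT y. rho (x - y) *\<^sub>R f y)) <= (LBINT x. norm (f x))"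
proof -
 have [measurable]: "f : borel_measurable borel" "rho : borel_measurable borel" using f rho(2) by auto
 have "(\<integral>\<^sup>+x. ennreal (norm (?F x)) \<partial>lborel) <= (\<integral>\<^sup>+x. (\<integral>\<^sup>+y. ennreal (rho (x - y)) * ennreal (norm (f y)) \<partial>lborel) \<partial>lborel)"
 proof (rule nn_integral_mono)
 fix x
 have "ennreal (norm (?F x)) <= (\<integral>\<^sup>+y. ennreal (norm (rho (x - y) *\<^sub>R f y)) \<partial>lborel)"
 \<comment> \<open>Without integrability the Bochner integral is 0 by convention, and the estimate
   still holds; integrability for almost every \<open>x\<close> need not be settled first.\<close>
 proof (cases "integrable lborel (%y. rho (x - y) *\<^sub>R f y)")
  case False
  from not_integrable_integral_eq[OF this] show ?thesis by (simp only: norm_zero ennreal_0) simp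
 qed (rule integral_norm_bound_ennreal)
 thus "ennreal (norm (?F x)) <= (\<integral>\<^sup>+y. ennreal (rho (x - y)) * ennreal (norm (f y)) \<partial>lborel)"
  using rho(1) by (simp add: ennreal_mult')
 qed
 also have "... = (\<integral>\<^sup>+y. (\<integral>\<^sup>+x. ennreal (rho (x - y)) * ennreal (norm (f y)) \<partial>lborel) \<partial>lborel)"
 by (rule lborel_pair.Fubini') measurable
 also have "... = (\<integral>\<^sup>+y. (\<integral>\<^sup>+x. ennreal (rho x) \<partial>lborel) * ennreal (norm (f y)) \<partial>lborel)"
 using nn_integral_lborel_shift[of "%x. ennreal (rho x)" "- _"] by (simp add: nn_integral_multc)
 also have "(\<integral>\<^sup>+x. ennreal (rho x) \<partial>lborel) = 1" using nn_integral_eq_integral[OF rho(2)] rho(1,3) by simp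
 also have "(\<integral>\<^sup>+y. 1 * ennreal (norm (f y)) \<partial>lborel) = ennreal (LBINT x. norm (f x))"
 using f by (simp add: nn_integral_eq_integral)
 finally have le: "(\<integral>\<^sup>+x. ennreal (norm (?F x)) \<partial>lborel) <= ennreal (LBINT x. norm (f x))" .
 show i: "integrable lborel ?F" using le by (intro integrableI_bounded) (auto intro: le_less_trans)
 show "(LBINT x. norm (?F x)) <= (LBINT x. norm (f x))"
 using le nn_integral_eq_integral[OF integrable_norm[OF i]] by simp
qed

text \<open>Induction over integrable functions. An indicator is approximated from inside by a
  compact set, and this in turn by cut-offs that shrink to it; sums and dominated limits add the
  errors.\<close>

lemma L1_dense_continuous:
 fixes f :: "'a::euclidean_space => 'b::{banach,second_countable_topology}"
 assumes "integrable lborel f"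
 shows "ALL e>0. EX g K. continuous_on UNIV g & compact K & (ALL x. x ~: K --> g x = 0) & (LBINT x. norm (f x - g x)) < e"
 using assms
proof (induction rule: integrable_induct)
 case (base A c)
 show ?case
 proof (intro allI impI)
 fix e :: real assume e: "0 < e"
 have As: "A : sets borel" using base by simp
 \<comment> \<open>Lebesgue measure restricted to \<open>A\<close> is finite, as inner regularity is
   stated for finite measures.\<close>
 define M where "M = density lborel (indicator A :: 'a => ennreal)"
 have M: "finite_measure M" "sets M = sets borel" using base by (auto simp: M_def emeasure_density intro!: finite_measureI)
 have pos: "0 < norm c + 1" by (simp add: add_nonneg_pos)
 obtain K where K: "compact K" "K <= A" "measure M (A - K) < e / (norm c + 1)"
  by (rule inner_regular_finite[OF M As, of "e / (norm c + 1)"]) (use e pos in simp, rule that)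
 have Ks: "K : sets borel" using K(1) by (simp add: borel_compact)
 obtain R where R: "K <= ball 0 R" using bounded_subset_ballD[OF compact_imp_bounded[OF K(1)]] by blast
 obtain eta :: "nat => 'a => real" and eta' C where eta: "!!n. c1_deriv (eta n) (eta' n)" "!!n x. 0 <= eta n x & eta n x <= 1"
  "!!n x. x : K ==> eta n x = 1" "!!n. compact (C n)" "!!n. C n <= ball 0 R" "!!n x. x ~: C n ==> eta n x = 0" "!!x. (%n. eta n x) \<longlonglongrightarrow> indicator K x"
  by (rule cutoff_sequence[OF K(1) open_ball R]) (rule that)
 have [measurable]: "eta n : borel_measurable borel" for n by (rule c1_deriv_measurable[OF eta(1)])
 have "(%n. LBINT x. norm (indicator A x *\<^sub>R c - eta n x *\<^sub>R c)) \<longlonglongrightarrow> (LBINT x. norm (indicator A x *\<^sub>R c - indicator K x *\<^sub>R c))"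
 proof (rule integral_dominated_convergence)
  show "integrable lborel (%x. (indicat_real A x + indicat_real (ball 0 R) x) * norm c)"
  using base emeasure_bounded_finite[OF bounded_ball, of 0 R]
  by (intro integrable_mult_left Bochner_Integration.integrable_add integrable_real_indicator) auto
  show "AE x in lborel. (%n. norm (indicator A x *\<^sub>R c - eta n x *\<^sub>R c)) \<longlonglongrightarrow> norm (indicator A x *\<^sub>R c - indicator K x *\<^sub>R c)"
  by (intro AE_I2 tendsto_intros eta(7))
  show "AE x in lborel. norm (norm (indicator A x *\<^sub>R c - eta n x *\<^sub>R c)) <= (indicat_real A x + indicat_real (ball 0 R) x) * norm c" for n
  proof (rule AE_I2)
  fix x :: 'a
  have "\<bar>indicator A x - eta n x\<bar> <= indicat_real A x + indicat_real (ball 0 R) x"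
   using eta(2)[of n x] eta(6)[of x n] subsetD[OF eta(5), of x n] by (cases "x : C n") (auto simp: indicator_def)
  thus "norm (norm (indicator A x *\<^sub>R c - eta n x *\<^sub>R c)) <= (indicat_real A x + indicat_real (ball 0 R) x) * norm c"
   by (simp add: scaleR_left_diff_distrib[symmetric] mult_right_mono)
  qed
 qed (use As Ks in measurable)
 moreover have "(LBINT x. norm (indicator A x *\<^sub>R c - indicator K x *\<^sub>R c)) < e"
 proof -
  have "(%x. norm (indicator A x *\<^sub>R c - indicator K x *\<^sub>R c)) = (%x. norm c * indicat_real (A - K) x)"
  using K(2) by (auto simp: indicator_def fun_eq_iff)
  moreover have "measure M (A - K) = measure lborel (A - K)"
  using As Ks unfolding M_def measure_def by (simp add: emeasure_restricted Int_absorb1)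
  moreover have "norm c * measure M (A - K) <= (norm c + 1) * measure M (A - K)" by (intro mult_right_mono) auto
  moreover have "(norm c + 1) * measure M (A - K) < e" using K(3) pos by (simp add: field_simps)
  ultimately show ?thesis using As Ks by simp
 qed
 ultimately have "\<forall>\<^sub>F n in sequentially. (LBINT x. norm (indicator A x *\<^sub>R c - eta n x *\<^sub>R c)) < e" by (rule order_tendstoD(2))
 then obtain n where "(LBINT x. norm (indicator A x *\<^sub>R c - eta n x *\<^sub>R c)) < e" by (auto simp: eventually_sequentially)
 thus "EX g K. continuous_on UNIV g & compact K & (ALL x. x ~: K --> g x = 0) & (LBINT x. norm (indicator A x *\<^sub>R c - g x)) < e"
  using eta(4,6) c1_deriv_continuous[OF eta(1)] by (intro exI[of _ "%x. eta n x *\<^sub>R c"] exI[of _ "C n"]) (auto intro!: continuous_intros)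
 qed
next
 case (add f1 f2)
 show ?case
 proof (intro allI impI)
 fix e :: real assume "0 < e"
 hence e: "0 < e / 2" by simp
 obtain g1 K1 where 1: "continuous_on UNIV g1" "compact K1" "ALL x. x ~: K1 --> g1 x = 0" "(LBINT x. norm (f1 x - g1 x)) < e/2" using add(3) e by blast
 obtain g2 K2 where 2: "continuous_on UNIV g2" "compact K2" "ALL x. x ~: K2 --> g2 x = 0" "(LBINT x. norm (f2 x - g2 x)) < e/2" using add(4) e by blast
 have gi: "integrable lborel g1" "integrable lborel g2" using integrable_compact_support 1 2 by blast+
 have "(LBINT x. norm (f1 x + f2 x - (g1 x + g2 x))) <= (LBINT x. norm (f1 x - g1 x) + norm (f2 x - g2 x))"
  using add(1,2) gi by (intro integral_mono) (auto simp: norm_diff_triangle_ineq)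
 also have "... < e" using add(1,2) gi 1(4) 2(4) by simp
 finally show "EX g K. continuous_on UNIV g & compact K & (ALL x. x ~: K --> g x = 0) & (LBINT x. norm (f1 x + f2 x - g x)) < e"
  using 1 2 by (intro exI[of _ "%x. g1 x + g2 x"] exI[of _ "K1 Un K2"]) (auto intro!: continuous_intros)
 qed
next
 case (lim f s)
 show ?case
 proof (intro allI impI)
 fix e :: real assume "0 < e"
 hence e: "0 < e / 2" by simp
 have "(%i. LBINT x. norm (s i x - f x)) \<longlonglongrightarrow> integral\<^sup>L lborel (%_::'a. 0 :: real)"
 \<comment> \<open>The approximating functions satisfy |s i x| <= 2 |f x|, whence the factor
   3.\<close>
 proof (rule integral_dominated_convergence[where w = "%x. 3 * norm (f x)"])
  show "AE x in lborel. (%i. norm (s i x - f x)) \<longlonglongrightarrow> 0"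
  using lim(2) by (intro AE_I2 tendsto_norm_zero) (auto simp: LIM_zero_iff)
  show "AE x in lborel. norm (norm (s i x - f x)) <= 3 * norm (f x)" for i
  using lim(3)[of _ i] norm_triangle_ineq4[of "s i _" "f _"] by (intro AE_I2) (smt (verit) norm_ge_zero real_norm_def space_lborel UNIV_I)
 qed (use lim in auto)
 hence "\<forall>\<^sub>F i in sequentially. (LBINT x. norm (s i x - f x)) < e/2" using e by (intro order_tendstoD(2)) auto
 then obtain i where i: "(LBINT x. norm (s i x - f x)) < e/2" by (auto simp: eventually_sequentially)
 obtain g K where g: "continuous_on UNIV g" "compact K" "ALL x. x ~: K --> g x = 0" "(LBINT x. norm (s i x - g x)) < e/2" using lim(5)[of i] e by blast
 have gi: "integrable lborel g" using integrable_compact_support g by blast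
 have "(LBINT x. norm (f x - g x)) <= (LBINT x. norm (s i x - f x) + norm (s i x - g x))"
 proof (rule integral_mono)
  show "norm (f x - g x) <= norm (s i x - f x) + norm (s i x - g x)" for x using norm_triangle_ineq4[of "s i x - g x" "s i x - f x"] by simp
 qed (use lim(1,4) gi in auto)
 also have "... < e" using lim(1,4) gi i g(4) by simp
 finally show "EX g K. continuous_on UNIV g & compact K & (ALL x. x ~: K --> g x = 0) & (LBINT x. norm (f x - g x)) < e" using g by blast
 qed
qed

lemma continuous_c1_deriv_apply:
 fixes eta :: "'a::euclidean_space => real"
 assumes "c1_deriv eta eta'" "continuous_on UNIV ph"
 shows "continuous_on UNIV (%x. eta' x (ph x))"
proof -
 have "eta' x (ph x) = (\<Sum>b\<in>Basis. eta' x b * (ph x \<bullet> b))" for x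
 by (rule linear_eq_sum_Basis[OF c1_deriv_linear[OF assms(1)]])
 thus ?thesis using c1_deriv_continuous_deriv[OF assms(1)] assms(2) by (auto intro!: continuous_intros)
qed

lemma integral_by_parts_c1:
 fixes u :: "'a::euclidean_space => real" and ph :: "'a => 'a"
 assumes u: "c1_deriv u u'" and ph: "c1_deriv ph ph'" "compact K" "!!x. x ~: K ==> ph x = 0"
 shows "- (LBINT x. u x * divergence ph x) = (LBINT x. u' x (ph x))"
 and "integrable lborel (%x. u' x (ph x))"
proof -
 have d0: "divergence ph x = 0" if "x ~: K" for x
 using divergence_zero_off_closed[OF ph(1) compact_imp_closed[OF ph(2)] ph(3) that] .
 have 1: "integrable lborel (%x. u x * divergence ph x)"
 by (rule integrable_compact_support[OF _ ph(2)])
  (use d0 c1_deriv_continuous[OF u] continuous_divergence[OF ph(1)] in \<open>auto intro!: continuous_intros\<close>)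
 show 2: "integrable lborel (%x. u' x (ph x))"
 by (rule integrable_compact_support[OF continuous_c1_deriv_apply[OF u c1_deriv_continuous[OF ph(1)]] ph(2)])
  (simp add: ph(3) linear_0[OF c1_deriv_linear[OF u]])
 have "(LBINT x. divergence (%x. u x *\<^sub>R ph x) x) = 0"
 by (rule integral_divergence_zero[OF c1_deriv_scaleR[OF u ph(1)] ph(2)]) (simp add: ph(3))
 thus "- (LBINT x. u x * divergence ph x) = (LBINT x. u' x (ph x))"
 using 1 2 by (simp add: divergence_scaleR[OF u ph(1)])
qed

definition mollifiers where
 "mollifiers rho rho' \<longleftrightarrow> (ALL j. c1_deriv (rho j) (rho' j) & (ALL x. 0 <= rho j x) & (ALL x. x ~: ball 0 (1 / real (Suc j)) --> rho j x = 0) &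
  (LBINT x. rho j x) = 1 & integrable lborel (rho j))"

lemma mollifiers_exist:
 obtains rho :: "nat => 'a::euclidean_space => real" and rho' where "mollifiers rho rho'"
proof -
 define Q where "Q j = (%(rho :: 'a => real, rho'). c1_deriv rho rho' & (ALL x. 0 <= rho x) &
  (ALL x. x ~: ball 0 (1 / real (Suc j)) --> rho x = 0) & (LBINT x. rho x) = 1 & integrable lborel rho)" for j
 have "EX p. Q j p" for j
 proof -
 obtain rho :: "'a => real" and rho' where "c1_deriv rho rho'" "!!x. 0 <= rho x" "!!x. x ~: ball 0 (1 / real (Suc j)) ==> rho x = 0"
  "(LBINT x. rho x) = 1" "integrable lborel rho"
  by (rule mollifier_exists[of "1 / real (Suc j)"]) (simp, rule that)
 hence "Q j (rho, rho')" by (auto simp: Q_def)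
 thus ?thesis by blast
 qed
 then obtain p where p: "!!j. Q j (p j)" by metis
 hence "mollifiers (%j. fst (p j)) (%j. snd (p j))"
 by (auto simp: mollifiers_def Q_def case_prod_unfold)
 thus thesis by (rule that)
qed

lemma mollifiers_compact_support:
 assumes "mollifiers rho rho'"
 shows "x ~: cball 0 (1 / real (Suc j)) ==> rho j x = 0"
proof -
 assume "x ~: cball 0 (1 / real (Suc j))"
 hence "x ~: ball 0 (1 / real (Suc j))" by simp
 thus ?thesis using assms unfolding mollifiers_def by blast
qed

text \<open>Mollification contracts the L1 norm, so \<open>w\<close> may be replaced by a nearby
  continuous \<open>g\<close> of compact support. For \<open>g\<close> the convergence is uniform
  and, for radii below one, takes place inside the fixed ball \<open>I\<close>. Three errors of at
  most e/4 leave room for strictness.\<close>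

lemma mollifiers_L1:
 fixes w :: "'a::euclidean_space => 'b::{banach,second_countable_topology}"
 assumes rho: "mollifiers rho rho'" and w: "integrable lborel w"
 shows "integrable lborel (%x. (LBINT y. rho j (x - y) *\<^sub>R w y) - w x)"
 and "(%j. LBINT x. norm ((LBINT y. rho j (x - y) *\<^sub>R w y) - w x)) \<longlonglongrightarrow> 0"
proof -
 have r: "c1_deriv (rho j) (rho' j)" "!!x. 0 <= rho j x" "!!x. x ~: ball 0 (1 / real (Suc j)) ==> rho j x = 0"
  "(LBINT x. rho j x) = 1" "integrable lborel (rho j)" for j
 using rho by (auto simp: mollifiers_def)
 define F where "F j f x = (LBINT y. rho j (x - y) *\<^sub>R f y)" for j x and f :: "'a => 'b"
 have C: "integrable lborel (F j f)" "(LBINT x. norm (F j f x)) <= (LBINT x. norm (f x))" if "integrable lborel f" for j f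
 unfolding F_def using mollify_contraction[OF that r(2,5,4)] by auto
 show "integrable lborel (%x. (LBINT y. rho j (x - y) *\<^sub>R w y) - w x)" using Bochner_Integration.integrable_diff[OF C(1)[OF w, of j] w] by (simp add: F_def)
 have wi: "integrable lborel (%y. rho j (x - y) *\<^sub>R w y)" for j x
 proof -
 have [measurable]: "rho j : borel_measurable borel" "w : borel_measurable borel" using r(5) w by auto
 obtain B where B: "0 < B" "!!x. norm (rho j x) <= B"
  by (rule bounded_compact_support[OF c1_deriv_continuous[OF r(1)] compact_cball mollifiers_compact_support[OF rho]])
  (assumption, rule that)
 show ?thesis
  by (rule Bochner_Integration.integrable_bound[of _ "%y. B * norm (w y)"]) (use w B in \<open>auto intro!: mult_right_mono\<close>)
 qed
 show "(%j. LBINT x. norm ((LBINT y. rho j (x - y) *\<^sub>R w y) - w x)) \<longlonglongrightarrow> 0"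
 proof (rule LIMSEQ_I)
 fix e :: real assume e: "0 < e"
 obtain g K where g: "continuous_on UNIV g" "compact K" "!!x. x ~: K ==> g x = 0" "(LBINT x. norm (w x - g x)) < e/4"
  using L1_dense_continuous[OF w] e by (metis divide_pos_pos zero_less_numeral)
 have gi: "integrable lborel g" by (rule integrable_compact_support[OF g(1-3)])
 obtain B where B: "0 < B" "!!x. norm (g x) <= B" by (rule bounded_compact_support[OF g(1-3)]) (assumption, rule that)
 obtain R where R: "0 < R" "K <= ball 0 R" using bounded_subset_ballD[OF compact_imp_bounded[OF g(2)]] by blast
 define I where "I = cball (0::'a) (R + 1)"
 have I: "integrable lborel (indicat_real I)" using emeasure_bounded_finite[of I] by (auto simp: I_def)
 define c where "c = measure lborel I + 1"
 have c: "0 < c" by (simp add: c_def add_nonneg_pos)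
 obtain d where d: "0 < d" "!!x y. dist x y < d ==> norm (g x - g y) < e / (4 * c)"
  by (rule uniform_compact_support[OF g(1-3), of "e / (4 * c)"]) (assumption, use e c in simp, rule that)
 obtain J where J: "1 / real (Suc J) < min d 1" using nat_approx_posE[of "min d 1"] d(1) by auto
 have "(LBINT x. norm (F j w x - w x)) < e" if "J <= j" for j
 proof -
  have "1 / real (Suc j) <= 1 / real (Suc J)" using that by (intro divide_left_mono) auto
  hence jd: "1 / real (Suc j) < d" "1 / real (Suc j) < 1" using J by linarith+
  have mu: "integrable lborel (%y. rho j (x - y) *\<^sub>R g y)" for x by (rule mollify_uniform(1)[OF r(2,3,5,4) g(1) B(2)])
  have g1: "norm (F j g x - g x) <= e / (4 * c) * indicator I x" for x
  proof (cases "x : I")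
  case True
  have "norm (F j g x - g x) <= e / (4 * c)" unfolding F_def 
   by (rule mollify_uniform(3)[OF r(2,3,5,4) g(1) B(2)], assumption, rule less_imp_le, rule d(2)) (use jd in linarith)
  thus ?thesis using True by simp
  next
  case False
  have "rho j (x - y) *\<^sub>R g y = 0" for y
  proof (cases "y : K")
   case True
   hence "norm y < R" "R + 1 < norm x" using R(2) False by (auto simp: I_def)
   moreover have "norm x <= norm (x - y) + norm y" using norm_triangle_ineq[of "x - y" y] by simp
   ultimately have "\<not> norm (x - y) < 1 / real (Suc j)" using jd by linarith
   thus ?thesis using r(3)[of "x - y" j] by simp
  qed (simp add: g(3))
  hence "(%y. rho j (x - y) *\<^sub>R g y) = (%_. 0)" by (rule ext)
  hence "F j g x = 0" by (simp only: F_def integral_zero)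
  moreover have "g x = 0" using False R by (intro g(3)) (auto simp: I_def subset_iff)
  ultimately show ?thesis using e c by simp
  qed
  have Fw: "F j w x = F j (%x. w x - g x) x + F j g x" for x
  unfolding F_def scaleR_diff_right by (subst Bochner_Integration.integral_diff[OF wi mu]) simp
  note wg = Bochner_Integration.integrable_diff[OF w gi]
  have "(LBINT x. norm (F j w x - w x)) <= (LBINT x. norm (F j (%x. w x - g x) x) + e / (4 * c) * indicator I x + norm (w x - g x))"
  proof (rule integral_mono)
  show "norm (F j w x - w x) <= norm (F j (%x. w x - g x) x) + e / (4 * c) * indicator I x + norm (w x - g x)" for x
   using g1[of x] norm_triangle_ineq[of "F j (%x. w x - g x) x" "F j g x - g x"] norm_triangle_ineq4[of "F j w x - g x" "w x - g x"]
   by (simp add: Fw add_diff_eq)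
  qed (use C(1)[OF w] C(1)[OF wg] w wg I in auto)
  also have "... = (LBINT x. norm (F j (%x. w x - g x) x)) + e / (4 * c) * measure lborel I + (LBINT x. norm (w x - g x))"
  using C(1)[OF wg] wg I by simp
  finally have "(LBINT x. norm (F j w x - w x)) <= ..." .
  moreover have "e / (4 * c) * measure lborel I <= e / (4 * c) * c" using e c by (intro mult_left_mono) (auto simp: c_def)
  moreover have "e / (4 * c) * c = e / 4" using c by simp
  ultimately show ?thesis using C(2)[OF wg, of j] g(4) e by linarith
 qed
 thus "EX no. ALL n>=no. norm ((LBINT x. norm ((LBINT y. rho n (x - y) *\<^sub>R w y) - w x)) - 0) < e"
  by (intro exI[of _ J]) (simp add: F_def)
 qed
qed

section \<open>Chain rule for the mollified function\<close>

context bv_rep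
begin

text \<open>\<open>N\<close> carries the part of \<open>M\<close> that is singular to Lebesgue
  measure and \<open>k\<close> is the density of the rest, so that \<open>k x *\<^sub>R s x\<close>
  is the density of the absolutely continuous part of \<open>Dv\<close>.\<close>

definition decomp :: "'a set => ('a => real) => bool" where
 "decomp N k \<longleftrightarrow> N : null_sets lborel & k : borel_measurable borel & (ALL x. 0 <= k x) & integrable lborel k &
 density M (indicator (- N)) = density lborel (%x. ennreal (k x))"

lemma decomp_exists: obtains N k where "decomp N k"
 using lebesgue_decomposition[OF M_fin M_sets] unfolding decomp_def by metis

lemma decomp_integral:
 fixes G :: "'a => 'b::{banach,second_countable_topology}"
 assumes d: "decomp N k" and G: "G : borel_measurable borel" "integrable M G"
 shows "integrable lborel (%x. k x *\<^sub>R G x)"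
 and "(LINT x|M. indicator (- N) x *\<^sub>R G x) = (LBINT x. k x *\<^sub>R G x)"
 and "(LINT x|M. G x) = (LBINT x. k x *\<^sub>R G x) + (LINT x|M. indicator N x *\<^sub>R G x)"
proof -
 have N: "N : sets borel" and k: "k : borel_measurable borel" "!!x. 0 <= k x"
 and dens: "density M (indicator (- N)) = density lborel (%x. ennreal (k x))"
 using d by (auto simp: decomp_def null_sets_def)
 have ind: "density M (indicator (- N)) = density M (%x. ennreal (indicat_real (- N) x))"
 by (simp add: ennreal_indicator)
 have NM: "N : sets M" "- N : sets M" "indicat_real (- N) : borel_measurable M"
 using N borel_comp[OF N] by (auto simp: M_sets intro!: borel_measurable_indicator)
 have iN: "integrable M (%x. indicat_real (- N) x *\<^sub>R G x)" "integrable M (%x. indicat_real N x *\<^sub>R G x)"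
 using G(2) NM by (auto intro!: integrable_mult_indicator)
 have GM: "G : borel_measurable M" using G(1) by (rule borel_measurable_M)
 have "integrable (density M (indicator (- N))) G"
 unfolding ind using iN(1) NM GM by (subst integrable_density) auto
 thus "integrable lborel (%x. k x *\<^sub>R G x)"
 unfolding dens using k G(1) by (subst (asm) integrable_density) auto
 have "(LINT x|M. indicator (- N) x *\<^sub>R G x) = (LINT x|density M (indicator (- N)). G x)"
 unfolding ind using NM GM by (subst integral_density) auto
 also have "... = (LBINT x. k x *\<^sub>R G x)"
 unfolding dens using k G(1) by (subst integral_density) auto
 finally show 1: "(LINT x|M. indicator (- N) x *\<^sub>R G x) = (LBINT x. k x *\<^sub>R G x)" .
 have "(LINT x|M. G x) = (LINT x|M. indicat_real (- N) x *\<^sub>R G x + indicat_real N x *\<^sub>R G x)"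
 by (intro Bochner_Integration.integral_cong) (auto simp: indicator_def)
 also have "... = (LINT x|M. indicator (- N) x *\<^sub>R G x) + (LINT x|M. indicator N x *\<^sub>R G x)"
 using iN by (rule Bochner_Integration.integral_add)
 finally show "(LINT x|M. G x) = (LBINT x. k x *\<^sub>R G x) + (LINT x|M. indicator N x *\<^sub>R G x)" using 1 by simp
qed

lemma decomp_density_integrable:
 assumes "decomp N k" shows "integrable lborel (%x. k x *\<^sub>R s x)"
 using decomp_integral(1)[OF assms s_meas] integrable_scale_s[of "%_. 1" 1] by simp

text \<open>The mollified function has gradient \<open>rho * Dv\<close> away from the boundary of \<open>Om\<close>.\<close>

lemma mollified_deriv:
 assumes d: "decomp N k" and rho: "c1_deriv rho rho'" "!!x. x ~: ball 0 e ==> rho x = 0" and x: "cball x e <= Om"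
 shows "(LBINT y. rho' (x - y) h * v y)
 = h \<bullet> (LBINT y. rho (x - y) *\<^sub>R (k y *\<^sub>R s y)) + (LINT y|M. indicator N y * (rho (x - y) * (h \<bullet> s y)))"
proof -
 have bl: "c1_deriv (%y. x - y) (%_ h. - h)"
 by (auto simp: c1_deriv_def intro!: derivative_eq_intros)
 have c1: "c1_deriv (%y. rho (x - y)) (%y h. rho' (x - y) (- h))" by (rule c1_deriv_compose[OF bl rho(1)])
 have off: "rho (x - y) = 0" if "y ~: cball x e" for y
 using rho(2)[of "x - y"] that by (auto simp: dist_norm norm_minus_commute)
 have t: "test_field Om (%y. rho (x - y) *\<^sub>R h)"
 by (rule test_field_scaleR_const[OF c1 compact_cball x off])
 have "rho' (x - y) (- h) = - rho' (x - y) h" for y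
 using linear_neg[OF c1_deriv_linear[OF rho(1)]] by blast
 hence dv: "divergence (%y. rho (x - y) *\<^sub>R h) y = - rho' (x - y) h" for y
 using divergence_scaleR_const[OF c1] by simp
 have A: "(LBINT y. rho' (x - y) h * v y) = (LINT y|M. (rho (x - y) *\<^sub>R h) \<bullet> s y)"
 using by_parts[OF t] unfolding dv by (simp add: mult.commute)
 obtain B where B: "0 < B" "!!y. norm (rho (x - y)) <= B"
 by (rule bounded_compact_support[OF c1_deriv_continuous[OF c1] compact_cball off]) (assumption, rule that)
 have m: "(%y. rho (x - y)) : borel_measurable borel" by (rule c1_deriv_measurable[OF c1])
 define G where "G y = rho (x - y) *\<^sub>R s y" for y
 have Gm: "G : borel_measurable borel" unfolding G_def using m s_meas by (rule borel_measurable_scaleR)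
 have Gi: "integrable M G" unfolding G_def using integrable_scale_s[OF m, of B] B(2) by simp
 note di = decomp_integral[OF d Gm Gi]
 have Ni: "integrable M (%y. indicat_real N y *\<^sub>R G y)"
 using Gi d by (intro integrable_mult_indicator) (auto simp: M_sets decomp_def null_sets_def)
 have "(LINT y|M. (rho (x - y) *\<^sub>R h) \<bullet> s y) = (LINT y|M. h \<bullet> G y)" by (simp add: G_def)
 also have "... = h \<bullet> (LINT y|M. G y)" by (intro integral_inner_right Gi)
 also have "... = h \<bullet> (LBINT y. k y *\<^sub>R G y) + h \<bullet> (LINT y|M. indicator N y *\<^sub>R G y)"
 by (simp add: di(3) inner_add_right)
 also have "(LBINT y. k y *\<^sub>R G y) = (LBINT y. rho (x - y) *\<^sub>R (k y *\<^sub>R s y))"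
 by (simp add: G_def mult.commute)
 also have "h \<bullet> (LINT y|M. indicator N y *\<^sub>R G y) = (LINT y|M. indicator N y * (rho (x - y) * (h \<bullet> s y)))"
 using Ni by (subst integral_inner_right[symmetric]) (auto simp: G_def mult.assoc)
 finally show ?thesis using A by simp
qed

text \<open>Tonelli moves the mollifier from the measure to \<open>norm (ph x)\<close>. Averages of
  this function near \<open>y\<close> exceed its value at \<open>y\<close> by at most the
  oscillation \<open>om\<close>.\<close>

lemma mollified_singular_part:
 assumes N: "N : sets borel" and ph: "continuous_on UNIV ph" "compact K" "!!x. x ~: K ==> ph x = (0::'a)"
 and rho: "c1_deriv rho rho'" "!!x. 0 <= rho x" "!!x. x ~: ball 0 e ==> rho x = 0" "(LBINT x. rho x) = 1" "integrable lborel rho"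
 and om: "!!x y. dist x y < e ==> norm (ph x - ph y) <= om" "0 <= om"
 shows "integrable lborel (%x. norm (ph x) * (LINT y|M. indicator N y * rho (x - y)))"
 and "(LBINT x. norm (ph x) * (LINT y|M. indicator N y * rho (x - y))) <= (LINT y|M. indicator N y * norm (ph y)) + om * measure M UNIV"
proof -
 interpret P: pair_sigma_finite M "lborel :: 'a measure" ..
 note [measurable_cong] = M_sets
 have [measurable]: "rho : borel_measurable borel" "ph : borel_measurable borel" "N : sets borel"
 using rho(5) borel_measurable_continuous_onI[OF ph(1)] N by auto
 obtain B where B: "0 < B" "!!y. norm (rho y) <= B"
 by (rule bounded_compact_support[OF c1_deriv_continuous[OF rho(1)] compact_cball[of 0 e]]) (use rho(3) in simp, rule that)
 obtain C where C: "0 < C" "!!y. norm (ph y) <= C"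
 by (rule bounded_compact_support[OF ph]) (assumption, rule that)
 define G where "G x = (LINT y|M. indicator N y * rho (x - y))" for x
 have Gi: "integrable M (%y. indicator N y * rho (x - y))" for x
 using B by (intro integrable_bounded_M[of _ B]) (auto simp: indicator_def less_imp_le)
 have G0: "0 <= G x" for x unfolding G_def using rho(2) by (intro integral_nonneg_AE) auto
 have Gnn: "ennreal (G x) = (\<integral>\<^sup>+y. indicator N y * ennreal (rho (x - y)) \<partial>M)" for x
 unfolding G_def using Gi[of x] rho(2)
 by (subst nn_integral_eq_integral[symmetric]) (auto simp: ennreal_mult' ennreal_indicator)
 have Gm[measurable]: "G : borel_measurable borel" unfolding G_def by measurable
 have rho1: "(\<integral>\<^sup>+x. ennreal (rho x) \<partial>lborel) = 1" using nn_integral_eq_integral[OF rho(5)] rho(2,4) by simp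
 have ii: "integrable M (%y. indicator N y * norm (ph y))" "integrable M (%y. indicator N y * (norm (ph y) + om))"
 using C om(2) by (intro integrable_bounded_M[of _ C] integrable_bounded_M[of _ "C + om"]; auto simp: indicator_def less_imp_le)+
 have "(\<integral>\<^sup>+x. ennreal (norm (ph x) * G x) \<partial>lborel)
  = (\<integral>\<^sup>+x. (\<integral>\<^sup>+y. indicator N y * (ennreal (rho (x - y)) * ennreal (norm (ph x))) \<partial>M) \<partial>lborel)"
 proof (rule nn_integral_cong)
 fix x
 have "ennreal (norm (ph x) * G x) = ennreal (norm (ph x)) * (\<integral>\<^sup>+y. indicator N y * ennreal (rho (x - y)) \<partial>M)"
  by (simp add: ennreal_mult' Gnn)
 also have "... = (\<integral>\<^sup>+y. ennreal (norm (ph x)) * (indicator N y * ennreal (rho (x - y))) \<partial>M)"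
  by (rule nn_integral_cmult[symmetric]) measurable
 finally show "ennreal (norm (ph x) * G x) = (\<integral>\<^sup>+y. indicator N y * (ennreal (rho (x - y)) * ennreal (norm (ph x))) \<partial>M)"
  by (simp add: mult.commute mult.left_commute)
 qed
 also have "... = (\<integral>\<^sup>+y. (\<integral>\<^sup>+x. indicator N y * (ennreal (rho (x - y)) * ennreal (norm (ph x))) \<partial>lborel) \<partial>M)"
 by (rule P.Fubini') measurable
 also have "... = (\<integral>\<^sup>+y. indicator N y * (\<integral>\<^sup>+x. ennreal (rho (x - y)) * ennreal (norm (ph x)) \<partial>lborel) \<partial>M)"
 by (simp add: nn_integral_cmult)
 also have "... <= (\<integral>\<^sup>+y. ennreal (indicator N y * (norm (ph y) + om)) \<partial>M)"
 proof (rule nn_integral_mono)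
 fix y
 have "(\<integral>\<^sup>+x. ennreal (rho (x - y)) * ennreal (norm (ph x)) \<partial>lborel) <= (\<integral>\<^sup>+x. ennreal (rho (x - y)) * ennreal (norm (ph y) + om) \<partial>lborel)"
 proof (rule nn_integral_mono)
  fix x
  show "ennreal (rho (x - y)) * ennreal (norm (ph x)) <= ennreal (rho (x - y)) * ennreal (norm (ph y) + om)"
  proof (cases "dist x y < e")
  case True
  hence "norm (ph x) <= norm (ph y) + om"
   using om(1)[OF True] norm_triangle_ineq2[of "ph x" "ph y"] by linarith
  thus ?thesis by (intro mult_left_mono ennreal_leI) auto
  next
  case False
  hence "rho (x - y) = 0" using rho(3)[of "x - y"] by (simp add: dist_norm norm_minus_commute)
  thus ?thesis by simp
  qed
 qed
 also have "... = (\<integral>\<^sup>+x. ennreal (rho (x - y)) \<partial>lborel) * ennreal (norm (ph y) + om)"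
  by (rule nn_integral_multc) measurable
 also have "(\<integral>\<^sup>+x. ennreal (rho (x - y)) \<partial>lborel) = 1"
  using nn_integral_lborel_shift[of "%x. ennreal (rho x)" "- y"] rho1 by simp
 finally show "indicator N y * (\<integral>\<^sup>+x. ennreal (rho (x - y)) * ennreal (norm (ph x)) \<partial>lborel) <= ennreal (indicator N y * (norm (ph y) + om))"
  by (auto simp: indicator_def)
 qed
 also have "... = ennreal (LINT y|M. indicator N y * (norm (ph y) + om))"
 using ii(2) om(2) by (intro nn_integral_eq_integral) auto
 finally have le: "(\<integral>\<^sup>+x. ennreal (norm (ph x) * G x) \<partial>lborel) <= ennreal (LINT y|M. indicator N y * (norm (ph y) + om))" .
 have i: "integrable lborel (%x. norm (ph x) * G x)"
 proof (rule integrableI_bounded)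
 have "(\<integral>\<^sup>+x. ennreal (norm (norm (ph x) * G x)) \<partial>lborel) = (\<integral>\<^sup>+x. ennreal (norm (ph x) * G x) \<partial>lborel)"
  using G0 by (simp add: abs_mult)
 thus "(\<integral>\<^sup>+x. ennreal (norm (norm (ph x) * G x)) \<partial>lborel) < \<infinity>" using le by (auto intro: le_less_trans)
 qed measurable
 thus "integrable lborel (%x. norm (ph x) * (LINT y|M. indicator N y * rho (x - y)))" by (simp add: G_def)
 have "ennreal (LBINT x. norm (ph x) * G x) <= ennreal (LINT y|M. indicator N y * (norm (ph y) + om))"
 using nn_integral_eq_integral[OF i] G0 le by simp
 hence "(LBINT x. norm (ph x) * G x) <= (LINT y|M. indicator N y * (norm (ph y) + om))"
 using om(2) by (subst (asm) ennreal_le_iff) (auto intro!: integral_nonneg_AE)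
 also have "... <= (LINT y|M. indicator N y * norm (ph y) + om)"
 using ii om(2) by (intro integral_mono) (auto simp: indicator_def)
 also have "... = (LINT y|M. indicator N y * norm (ph y)) + om * measure M UNIV"
 using ii by (simp add: space_M)
 finally show "(LBINT x. norm (ph x) * (LINT y|M. indicator N y * rho (x - y))) <= (LINT y|M. indicator N y * norm (ph y)) + om * measure M UNIV"
 by (simp add: G_def)
qed

end

lemma smoothstep_measurable [measurable]: "smoothstep : borel_measurable borel" "smoothstep_deriv : borel_measurable borel"
 by (auto intro!: borel_measurable_continuous_onI continuous_smoothstep continuous_smoothstep_deriv)

lemma smoothstep_deriv_inner_le:
 assumes "norm p <= C"
 shows "\<bar>smoothstep_deriv t * (p \<bullet> z)\<bar> <= 3/2 * C * norm z"
proof -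
 have "\<bar>p \<bullet> z\<bar> <= C * norm z" using Cauchy_Schwarz_ineq2[of p z] mult_right_mono[OF assms norm_ge_zero[of z]] by linarith
 hence "\<bar>smoothstep_deriv t\<bar> * \<bar>p \<bullet> z\<bar> <= 3/2 * (C * norm z)" using smoothstep_deriv_le smoothstep_deriv_nonneg by (intro mult_mono) auto
 thus ?thesis by (simp add: abs_mult)
qed

lemma integrable_smoothstep_deriv_inner:
 fixes w :: "'a::euclidean_space => 'a"
 assumes [measurable]: "u : borel_measurable borel" "ph : borel_measurable borel" and C: "!!x. norm (ph x) <= C" and w: "integrable lborel w"
 shows "integrable lborel (%x. smoothstep_deriv (u x) * (ph x \<bullet> w x))"
proof (rule Bochner_Integration.integrable_bound)
 show "integrable lborel (%x. 3/2 * C * norm (w x))" using w by simp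
 show "AE x in lborel. norm (smoothstep_deriv (u x) * (ph x \<bullet> w x)) <= norm (3/2 * C * norm (w x))"
 unfolding real_norm_def by (intro AE_I2 order_trans[OF smoothstep_deriv_inner_le[OF C] abs_ge_self])
qed (use w in measurable)

lemma integrable_smoothstep_divergence:
 assumes "test_field Om ph"
 shows "integrable lborel (divergence ph)" "u : borel_measurable borel ==> integrable lborel (%x. smoothstep (u x) * divergence ph x)"
proof -
 obtain ph' K where ph: "c1_deriv ph ph'" "compact K" "K <= Om" "!!x. x ~: K ==> ph x = 0" by (rule test_fieldE[OF assms]) (rule that)
 show i: "integrable lborel (divergence ph)"
 by (rule integrable_compact_support[OF continuous_divergence[OF ph(1)] ph(2)
  divergence_zero_off_closed[OF ph(1) compact_imp_closed[OF ph(2)] ph(4)]])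
 show "integrable lborel (%x. smoothstep (u x) * divergence ph x)" if "u : borel_measurable borel"
 by (rule integrable_bounded_times[OF i measurable_compose[OF that smoothstep_measurable(1)], of 1]) (simp add: smoothstep_nonneg smoothstep_le_1)
qed

context bv_rep
begin

text \<open>Mollify \<open>v\<close>, integrate by parts and pass to the limit. The singular part of \<open>Dv\<close> only enters
 through the Lipschitz constant of the smooth step.\<close>

lemma chain_rule_bound:
 assumes d: "decomp N k" and t: "test_field Om ph"
 shows "- (LBINT x. smoothstep (v x) * divergence ph x)
 <= (LBINT x. smoothstep_deriv (v x) * (ph x \<bullet> (k x *\<^sub>R s x))) + 3/2 * (LINT x|M. indicator N x * norm (ph x))"
proof -
 obtain ph' K where ph: "c1_deriv ph ph'" "compact K" "K <= Om" "!!x. x ~: K ==> ph x = 0"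
 by (rule test_fieldE[OF t]) (rule that)
 obtain rho :: "nat => 'a => real" and rho' where mol: "mollifiers rho rho'" by (rule mollifiers_exist)
 have rho: "c1_deriv (rho j) (rho' j)" "!!x. 0 <= rho j x" "!!x. x ~: ball 0 (1 / real (Suc j)) ==> rho j x = 0"
  "(LBINT x. rho j x) = 1" "integrable lborel (rho j)" for j
 using mol by (auto simp: mollifiers_def)
 define w where "w x = k x *\<^sub>R s x" for x
 have w: "integrable lborel w" unfolding w_def by (rule decomp_density_integrable[OF d])
 have Nb: "N : sets borel" using d by (auto simp: decomp_def null_sets_def)
 have [measurable]: "v : borel_measurable borel" "w : borel_measurable borel" using v_int w by auto
 define V where "V j x = (LBINT y. rho j (x - y) * v y)" for j x
 define V' where "V' j x h = (LBINT y. rho' j (x - y) h * v y)" for j x h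
 define W where "W j x = (LBINT y. rho j (x - y) *\<^sub>R w y)" for j x
 have Vc1: "c1_deriv (V j) (V' j)" for j
 unfolding V_def[abs_def] V'_def[abs_def]
 by (rule convolution_c1_deriv[OF rho(1) compact_cball mollifiers_compact_support[OF mol] v_int])
 have Vm[measurable]: "V j : borel_measurable borel" for j
 by (rule c1_deriv_measurable[OF Vc1])
 have VL: "integrable lborel (%x. V j x - v x)" "(%j. LBINT x. \<bar>V j x - v x\<bar>) \<longlonglongrightarrow> 0" for j
 using mollifiers_L1[OF mol v_int] by (simp_all add: V_def)
 have WL: "integrable lborel (%x. W j x - w x)" "(%j. LBINT x. norm (W j x - w x)) \<longlonglongrightarrow> 0" for j
 using mollifiers_L1[OF mol w] by (simp_all add: W_def)
 have Wi: "integrable lborel (W j)" for j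
 using Bochner_Integration.integrable_add[OF WL(1) w, of j] by simp
 have Wm[measurable]: "W j : borel_measurable borel" for j using Wi[of j] by auto
 have phm[measurable]: "ph : borel_measurable borel" "divergence ph : borel_measurable borel"
 using c1_deriv_continuous[OF ph(1)] continuous_divergence[OF ph(1)] by (auto intro!: borel_measurable_continuous_onI)
 obtain C where C: "0 < C" "!!x. norm (ph x) <= C"
 by (rule bounded_compact_support[OF c1_deriv_continuous[OF ph(1)] ph(2,4)]) (assumption, rule that)
 note Sd = integrable_smoothstep_divergence[OF t]
 note Sw = integrable_smoothstep_deriv_inner[OF _ phm(1) C(2)]
 let ?L = "- (LBINT x. smoothstep (v x) * divergence ph x)" and ?R = "LBINT x. smoothstep_deriv (v x) * (ph x \<bullet> w x)"
 define A where "A j = - (LBINT x. smoothstep (V j x) * divergence ph x)" for j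
 define B where "B j = (LBINT x. smoothstep_deriv (V j x) * (ph x \<bullet> W j x))" for j
 define I where "I = (LINT x|M. indicator N x * norm (ph x))"
 have VL0: "(%j. LBINT x. norm (V j x - v x)) \<longlonglongrightarrow> 0" using VL(2) by simp
 \<comment> \<open>The mollified function enters nonlinearly. Convergence in L1 yields convergence
   almost everywhere along a subsequence, to which dominated convergence applies.\<close>
 obtain r where r: "strict_mono r" "AE x in lborel. (%n. V (r n) x - v x) \<longlonglongrightarrow> 0"
 using tendsto_L1_AE_subseq[OF VL(1) VL0] by blast
 have Vlim: "AE x in lborel. (%n. V (r n) x) \<longlonglongrightarrow> v x" using r(2) by (simp only: LIM_zero_iff)
 have Alim: "(%n. A (r n)) \<longlonglongrightarrow> ?L"
 unfolding A_def
 proof (intro tendsto_minus integral_dominated_convergence)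
 show "integrable lborel (%x. \<bar>divergence ph x\<bar>)" using Sd(1) by simp
 show "AE x in lborel. (%n. smoothstep (V (r n) x) * divergence ph x) \<longlonglongrightarrow> smoothstep (v x) * divergence ph x"
  using Vlim by eventually_elim (auto intro!: tendsto_mult_right continuous_on_tendsto_compose[OF continuous_smoothstep[of UNIV]])
 show "AE x in lborel. norm (smoothstep (V (r n) x) * divergence ph x) <= \<bar>divergence ph x\<bar>" for n
  by (intro AE_I2) (simp add: abs_mult smoothstep_nonneg smoothstep_le_1 mult_left_le_one_le)
 qed measurable
 have Blim: "(%n. B (r n)) \<longlonglongrightarrow> ?R"
 proof -
 \<comment> \<open>Intermediate integral with the mollified argument in the step but the limit
   density \<open>w\<close>. The passage from \<open>B\<close> to \<open>B2\<close> uses L1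
   convergence of \<open>W\<close>, the passage from \<open>B2\<close> to the limit uses dominated
   convergence.\<close>
 define B2 where "B2 n = (LBINT x. smoothstep_deriv (V (r n) x) * (ph x \<bullet> w x))" for n
 have "B2 \<longlonglongrightarrow> ?R"
  unfolding B2_def
 proof (rule integral_dominated_convergence)
  show "integrable lborel (%x. 3/2 * C * norm (w x))" using w by simp
  show "AE x in lborel. (%n. smoothstep_deriv (V (r n) x) * (ph x \<bullet> w x)) \<longlonglongrightarrow> smoothstep_deriv (v x) * (ph x \<bullet> w x)"
  using Vlim by eventually_elim (auto intro!: tendsto_mult_right continuous_on_tendsto_compose[OF continuous_smoothstep_deriv[of UNIV]])
  show "AE x in lborel. norm (smoothstep_deriv (V (r n) x) * (ph x \<bullet> w x)) <= 3/2 * C * norm (w x)" for n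
  unfolding real_norm_def by (intro AE_I2 smoothstep_deriv_inner_le C(2))
 qed measurable
 moreover have "(%n. B (r n) - B2 n) \<longlonglongrightarrow> 0"
 proof (rule Lim_null_comparison)
  have "norm (B (r n) - B2 n) <= 3/2 * C * (LBINT x. norm (W (r n) x - w x))" for n
  proof -
  have eq: "B (r n) - B2 n = (LBINT x. smoothstep_deriv (V (r n) x) * (ph x \<bullet> (W (r n) x - w x)))"
   unfolding B_def B2_def using Sw[OF Vm Wi, of "r n" "r n"] Sw[OF Vm w, of "r n"]
   by (simp add: inner_diff_right right_diff_distrib)
  have "norm (B (r n) - B2 n) <= (LBINT x. norm (smoothstep_deriv (V (r n) x) * (ph x \<bullet> (W (r n) x - w x))))"
   unfolding eq by (rule integral_norm_bound)
  also have "... <= (LBINT x. 3/2 * C * norm (W (r n) x - w x))"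
  proof (rule integral_mono)
   show "integrable lborel (%x. norm (smoothstep_deriv (V (r n) x) * (ph x \<bullet> (W (r n) x - w x))))"
   using Sw[OF Vm WL(1)] by (rule integrable_norm)
   show "integrable lborel (%x. 3/2 * C * norm (W (r n) x - w x))"
   using WL(1) by (intro integrable_mult_right integrable_norm)
   show "norm (smoothstep_deriv (V (r n) x) * (ph x \<bullet> (W (r n) x - w x))) <= 3/2 * C * norm (W (r n) x - w x)" for x
   unfolding real_norm_def by (intro smoothstep_deriv_inner_le C(2))
  qed
  finally show ?thesis by simp
  qed
  thus "\<forall>\<^sub>F n in sequentially. norm (B (r n) - B2 n) <= 3/2 * C * (LBINT x. norm (W (r n) x - w x))" by simp
  show "(%n. 3/2 * C * (LBINT x. norm (W (r n) x - w x))) \<longlonglongrightarrow> 0"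
  using tendsto_mult_left[OF LIMSEQ_subseq_LIMSEQ[OF WL(2) r(1)], of "3/2 * C"] by (simp add: comp_def)
 qed
 ultimately show ?thesis using tendsto_add[of "%n. B (r n) - B2 n" 0 sequentially B2] by simp
 qed
 \<comment> \<open>\<open>mollified_deriv\<close> holds at points whose mollification ball lies in
   \<open>Om\<close>; on the compact support of \<open>ph\<close> this is true for all small
   radii.\<close>
 obtain ep0 where ep0: "0 < ep0" "(\<Union>x\<in>K. ball x ep0) <= Om"
 using compact_subset_open_imp_ball_epsilon_subset[OF ph(2) open_dom ph(3)] by blast
 define m where "m = measure M UNIV"
 have m0: "0 <= m" by (simp add: m_def)
 have key: "?L <= ?R + 3/2 * (I + om * m)" if om: "0 < om" for om
 proof -
 obtain d where dd: "0 < d" "!!x y. dist x y < d ==> norm (ph x - ph y) < om"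
  by (rule uniform_compact_support[OF c1_deriv_continuous[OF ph(1)] ph(2,4) om]) (assumption, rule that)
 obtain J where J: "1 / real (Suc J) < min d ep0" using nat_approx_posE[of "min d ep0"] dd(1) ep0(1) by auto
 have "A j <= B j + 3/2 * (I + om * m)" if j: "J <= j" for j
 proof -
  have jJ: "1 / real (Suc j) <= 1 / real (Suc J)" using j by (intro divide_left_mono) auto
  have omj: "norm (ph x - ph y) <= om" if "dist x y < 1 / real (Suc j)" for x y
  using dd(2)[of x y] that jJ J by (simp add: less_imp_le)
  define G where "G x = (LINT y|M. indicator N y * rho j (x - y))" for x
  have sing: "integrable lborel (%x. norm (ph x) * G x)" "(LBINT x. norm (ph x) * G x) <= I + om * m"
  unfolding G_def I_def m_def
  by (rule mollified_singular_part[where e = "1 / real (Suc j)" and K = K and om = om];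
   (rule Nb c1_deriv_continuous[OF ph(1)] ph(2) rho(1) rho(2) rho(4) rho(5) less_imp_le[OF om] | erule ph(4) rho(3) omj))+
  have pt: "smoothstep_deriv (V j x) * V' j x (ph x) <= smoothstep_deriv (V j x) * (ph x \<bullet> W j x) + 3/2 * (norm (ph x) * G x)" for x
  proof (cases "x : K")
  case False
  thus ?thesis using ph(4) linear_0[OF c1_deriv_linear[OF Vc1]] by simp
  next
  case True
  have "cball x (1 / real (Suc j)) <= ball x ep0" using jJ J by auto
  hence cb: "cball x (1 / real (Suc j)) <= Om" using ep0(2) True by blast
  have eq: "V' j x (ph x) = ph x \<bullet> W j x + (LINT y|M. indicator N y * (rho j (x - y) * (ph x \<bullet> s y)))"
   unfolding V'_def W_def w_def by (rule mollified_deriv[OF d rho(1) rho(3) cb])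
  have bm: "(%y. indicator N y * rho j (x - y)) : borel_measurable borel"
   using Nb rho(5)[of j] by measurable
  obtain R where R: "0 < R" "!!y. norm (rho j y) <= R"
   by (rule bounded_compact_support[OF c1_deriv_continuous[OF rho(1)] compact_cball mollifiers_compact_support[OF mol]])
   (assumption, rule that)
  have Gi: "integrable M (%y. indicator N y * rho j (x - y))"
   using bm R by (intro integrable_bounded_M[of _ R]) (auto simp: indicator_def less_imp_le)
  have "\<bar>LINT y|M. indicator N y * (rho j (x - y) * (ph x \<bullet> s y))\<bar> <= (LINT y|M. norm (indicator N y * (rho j (x - y) * (ph x \<bullet> s y))))"
   using integral_norm_bound[of M "%y. indicator N y * (rho j (x - y) * (ph x \<bullet> s y))"] by simp
  also have "... <= (LINT y|M. norm (ph x) * (indicator N y * rho j (x - y)))"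
  proof (rule integral_mono_AE')
   show "integrable M (%y. norm (ph x) * (indicator N y * rho j (x - y)))" using Gi by (rule integrable_mult_right)
   show "AE y in M. norm (indicator N y * (rho j (x - y) * (ph x \<bullet> s y))) <= norm (ph x) * (indicator N y * rho j (x - y))"
   using s_unit
   proof eventually_elim
   case (elim y)
   have "\<bar>ph x \<bullet> s y\<bar> <= norm (ph x)" using Cauchy_Schwarz_ineq2[of "ph x" "s y"] elim by simp
   hence "indicator N y * rho j (x - y) * \<bar>ph x \<bullet> s y\<bar> <= indicator N y * rho j (x - y) * norm (ph x)"
    using rho(2) by (intro mult_left_mono) auto
   thus ?case using rho(2)[of j "x - y"] by (simp add: abs_mult mult.commute mult.left_commute)
   qed
   show "AE y in M. 0 <= norm (ph x) * (indicator N y * rho j (x - y))" using rho(2)[of j] by simp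
  qed
  also have "... = norm (ph x) * G x" by (simp add: G_def)
  finally have le: "\<bar>LINT y|M. indicator N y * (rho j (x - y) * (ph x \<bullet> s y))\<bar> <= norm (ph x) * G x" .
  have "smoothstep_deriv (V j x) * (LINT y|M. indicator N y * (rho j (x - y) * (ph x \<bullet> s y)))
   <= smoothstep_deriv (V j x) * (norm (ph x) * G x)"
   using le smoothstep_deriv_nonneg by (intro mult_left_mono) auto
  also have "... <= 3/2 * (norm (ph x) * G x)"
   using le smoothstep_deriv_le by (intro mult_right_mono) auto
  finally show ?thesis unfolding eq by (simp add: distrib_left)
  qed
  note S1 = c1_deriv_compose_real[OF Vc1[of j] smoothstep_has_deriv continuous_smoothstep_deriv]
  have "A j = (LBINT x. smoothstep_deriv (V j x) * V' j x (ph x))"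
  unfolding A_def using integral_by_parts_c1(1)[OF S1 ph(1,2,4)] by simp
  also have "... <= (LBINT x. smoothstep_deriv (V j x) * (ph x \<bullet> W j x) + 3/2 * (norm (ph x) * G x))"
  proof (rule integral_mono)
  show "integrable lborel (%x. smoothstep_deriv (V j x) * V' j x (ph x))"
   using integral_by_parts_c1(2)[OF S1 ph(1,2,4)] by simp
  show "integrable lborel (%x. smoothstep_deriv (V j x) * (ph x \<bullet> W j x) + 3/2 * (norm (ph x) * G x))"
   using Sw[OF Vm Wi] sing(1) by (intro Bochner_Integration.integrable_add integrable_mult_right) auto
  qed (rule pt)
  also have "... = B j + 3/2 * (LBINT x. norm (ph x) * G x)"
  unfolding B_def using Sw[OF Vm Wi] sing(1) by simp
  also have "... <= B j + 3/2 * (I + om * m)" using sing(2) by simp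
  finally show ?thesis .
 qed
 hence ev: "\<forall>\<^sub>F n in sequentially. A (r n) <= B (r n) + 3/2 * (I + om * m)"
  using seq_suble[OF r(1)] by (auto simp: eventually_sequentially intro!: exI[of _ J] intro: order_trans)
 show ?thesis
 proof (rule tendsto_le[OF sequentially_bot _ _ ev])
  show "(%n. B (r n) + 3/2 * (I + om * m)) \<longlonglongrightarrow> ?R + 3/2 * (I + om * m)" by (intro tendsto_add Blim tendsto_const)
 qed (rule Alim)
 qed
 have "?L <= (?R + 3/2 * I) + e" if e: "0 < e" for e
 proof -
 define om where "om = e / (3/2 * (m + 1))"
 have "0 < om" using e m0 by (simp add: om_def)
 moreover have "3/2 * (om * m) <= e"
 proof -
  have "om * m <= om * (m + 1)" using \<open>0 < om\<close> by simp
  moreover have "3/2 * (om * (m + 1)) = e" using m0 by (simp add: om_def field_simps)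
  ultimately show ?thesis by linarith
 qed
 ultimately show ?thesis using key[of om] by (simp add: distrib_left)
 qed
 thus ?thesis unfolding w_def[symmetric] I_def[symmetric] by (rule field_le_epsilon)
qed

end

section \<open>The calibration inequality\<close>

lemma nbhd_mono: "A <= B ==> r <= r' ==> (\<Union>k\<in>A. ball k r) <= (\<Union>k\<in>B. ball k r')"
 by (intro UN_mono subset_ball)

text \<open>The neighbourhoods shrink to \<open>K\<close>, a null set. This will make the absolutely
  continuous part negligible on the supports of the cut-offs around the jump set.\<close>

lemma nbhd_small_integral:
 fixes w :: "'a::euclidean_space => 'b::{banach,second_countable_topology}"
 assumes K: "compact K" "K : null_sets lborel" and w: "integrable lborel w" and e: "0 < e"
 obtains r where "0 < r" "(LBINT x. indicator (\<Union>k\<in>K. ball k r) x * norm (w x)) < e"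
proof -
 define U where "U n = (\<Union>k\<in>K. ball k (1 / real (Suc n)))" for n
 have oU: "open (U n)" for n by (auto simp: U_def)
 have "(%n. LBINT x. indicator (U n) x * norm (w x)) \<longlonglongrightarrow> (LBINT x. indicator K x * norm (w x))"
 proof (rule integral_dominated_convergence[where w = "%x. norm (w x)"])
 show "AE x in lborel. (%n. indicator (U n) x * norm (w x)) \<longlonglongrightarrow> indicator K x * norm (w x)"
 proof (rule AE_I2)
  fix x
  show "(%n. indicator (U n) x * norm (w x)) \<longlonglongrightarrow> indicator K x * norm (w x)"
  proof (cases "x : K")
  case True
  hence "x : U n" for n by (auto simp: U_def intro!: bexI[of _ x])
  thus ?thesis using True by simp
  next
  case False
  obtain e where e: "0 < e" "!!y. y : K ==> e <= dist x y"
   using separate_point_closed[OF compact_imp_closed[OF K(1)] False] by blast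
  obtain J where J: "1 / real (Suc J) < e" using nat_approx_posE[OF e(1)] by blast
  have "x ~: U n" if "J <= n" for n
  proof -
   have "1 / real (Suc n) <= 1 / real (Suc J)" using that by (intro divide_left_mono) auto
   thus ?thesis using e(2) J by (force simp: U_def dist_commute)
  qed
  hence "eventually (%n. indicator (U n) x * norm (w x) = 0) sequentially"
   by (auto simp: eventually_sequentially intro!: exI[of _ J])
  thus ?thesis using False by (simp add: tendsto_eventually)
  qed
 qed
 show "AE x in lborel. norm (indicator (U n) x * norm (w x)) <= norm (w x)" for n
  by (rule AE_I2) (simp add: indicator_def)
 show "(%x. indicator K x * norm (w x)) : borel_measurable lborel"
  using w K by (intro borel_measurable_times borel_measurable_indicator) (auto simp: borel_compact)
 show "(%x. indicator (U n) x * norm (w x)) : borel_measurable lborel" for n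
  using w oU by (intro borel_measurable_times borel_measurable_indicator) auto
 qed (use w in auto)
 moreover have "(LBINT x. indicator K x * norm (w x)) = 0"
 proof (rule integral_eq_zero_AE)
 have "AE x in lborel. x ~: K" using K(2) by (rule AE_not_in)
 thus "AE x in lborel. indicator K x * norm (w x) = 0" by eventually_elim simp
 qed
 ultimately have "(%n. LBINT x. indicator (U n) x * norm (w x)) \<longlonglongrightarrow> 0" by simp
 from order_tendstoD(2)[OF this e] obtain n where "(LBINT x. indicator (U n) x * norm (w x)) < e"
 unfolding eventually_sequentially by blast
 thus thesis using that[of "1 / real (Suc n)"] by (simp add: U_def)
qed

lemma separate_finite_compacts:
 fixes K :: "nat => 'a::euclidean_space set"
 assumes K: "!!i. i < m ==> compact (K i)" and disj: "!!i j. i < m ==> j < m ==> i ~= j ==> K i Int K j = {}"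
 obtains r where "0 < r" "!!i j x. i < m ==> j < m ==> i ~= j ==> x : (\<Union>k\<in>K i. ball k r) ==> x ~: (\<Union>k\<in>K j. ball k r)"
proof -
 have "EX d>0. i < m --> j < m --> i ~= j --> (ALL x:K i. ALL y:K j. d <= dist x y)" for i j
 proof (cases "i < m & j < m & i ~= j")
 case True
 thus ?thesis
  using separate_compact_closed[OF K compact_imp_closed[OF K] disj, of i j] by blast
 qed (auto intro: exI[of _ 1])
 then obtain d where d: "!!i j. 0 < d i j" "!!i j x y. i < m ==> j < m ==> i ~= j ==> x : K i ==> y : K j ==> d i j <= (dist x y :: real)"
 by metis
 define D where "D = Min (insert 1 ((%(i, j). d i j) ` ({..<m} \<times> {..<m})))"
 have D: "0 < D" unfolding D_def using d(1) by (subst Min_gr_iff) auto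
 have Dd: "D <= d i j" if "i < m" "j < m" for i j
 unfolding D_def using that by (intro Min_le) auto
 show thesis
 proof (rule that[of "D/2"])
 fix i j x assume ij: "i < m" "j < m" "i ~= j" and x: "x : (\<Union>k\<in>K i. ball k (D/2))"
 show "x ~: (\<Union>k\<in>K j. ball k (D/2))"
 proof
  assume "x : (\<Union>k\<in>K j. ball k (D/2))"
  then obtain a b where ab: "a : K i" "dist a x < D/2" "b : K j" "dist b x < D/2" using x by auto
  have "dist a b < D" using ab(2,4) dist_triangle2[of a b x] by linarith
  thus False using d(2)[OF ij ab(1,3)] Dd[OF ij(1,2)] by linarith
 qed
 qed (use D in simp)
qed

lemma sum_hausdorff_outer_disjoint_le:
 fixes K :: "nat => 'a::euclidean_space set"
 assumes K: "!!i. i < m ==> K i : sets borel" and disj: "!!i j. i < m ==> j < m ==> i ~= j ==> K i Int K j = {}"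
 and S: "S : sets borel" "!!i. i < m ==> K i <= S"
 shows "(\<Sum>i<m. hausdorff_outer k (K i)) <= hausdorff_outer k S"
proof -
 have "(\<Sum>i<m. hausdorff_outer k (K i)) = (\<Sum>i<m. emeasure (hausdorff_measure k) (K i))"
 using K by (intro sum.cong) (auto simp: emeasure_hausdorff_measure)
 also have "... = emeasure (hausdorff_measure k) (\<Union>i<m. K i)"
 using K disj by (intro sum_emeasure) (auto simp: disjoint_family_on_def)
 also have "... <= emeasure (hausdorff_measure k) S"
 using S by (intro emeasure_mono) auto
 also have "... = hausdorff_outer k S" using S(1) by (rule emeasure_hausdorff_measure)
 finally show ?thesis .
qed

text \<open>The unit ball is covered by finitely many balls of radius \<open>e\<close>, made
  disjoint; their preimages partition \<open>A\<close>. Inner regularity replaces each of the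
  \<open>m\<close> parts by a compact subset, losing at most \<open>e / m\<close>.\<close>

lemma approx_by_constant_pieces:
 fixes M :: "'a::euclidean_space measure" and ph :: "'a => 'a"
 assumes M: "finite_measure M" "sets M = sets borel" and A: "A : sets borel" and ph: "ph : borel_measurable borel" "!!x. norm (ph x) <= 1" and e: "0 < e"
 obtains m :: nat and c K where "0 < m" "!!i. i < m ==> norm (c i) <= 1" "!!i. i < m ==> compact (K i)" "!!i. i < m ==> K i <= A"
 "!!i j. i < m ==> j < m ==> i ~= j ==> K i Int K j = {}" "!!i x. i < m ==> x : K i ==> norm (ph x - c i) <= e"
 "measure M (A - (\<Union>i<m. K i)) <= e"
proof -
 interpret finite_measure M by fact
 obtain D where D: "D <= cball (0::'a) 1" "finite D" "cball 0 1 <= (\<Union>c\<in>D. ball c e)"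
 by (rule compactE_image[OF compact_cball[of "0::'a" 1], of "cball 0 1" "%c. ball c e"]) (use e in \<open>auto intro: that\<close>)
 have "D ~= {}" using D(3) by auto
 define m where "m = card D"
 have m: "0 < m" using D(2) \<open>D ~= {}\<close> by (simp add: m_def card_gt_0_iff)
 obtain c where c: "bij_betw c {..<m} D" unfolding m_def
 using ex_bij_betw_nat_finite[OF D(2)] by (auto simp: atLeast0LessThan)
 have cD: "c i : D" if "i < m" for i using c that by (auto simp: bij_betw_def)
 define B where "B = (%i::nat. ball (c i) e)"
 define P where "P i = A Int {x. ph x : disjointed B i}" for i
 have "range B <= sets borel" by (auto simp: B_def)
 hence "range (disjointed B) <= sets borel" by (rule sets.range_disjointed_sets)
 hence Bm: "disjointed B i : sets borel" for i by auto
 have Pm: "P i : sets borel" for i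
 unfolding P_def using A ph(1) Bm[of i] by (intro sets.Int) (auto intro: measurable_sets_borel[of ph borel, unfolded vimage_def])
 have "EX K. compact K & K <= P i & measure M (P i - K) < e / real m" for i
 by (rule inner_regular_finite[OF M Pm[of i], of "e / real m"]) (use e m in auto)
 then obtain K where K: "!!i. compact (K i)" "!!i. K i <= P i" "!!i. measure M (P i - K i) < e / real m" by metis
 have Ks: "K i : sets borel" for i using K(1) by (simp add: borel_compact)
 have cover: "A = (\<Union>i<m. P i)"
 proof
 show "(\<Union>i<m. P i) <= A" by (auto simp: P_def)
 show "A <= (\<Union>i<m. P i)"
 proof
  fix x assume x: "x : A"
  have "ph x : cball 0 1" using ph(2)[of x] by simp
  then obtain b where "b : D" "ph x : ball b e" using D(3) by blast
  then obtain i where i: "i < m" "ph x : B i" using c by (auto simp: bij_betw_def B_def)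
  hence "ph x : (\<Union>i\<in>{0..<m}. B i)" by auto
  hence "ph x : (\<Union>i\<in>{0..<m}. disjointed B i)" unfolding finite_UN_disjointed_eq .
  thus "x : (\<Union>i<m. P i)" using x by (auto simp: P_def)
 qed
 qed
 have "measure M (A - (\<Union>i<m. K i)) <= measure M (\<Union>i<m. P i - K i)"
 using Pm Ks by (intro finite_measure_mono) (auto simp: cover M(2))
 also have "... <= (\<Sum>i<m. measure M (P i - K i))"
 using Pm Ks by (intro finite_measure_subadditive_finite) (auto simp: M(2))
 also have "... <= (\<Sum>i<m. e / real m)" using K(3) by (intro sum_mono) (auto intro: less_imp_le)
 also have "... = e" using m by simp
 finally have me: "measure M (A - (\<Union>i<m. K i)) <= e" .
 show thesis
 proof (rule that[OF m _ K(1)])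
 show "norm (c i) <= 1" if "i < m" for i using cD[OF that] D(1) by auto
 show "K i <= A" if "i < m" for i using K(2)[of i] by (auto simp: P_def)
 show "K i Int K j = {}" if "i < m" "j < m" "i ~= j" for i j
 proof -
  have "disjointed B i Int disjointed B j = {}"
  using disjoint_family_disjointed[of B] that(3) by (auto simp: disjoint_family_on_def)
  thus ?thesis using K(2)[of i] K(2)[of j] by (auto simp: P_def)
 qed
 show "norm (ph x - c i) <= e" if "i < m" "x : K i" for i x
 proof -
  have "ph x : disjointed B i" using K(2)[of i] that(2) by (auto simp: P_def)
  hence "ph x : B i" using disjointed_subset[of B i] by blast
  thus ?thesis by (simp add: B_def dist_norm norm_minus_commute)
 qed
 show "measure M (A - (\<Union>i<m. K i)) <= e" by (rule me)
 qed
qed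

text \<open>Both the step and \<open>t\<close> lie between 0 and 1, so the integrand is at most the
  negative part of the derivative of the cut-off. This is where a jump of the composed function by
  at most 1 enters, and it requires no differentiability of \<open>v\<close>.\<close>

lemma integral_smoothstep_cutoff_le:
 fixes v :: "'a::euclidean_space => real" and eta :: "'a => real"
 assumes v: "v : borel_measurable borel" and eta: "c1_deriv eta eta'" and le: "(\<integral>\<^sup>+x. ennreal (- eta' x e) \<partial>lborel) <= ennreal h"
 and h: "0 <= h" and t: "0 <= t" "t <= 1"
 shows "- (LBINT x. smoothstep (v x) * eta' x (t *\<^sub>R e)) <= h"
proof (cases "integrable lborel (%x. - (smoothstep (v x) * eta' x (t *\<^sub>R e)))")
 case True
 have "ennreal (- (LBINT x. smoothstep (v x) * eta' x (t *\<^sub>R e))) = ennreal (LBINT x. - (smoothstep (v x) * eta' x (t *\<^sub>R e)))"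
 by simp
 also have "... <= (\<integral>\<^sup>+x. ennreal (- (smoothstep (v x) * eta' x (t *\<^sub>R e))) \<partial>lborel)"
 proof -
 define f where "f x = - (smoothstep (v x) * eta' x (t *\<^sub>R e))" for x
 have fi: "integrable lborel f" using True by (simp add: f_def[abs_def])
 have "(LBINT x. f x) <= (LBINT x. max 0 (f x))" using fi by (intro integral_mono) auto
 also have "ennreal ... = (\<integral>\<^sup>+x. ennreal (max 0 (f x)) \<partial>lborel)"
  using fi by (intro nn_integral_eq_integral[symmetric]) auto
 finally show ?thesis by (simp add: f_def ennreal_leI)
 qed
 also have "... <= (\<integral>\<^sup>+x. ennreal (- eta' x e) \<partial>lborel)"
 proof (rule nn_integral_mono)
 fix x
 define a where "a = smoothstep (v x) * t"
 have a: "0 <= a" "a <= 1" unfolding a_def using smoothstep_nonneg smoothstep_le_1 t by (auto intro: mult_le_one)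
 have "- (smoothstep (v x) * eta' x (t *\<^sub>R e)) = a * (- eta' x e)"
  by (simp add: a_def linear_scale[OF c1_deriv_linear[OF eta]])
 also have "ennreal ... <= ennreal (- eta' x e)"
 proof (cases "0 <= - eta' x e")
  case True
  hence "a * (- eta' x e) <= 1 * (- eta' x e)" using a by (intro mult_right_mono) auto
  thus ?thesis by (intro ennreal_leI) simp
 next
  case False
  hence "a * (- eta' x e) <= 0" using a(1) by (intro mult_nonneg_nonpos) auto
  thus ?thesis by (simp add: ennreal_neg)
 qed
 finally show "ennreal (- (smoothstep (v x) * eta' x (t *\<^sub>R e))) <= ennreal (- eta' x e)" .
 qed
 also note le
 finally show ?thesis using h ennreal_le_iff by blast
next
 \<comment> \<open>By convention the integral is then 0.\<close>
 case False
 hence "(LBINT x. smoothstep (v x) * eta' x (t *\<^sub>R e)) = 0"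
 by (intro not_integrable_integral_eq) (metis integrable_minus)
 thus ?thesis using h by simp
qed

lemma divergence_add_sum:
 fixes ph :: "'a::euclidean_space => 'a" and eta :: "nat => 'a => real"
 assumes ph: "c1_deriv ph ph'" and eta: "!!i. i < m ==> c1_deriv (eta i) (eta' i)"
 shows "c1_deriv (%x. ph x - (\<Sum>i<m. eta i x *\<^sub>R c i)) (%x h. ph' x h - (\<Sum>i<m. eta' i x h *\<^sub>R c i))"
 and "divergence (%x. ph x - (\<Sum>i<m. eta i x *\<^sub>R c i)) x = divergence ph x - (\<Sum>i<m. eta' i x (c i))"
proof -
 have c: "c1_deriv (%x. eta i x *\<^sub>R c i) (%x h. eta' i x h *\<^sub>R c i)" if "i < m" for i
 using c1_deriv_scaleR[OF eta[OF that] c1_deriv_const[of "c i"]] by simp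
 show 1: "c1_deriv (%x. ph x - (\<Sum>i<m. eta i x *\<^sub>R c i)) (%x h. ph' x h - (\<Sum>i<m. eta' i x h *\<^sub>R c i))"
 by (intro c1_deriv_diff[OF ph] c1_deriv_sum) (auto intro: c)
 have e: "eta' i x (c i) = (\<Sum>b\<in>Basis. eta' i x b * (c i \<bullet> b))" if "i < m" for i
 by (rule linear_eq_sum_Basis[OF c1_deriv_linear[OF eta[OF that]]])
 have "(\<Sum>i<m. eta' i x (c i)) = (\<Sum>b\<in>Basis. \<Sum>i<m. eta' i x b * (c i \<bullet> b))"
 using e by (subst sum.swap) (auto intro: sum.cong)
 thus "divergence (%x. ph x - (\<Sum>i<m. eta i x *\<^sub>R c i)) x = divergence ph x - (\<Sum>i<m. eta' i x (c i))"
 by (simp add: divergence_c1_deriv[OF 1] divergence_c1_deriv[OF ph] inner_diff_left inner_sum_left sum_subtractf)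
qed

context bv_rep
begin

text \<open>On the compact pieces \<open>K i\<close>, which carry almost all of the singular part, \<open>ph\<close> is nearly the
 constant \<open>c i\<close>. The constants are split off with the cut-offs of the covering argument and are paid for
 by Hausdorff measure; on the remaining field the singular part is small.\<close>

lemma calibration_inequality:
 assumes d: "decomp N k" and S0: "S0 : sets borel" "S0 <= Om" "emeasure M (N - S0) = 0"
  "hausdorff_outer (DIM('a) - 1) S0 < \<infinity>"
 and t: "test_field Om ph" and ph1: "!!x. norm (ph x) <= 1"
 shows "- (LBINT x. smoothstep (v x) * divergence ph x)
 <= (LBINT x. smoothstep_deriv (v x) * (ph x \<bullet> (k x *\<^sub>R s x))) + enn2real (hausdorff_outer (DIM('a) - 1) S0)"
proof -
 define n1 where "n1 = DIM('a) - 1"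
 define h0 where "h0 = enn2real (hausdorff_outer n1 S0)"
 define w where "w x = k x *\<^sub>R s x" for x
 have w: "integrable lborel w" unfolding w_def by (rule decomp_density_integrable[OF d])
 define mm where "mm = measure M UNIV"
 obtain ph' Kp where ph: "c1_deriv ph ph'" "compact Kp" "Kp <= Om" "!!x. x ~: Kp ==> ph x = 0"
 by (rule test_fieldE[OF t]) (rule that)
 have Nn: "N : null_sets lborel" and Nb: "N : sets borel" using d by (auto simp: decomp_def null_sets_def)
 have phm[measurable]: "ph : borel_measurable borel"
 by (rule c1_deriv_measurable[OF ph(1)])
 have vm: "v : borel_measurable borel" using v_int by simp
 note bd = integrable_smoothstep_deriv_inner[OF vm _ _ w]
 let ?L = "- (LBINT x. smoothstep (v x) * divergence ph x)" and ?R = "LBINT x. smoothstep_deriv (v x) * (ph x \<bullet> w x)"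
 \<comment> \<open>The errors are \<open>3/2 * e\<close> from the density \<open>w\<close> on the
   supports of the cut-offs, \<open>3/2 * e * (mm + 2)\<close> from the singular part under the
   remaining field, and \<open>e\<close> from the cut-offs themselves.\<close>
 have main: "?L <= ?R + h0 + e * (3/2 + 3/2 * (mm + 2) + 1)" if e: "0 < e" for e
 proof -
 have AS: "N Int S0 : sets borel" using Nb S0(1) by auto
 obtain m :: nat and c K where K: "0 < m" "!!i. i < m ==> norm (c i) <= 1" "!!i. i < m ==> compact (K i)" "!!i. i < m ==> K i <= N Int S0"
  "!!i j. i < m ==> j < m ==> i ~= j ==> K i Int K j = {}" "!!i x. i < m ==> x : K i ==> norm (ph x - c i) <= e"
  "measure M (N Int S0 - (\<Union>i<m. K i)) <= e"
  by (rule approx_by_constant_pieces[OF M_fin M_sets AS phm ph1 e]) (rule that)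
 define KK where "KK = (\<Union>i<m. K i)"
 have KKc: "compact KK" unfolding KK_def using K(3) by (intro compact_UN) auto
 have KKN: "KK <= N" "KK <= Om" using K(4) S0(2) by (auto simp: KK_def)
 have KKb: "KK : sets borel" using KKc by (simp add: borel_compact)
 have KKn: "KK : null_sets lborel" using null_sets_subset[OF Nn _ KKN(1)] KKb by simp
 have Kb: "K i : sets borel" if "i < m" for i using K(3)[OF that] by (simp add: borel_compact)
 obtain r1 where r1: "0 < r1" "!!i j x. i < m ==> j < m ==> i ~= j ==> x : (\<Union>k\<in>K i. ball k r1) ==> x ~: (\<Union>k\<in>K j. ball k r1)"
  by (rule separate_finite_compacts[of m K, OF K(3) K(5)]) (assumption, assumption, assumption, assumption, rule that)
 obtain r2 where r2: "0 < r2" "(\<Union>x\<in>KK. ball x r2) <= Om"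
  using compact_subset_open_imp_ball_epsilon_subset[OF KKc open_dom KKN(2)] by blast
 obtain r3 where r3: "0 < r3" "(LBINT x. indicator (\<Union>k\<in>KK. ball k r3) x * norm (w x)) < e"
  by (rule nbhd_small_integral[OF KKc KKn w e]) (rule that)
 define U where "U = (\<Union>k\<in>KK. ball k r3)"
 \<comment> \<open>\<open>r1\<close> keeps the supports of the cut-offs disjoint, \<open>r2\<close>
   keeps them in \<open>Om\<close>, and \<open>r3\<close> makes the integral of the density over
   them small.\<close>
 define r where "r = min r1 (min r2 r3)"
 have r: "0 < r" "r <= r1" "r <= r2" "r <= r3" using r1 r2 r3 by (auto simp: r_def)
 \<comment> \<open>The cut-off of each piece is adapted to the direction of its constant; for the
   constant 0 any unit vector will do.\<close>
 define u where "u i = (if c i = 0 then SOME b. b : Basis else sgn (c i))" for i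
 have u: "norm (u i) = 1" for i
  unfolding u_def using nonempty_Basis some_in_eq by (auto simp: norm_sgn)
 have cu: "c i = norm (c i) *\<^sub>R u i" for i by (auto simp: u_def sgn_div_norm)
 have Hfin: "hausdorff_outer n1 (K i) < \<infinity>" if "i < m" for i
  using hausdorff_outer_mono[of "K i" S0 n1] K(4)[OF that] S0(4) by (auto simp: n1_def intro: le_less_trans)
 define Q where "Q i = (%(eta :: 'a => real, eta', S). c1_deriv eta eta' & (ALL x. 0 <= eta x & eta x <= 1) & (ALL x:K i. eta x = 1) &
  compact S & S <= (\<Union>k\<in>K i. ball k r) & (ALL x. x ~: S --> eta x = 0) &
  (\<integral>\<^sup>+x. ennreal (- eta' x (u i)) \<partial>lborel) <= hausdorff_outer n1 (K i) + ennreal (e / m))" for i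
 have "EX p. i < m --> Q i p" for i
 proof (cases "i < m")
  case True
  obtain eta :: "'a => real" and eta' S where "c1_deriv eta eta'" "!!x. 0 <= eta x" "!!x. eta x <= 1"
  "!!x. x : K i ==> eta x = 1" "compact S" "S <= (\<Union>k\<in>K i. ball k r)" "!!x. x ~: S ==> eta x = 0"
  "(\<integral>\<^sup>+x. ennreal (- eta' x (u i)) \<partial>lborel) <= hausdorff_outer (DIM('a) - 1) (K i) + ennreal (e / m)"
  by (rule hausdorff_cutoff[OF K(3)[OF True] Hfin[OF True, unfolded n1_def] u[of i] r(1), of "e / m"])
   (use e K(1) in simp, rule that)
  hence "Q i (eta, eta', S)" by (auto simp: Q_def n1_def)
  thus ?thesis by blast
 qed simp
 then obtain p where p: "!!i. i < m ==> Q i (p i)" by metis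
 define eta where "eta i = fst (p i)" for i
 define eta' where "eta' i = fst (snd (p i))" for i
 define S where "S i = snd (snd (p i))" for i
 have eta: "c1_deriv (eta i) (eta' i)" "!!x. 0 <= eta i x & eta i x <= 1" "!!x. x : K i ==> eta i x = 1"
  "compact (S i)" "S i <= (\<Union>k\<in>K i. ball k r)" "!!x. x ~: S i ==> eta i x = 0"
  "(\<integral>\<^sup>+x. ennreal (- eta' i x (u i)) \<partial>lborel) <= hausdorff_outer n1 (K i) + ennreal (e / m)" if "i < m" for i
  using p[OF that] by (auto simp: Q_def eta_def eta'_def S_def case_prod_unfold)
 have sup1: "eta j x = 0" if "i < m" "j < m" "i ~= j" "x : S i" for i j x
 proof -
  have "x : (\<Union>k\<in>K i. ball k r1)" using eta(5)[OF that(1)] that(4) nbhd_mono[OF order_refl r(2), of "K i"] by blast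
  hence "x ~: (\<Union>k\<in>K j. ball k r1)" using r1(2) that by blast
  hence "x ~: S j" using eta(5)[OF that(2)] nbhd_mono[OF order_refl r(2), of "K j"] by blast
  thus ?thesis using eta(6)[OF that(2)] by blast
 qed
 have single: "EX i<m. ALL j<m. j ~= i --> eta j x = 0" for x
 proof (cases "EX i<m. x : S i")
  case True thus ?thesis using sup1 by metis
 next
  case False thus ?thesis using K(1) eta(6) by blast
 qed
 \<comment> \<open>The remaining field is at most \<open>e\<close> on the pieces and at most 2
   everywhere, so the factor 3/2 of \<open>chain_rule_bound\<close> multiplies only small
   quantities.\<close>
 define Psi where "Psi x = ph x - (\<Sum>i<m. eta i x *\<^sub>R c i)" for x
 have sum_le: "norm (\<Sum>i<m. eta i x *\<^sub>R c i) <= 1" for x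
 proof -
  obtain i where i: "i < m" "!!j. j < m ==> j ~= i ==> eta j x = 0" using single by blast
  have "(\<Sum>j<m. eta j x *\<^sub>R c j) = (\<Sum>j\<in>{i}. eta j x *\<^sub>R c j)"
  using i by (intro sum.mono_neutral_right) auto
  thus ?thesis using eta(2)[OF i(1), of x] K(2)[OF i(1)] by (simp add: mult_le_one)
 qed
 have PsiK: "norm (Psi x) <= e" if xK: "x : KK" for x
 proof -
  obtain i where i: "i < m" "x : K i" using xK unfolding KK_def by blast
  have "x : S i" using eta(3)[OF i] eta(6)[OF i(1), of x] by fastforce
  hence "(\<Sum>j<m. eta j x *\<^sub>R c j) = (\<Sum>j\<in>{i}. eta j x *\<^sub>R c j)"
  using i(1) sup1[OF i(1)] by (intro sum.mono_neutral_right) auto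
  thus ?thesis using eta(3)[OF i] K(6)[OF i] by (simp add: Psi_def)
 qed
 have Psi2: "norm (Psi x) <= 2" for x
  unfolding Psi_def using norm_triangle_ineq4[of "ph x" "\<Sum>i<m. eta i x *\<^sub>R c i"] ph1[of x] sum_le[of x] by linarith
 note dv = divergence_add_sum[OF ph(1), of m eta eta' c, OF eta(1)]
 have Psic1: "c1_deriv Psi (%x h. ph' x h - (\<Sum>i<m. eta' i x h *\<^sub>R c i))" unfolding Psi_def[abs_def] by (rule dv(1))
 have Psim[measurable]: "Psi : borel_measurable borel" by (rule c1_deriv_measurable[OF Psic1])
 have Psidiv: "divergence Psi x = divergence ph x - (\<Sum>i<m. eta' i x (c i))" for x unfolding Psi_def[abs_def] by (rule dv(2))
 have SOm: "S i <= Om" if "i < m" for i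
 proof -
  have "K i <= KK" using that by (auto simp: KK_def)
  hence "S i <= (\<Union>x\<in>KK. ball x r2)" using eta(5)[OF that] nbhd_mono[OF _ r(3)] by blast
  thus ?thesis using r2(2) by blast
 qed
 have Psit: "test_field Om Psi"
 proof (rule test_fieldI[OF Psic1, of "Kp Un (\<Union>i<m. S i)"])
  show "compact (Kp Un (\<Union>i<m. S i))" using ph(2) eta(4) by (intro compact_Un compact_UN) auto
  show "Kp Un (\<Union>i<m. S i) <= Om" using ph(3) SOm by blast
  show "Psi x = 0" if "x ~: Kp Un (\<Union>i<m. S i)" for x
  using that ph(4)[of x] eta(6) by (auto simp: Psi_def intro!: sum.neutral)
 qed
 have step1: "- (LBINT x. smoothstep (v x) * divergence Psi x)
  <= ?R + 3/2 * e + 3/2 * (e * (mm + 2))"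
 proof -
  have Ui: "integrable lborel (%x. indicat_real U x * norm (w x))"
  using integrable_mult_indicator[OF _ integrable_norm[OF w], of U] by (auto simp: U_def intro!: borel_open)
  have 1: "(LBINT x. smoothstep_deriv (v x) * (Psi x \<bullet> w x))
   <= (LBINT x. smoothstep_deriv (v x) * (ph x \<bullet> w x) + 3/2 * (indicator U x * norm (w x)))"
  proof (rule integral_mono)
  show "integrable lborel (%x. smoothstep_deriv (v x) * (Psi x \<bullet> w x))" by (rule bd[OF Psim Psi2])
  show "integrable lborel (%x. smoothstep_deriv (v x) * (ph x \<bullet> w x) + 3/2 * (indicator U x * norm (w x)))"
   using bd[OF phm ph1] Ui by simp
  fix x
  define q where "q = (\<Sum>i<m. eta i x *\<^sub>R c i)"
  have q: "norm q <= indicator U x"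
  proof (cases "x : U")
   case True thus ?thesis using sum_le[of x] by (simp add: q_def)
  next
   case False
   have "x ~: S i" if "i < m" for i
   proof -
   have "K i <= KK" using that by (auto simp: KK_def)
   thus ?thesis using False eta(5)[OF that] nbhd_mono[OF _ r(4)] unfolding U_def by blast
   qed
   hence "q = 0" unfolding q_def using eta(6) by (intro sum.neutral) auto
   thus ?thesis by simp
  qed
  have "\<bar>smoothstep_deriv (v x) * (q \<bullet> w x)\<bar> <= 3/2 * indicator U x * norm (w x)" by (rule smoothstep_deriv_inner_le[OF q])
  thus "smoothstep_deriv (v x) * (Psi x \<bullet> w x)
   <= smoothstep_deriv (v x) * (ph x \<bullet> w x) + 3/2 * (indicator U x * norm (w x))"
   unfolding Psi_def q_def[symmetric] by (simp add: inner_diff_left right_diff_distrib abs_le_iff)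
  qed
  also have "... = ?R + 3/2 * (LBINT x. indicator U x * norm (w x))" using bd[OF phm ph1] Ui by simp
  also have "... <= ?R + 3/2 * e" using r3(2) by (simp add: U_def)
  finally have A: "(LBINT x. smoothstep_deriv (v x) * (Psi x \<bullet> w x)) <= ?R + 3/2 * e" .
  have "(LINT x|M. indicator N x * norm (Psi x)) <= (LINT x|M. e + 2 * indicator (N - KK) x)"
  proof (rule integral_mono)
  show "integrable M (%x. indicator N x * norm (Psi x))"
   using Psi2 Nb by (intro integrable_bounded_M[of _ 2]) (auto simp: indicator_def)
  show "integrable M (%x. e + 2 * indicator (N - KK) x)"
   using Nb KKb e by (intro integrable_bounded_M[of _ "e + 2"]) (auto simp: indicator_def)
  show "indicator N x * norm (Psi x) <= e + 2 * indicator (N - KK) x" for x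
   using Psi2[of x] PsiK[of x] e by (auto simp: indicator_def)
  qed
  also have "... = e * mm + 2 * measure M (N - KK)"
  using Nb KKb by (subst Bochner_Integration.integral_add) (auto simp: M_sets space_M mm_def mult.commute emeasure_eq_measure intro!: integrable_mult_right integrable_real_indicator)
  \<comment> \<open>The singular part charges \<open>N\<close> only within \<open>S0\<close>, and
    the pieces exhaust \<open>N Int S0\<close> up to mass \<open>e\<close>.\<close>
  also have "measure M (N - KK) <= e"
  proof -
  have "measure M (N - KK) <= measure M ((N - S0) Un (N Int S0 - KK))"
   using Nb KKb S0(1) by (intro finite_measure_mono) (auto simp: M_sets)
  also have "... <= measure M (N - S0) + measure M (N Int S0 - KK)"
   using Nb KKb S0(1) by (intro measure_Un_le) (auto simp: M_sets)
  also have "measure M (N - S0) = 0" using S0(3) by (simp add: measure_def)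
  finally show ?thesis using K(7) by (simp add: KK_def)
  qed
  finally have B: "(LINT x|M. indicator N x * norm (Psi x)) <= e * (mm + 2)" by (simp add: algebra_simps)
  have "- (LBINT x. smoothstep (v x) * divergence Psi x)
   <= (LBINT x. smoothstep_deriv (v x) * (Psi x \<bullet> w x)) + 3/2 * (LINT x|M. indicator N x * norm (Psi x))"
  using chain_rule_bound[OF d Psit] by (simp add: w_def)
  thus ?thesis using A B by linarith
 qed
 have step2: "- (LBINT x. smoothstep (v x) * eta' i x (c i)) <= enn2real (hausdorff_outer n1 (K i)) + e / m" if i: "i < m" for i
 proof -
  have "(\<integral>\<^sup>+x. ennreal (- eta' i x (u i)) \<partial>lborel) <= hausdorff_outer n1 (K i) + ennreal (e / m)" by (rule eta(7)[OF i])
  also have "... = ennreal (enn2real (hausdorff_outer n1 (K i)) + e / m)"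
  using Hfin[OF i] e by (subst ennreal_plus) (auto simp: less_top)
  finally have le: "(\<integral>\<^sup>+x. ennreal (- eta' i x (u i)) \<partial>lborel) <= ennreal (enn2real (hausdorff_outer n1 (K i)) + e / m)" .
  have "- (LBINT x. smoothstep (v x) * eta' i x (norm (c i) *\<^sub>R u i)) <= enn2real (hausdorff_outer n1 (K i)) + e / m"
  by (rule integral_smoothstep_cutoff_le[OF _ eta(1)[OF i] le]) (use e K(2)[OF i] v_int in auto)
  thus ?thesis using cu[of i] by simp
 qed
 have sumH: "(\<Sum>i<m. enn2real (hausdorff_outer n1 (K i))) <= h0"
 proof -
  have "ennreal (\<Sum>i<m. enn2real (hausdorff_outer n1 (K i))) = (\<Sum>i<m. ennreal (enn2real (hausdorff_outer n1 (K i))))"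
  by (intro sum_ennreal[symmetric]) auto
  also have "... = (\<Sum>i<m. hausdorff_outer n1 (K i))" using Hfin by (intro sum.cong) (auto simp: less_top)
  also have "... <= hausdorff_outer n1 S0"
  using Kb K(4,5) S0(1) by (intro sum_hausdorff_outer_disjoint_le) auto
  also have "... = ennreal h0" using S0(4) by (simp add: h0_def n1_def less_top)
  finally show ?thesis by (subst (asm) ennreal_le_iff) (auto simp: h0_def)
 qed
 have etai: "integrable lborel (%x. smoothstep (v x) * eta' i x (c i))" if i: "i < m" for i
 proof (rule integrable_bounded_times[of _ _ 1])
  show "integrable lborel (%x. eta' i x (c i))"
  by (rule integrable_compact_support[OF c1_deriv_continuous_deriv[OF eta(1)[OF i]] eta(4)[OF i]
   c1_deriv_zero_off_closed[OF eta(1)[OF i] compact_imp_closed[OF eta(4)[OF i]] eta(6)[OF i]]])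
  show "(%x. smoothstep (v x)) : borel_measurable borel" using vm by measurable
 qed (simp add: smoothstep_nonneg smoothstep_le_1)
 note Psii = integrable_smoothstep_divergence(2)[OF Psit vm]
 have "divergence ph x = divergence Psi x + (\<Sum>i<m. eta' i x (c i))" for x using Psidiv[of x] by simp
 hence "?L = - (LBINT x. smoothstep (v x) * divergence Psi x + (\<Sum>i<m. smoothstep (v x) * eta' i x (c i)))"
  by (simp add: distrib_left sum_distrib_left)
 also have "... = - (LBINT x. smoothstep (v x) * divergence Psi x) + (\<Sum>i<m. - (LBINT x. smoothstep (v x) * eta' i x (c i)))"
  using Psii etai by (subst Bochner_Integration.integral_add) (auto simp: sum_negf)
 also have "(\<Sum>i<m. - (LBINT x. smoothstep (v x) * eta' i x (c i))) <= (\<Sum>i<m. enn2real (hausdorff_outer n1 (K i)) + e / m)"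
  using step2 by (intro sum_mono) auto
 also have "... = (\<Sum>i<m. enn2real (hausdorff_outer n1 (K i))) + e" using K(1) by (simp add: sum.distrib)
 finally have "?L <= - (LBINT x. smoothstep (v x) * divergence Psi x) + ((\<Sum>i<m. enn2real (hausdorff_outer n1 (K i))) + e)" by simp
 moreover have "e * (3/2 + 3/2 * (mm + 2) + 1) = 3/2 * e + 3/2 * (e * (mm + 2)) + e" by (simp add: field_simps)
 ultimately show ?thesis using step1 sumH by linarith
 qed
 have "?L <= (?R + h0) + e" if e: "0 < e" for e
 proof -
 define q where "q = 3/2 + 3/2 * (mm + 2) + 1"
 have q: "0 < q" by (simp add: q_def mm_def add_nonneg_pos add_pos_nonneg)
 have "e / q * q = e" using q by simp
 thus ?thesis using main[of "e / q"] e q unfolding q_def[symmetric] by simp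
 qed
 thus ?thesis unfolding w_def[symmetric] h0_def[unfolded n1_def, symmetric] by (rule field_le_epsilon)
qed

end

section \<open>The Gauss-Green formula below a graph\<close>

lemma lborel_eq_slab_product:
 fixes e :: "'a::euclidean_space"
 assumes e: "norm e = 1"
 shows "lborel = distr (slab e \<Otimes>\<^sub>M lborel) borel (%(y, t). y + t *\<^sub>R e)"
proof (rule measure_eqI)
 interpret S: sigma_finite_measure "slab e" by (rule sigma_finite_slab_measure[OF e])
 interpret P: pair_sigma_finite "slab e" "lborel :: real measure" ..
 have m: "(%(y, t). y + t *\<^sub>R e) : measurable (slab e \<Otimes>\<^sub>M lborel) borel" by measurable
 show "sets lborel = sets (distr (slab e \<Otimes>\<^sub>M lborel) borel (%(y, t). y + t *\<^sub>R e))" by simp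
 fix A :: "'a set" assume "A : sets lborel"
 hence [measurable]: "A : sets borel" by simp
 have "emeasure (distr (slab e \<Otimes>\<^sub>M lborel) borel (%(y, t). y + t *\<^sub>R e)) A
  = (\<integral>\<^sup>+x. indicator A x \<partial>distr (slab e \<Otimes>\<^sub>M lborel) borel (%(y, t). y + t *\<^sub>R e))" by simp
 also have "... = (\<integral>\<^sup>+p. indicator A (fst p + snd p *\<^sub>R e) \<partial>(slab e \<Otimes>\<^sub>M lborel))"
 using m by (subst nn_integral_distr) (auto simp: case_prod_unfold)
 also have "... = (\<integral>\<^sup>+y. (\<integral>\<^sup>+t. indicator A (y + t *\<^sub>R e) \<partial>lborel) \<partial>slab e)"
 by (subst lborel.nn_integral_fst[symmetric]) auto
 also have "... = (\<integral>\<^sup>+x. indicator A x \<partial>lborel)"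
 by (rule nn_integral_slab_fubini[OF e, symmetric]) measurable
 finally show "emeasure lborel A = emeasure (distr (slab e \<Otimes>\<^sub>M lborel) borel (%(y, t). y + t *\<^sub>R e)) A" by simp
qed

lemma integral_slab_fubini:
 fixes e :: "'a::euclidean_space" and F :: "'a => real"
 assumes e: "norm e = 1" and F: "integrable lborel F"
 shows "(LBINT x. F x) = (LINT y|slab e. (LBINT t. F (y + t *\<^sub>R e)))"
proof -
 interpret S: sigma_finite_measure "slab e" by (rule sigma_finite_slab_measure[OF e])
 interpret P: pair_sigma_finite "slab e" "lborel :: real measure" ..
 have m: "(%(y, t). y + t *\<^sub>R e) : measurable (slab e \<Otimes>\<^sub>M lborel) borel" by measurable
 have Fm: "F : borel_measurable borel" using F by auto
 have "integrable (distr (slab e \<Otimes>\<^sub>M lborel) borel (%(y, t). y + t *\<^sub>R e)) F"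
 using F lborel_eq_slab_product[OF e] by simp
 hence i: "integrable (slab e \<Otimes>\<^sub>M lborel) (%(y, t). F (y + t *\<^sub>R e))"
 using m Fm by (subst (asm) integrable_distr_eq) (auto simp: case_prod_unfold)
 have "(LBINT x. F x) = (\<integral>x. F x \<partial>distr (slab e \<Otimes>\<^sub>M lborel) borel (%(y, t). y + t *\<^sub>R e))"
 using lborel_eq_slab_product[OF e] by simp
 also have "... = (LINT p|(slab e \<Otimes>\<^sub>M lborel). (%(y, t). F (y + t *\<^sub>R e)) p)"
 using m Fm by (subst integral_distr) (auto simp: case_prod_unfold)
 also have "... = (LINT y|slab e. (LBINT t. F (y + t *\<^sub>R e)))"
 using P.integral_fst'[OF i] by simp
 finally show ?thesis .
qed

lemma integral_halfline_deriv:
 fixes th :: "'a::euclidean_space => real"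
 assumes th: "c1_deriv th th'" "compact K" "!!x. x ~: K ==> th x = 0" and nu: "norm nu = 1" and y: "y \<bullet> nu = 0"
 shows "(LBINT t. indicator {..0} t * th' (y + t *\<^sub>R nu) nu) = th y"
proof -
 obtain R where R: "0 < R" "K <= ball 0 R" using bounded_subset_ballD[OF compact_imp_bounded[OF th(2)]] by blast
 have off: "y + t *\<^sub>R nu ~: K" if "R <= \<bar>t\<bar>" for t
 proof -
 have "\<bar>t\<bar> = \<bar>(y + t *\<^sub>R nu) \<bullet> nu\<bar>" using y nu by (simp add: inner_add_left norm_eq_1)
 also have "... <= norm (y + t *\<^sub>R nu)" using Cauchy_Schwarz_ineq2[of "y + t *\<^sub>R nu" nu] nu by simp
 finally show ?thesis using that R(2) by auto
 qed
 have z: "th' (y + t *\<^sub>R nu) nu = 0" if "R <= \<bar>t\<bar>" for t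
 using c1_deriv_zero_off_closed[OF th(1) compact_imp_closed[OF th(2)] th(3) off[OF that]] .
 have eq: "indicator {..0} t * th' (y + t *\<^sub>R nu) nu = th' (y + t *\<^sub>R nu) nu * indicator {-R..0} t" for t
 using z[of t] R(1) by (auto simp: indicator_def)
 have "(LBINT t. indicator {..0} t * th' (y + t *\<^sub>R nu) nu) = (LBINT t. th' (y + t *\<^sub>R nu) nu * indicator {-R..0} t)"
 by (simp only: eq)
 also have "... = th (y + 0 *\<^sub>R nu) - th (y + (-R) *\<^sub>R nu)"
 proof (rule integral_FTC_Icc_real)
 show "((%t. th (y + t *\<^sub>R nu)) has_real_derivative th' (y + t *\<^sub>R nu) nu) (at t)" for t by (rule c1_deriv_line[OF th(1)])
 have "continuous_on UNIV (%t. th' (y + t *\<^sub>R nu) nu)"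
  by (rule continuous_on_compose2[OF c1_deriv_continuous_deriv[OF th(1), of UNIV]]) (auto intro!: continuous_intros)
 thus "isCont (%t. th' (y + t *\<^sub>R nu) nu) t" for t by (simp add: continuous_on_eq_continuous_at)
 qed (use R in simp)
 also have "... = th y" using th(3)[OF off[of "-R"]] R(1) by simp
 finally show ?thesis .
qed

text \<open>On each line parallel to \<open>nu\<close> the factor \<open>q\<close> is constant and
  the fundamental theorem leaves the value on the hyperplane. Such factors come from the gradient of
  a graph function, which is constant along the normal axis.\<close>

lemma integral_halfspace_deriv_normal:
 fixes th q :: "'a::euclidean_space => real"
 assumes th: "c1_deriv th th'" "compact K" "!!x. x ~: K ==> th x = 0" and nu: "norm nu = 1"
 and q: "continuous_on UNIV q" "!!x t. q (x + t *\<^sub>R nu) = q x"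
 shows "(LBINT x. indicator {x. x \<bullet> nu <= 0} x * (q x * th' x nu)) = (LINT y|slab nu. q y * th y)"
proof -
 have i0: "integrable lborel (%x. q x * th' x nu)"
 using q(1) c1_deriv_continuous_deriv[OF th(1)] c1_deriv_zero_off_closed[OF th(1) compact_imp_closed[OF th(2)] th(3)]
 by (intro integrable_compact_support[OF _ th(2)]) (auto intro!: continuous_intros)
 have i: "integrable lborel (%x. indicator {x. x \<bullet> nu <= 0} x * (q x * th' x nu))"
 using integrable_mult_indicator[OF _ i0, of "{x. x \<bullet> nu <= 0}"] by simp
 have "(LBINT x. indicator {x. x \<bullet> nu <= 0} x * (q x * th' x nu))
  = (LINT y|slab nu. (LBINT t. indicator {x. x \<bullet> nu <= 0} (y + t *\<^sub>R nu) * (q (y + t *\<^sub>R nu) * th' (y + t *\<^sub>R nu) nu)))"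
 by (rule integral_slab_fubini[OF nu i])
 also have "... = (LINT y|slab nu. q y * th y)"
 proof (rule integral_cong_AE)
 have [measurable]: "q : borel_measurable borel" "th : borel_measurable borel" "(%x. th' x nu) : borel_measurable borel"
  using q(1) c1_deriv_continuous[OF th(1)] c1_deriv_continuous_deriv[OF th(1)] by (auto intro: borel_measurable_continuous_onI)
 interpret S: sigma_finite_measure "slab nu" by (rule sigma_finite_slab_measure[OF nu])
 show "(%y. q y * th y) : borel_measurable (slab nu)" by measurable
 show "(%y. LBINT t. indicator {x. x \<bullet> nu <= 0} (y + t *\<^sub>R nu) * (q (y + t *\<^sub>R nu) * th' (y + t *\<^sub>R nu) nu)) : borel_measurable (slab nu)"
  by measurable
 show "AE y in slab nu. (LBINT t. indicator {x. x \<bullet> nu <= 0} (y + t *\<^sub>R nu) * (q (y + t *\<^sub>R nu) * th' (y + t *\<^sub>R nu) nu)) = q y * th y"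
  using AE_slab_measure[OF nu]
 proof eventually_elim
  case (elim y)
  have eq: "indicator {x. x \<bullet> nu <= 0} (y + t *\<^sub>R nu) * (q (y + t *\<^sub>R nu) * th' (y + t *\<^sub>R nu) nu)
   = q y * (indicator {..0} t * th' (y + t *\<^sub>R nu) nu)" for t
  using elim nu q(2) by (simp add: indicator_def inner_add_left norm_eq_1)
  show ?case unfolding eq using integral_halfline_deriv[OF th nu elim] by simp
 qed
 qed
 finally show ?thesis .
qed

text \<open>Split \<open>c\<close> into its normal and tangential parts. The half space is invariant
  under tangential translations, so the tangential derivative integrates to zero.\<close>

lemma integral_halfspace_deriv:
 fixes th :: "'a::euclidean_space => real"
 assumes th: "c1_deriv th th'" "compact K" "!!x. x ~: K ==> th x = 0" and nu: "norm nu = 1"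
 shows "(LBINT x. indicator {x. x \<bullet> nu <= 0} x * th' x c) = (c \<bullet> nu) * (LINT y|slab nu. th y)"
proof -
 have i: "integrable lborel (%x. indicator {x. x \<bullet> nu <= 0} x * th' x h)" for h
 proof -
 have "integrable lborel (%x. th' x h)"
  using c1_deriv_continuous_deriv[OF th(1)] c1_deriv_zero_off_closed[OF th(1) compact_imp_closed[OF th(2)] th(3)]
  by (intro integrable_compact_support[OF _ th(2)]) auto
 from integrable_mult_indicator[OF _ this, of "{x. x \<bullet> nu <= 0}"] show ?thesis by simp
 qed
 have lin: "th' x c = (c \<bullet> nu) * th' x nu + th' x (proj_along nu c)" for x
 proof -
 have "c = (c \<bullet> nu) *\<^sub>R nu + proj_along nu c" by (simp add: proj_along_def)
 hence "th' x c = th' x ((c \<bullet> nu) *\<^sub>R nu + proj_along nu c)" by simp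
 thus ?thesis by (simp add: linear_add[OF c1_deriv_linear[OF th(1)]] linear_scale[OF c1_deriv_linear[OF th(1)]])
 qed
 have 0: "(LBINT x. indicator {x. x \<bullet> nu <= 0} x * th' x (proj_along nu c)) = 0"
 by (rule integral_directional_deriv_zero[OF th]) (auto simp: inner_add_left proj_along_inner_self[OF nu])
 have 1: "(LBINT x. indicator {x. x \<bullet> nu <= 0} x * th' x nu) = (LINT y|slab nu. th y)"
 using integral_halfspace_deriv_normal[OF th nu, of "%_. 1"] by simp
 have "(LBINT x. indicator {x. x \<bullet> nu <= 0} x * th' x c)
  = (LBINT x. (c \<bullet> nu) * (indicator {x. x \<bullet> nu <= 0} x * th' x nu) + indicator {x. x \<bullet> nu <= 0} x * th' x (proj_along nu c))"
 by (intro Bochner_Integration.integral_cong) (auto simp: lin algebra_simps)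
 also have "... = (c \<bullet> nu) * (LBINT x. indicator {x. x \<bullet> nu <= 0} x * th' x nu)
  + (LBINT x. indicator {x. x \<bullet> nu <= 0} x * th' x (proj_along nu c))"
 using i by (subst Bochner_Integration.integral_add) auto
 finally show ?thesis using 0 1 by simp
qed

text \<open>On every line parallel to \<open>nu\<close> the map is a translation, because
  \<open>g\<close> is constant there; the slab version of Fubini does the rest.\<close>

lemma lborel_shear:
 fixes nu :: "'a::euclidean_space"
 assumes nu: "norm nu = 1" and g: "g : borel_measurable borel" "!!x t. g (x + t *\<^sub>R nu) = g x"
 shows "distr lborel borel (%x. x + g x *\<^sub>R nu) = lborel"
proof (rule measure_eqI)
 have [measurable]: "g : borel_measurable borel" by fact
 have m: "(%x. x + g x *\<^sub>R nu) : measurable lborel borel" by measurable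
 fix A :: "'a set" assume "A : sets (distr lborel borel (%x. x + g x *\<^sub>R nu))"
 hence [measurable]: "A : sets borel" by simp
 have "emeasure (distr lborel borel (%x. x + g x *\<^sub>R nu)) A = (\<integral>\<^sup>+x. indicator A x \<partial>distr lborel borel (%x. x + g x *\<^sub>R nu))" by simp
 also have "... = (\<integral>\<^sup>+x. indicator A (x + g x *\<^sub>R nu) \<partial>lborel)" by (subst nn_integral_distr) auto
 also have "... = (\<integral>\<^sup>+y. (\<integral>\<^sup>+t. indicator A ((y + t *\<^sub>R nu) + g (y + t *\<^sub>R nu) *\<^sub>R nu) \<partial>lborel) \<partial>slab nu)"
 by (rule nn_integral_slab_fubini[OF nu]) measurable
 also have "... = (\<integral>\<^sup>+y. (\<integral>\<^sup>+t. indicator A (y + t *\<^sub>R nu) \<partial>lborel) \<partial>slab nu)"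
 proof (rule nn_integral_cong)
 fix y
 have eq: "(y + t *\<^sub>R nu) + g (y + t *\<^sub>R nu) *\<^sub>R nu = y + (t + g y) *\<^sub>R nu" for t
  using g(2) by (simp add: scaleR_left_distrib add.assoc)
 show "(\<integral>\<^sup>+t. indicator A ((y + t *\<^sub>R nu) + g (y + t *\<^sub>R nu) *\<^sub>R nu) \<partial>lborel) = (\<integral>\<^sup>+t. indicator A (y + t *\<^sub>R nu) \<partial>lborel)"
  unfolding eq using nn_integral_lborel_shift[of "%t. indicator A (y + t *\<^sub>R nu)" "g y"] by simp
 qed
 also have "... = (\<integral>\<^sup>+x. indicator A x \<partial>lborel)" by (rule nn_integral_slab_fubini[OF nu, symmetric]) measurable
 finally show "emeasure (distr lborel borel (%x. x + g x *\<^sub>R nu)) A = emeasure lborel A" by simp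
qed simp

lemma integrable_slab_continuous:
 fixes f :: "'a::euclidean_space => real"
 assumes nu: "norm nu = 1" and f: "continuous_on UNIV f" "compact S" "!!x. x ~: S ==> f x = 0"
 shows "integrable (slab nu) f"
proof -
 obtain B where B: "0 < B" "!!x. norm (f x) <= B"
 by (rule bounded_compact_support[OF f]) (assumption, rule that)
 have Sb: "S : sets borel" using f(2) by (simp add: borel_compact)
 show ?thesis
 proof (rule Bochner_Integration.integrable_bound[of _ "%x. B * indicator S x"])
 show "integrable (slab nu) (%x. B * indicator S x)"
  using Sb emeasure_slab_measure_bounded[OF nu Sb compact_imp_bounded[OF f(2)]]
  by (intro integrable_mult_right integrable_real_indicator) auto
 show "f : borel_measurable (slab nu)" using borel_measurable_continuous_onI[OF f(1)] by measurable
 show "AE x in slab nu. norm (f x) <= norm (B * indicator S x)"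
  using B f(3) by (auto simp: indicator_def)
 qed
qed

locale chart =
 fixes E :: "'a::euclidean_space set" and p :: 'a and r :: real and nu :: 'a and ga :: "'a => real" and D :: "'a => 'a"
 assumes r_pos: "0 < r" and nu1: "norm nu = 1" and gamma_inv: "!!x t. ga (x + t *\<^sub>R nu) = ga x"
 and gamma_deriv: "!!x. (ga has_derivative (%h. h \<bullet> D x)) (at x)" and D_cont: "continuous_on UNIV D"
 and E_ball: "E Int ball p r = {x : ball p r. x \<bullet> nu <= ga x}"

lemma C11_chart_chart:
 assumes "C11_chart E p r nu ga"
 obtains D where "chart E p r nu ga D"
proof -
 obtain D L where D: "!!x. GDERIV ga x :> D x" "L-lipschitz_on UNIV D"
 using assms by (auto simp: C11_chart_def C11_function_def)
 have "chart E p r nu ga D"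
 using assms D lipschitz_on_continuous_on[OF D(2)]
 by (intro chart.intro) (auto simp: C11_chart_def graph_function_def gderiv_def)
 thus thesis by (rule that)
qed

context chart
begin

lemma gamma_c1: "c1_deriv ga (%x h. h \<bullet> D x)"
 unfolding c1_deriv_def using gamma_deriv D_cont by (auto intro!: continuous_intros)

lemma D_nu: "D x \<bullet> nu = 0"
proof -
 have "((%s. ga (x + s *\<^sub>R nu)) has_real_derivative nu \<bullet> D (x + 0 *\<^sub>R nu)) (at 0)"
 by (rule c1_deriv_line[OF gamma_c1])
 moreover have "((%s. ga (x + s *\<^sub>R nu)) has_real_derivative 0) (at 0)" by (simp add: gamma_inv)
 ultimately have "nu \<bullet> D (x + 0 *\<^sub>R nu) = 0" by (rule DERIV_unique)
 thus ?thesis by (simp add: inner_commute)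
qed

lemma D_inv: "D (x + t *\<^sub>R nu) = D x"
proof -
 have "((%z. z + t *\<^sub>R nu) has_derivative (%h. h)) (at x)" by (auto intro!: derivative_eq_intros)
 from has_derivative_compose[OF this gamma_deriv] have "(ga has_derivative (%h. h \<bullet> D (x + t *\<^sub>R nu))) (at x)"
 by (simp add: gamma_inv)
 hence "(%h. h \<bullet> D (x + t *\<^sub>R nu)) = (%h. h \<bullet> D x)" using gamma_deriv has_derivative_unique by blast
 thus ?thesis by (metis inner_commute vector_eq_rdot)
qed

definition graph_map :: "'a => 'a" where "graph_map x = x + ga x *\<^sub>R nu"

lemma gamma_cont: "continuous_on S ga" by (rule c1_deriv_continuous[OF gamma_c1])

lemma gamma_meas [measurable]: "ga : borel_measurable borel"
 by (rule borel_measurable_continuous_onI[OF gamma_cont])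

lemma D_meas [measurable]: "D : borel_measurable borel"
 by (rule borel_measurable_continuous_onI[OF D_cont])

lemma graph_map_meas [measurable]: "graph_map : borel_measurable borel"
 unfolding graph_map_def by measurable

text \<open>The shear \<open>graph_map\<close> preserves volume and turns the subgraph into a half
  space. By the chain rule, the derivative of \<open>eta\<close> along \<open>c\<close> becomes that
  of the sheared function along \<open>c\<close> minus \<open>c \<bullet> D x\<close> times its
  normal derivative; the two half space formulas evaluate these terms.\<close>

lemma chart_gauss_green:
 assumes eta: "c1_deriv eta eta'" "compact S" "S <= ball p r" "!!x. x ~: S ==> eta x = (0::real)"
 shows "(LBINT x. indicator E x * eta' x c) = (LINT y|slab nu. eta (graph_map y) * ((nu - D y) \<bullet> c))"
proof -
 define th where "th x = eta (graph_map x)" for x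
 define th' where "th' x h = eta' (graph_map x) (h + (h \<bullet> D x) *\<^sub>R nu)" for x h
 have gm: "c1_deriv graph_map (%x h. h + (h \<bullet> D x) *\<^sub>R nu)"
 unfolding c1_deriv_def graph_map_def using gamma_deriv D_cont by (auto intro!: derivative_eq_intros continuous_intros)
 have thc1: "c1_deriv th th'" unfolding th_def[abs_def] th'_def[abs_def] by (rule c1_deriv_compose[OF gm eta(1)])
 define S' where "S' = (%z. z - ga z *\<^sub>R nu) ` S"
 have S': "compact S'" unfolding S'_def using eta(2) gamma_cont[of S] by (intro compact_continuous_image continuous_intros)
 have th0: "th x = 0" if "x ~: S'" for x
 proof -
 have eq: "graph_map x - ga (graph_map x) *\<^sub>R nu = x" by (simp add: graph_map_def gamma_inv)
 have "graph_map x ~: S"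
 proof
  assume "graph_map x : S"
  hence "graph_map x - ga (graph_map x) *\<^sub>R nu : S'" unfolding S'_def by (rule imageI)
  thus False using that eq by simp
 qed
 thus ?thesis using eta(4) by (simp add: th_def)
 qed
 have thnu: "th' x nu = eta' (graph_map x) nu" for x using D_nu by (simp add: th'_def inner_commute)
 have thc: "eta' (graph_map x) c = th' x c - (c \<bullet> D x) * th' x nu" for x
 unfolding thnu unfolding th'_def by (simp add: linear_add[OF c1_deriv_linear[OF eta(1)]] linear_scale[OF c1_deriv_linear[OF eta(1)]])
 have eta'0: "eta' x h = 0" if "x ~: S" for x h
 using c1_deriv_zero_off_closed[OF eta(1) compact_imp_closed[OF eta(2)] eta(4) that] .
 have ind: "indicator E (graph_map x) * eta' (graph_map x) c = indicator {x. x \<bullet> nu <= 0} x * eta' (graph_map x) c" for x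
 proof (cases "graph_map x : S")
 case True
 hence "graph_map x : ball p r" using eta(3) by blast
 hence "graph_map x : E \<longleftrightarrow> graph_map x \<bullet> nu <= ga (graph_map x)" using E_ball by blast
 also have "... \<longleftrightarrow> x \<bullet> nu <= 0" using nu1 by (simp add: graph_map_def gamma_inv inner_add_left norm_eq_1)
 finally show ?thesis by (simp add: indicator_def)
 qed (simp add: eta'0)
 have eta'm: "(%x. eta' x c) : borel_measurable borel" by (rule borel_measurable_continuous_onI[OF c1_deriv_continuous_deriv[OF eta(1)]])
 \<comment> \<open>A Borel set that agrees with \<open>E\<close> in the ball, hence on the support
   of \<open>eta\<close>; measurability of \<open>E\<close> itself is not assumed here.\<close>
 define EB where "EB = {x : ball p r. x \<bullet> nu <= ga x}"
 have EBm: "EB : sets borel"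
 proof -
 have "EB = ball p r Int {x. x \<bullet> nu <= ga x}" by (auto simp: EB_def)
 moreover have "{x. x \<bullet> nu <= ga x} : sets borel" by measurable
 ultimately show ?thesis by simp
 qed
 have EB: "indicator E x * eta' x c = indicator EB x * eta' x c" for x
 proof (cases "x : S")
 case True
 hence "x : ball p r" using eta(3) by blast
 moreover have "E Int ball p r = EB" using E_ball by (simp only: EB_def)
 ultimately have "x : E \<longleftrightarrow> x : EB" by blast
 thus ?thesis by (simp add: indicator_def)
 qed (simp add: eta'0)
 have "(LBINT x. indicator E x * eta' x c) = (LBINT x. indicator EB x * eta' x c)" by (simp add: EB)
 also have "... = (\<integral>x. indicator EB x * eta' x c \<partial>distr lborel borel (%x. x + ga x *\<^sub>R nu))"
 by (subst lborel_shear[OF nu1 gamma_meas gamma_inv]) simp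
 also have "... = (LBINT x. indicator EB (graph_map x) * eta' (graph_map x) c)"
 using eta'm EBm by (subst integral_distr) (auto simp: graph_map_def)
 also have "... = (LBINT x. indicator {x. x \<bullet> nu <= 0} x * eta' (graph_map x) c)" by (simp only: EB[symmetric] ind)
 also have "... = (LBINT x. indicator {x. x \<bullet> nu <= 0} x * th' x c - indicator {x. x \<bullet> nu <= 0} x * ((c \<bullet> D x) * th' x nu))"
 by (simp add: thc right_diff_distrib)
 also have "... = (LBINT x. indicator {x. x \<bullet> nu <= 0} x * th' x c) - (LBINT x. indicator {x. x \<bullet> nu <= 0} x * ((c \<bullet> D x) * th' x nu))"
 proof (rule Bochner_Integration.integral_diff)
 have z: "th' x h = 0" if "x ~: S'" for x h
  using c1_deriv_zero_off_closed[OF thc1 compact_imp_closed[OF S'] th0 that] .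
 have "integrable lborel (%x. th' x c)" "integrable lborel (%x. (c \<bullet> D x) * th' x nu)"
  using c1_deriv_continuous_deriv[OF thc1] D_cont z
  by (auto intro!: integrable_compact_support[OF _ S'] continuous_intros)
 thus "integrable lborel (%x. indicator {x. x \<bullet> nu <= 0} x * th' x c)"
  "integrable lborel (%x. indicator {x. x \<bullet> nu <= 0} x * ((c \<bullet> D x) * th' x nu))"
  using integrable_mult_indicator[of "{x. x \<bullet> nu <= 0}" lborel "%x. th' x c"]
  integrable_mult_indicator[of "{x. x \<bullet> nu <= 0}" lborel "%x. (c \<bullet> D x) * th' x nu"] by simp_all
 qed
 also have "(LBINT x. indicator {x. x \<bullet> nu <= 0} x * th' x c) = (c \<bullet> nu) * (LINT y|slab nu. th y)"
 by (rule integral_halfspace_deriv[OF thc1 S' th0 nu1])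
 also have "(LBINT x. indicator {x. x \<bullet> nu <= 0} x * ((c \<bullet> D x) * th' x nu)) = (LINT y|slab nu. (c \<bullet> D y) * th y)"
 by (rule integral_halfspace_deriv_normal[OF thc1 S' th0 nu1]) (use D_cont D_inv in \<open>auto intro!: continuous_intros\<close>)
 also have "(c \<bullet> nu) * (LINT y|slab nu. th y) - (LINT y|slab nu. (c \<bullet> D y) * th y) = (LINT y|slab nu. th y * ((nu - D y) \<bullet> c))"
 proof -
 have "integrable (slab nu) th" "integrable (slab nu) (%y. (c \<bullet> D y) * th y)"
  using c1_deriv_continuous[OF thc1] D_cont th0
  by (auto intro!: integrable_slab_continuous[OF nu1 _ S'] continuous_intros)
 hence "(c \<bullet> nu) * (LINT y|slab nu. th y) - (LINT y|slab nu. (c \<bullet> D y) * th y)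
  = (LINT y|slab nu. (c \<bullet> nu) * th y - (c \<bullet> D y) * th y)" by simp
 also have "... = (LINT y|slab nu. th y * ((nu - D y) \<bullet> c))"
  by (intro Bochner_Integration.integral_cong) (auto simp: inner_diff_left inner_commute algebra_simps)
 finally show ?thesis .
 qed
 finally show ?thesis by (simp add: th_def)
qed

lemma nu_minus_D_nonzero: "nu - D x ~= 0"
proof
 assume "nu - D x = 0"
 hence "(nu - D x) \<bullet> nu = 0" by simp
 thus False using D_nu[of x] nu1 by (simp add: inner_diff_left norm_eq_1)
qed

lemma frontier_ball: "z : ball p r ==> z : frontier E \<longleftrightarrow> z \<bullet> nu = ga z"
proof -
 assume z: "z : ball p r"
 have inE: "x : E \<longleftrightarrow> x \<bullet> nu <= ga x" if "x : ball p r" for x using E_ball that by blast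
 have o1: "open ({x. x \<bullet> nu < ga x} Int ball p r)" and o2: "open ({x. ga x < x \<bullet> nu} Int ball p r)"
 using gamma_cont[of UNIV] by (auto intro!: open_Int open_Collect_less continuous_intros)
 show ?thesis
 proof
 assume fr: "z : frontier E"
 show "z \<bullet> nu = ga z"
 proof (rule ccontr)
  assume "z \<bullet> nu ~= ga z"
  then consider "z \<bullet> nu < ga z" | "ga z < z \<bullet> nu" by linarith
  thus False
  proof cases
  case 1
  have "{x. x \<bullet> nu < ga x} Int ball p r <= E" using inE by auto
  hence "z : interior E" using o1 1 z by (intro interiorI[of "{x. x \<bullet> nu < ga x} Int ball p r"]) auto
  thus False using fr by (simp add: frontier_def)
  next
  case 2
  have "{x. ga x < x \<bullet> nu} Int ball p r <= - E" using inE by auto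
  hence "z : interior (- E)" using o2 2 z by (intro interiorI[of "{x. ga x < x \<bullet> nu} Int ball p r"]) auto
  thus False using fr by (simp add: frontier_def interior_complement)
  qed
 qed
 next
 assume eq: "z \<bullet> nu = ga z"
 hence "z : E" using inE[OF z] by simp
 hence "z : closure E" using closure_subset by blast
 moreover have "z ~: interior E"
 proof
  assume "z : interior E"
  then obtain e where e: "0 < e" "ball z e <= E" by (meson mem_interior)
  obtain e2 where e2: "0 < e2" "ball z e2 <= ball p r" using z open_ball open_contains_ball_eq by blast
  define t where "t = min e e2 / 2"
  have t: "0 < t" "t < e" "t < e2" using e e2 by (auto simp: t_def)
  have d: "dist z (z + t *\<^sub>R nu) = t" using t nu1 by (simp add: dist_norm)
  have "z + t *\<^sub>R nu : E" using subsetD[OF e(2), of "z + t *\<^sub>R nu"] d t by simp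
  moreover have "z + t *\<^sub>R nu : ball p r" using subsetD[OF e2(2), of "z + t *\<^sub>R nu"] d t by simp
  ultimately have "(z + t *\<^sub>R nu) \<bullet> nu <= ga (z + t *\<^sub>R nu)" using inE by blast
  thus False using eq t nu1 by (simp add: gamma_inv inner_add_left norm_eq_1)
 qed
 ultimately show "z : frontier E" by (simp add: frontier_def)
 qed
qed

definition normal :: "'a => 'a" where "normal x = sgn (D x - nu)"

text \<open>Surface measure of the graph inside the ball. Since \<open>D y\<close> is orthogonal to
  the unit vector \<open>nu\<close>, \<open>norm (nu - D y)\<close> is the area element sqrt (1 + |D
  y|^2).\<close>

definition bdry_measure :: "'a measure" where
 "bdry_measure = density (distr (density (slab nu) (%y. ennreal (norm (nu - D y)))) borel graph_map) (indicator (ball p r))"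

lemma sets_bdry_measure [simp, measurable_cong]: "sets bdry_measure = sets borel"
 by (simp add: bdry_measure_def)

lemma nn_integral_bdry_measure:
 assumes [measurable]: "F : borel_measurable borel"
 shows "(\<integral>\<^sup>+z. F z \<partial>bdry_measure) = (\<integral>\<^sup>+y. ennreal (norm (nu - D y)) * (indicator (ball p r) (graph_map y) * F (graph_map y)) \<partial>slab nu)"
proof -
 have [measurable]: "ball p r : sets borel" by simp
 show ?thesis unfolding bdry_measure_def
 by (simp add: nn_integral_density nn_integral_distr)
qed

lemma finite_bdry_measure: "finite_measure bdry_measure"
proof (rule finite_measureI)
 obtain R where R: "0 < R" "ball p r <= cball 0 R"
 using bounded_subset_ballD[OF bounded_ball, of p r 0] ball_subset_cball by (meson order_trans)
 have "bounded ((%y. norm (nu - D y)) ` cball 0 R)"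
 using D_cont by (intro compact_imp_bounded compact_continuous_image) (auto intro!: continuous_intros intro: continuous_on_subset)
 then obtain B where B: "0 < B" "!!y. y : cball 0 R ==> norm (nu - D y) <= B" by (auto simp: bounded_pos)
 have sp: "space bdry_measure = UNIV" by (simp add: bdry_measure_def)
 have "emeasure bdry_measure UNIV = (\<integral>\<^sup>+z. 1 \<partial>bdry_measure)" using sp by simp
 also have "... = (\<integral>\<^sup>+y. ennreal (norm (nu - D y)) * (indicator (ball p r) (graph_map y) * 1) \<partial>slab nu)"
 by (rule nn_integral_bdry_measure) simp
 also have "... <= (\<integral>\<^sup>+y. ennreal B * indicator (cball 0 R) y \<partial>slab nu)"
 proof (rule nn_integral_mono_AE)
 show "AE y in slab nu. ennreal (norm (nu - D y)) * (indicator (ball p r) (graph_map y) * 1) <= ennreal B * indicator (cball 0 R) y"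
  using AE_slab_measure[OF nu1]
 proof eventually_elim
  case (elim y)
  show ?case
  proof (cases "graph_map y : ball p r")
  case True
  hence "norm (graph_map y) <= R" using R(2) by auto
  moreover have "proj_along nu (graph_map y) = y" using elim by (simp add: graph_map_def proj_along_shift[OF nu1] proj_along_id)
  ultimately have "norm y <= R" using norm_proj_along_le[OF nu1, of "graph_map y"] by simp
  thus ?thesis using True B(2)[of y] by (simp add: ennreal_leI)
  qed simp
 qed
 qed
 also have "... = ennreal B * emeasure (slab nu) (cball 0 R)" by (rule nn_integral_cmult_indicator) simp
 also have "... < \<infinity>" using emeasure_slab_measure_bounded[OF nu1, of "cball 0 R"] by (simp add: ennreal_mult_less_top)
 finally show "emeasure bdry_measure (space bdry_measure) ~= \<infinity>" using sp by simp
qed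

lemma bdry_measure_off: "emeasure bdry_measure (- (frontier E Int ball p r)) = 0"
proof -
 have m: "- (frontier E Int ball p r) : sets borel" by (intro borel_comp sets.Int) auto
 have "emeasure bdry_measure (- (frontier E Int ball p r)) = (\<integral>\<^sup>+z. indicator (- (frontier E Int ball p r)) z \<partial>bdry_measure)"
 using m by simp
 also have "... = (\<integral>\<^sup>+y. ennreal (norm (nu - D y)) * (indicator (ball p r) (graph_map y) * indicator (- (frontier E Int ball p r)) (graph_map y)) \<partial>slab nu)"
 using m by (intro nn_integral_bdry_measure) auto
 also have "... = (\<integral>\<^sup>+y. 0 \<partial>slab nu)"
 proof (rule nn_integral_cong_AE)
 show "AE y in slab nu. ennreal (norm (nu - D y)) * (indicator (ball p r) (graph_map y) * indicator (- (frontier E Int ball p r)) (graph_map y)) = 0"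
  using AE_slab_measure[OF nu1]
 proof eventually_elim
  case (elim y)
  have "graph_map y \<bullet> nu = ga (graph_map y)" using elim nu1 by (simp add: graph_map_def gamma_inv inner_add_left norm_eq_1)
  thus ?case using frontier_ball[of "graph_map y"] by (auto simp: indicator_def)
 qed
 qed
 finally show ?thesis by simp
qed

lemma bdry_gauss_green:
 assumes eta: "c1_deriv eta eta'" "compact S" "S <= ball p r" "!!x. x ~: S ==> eta x = (0::real)"
 shows "(LBINT x. indicator E x * eta' x c) = - (LINT z|bdry_measure. eta z * (normal z \<bullet> c))"
proof -
 have [measurable]: "eta : borel_measurable borel" by (rule c1_deriv_measurable[OF eta(1)])
 have nm[measurable]: "normal : borel_measurable borel" unfolding normal_def sgn_div_norm by measurable
 have bm[measurable]: "ball p r : sets borel" by simp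
 have ind: "indicator (ball p r) = (%x. ennreal (indicat_real (ball p r) x))" by (simp add: ennreal_indicator fun_eq_iff)
 have "(LINT z|bdry_measure. eta z * (normal z \<bullet> c))
  = (\<integral>z. indicat_real (ball p r) z *\<^sub>R (eta z * (normal z \<bullet> c)) \<partial>distr (density (slab nu) (%y. ennreal (norm (nu - D y)))) borel graph_map)"
 unfolding bdry_measure_def ind by (subst integral_density) auto
 also have "... = (\<integral>y. indicat_real (ball p r) (graph_map y) *\<^sub>R (eta (graph_map y) * (normal (graph_map y) \<bullet> c)) \<partial>density (slab nu) (%y. ennreal (norm (nu - D y))))"
 by (subst integral_distr) auto
 also have "... = (LINT y|slab nu. norm (nu - D y) *\<^sub>R (indicat_real (ball p r) (graph_map y) *\<^sub>R (eta (graph_map y) * (normal (graph_map y) \<bullet> c))))"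
 by (subst integral_density) auto
 also have "... = (LINT y|slab nu. - (eta (graph_map y) * ((nu - D y) \<bullet> c)))"
 proof (rule Bochner_Integration.integral_cong)
 fix y
 have 1: "indicat_real (ball p r) (graph_map y) *\<^sub>R (eta (graph_map y) * (normal (graph_map y) \<bullet> c)) = eta (graph_map y) * (normal (graph_map y) \<bullet> c)"
 proof (cases "graph_map y : ball p r")
  case False
  hence "eta (graph_map y) = 0" using eta(3) eta(4)[of "graph_map y"] by blast
  thus ?thesis by simp
 qed simp
 have "norm (nu - D y) *\<^sub>R normal (graph_map y) = - (nu - D y)"
  using nu_minus_D_nonzero[of y] by (simp add: normal_def graph_map_def D_inv sgn_div_norm norm_minus_commute)
 hence 2: "norm (nu - D y) * (normal (graph_map y) \<bullet> c) = - ((nu - D y) \<bullet> c)" by (metis inner_minus_left inner_scaleR_left)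
 have "norm (nu - D y) *\<^sub>R (eta (graph_map y) * (normal (graph_map y) \<bullet> c))
  = eta (graph_map y) * (norm (nu - D y) * (normal (graph_map y) \<bullet> c))" by simp
 thus "norm (nu - D y) *\<^sub>R (indicat_real (ball p r) (graph_map y) *\<^sub>R (eta (graph_map y) * (normal (graph_map y) \<bullet> c)))
  = - (eta (graph_map y) * ((nu - D y) \<bullet> c))" unfolding 1 2 by simp
 qed simp
 also have "... = - (LBINT x. indicator E x * eta' x c)" using chart_gauss_green[OF eta] by simp
 finally show ?thesis by simp
qed

end

section \<open>Blow-ups, normals and jumps\<close>

text \<open>The dilations of \<open>E\<close> at \<open>z\<close> converge almost everywhere to the
  half space into which \<open>n\<close> points. No chart occurs in this description of the inner
  normal, so it links the normals of different charts, the prescribed field and the jump direction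
  of the indicator.\<close>

definition blowup :: "'a::euclidean_space set => 'a => 'a => bool" where
 "blowup E z n \<longleftrightarrow> norm n = 1 &
 (AE u in lborel. ((%r. indicat_real E (z + r *\<^sub>R u)) \<longlongrightarrow> indicat_real {u. 0 < u \<bullet> n} u) (at_right 0))"

lemma AE_off_hyperplane:
 fixes n :: "'a::euclidean_space"
 assumes "norm n = 1" shows "AE u in lborel. u \<bullet> n ~= 0"
proof -
 have eq: "{x. proj_along n x : UNIV & x \<bullet> n : {0}} = {u. u \<bullet> n = 0}" by auto
 have "emeasure lborel {u. u \<bullet> n = 0} = emeasure (slab n) UNIV * emeasure lborel {0::real}"
 using emeasure_slab_product[OF assms, of UNIV "{0}"] by (simp add: eq)
 hence "{u. u \<bullet> n = 0} : null_sets lborel" by (auto simp: null_sets_def)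
 thus ?thesis by (rule AE_I') auto
qed

lemma AE_on_open:
 fixes B :: "'a::euclidean_space set"
 assumes "AE u in lborel. P u" "open B" "B ~= {}"
 shows "EX u:B. P u"
proof (rule ccontr)
 assume "\<not> ?thesis"
 hence "AE u in lborel. u ~: B" using assms(1) by (auto elim!: eventually_mono)
 hence "B : null_sets lborel" using assms(2) AE_iff_null_sets[of B lborel] by simp
 hence "negligible B" by (simp add: negligible_iff_null_sets null_sets_completionI)
 thus False using open_not_negligible assms by blast
qed

text \<open>Half spaces with different inner normals differ on the open set of points with 0 < u . n
  and u . m < 0, which contains \<open>n - m\<close>.\<close>

lemma blowup_unique:
 assumes "blowup E z n" "blowup E z m"
 shows "n = m"
proof (rule ccontr)
 assume ne: "n ~= m"
 have nm: "norm n = 1" "norm m = 1" using assms by (auto simp: blowup_def)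
 have "AE u in lborel. indicat_real {u. 0 < u \<bullet> n} u = indicat_real {u. 0 < u \<bullet> m} u"
 using assms[unfolded blowup_def, THEN conjunct2]
 proof eventually_elim
 case (elim u)
 show ?case using tendsto_unique[OF trivial_limit_at_right_real elim] by simp
 qed
 moreover have "open {u. 0 < u \<bullet> n & u \<bullet> m < 0}"
 proof -
 have "open ({u. 0 < u \<bullet> n} Int {u. u \<bullet> m < 0})"
  by (intro open_Int open_Collect_less continuous_intros)
 thus ?thesis by (simp add: Int_def)
 qed
 moreover have "n - m : {u. 0 < u \<bullet> n & u \<bullet> m < 0}"
 proof -
 have "n \<bullet> m < 1"
 proof -
  have "0 < (n - m) \<bullet> (n - m)" using ne by simp
  also have "... = 2 - 2 * (n \<bullet> m)" using nm by (simp add: inner_diff_left inner_diff_right norm_eq_1 inner_commute)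
  finally show ?thesis by simp
 qed
 thus ?thesis using nm by (simp add: inner_diff_left norm_eq_1 inner_commute[of m n])
 qed
 ultimately obtain u where "u : {u. 0 < u \<bullet> n & u \<bullet> m < 0}" "indicat_real {u. 0 < u \<bullet> n} u = indicat_real {u. 0 < u \<bullet> m} u"
 using AE_on_open by blast
 thus False by (simp add: indicator_def)
qed

text \<open>First order expansion of \<open>x \<bullet> nu - ga x\<close> at a zero. Along a ray off
  the tangent hyperplane its sign, and with it membership in \<open>E\<close>, is decided for all
  small radii; the hyperplane is a null set.\<close>

lemma (in chart) blowup_normal:
 assumes z: "z : frontier E" "z : ball p r"
 shows "blowup E z (normal z)"
proof -
 have n1: "norm (normal z) = 1"
 using nu_minus_D_nonzero[of z] by (simp add: normal_def norm_sgn)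
 have zg: "z \<bullet> nu = ga z" using frontier_ball[OF z(2)] z(1) by simp
 have un: "u \<bullet> (nu - D z) = - (norm (nu - D z) * (u \<bullet> normal z))" for u
 proof -
 have "nu - D z = - (norm (nu - D z) *\<^sub>R normal z)"
  using nu_minus_D_nonzero[of z] by (simp add: normal_def sgn_div_norm norm_minus_commute)
 thus ?thesis by (metis inner_minus_right inner_scaleR_right)
 qed
 have pos: "0 < norm (nu - D z)" using nu_minus_D_nonzero[of z] by simp
 have lim: "((%s. ((z + s *\<^sub>R u) \<bullet> nu - ga (z + s *\<^sub>R u)) / s) \<longlongrightarrow> u \<bullet> (nu - D z)) (at_right 0)" for u
 proof -
 have "((%s. ga (z + s *\<^sub>R u)) has_real_derivative u \<bullet> D (z + 0 *\<^sub>R u)) (at 0)" by (rule c1_deriv_line[OF gamma_c1])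
 hence "((%s. (z + s *\<^sub>R u) \<bullet> nu - ga (z + s *\<^sub>R u)) has_real_derivative u \<bullet> (nu - D z)) (at 0)"
  by (auto simp: inner_add_left inner_diff_right intro!: derivative_eq_intros)
 hence "((%s. ((z + s *\<^sub>R u) \<bullet> nu - ga (z + s *\<^sub>R u)) / s) \<longlongrightarrow> u \<bullet> (nu - D z)) (at 0)"
  using zg by (simp add: has_field_derivative_iff)
 thus ?thesis by (rule tendsto_within_subset) simp
 qed
 have inb: "\<forall>\<^sub>F s in at_right 0. z + s *\<^sub>R u : ball p r" for u
 proof -
 have "((%s. z + s *\<^sub>R u) \<longlongrightarrow> z + 0 *\<^sub>R u) (at_right 0)" by (intro tendsto_intros)
 thus ?thesis using topological_tendstoD[OF _ open_ball] z(2) by auto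
 qed
 have spos: "\<forall>\<^sub>F s in at_right (0::real). 0 < s" by (simp add: eventually_at_right_less)
 have "AE u in lborel. ((%r. indicat_real E (z + r *\<^sub>R u)) \<longlongrightarrow> indicat_real {u. 0 < u \<bullet> normal z} u) (at_right 0)"
 using AE_off_hyperplane[OF n1]
 proof eventually_elim
 case (elim u)
 show ?case
 proof (cases "0 < u \<bullet> normal z")
  case True
  hence "u \<bullet> (nu - D z) < 0" using un pos by simp
  from order_tendstoD(2)[OF lim this] inb[of u] spos have "\<forall>\<^sub>F s in at_right 0. indicat_real E (z + s *\<^sub>R u) = 1"
  proof eventually_elim
  case (elim s)
  hence "(z + s *\<^sub>R u) \<bullet> nu < ga (z + s *\<^sub>R u)" by (simp add: divide_less_0_iff)
  hence "z + s *\<^sub>R u : E" using E_ball elim(2) by fastforce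
  thus ?case by simp
  qed
  thus ?thesis using True by (simp add: tendsto_eventually)
 next
  case False
  hence "u \<bullet> normal z < 0" using elim by linarith
  hence "0 < u \<bullet> (nu - D z)" using un pos by (simp add: mult_pos_neg)
  from order_tendstoD(1)[OF lim this] inb[of u] spos have "\<forall>\<^sub>F s in at_right 0. indicat_real E (z + s *\<^sub>R u) = 0"
  proof eventually_elim
  case (elim s)
  hence "ga (z + s *\<^sub>R u) < (z + s *\<^sub>R u) \<bullet> nu" by (simp add: zero_less_divide_iff)
  have "z + s *\<^sub>R u ~: E"
  proof
   assume "z + s *\<^sub>R u : E"
   hence "z + s *\<^sub>R u : {x : ball p r. x \<bullet> nu <= ga x}" using E_ball elim(2) by blast
   thus False using \<open>ga (z + s *\<^sub>R u) < (z + s *\<^sub>R u) \<bullet> nu\<close> by simp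
  qed
  thus ?case by simp
  qed
  thus ?thesis using False by (simp add: tendsto_eventually)
 qed
 qed
 thus ?thesis using n1 by (simp add: blowup_def)
qed

lemma inner_unit_normal_blowup:
 assumes "inner_unit_normal E p N"
 shows "blowup E p N"
proof -
 obtain r nu ga w where c: "p : frontier E" "C11_chart E p r nu ga" "GDERIV ga p :> w" "N = sgn (w - nu)"
 using assms by (auto simp: inner_unit_normal_def)
 obtain D where "chart E p r nu ga D" by (rule C11_chart_chart[OF c(2)])
 then interpret chart E p r nu ga D .
 have "(%h. h \<bullet> D p) = (%h. h \<bullet> w)"
 using gamma_deriv[of p] c(3) has_derivative_unique unfolding gderiv_def by blast
 hence "D p = w" by (metis inner_commute vector_eq_rdot)
 thus ?thesis using blowup_normal[OF c(1)] r_pos c(4) by (simp add: normal_def)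
qed

lemma lebesgue_integral_scale:
 fixes H :: "'a::euclidean_space => real"
 assumes H: "H : borel_measurable borel" and r: "0 < r"
 shows "(LBINT y. H y) = r ^ DIM('a) * (LBINT u. H (x + r *\<^sub>R u))"
proof -
 have "(LBINT y. H y) = (\<integral>y. H y \<partial>density (distr lborel borel (%u. x + r *\<^sub>R u)) (%_. ennreal (r ^ DIM('a))))"
 using lborel_affine[of r x] r by simp
 also have "... = (\<integral>y. r ^ DIM('a) *\<^sub>R H y \<partial>distr lborel borel (%u. x + r *\<^sub>R u))"
 using H r by (subst integral_density) auto
 also have "... = (LBINT u. r ^ DIM('a) *\<^sub>R H (x + r *\<^sub>R u))"
 using H by (subst integral_distr) auto
 finally show ?thesis by simp
qed

lemma ball_average_scale:
 fixes v :: "'a::euclidean_space => real"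
 assumes v: "v : borel_measurable borel" and A: "A : sets borel" and r: "0 < r"
 and AB: "!!u. x + r *\<^sub>R u : B \<longleftrightarrow> u : A" and B: "B : sets borel"
 shows "(LINT y:B|lebesgue. \<bar>v y - a\<bar>) / r ^ DIM('a) = (LBINT u. indicator A u * \<bar>v (x + r *\<^sub>R u) - a\<bar>)"
proof -
 have m: "(%y. indicator B y * \<bar>v y - a\<bar>) : borel_measurable borel" using v B by measurable
 have "(LINT y:B|lebesgue. \<bar>v y - a\<bar>) = (LBINT y. indicator B y * \<bar>v y - a\<bar>)"
 using m by (simp add: set_lebesgue_integral_def integral_completion)
 also have "... = r ^ DIM('a) * (LBINT u. indicator B (x + r *\<^sub>R u) * \<bar>v (x + r *\<^sub>R u) - a\<bar>)"
 by (rule lebesgue_integral_scale[OF m r])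
 also have "(%u. indicator B (x + r *\<^sub>R u)) = (indicator A :: 'a => real)" using AB by (auto simp: indicator_def)
 finally show ?thesis using r by (simp add: fun_eq_iff)
qed

lemma blowup_tendsto_integral:
 fixes q :: "'a::euclidean_space => real => real"
 assumes b: "blowup E z n" and E: "E : sets borel"
 and q: "!!t. (%u. q u t) : borel_measurable borel" "!!u t. t : {0, 1} ==> \<bar>q u t\<bar> <= B * indicator (cball 0 R) u"
 shows "((%r. LBINT u. q u (indicat_real E (z + r *\<^sub>R u))) \<longlongrightarrow> (LBINT u. q u (indicat_real {u. 0 < u \<bullet> n} u))) (at_right 0)"
 unfolding tendsto_at_iff_sequentially
proof (intro allI impI)
 fix X :: "nat => real" assume X: "ALL i. X i : {0<..} - {0}" "X \<longlonglongrightarrow> 0"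
 have Xp: "0 < X i" for i using X(1) by auto
 have XF: "filterlim X (at_right 0) sequentially" using X(2) Xp by (auto simp: filterlim_at order_less_imp_not_eq2)
 \<comment> \<open>An indicator takes two values, so \<open>q\<close> may be treated as affine in
   it. This gives measurability and convergence without any continuity of \<open>q\<close> in its
   second argument.\<close>
 have qe: "q u (indicat_real S w) = q u 0 + indicat_real S w * (q u 1 - q u 0)" for u w and S :: "'a set"
 by (simp add: indicator_def)
 show "((%r. LBINT u. q u (indicat_real E (z + r *\<^sub>R u))) \<circ> X) \<longlonglongrightarrow> (LBINT u. q u (indicat_real {u. 0 < u \<bullet> n} u))"
 unfolding comp_def
 proof (rule integral_dominated_convergence[where w = "%u. B * indicator (cball (0::'a) R) u"])
 show "integrable lborel (%u. B * indicator (cball (0::'a) R) u)"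
  using emeasure_bounded_finite[of "cball (0::'a) R"] by (intro integrable_mult_right integrable_real_indicator) auto
 show "(%u. q u (indicat_real {u. 0 < u \<bullet> n} u)) : borel_measurable lborel"
  unfolding qe using q(1) by measurable
 show "(%u. q u (indicat_real E (z + X i *\<^sub>R u))) : borel_measurable lborel" for i
  unfolding qe using q(1) E by measurable
 show "AE u in lborel. norm (q u (indicat_real E (z + X i *\<^sub>R u))) <= B * indicator (cball 0 R) u" for i
  using q(2) by (intro AE_I2) (auto simp: indicator_def)
 show "AE u in lborel. (%i. q u (indicat_real E (z + X i *\<^sub>R u))) \<longlonglongrightarrow> q u (indicat_real {u. 0 < u \<bullet> n} u)"
  using b[unfolded blowup_def, THEN conjunct2]
 proof eventually_elim
  case (elim u)
  have "(%i. indicat_real E (z + X i *\<^sub>R u)) \<longlonglongrightarrow> indicat_real {u. 0 < u \<bullet> n} u"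
  using filterlim_compose[OF elim XF] .
  thus ?case unfolding qe by (intro tendsto_intros)
 qed
 qed
qed

lemma blowup_average_tendsto:
 fixes A :: "'a::euclidean_space set"
 assumes b: "blowup E z n" and E: "E : sets borel" and A: "A : sets borel" "A <= ball 0 1"
 and Br: "!!r u. 0 < r ==> z + r *\<^sub>R u : B r \<longleftrightarrow> u : A" "!!r. B r : sets borel"
 shows "((%r. (LINT y:B r|lebesgue. \<bar>indicat_real E y - a\<bar>) / r ^ DIM('a))
 \<longlongrightarrow> (LBINT u. indicator A u * \<bar>indicat_real {u. 0 < u \<bullet> n} u - a\<bar>)) (at_right 0)"
proof -
 have "((%r. LBINT u. indicator A u * \<bar>indicat_real E (z + r *\<^sub>R u) - a\<bar>)
  \<longlongrightarrow> (LBINT u. indicator A u * \<bar>indicat_real {u. 0 < u \<bullet> n} u - a\<bar>)) (at_right 0)"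
 proof (rule blowup_tendsto_integral[OF b E, where q = "%u t. indicator A u * \<bar>t - a\<bar>" and B = "1 + \<bar>a\<bar>" and R = 1])
 show "(%u. indicator A u * \<bar>t - a\<bar>) : borel_measurable borel" for t using A(1) by measurable
 show "\<bar>indicator A u * \<bar>t - a\<bar>\<bar> <= (1 + \<bar>a\<bar>) * indicator (cball 0 1) u" if "t : {0, 1}" for u t
  using that subsetD[OF A(2), of u] by (auto simp: indicator_def)
 qed
 moreover have "\<forall>\<^sub>F r in at_right 0. (LBINT u. indicator A u * \<bar>indicat_real E (z + r *\<^sub>R u) - a\<bar>)
  = (LINT y:B r|lebesgue. \<bar>indicat_real E y - a\<bar>) / r ^ DIM('a)"
 using eventually_at_right_less[of "0::real"]
 proof eventually_elim
 case (elim r)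
 show ?case using ball_average_scale[OF _ A(1) elim Br(1)[OF elim] Br(2), of "indicat_real E" a] E by simp
 qed
 ultimately show ?thesis by (rule Lim_transform_eventually)
qed

text \<open>The averages converge to the integral of the same expression for the half space. If that
  is zero, the half space indicator equals \<open>a\<close> almost everywhere on \<open>A\<close>,
  hence at some point of every nonempty open subset.\<close>

lemma blowup_average_zero:
 fixes A :: "'a::euclidean_space set"
 assumes b: "blowup E z n" and E: "E : sets borel" and A: "A : sets borel" "A <= ball 0 1"
 and Br: "!!r u. 0 < r ==> z + r *\<^sub>R u : B r \<longleftrightarrow> u : A" "!!r. B r : sets borel"
 and lim: "((%r. (LINT y:B r|lebesgue. \<bar>indicat_real E y - a\<bar>) / r ^ DIM('a)) \<longlongrightarrow> 0) (at_right 0)"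
 and U: "open U" "U ~= {}" "U <= A"
 shows "EX u:U. indicat_real {u. 0 < u \<bullet> n} u = a"
proof -
 have "(LBINT u. indicator A u * \<bar>indicat_real {u. 0 < u \<bullet> n} u - a\<bar>) = 0"
 using tendsto_unique[OF trivial_limit_at_right_real blowup_average_tendsto[OF b E A Br] lim] .
 moreover have i: "integrable lborel (%u. indicator A u * \<bar>indicat_real {u. 0 < u \<bullet> n} u - a\<bar>)"
 proof (rule Bochner_Integration.integrable_bound[of _ "%u. (1 + \<bar>a\<bar>) * indicator (cball (0::'a) 1) u"])
 show "integrable lborel (%u. (1 + \<bar>a\<bar>) * indicator (cball (0::'a) 1) u)"
  using emeasure_bounded_finite[of "cball (0::'a) 1"] by (intro integrable_mult_right integrable_real_indicator) auto
 show "(%u. indicator A u * \<bar>indicat_real {u. 0 < u \<bullet> n} u - a\<bar>) : borel_measurable lborel" using A(1) by measurable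
 show "AE u in lborel. norm (indicator A u * \<bar>indicat_real {u. 0 < u \<bullet> n} u - a\<bar>) <= norm ((1 + \<bar>a\<bar>) * indicator (cball (0::'a) 1) u)"
 proof (rule AE_I2)
  fix u :: 'a show "norm (indicator A u * \<bar>indicat_real {u. 0 < u \<bullet> n} u - a\<bar>) <= norm ((1 + \<bar>a\<bar>) * indicator (cball (0::'a) 1) u)"
  using subsetD[OF A(2), of u] by (auto simp: indicator_def)
 qed
 qed
 ultimately have "AE u in lborel. indicator A u * \<bar>indicat_real {u. 0 < u \<bullet> n} u - a\<bar> = 0"
 using integral_nonneg_eq_0_iff_AE[OF i] by simp
 from AE_on_open[OF this U(1,2)] obtain u where "u : U" "indicator A u * \<bar>indicat_real {u. 0 < u \<bullet> n} u - a\<bar> = 0" by blast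
 thus ?thesis using U(3) by (auto simp: indicator_def split: if_splits)
qed

definition half_ball :: "'a::euclidean_space => 'a set" where
 "half_ball nu = {u : ball 0 1. 0 < u \<bullet> nu}"

lemma half_ball_scale: "0 < r ==> x + r *\<^sub>R u : {y : ball x r. (y - x) \<bullet> nu > 0} \<longleftrightarrow> u : half_ball nu"
 by (simp add: half_ball_def dist_norm zero_less_mult_iff)

lemma half_ball_sets [simp]: "half_ball nu : sets borel" "{y : ball x r. (y - x) \<bullet> nu > 0} : sets borel" "open (half_ball nu)"
proof -
 have "open (ball 0 1 Int {u. 0 < u \<bullet> nu})" "open (ball x r Int {y. 0 < (y - x) \<bullet> nu})"
 by (intro open_Int open_Collect_less continuous_intros open_ball)+
 hence "open (half_ball nu)" "open {y : ball x r. (y - x) \<bullet> nu > 0}"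
 by (simp_all add: half_ball_def Int_def)
 thus "half_ball nu : sets borel" "{y : ball x r. (y - x) \<bullet> nu > 0} : sets borel" "open (half_ball nu)" by auto
qed

lemma half_ball_subset: "half_ball nu <= ball 0 1" by (auto simp: half_ball_def)

lemma blowup_halfspace_limit:
 assumes b: "blowup E z n" and E: "E : sets borel"
 shows "approx_halfspace_limit (indicat_real E) z n 1" "approx_halfspace_limit (indicat_real E) z (- n) 0"
proof -
 note t = blowup_average_tendsto[OF b E half_ball_sets(1) half_ball_subset half_ball_scale half_ball_sets(2)]
 have "(LBINT u. indicator (half_ball n) u * \<bar>indicat_real {u. 0 < u \<bullet> n} u - 1\<bar>) = (LINT u|(lborel :: 'a measure). 0)"
 by (intro Bochner_Integration.integral_cong) (auto simp: half_ball_def indicator_def)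
 thus "approx_halfspace_limit (indicat_real E) z n 1" using t[of n 1] by (simp add: approx_halfspace_limit_def)
 have "(LBINT u. indicator (half_ball (- n)) u * \<bar>indicat_real {u. 0 < u \<bullet> n} u - 0\<bar>) = (LINT u|(lborel :: 'a measure). 0)"
 by (intro Bochner_Integration.integral_cong) (auto simp: half_ball_def indicator_def)
 thus "approx_halfspace_limit (indicat_real E) z (- n) 0" using t[of "- n" 0] by (simp add: approx_halfspace_limit_def)
qed

lemma half_ball_meets:
 assumes "norm nu = 1" "norm n = 1" "nu ~= n" "nu ~= - n"
 shows "half_ball nu Int {u. 0 < u \<bullet> n} ~= {}" "half_ball nu Int {u. u \<bullet> n < 0} ~= {}"
proof -
 have q: "nu \<bullet> nu = 1" "n \<bullet> n = 1" using assms by (auto simp: norm_eq_1)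
 have "0 < (nu - n) \<bullet> (nu - n)" "0 < (nu + n) \<bullet> (nu + n)" using assms(3,4) by (auto simp: add_eq_0_iff2)
 hence lt: "nu \<bullet> n < 1" "- 1 < nu \<bullet> n" using q by (simp_all add: inner_diff_left inner_diff_right inner_add_left inner_add_right inner_commute)
 \<comment> \<open>The factor 1/3 brings the sum and the difference, of norm at most 2, into the
   open unit ball.\<close>
 have small: "norm ((1/3::real) *\<^sub>R (nu + n)) < 1" "norm ((1/3::real) *\<^sub>R (nu - n)) < 1"
 using norm_triangle_ineq[of nu n] norm_triangle_ineq4[of nu n] assms(1,2) by auto
 have "(1/3) *\<^sub>R (nu + n) : half_ball nu Int {u. 0 < u \<bullet> n}"
 using small lt q by (simp add: half_ball_def inner_add_left inner_commute[of n nu])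
 thus "half_ball nu Int {u. 0 < u \<bullet> n} ~= {}" by blast
 have "(1/3) *\<^sub>R (nu - n) : half_ball nu Int {u. u \<bullet> n < 0}"
 using small lt q by (simp add: half_ball_def inner_diff_left inner_commute[of n nu])
 thus "half_ball nu Int {u. u \<bullet> n < 0} ~= {}" by blast
qed

lemma half_ball_nonempty: "norm nu = 1 ==> half_ball nu ~= {}"
proof -
 assume nu: "norm nu = 1"
 hence "nu \<bullet> nu = 1" by (simp add: norm_eq_1)
 hence "(1/2) *\<^sub>R nu : half_ball nu" using nu by (simp add: half_ball_def)
 thus ?thesis by blast
qed

text \<open>A half ball with axis other than \<open>n\<close> and \<open>- n\<close> meets both
  sides of the hyperplane orthogonal to \<open>n\<close> in open sets, so its one-sided limit would
  have to be 1 and 0 at once.\<close>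

lemma blowup_halfspace_value:
 assumes b: "blowup E z n" and E: "E : sets borel" and nu: "norm nu = 1" and l: "approx_halfspace_limit (indicat_real E) z nu a"
 shows "nu = n & a = 1 \<or> nu = - n & a = 0"
proof -
 have n: "norm n = 1" using b by (simp add: blowup_def)
 have Z: "EX u:U. indicat_real {u. 0 < u \<bullet> n} u = a" if "open U" "U ~= {}" "U <= half_ball nu" for U
 by (rule blowup_average_zero[OF b E half_ball_sets(1) half_ball_subset _ half_ball_sets(2) l[unfolded approx_halfspace_limit_def] that])
  (rule half_ball_scale)
 have o: "open {u. 0 < u \<bullet> n}" "open {u. u \<bullet> n < 0}" by (auto intro!: open_Collect_less continuous_intros)
 show ?thesis
 proof (cases "nu = n \<or> nu = - n")
 case True
 obtain u where u: "u : half_ball nu" "indicat_real {u. 0 < u \<bullet> n} u = a"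
  using Z[OF half_ball_sets(3) half_ball_nonempty[OF nu] order_refl] by blast
 show ?thesis using True u by (auto simp: half_ball_def indicator_def split: if_splits)
 next
 case False
 hence ne: "nu ~= n" "nu ~= - n" by auto
 obtain u where "u : half_ball nu Int {u. 0 < u \<bullet> n}" "indicat_real {u. 0 < u \<bullet> n} u = a"
  using Z[OF open_Int[OF half_ball_sets(3) o(1)] half_ball_meets(1)[OF nu n ne] Int_lower1] by blast
 moreover obtain u' where "u' : half_ball nu Int {u. u \<bullet> n < 0}" "indicat_real {u. 0 < u \<bullet> n} u' = a"
  using Z[OF open_Int[OF half_ball_sets(3) o(2)] half_ball_meets(2)[OF nu n ne] Int_lower1] by blast
 ultimately show ?thesis by (auto simp: indicator_def split: if_splits)
 qed
qed

lemma blowup_jump_vector: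
 assumes b: "blowup E z n" and E: "E : sets borel"
 shows "jump_vector (indicat_real E) z = n"
proof -
 have n: "norm n = 1" "n ~= 0" using b by (auto simp: blowup_def)
 have j: "approx_jump (indicat_real E) z 1 0 n" using blowup_halfspace_limit[OF b E] n by (simp add: approx_jump_def)
 have "(THE w. EX a c nu. approx_jump (indicat_real E) z a c nu & w = (a - c) *\<^sub>R nu) = n"
 proof (rule the_equality)
 show "EX a c nu. approx_jump (indicat_real E) z a c nu & n = (a - c) *\<^sub>R nu" using j by (intro exI[of _ 1] exI[of _ 0] exI[of _ n]) auto
 fix w assume "EX a c nu. approx_jump (indicat_real E) z a c nu & w = (a - c) *\<^sub>R nu"
 then obtain a c nu where *: "approx_jump (indicat_real E) z a c nu" "w = (a - c) *\<^sub>R nu" by blast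
 hence nu: "norm nu = 1" "norm (- nu) = 1" and l: "approx_halfspace_limit (indicat_real E) z nu a" "approx_halfspace_limit (indicat_real E) z (- nu) c"
  by (auto simp: approx_jump_def)
 have "n ~= - n" using n by (simp add: eq_neg_iff_add_eq_0 scaleR_2[symmetric])
 thus "w = n"
  using blowup_halfspace_value[OF b E nu(1) l(1)] blowup_halfspace_value[OF b E nu(2) l(2)] *(2) by auto
 qed
 thus ?thesis using j unfolding jump_vector_def by auto
qed

lemma blowup_no_approx_limit:
 assumes b: "blowup E z n" and E: "E : sets borel"
 shows "\<not> approx_limit (indicat_real E) z a"
proof
 assume l: "approx_limit (indicat_real E) z a"
 have n: "norm n = 1" "norm (- n) = 1" using b by (auto simp: blowup_def)
 have sc: "z + r *\<^sub>R u : ball z r \<longleftrightarrow> u : ball 0 1" if "0 < r" for r u using that by (simp add: dist_norm)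
 have bs: "ball z r : sets borel" "ball (0::'a) 1 : sets borel" for r by auto
 have Z: "EX u:U. indicat_real {u. 0 < u \<bullet> n} u = a" if "open U" "U ~= {}" "U <= ball 0 1" for U
 by (rule blowup_average_zero[OF b E bs(2) order_refl _ bs(1) l[unfolded approx_limit_def] that]) (rule sc)
 obtain u where "u : half_ball n" "indicat_real {u. 0 < u \<bullet> n} u = a"
 using Z[OF half_ball_sets(3) half_ball_nonempty[OF n(1)] half_ball_subset] by blast
 moreover obtain u' where "u' : half_ball (- n)" "indicat_real {u. 0 < u \<bullet> n} u' = a"
 using Z[OF half_ball_sets(3) half_ball_nonempty[OF n(2)] half_ball_subset] by blast
 ultimately show False by (auto simp: half_ball_def indicator_def split: if_splits)
qed

lemma approx_limit_locally_constant:
 assumes "0 < e" "!!y. y : ball x e ==> v y = a"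
 shows "approx_limit v x a"
proof -
 have "\<forall>\<^sub>F r in at_right 0. (LINT y:ball x r|lebesgue. \<bar>v y - a\<bar>) / r ^ DIM('a) = 0"
 using eventually_at_right_real[OF assms(1)]
 proof eventually_elim
 case (elim r)
 have "(LINT y:ball x r|lebesgue. \<bar>v y - a\<bar>) = (LINT y:ball x r|lebesgue. 0)"
  unfolding set_lebesgue_integral_def using elim assms(2)
  by (intro Bochner_Integration.integral_cong) (auto simp: indicator_def)
 thus ?case by simp
 qed
 thus ?thesis unfolding approx_limit_def by (simp add: tendsto_eventually)
qed

lemma approx_limit_off_frontier:
 assumes "x ~: frontier E"
 shows "EX a. approx_limit (indicat_real E) x a"
proof -
 consider "x : interior E" | "x : interior (- E)"
 using assms closure_subset[of E] interior_complement[of E] by (auto simp: frontier_def)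
 thus ?thesis
 proof cases
 case 1
 then obtain e where "0 < e" "ball x e <= E" by (meson mem_interior)
 thus ?thesis by (intro exI[of _ 1] approx_limit_locally_constant[of e]) auto
 next
 case 2
 then obtain e where "0 < e" "ball x e <= - E" by (meson mem_interior)
 thus ?thesis by (intro exI[of _ 0] approx_limit_locally_constant[of e]) (auto simp: indicator_def)
 qed
qed

lemma singular_set_indicator:
 assumes "frontier E <= Om" "E : sets borel" "!!z. z : frontier E ==> blowup E z (n z)"
 shows "singular_set Om (indicat_real E) = frontier E"
 unfolding singular_set_def
 using assms approx_limit_off_frontier[of _ E] blowup_no_approx_limit by blast

section \<open>Perimeter measure and Hausdorff measure\<close>

lemma integrable_times_unit_inner:
 fixes G :: "'a::euclidean_space measure" and n :: "'a => 'a"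
 assumes "finite_measure G" and G: "sets G = sets borel" and n: "n : borel_measurable borel" "AE z in G. norm (n z) = 1"
 and f: "f : borel_measurable borel" "!!x. \<bar>f x\<bar> <= B"
 shows "integrable G (%z. f z * (n z \<bullet> c))"
proof -
 interpret finite_measure G by fact
 show ?thesis
 proof (rule integrable_const_bound[of _ "B * norm c"])
 show "(%z. f z * (n z \<bullet> c)) : borel_measurable G"
  unfolding measurable_cong_sets[OF G refl] using f(1) n(1) by measurable
 show "AE z in G. norm (f z * (n z \<bullet> c)) <= B * norm c"
  using n(2)
 proof eventually_elim
  case (elim z)
  have "\<bar>n z \<bullet> c\<bar> <= norm c" using Cauchy_Schwarz_ineq2[of "n z" c] elim by simp
  moreover have "0 <= B" using f(2)[of z] by linarith
  ultimately have "\<bar>f z\<bar> * \<bar>n z \<bullet> c\<bar> <= B * norm c" using f(2)[of z] by (intro mult_mono) auto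
  thus ?case by (simp add: abs_mult)
 qed
 qed
qed

text \<open>In the open set \<open>b\<close> the distributional derivative of the indicator of \<open>E\<close> is \<open>n \<cdot> G\<close>.\<close>

locale perim =
 fixes b E :: "'a::euclidean_space set" and G :: "'a measure" and n :: "'a => 'a"
 assumes b_open: "open b" and E_sets: "E : sets borel" and G_fin: "finite_measure G" and G_sets: "sets G = sets borel"
 and G_off: "emeasure G (- (frontier E Int b)) = 0" and n_cont: "continuous_on UNIV n"
 and n_blowup: "!!z. z : frontier E ==> z : b ==> blowup E z (n z)"
 and gauss_green: "!!(eta :: 'a => real) eta' S c. c1_deriv eta eta' ==> compact S ==> S <= b ==> (!!x. x ~: S ==> eta x = 0) ==>
  (LBINT x. indicator E x * eta' x c) = - (LINT z|G. eta z * (n z \<bullet> c))"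
begin

sublocale finite_measure G by (rule G_fin)

lemma n_meas: "n : borel_measurable borel" by (rule borel_measurable_continuous_onI[OF n_cont])

lemma space_G: "space G = UNIV" using sets_eq_imp_space_eq[OF G_sets] by simp

lemma measurable_G: "f : borel_measurable borel ==> f : borel_measurable G"
 using G_sets by (simp cong: measurable_cong_sets)

lemma frontier_sets: "frontier E Int b : sets borel" using b_open by (intro sets.Int) auto

lemma AE_frontier: "AE z in G. z : frontier E Int b"
 by (rule AE_I[OF _ G_off]) (use borel_comp[OF frontier_sets] G_sets in \<open>auto simp del: Compl_Int\<close>)

lemma n_norm: "z : frontier E ==> z : b ==> norm (n z) = 1" using n_blowup by (auto simp: blowup_def)

lemma AE_n_norm: "AE z in G. norm (n z) = 1"
 using AE_frontier by eventually_elim (auto simp: n_norm)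

lemma integrable_G_bounded:
 assumes "f : borel_measurable borel" "!!x. \<bar>f x\<bar> <= B"
 shows "integrable G (%z. f z * (n z \<bullet> c))"
 using G_fin G_sets n_meas AE_n_norm assms by (rule integrable_times_unit_inner)

text \<open>Gauss-Green for a bump shrunk to radius \<open>r\<close> at \<open>z\<close>, tested in
  the direction of the normal at \<open>z\<close>. After rescaling, the volume integral tends to the
  integral of the bump over the tangent hyperplane, which is at least the slab measure of a ball of
  radius \<open>rho\<close> slightly below 1. On the other side the bump is at most the indicator of
  the ball and the normals have inner product at most 1.\<close>

lemma lower_density:
 assumes z: "z : frontier E" "z : b" and c: "c < unit_ball_vol (real (DIM('a) - 1))"
 shows "\<forall>\<^sub>F r in at_right 0. c * r ^ (DIM('a) - 1) <= measure G (cball z r) & cball z r <= b"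
proof -
 define n1 where "n1 = DIM('a) - 1"
 define om where "om = unit_ball_vol (real n1)"
 define e where "e = n z"
 have bl: "blowup E z e" using n_blowup[OF z] by (simp add: e_def)
 have e1: "norm e = 1" "norm (- e) = 1" using bl by (auto simp: blowup_def)
 have "((%rho. om * rho ^ n1) \<longlongrightarrow> om * 1 ^ n1) (at_left 1)" by (intro tendsto_intros)
 hence "\<forall>\<^sub>F rho in at_left 1. c < om * rho ^ n1" using c by (intro order_tendstoD(1)) (auto simp: om_def n1_def)
 moreover have "\<forall>\<^sub>F rho in at_left (1::real). rho : {0<..<1}" by (rule eventually_at_left_real) simp
 ultimately have "\<forall>\<^sub>F rho in at_left (1::real). rho : {0<..<1} & c < om * rho ^ n1" by eventually_elim auto
 then obtain rho where rho: "0 < rho" "rho < 1" "c < om * rho ^ n1"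
 using eventually_happens[of _ "at_left (1::real)"] by (auto simp: trivial_limit_at_left_real)
 obtain eta :: "'a => real" and eta' where eta: "c1_deriv eta eta'" "!!x. 0 <= eta x" "!!x. eta x <= 1"
 "!!x. x : cball 0 rho ==> eta x = 1" "!!x. x ~: ball 0 1 ==> eta x = 0"
 by (rule c1_bump_ball[OF rho(1,2), of 0]) (rule that)
 have eta0: "eta x = 0" if "x ~: cball 0 1" for x using eta(5)[of x] that by auto
 have eta'0: "eta' x h = 0" if "x ~: cball 0 1" for x h
 using c1_deriv_zero_off_closed[OF eta(1) closed_cball eta0 that] .
 define L where "L = (LINT y|slab (- e). eta y)"
 have etasi: "integrable (slab (- e)) eta"
 by (rule integrable_slab_continuous[OF e1(2) c1_deriv_continuous[OF eta(1)] compact_cball eta0])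
 have "ennreal (om * rho ^ n1) = (\<integral>\<^sup>+y. indicator (cball 0 rho) y \<partial>slab (- e))"
 using emeasure_slab_cball[OF e1(2) rho(1)] by (simp add: om_def n1_def)
 also have "... <= (\<integral>\<^sup>+y. ennreal (eta y) \<partial>slab (- e))"
 using eta(4) by (intro nn_integral_mono) (auto simp: indicator_def)
 also have "... = ennreal L" unfolding L_def using etasi eta(2) by (intro nn_integral_eq_integral) auto
 finally have L: "om * rho ^ n1 <= L" by (subst (asm) ennreal_le_iff) (auto simp: L_def eta(2) intro!: integral_nonneg_AE)
 \<comment> \<open>The Gauss-Green integral of the shrunken bump, brought back to unit
   scale.\<close>
 define J where "J r = (LBINT u. - indicat_real E (z + r *\<^sub>R u) * eta' u e)" for r
 have eta'm: "(%u. eta' u e) : borel_measurable borel" by (rule borel_measurable_continuous_onI[OF c1_deriv_continuous_deriv[OF eta(1)]])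
 have "(J \<longlongrightarrow> (LBINT u. - indicat_real {u. 0 < u \<bullet> e} u * eta' u e)) (at_right 0)"
 proof -
 obtain B where B: "0 < B" "!!u. norm (eta' u e) <= B"
  by (rule bounded_compact_support[OF c1_deriv_continuous_deriv[OF eta(1)] compact_cball eta'0]) (assumption, rule that)
 show ?thesis unfolding J_def
 proof (rule blowup_tendsto_integral[OF bl E_sets, where q = "%u t. - t * eta' u e" and B = B and R = 1])
  show "(%u. - t * eta' u e) : borel_measurable borel" for t using eta'm by measurable
  show "\<bar>- t * eta' u e\<bar> <= B * indicator (cball 0 1) u" if "t : {0, 1}" for u t
  using that B(2)[of u] eta'0[of u e] B(1) by (auto simp: indicator_def)
 qed
 qed
 moreover have "(LBINT u. - indicat_real {u. 0 < u \<bullet> e} u * eta' u e) = L"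
 proof -
 have "(LBINT u. - indicat_real {u. 0 < u \<bullet> e} u * eta' u e) = (LBINT u. indicat_real {u. u \<bullet> (- e) <= 0} u * eta' u (- e))"
 proof (rule integral_cong_AE)
  have "(%u. eta' u (- e)) : borel_measurable borel" by (rule borel_measurable_continuous_onI[OF c1_deriv_continuous_deriv[OF eta(1)]])
  thus "(%u. indicat_real {u. u \<bullet> (- e) <= 0} u * eta' u (- e)) : borel_measurable lborel" by measurable
  show "(%u. - indicat_real {u. 0 < u \<bullet> e} u * eta' u e) : borel_measurable lborel" using eta'm by measurable
  show "AE u in lborel. - indicat_real {u. 0 < u \<bullet> e} u * eta' u e = indicat_real {u. u \<bullet> (- e) <= 0} u * eta' u (- e)"
  using AE_off_hyperplane[OF e1(1)]
  proof eventually_elim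
  case (elim u)
  thus ?case by (auto simp: indicator_def linear_neg[OF c1_deriv_linear[OF eta(1)]])
  qed
 qed
 also have "... = ((- e) \<bullet> (- e)) * L" unfolding L_def by (rule integral_halfspace_deriv[OF eta(1) compact_cball eta0 e1(2)])
 also have "... = L" using e1 by (simp add: norm_eq_1)
 finally show ?thesis .
 qed
 ultimately have "(J \<longlongrightarrow> L) (at_right 0)" by simp
 hence ev1: "\<forall>\<^sub>F r in at_right 0. c < J r" by (rule order_tendstoD(1)) (use rho(3) L in linarith)
 obtain r0 where r0: "0 < r0" "cball z r0 <= b" using b_open z(2) open_contains_cball_eq by blast
 have ev2: "\<forall>\<^sub>F r in at_right 0. r : {0<..<r0}" using r0(1) by (rule eventually_at_right_real)
 show ?thesis using ev1 ev2
 proof eventually_elim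
 case (elim r)
 hence r: "0 < r" "cball z r <= b" using r0(2) by (auto simp: subset_iff)
 define th where "th x = eta ((1/r) *\<^sub>R (x - z))" for x
 define th' where "th' x h = eta' ((1/r) *\<^sub>R (x - z)) ((1/r) *\<^sub>R h)" for x h
 have aff: "c1_deriv (%x. (1/r) *\<^sub>R (x - z)) (%_ h. (1/r) *\<^sub>R h)"
  by (auto simp: c1_deriv_def intro!: derivative_eq_intros)
 have thc1: "c1_deriv th th'" unfolding th_def[abs_def] th'_def[abs_def] by (rule c1_deriv_compose[OF aff eta(1)])
 have th0: "th x = 0" if "x ~: cball z r" for x
 proof -
  have "r < norm (x - z)" using that by (simp add: dist_norm norm_minus_commute)
  hence "1 < norm ((1/r) *\<^sub>R (x - z))" using r by simp
  thus ?thesis unfolding th_def by (intro eta0) simp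
 qed
 have the: "th' x e = eta' ((1/r) *\<^sub>R (x - z)) e / r" for x
  by (simp add: th'_def linear_scale[OF c1_deriv_linear[OF eta(1)]])
 have m: "(%x. indicator E x * (eta' ((1/r) *\<^sub>R (x - z)) e / r)) : borel_measurable borel"
 proof -
  have "(%x. eta' ((1/r) *\<^sub>R (x - z)) e) : borel_measurable borel" using eta'm by measurable
  thus ?thesis using E_sets by measurable
 qed
 have "(LBINT x. indicator E x * th' x e) = r ^ DIM('a) * (LBINT u. indicator E (z + r *\<^sub>R u) * (eta' ((1/r) *\<^sub>R (z + r *\<^sub>R u - z)) e / r))"
  unfolding the by (rule lebesgue_integral_scale[OF m r(1)])
 also have "... = r ^ DIM('a) * (- (J r) / r)" using r(1) by (simp add: J_def)
 also have "r ^ DIM('a) = r * r ^ n1" unfolding n1_def using DIM_positive[where 'a='a] by (metis Suc_pred' power_Suc)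
 finally have "(LBINT x. indicator E x * th' x e) = - (r ^ n1 * J r)" using r(1) by simp
 hence eq: "r ^ n1 * J r = (LINT y|G. th y * (n y \<bullet> e))"
  using gauss_green[OF thc1 compact_cball r(2) th0, of e] by simp
 also have "... <= (LINT y|G. indicator (cball z r) y)"
 proof (rule integral_mono_AE)
  have "th : borel_measurable borel" by (rule c1_deriv_measurable[OF thc1])
  thus "integrable G (%y. th y * (n y \<bullet> e))" by (rule integrable_G_bounded[of _ 1]) (use eta(2,3) in \<open>simp add: th_def\<close>)
  show "integrable G (indicat_real (cball z r))" by (intro integrable_real_indicator) (auto simp: G_sets emeasure_eq_measure)
  show "AE y in G. th y * (n y \<bullet> e) <= indicat_real (cball z r) y"
  using AE_n_norm
  proof eventually_elim
  case (elim y)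
  show ?case
  proof (cases "y : cball z r")
   case True
   have "n y \<bullet> e <= 1" using Cauchy_Schwarz_ineq2[of "n y" e] elim e1 by simp
   hence "th y * (n y \<bullet> e) <= th y * 1" using eta(2) by (intro mult_left_mono) (auto simp: th_def)
   also have "... <= 1" using eta(3) by (simp add: th_def)
   finally show ?thesis using True by simp
  qed (simp add: th0)
  qed
 qed
 also have "... = measure G (cball z r)" by (simp add: G_sets)
 finally have "r ^ n1 * J r <= measure G (cball z r)" .
 moreover have "c * r ^ n1 <= r ^ n1 * J r" using elim(1) r(1) by (simp add: mult.commute)
 ultimately show ?case using r(2) by (simp add: n1_def)
 qed
qed

text \<open>Balls whose \<open>G\<close>-mass is at least \<open>c r^(n-1)\<close> are thinned out
  by Vitali's lemma. The disjoint balls have total cost at most \<open>om / c\<close> times the mass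
  of \<open>V\<close>. Only the balls after the first \<open>N\<close> have to be enlarged fivefold
  to cover \<open>B\<close>, and the enlarged tail costs arbitrarily little, so the factor 5 does
  not enter the constant.\<close>

lemma vitali_bound:
 assumes B: "B : sets borel" "B <= frontier E Int b" and c: "0 < c" "c < unit_ball_vol (real (DIM('a) - 1))"
 and de: "0 < de" and V: "open V" "B <= V"
 shows "hausdorff_pre (DIM('a) - 1) de B <= ennreal (unit_ball_vol (real (DIM('a) - 1)) / c) * emeasure G V"
proof -
 define n1 where "n1 = DIM('a) - 1"
 define om where "om = unit_ball_vol (real n1)"
 have om: "0 < om" by (simp add: om_def)
 \<comment> \<open>The bound \<open>10 * r <= de\<close> leaves the fivefold enlarged balls with
   diameter at most \<open>de\<close>.\<close>
 define K where "K = {(x, r). x : B & 0 < r & 10 * r <= de & cball x r <= V & c * r ^ n1 <= measure G (cball x r)}"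
 have Kr: "0 < snd i & snd i <= de / 10" if "i : K" for i using that by (auto simp: K_def)
 obtain C where C: "countable C" "C <= K" "pairwise (%i j. disjnt (cball (fst i) (snd i)) (cball (fst j) (snd j))) C"
 "!!i. i : K ==> EX j. j : C & \<not> disjnt (cball (fst i) (snd i)) (cball (fst j) (snd j)) & cball (fst i) (snd i) <= ball (fst j) (5 * snd j)"
 by (rule Vitali_covering_lemma_cballs_balls[where a = fst and r = snd and K = K and B = "de / 10", OF Kr]) (assumption, rule that)
 define S where "S = to_nat_on C ` C"
 define f where "f = from_nat_into C"
 have fS: "f i : C" if "i : S" for i
 using that C(1) by (auto simp: S_def f_def)
 have finj: "f i ~= f j" if "i : S" "j : S" "i ~= j" for i j
 using that C(1) by (auto simp: S_def f_def)
 define X where "X i = (if i : S then cball (fst (f i)) (snd (f i)) else {})" for i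
 define R where "R i = (if i : S then ennreal (snd (f i) ^ n1) else 0)" for i
 have fK: "0 < snd (f i)" "10 * snd (f i) <= de" "cball (fst (f i)) (snd (f i)) <= V" "c * snd (f i) ^ n1 <= measure G (cball (fst (f i)) (snd (f i)))"
 if "i : S" for i
 using fS[OF that] C(2) by (auto simp: K_def case_prod_unfold)
 have Xs: "X i : sets G" for i by (simp add: X_def G_sets)
 have disj: "disjoint_family X"
 unfolding disjoint_family_on_def
 proof (intro ballI impI)
 fix i j :: nat assume "i ~= j"
 show "X i Int X j = {}"
 proof (cases "i : S & j : S")
  case True
  hence "disjnt (cball (fst (f i)) (snd (f i))) (cball (fst (f j)) (snd (f j)))"
  using C(3) fS finj[of i j] \<open>i ~= j\<close> unfolding pairwise_def by blast
  thus ?thesis using True by (simp add: X_def disjnt_def)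
 qed (auto simp: X_def)
 qed
 have "ennreal c * (\<Sum>i. R i) = (\<Sum>i. ennreal c * R i)" by (rule ennreal_suminf_cmult[symmetric])
 also have "... <= (\<Sum>i. emeasure G (X i))"
 proof (intro suminf_le)
 fix i
 show "ennreal c * R i <= emeasure G (X i)"
  using fK[of i] c(1) by (auto simp: R_def X_def emeasure_eq_measure ennreal_mult[symmetric] ennreal_leI)
 qed auto
 also have "... = emeasure G (\<Union>i. X i)" using Xs disj by (intro suminf_emeasure) auto
 also have "... <= emeasure G V"
 using V(1) fK(3) by (intro emeasure_mono) (auto simp: X_def G_sets split: if_splits)
 finally have cR: "ennreal c * (\<Sum>i. R i) <= emeasure G V" .
 have Rle: "(\<Sum>i. R i) <= ennreal (1 / c) * emeasure G V"
 proof -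
 have "(\<Sum>i. R i) = ennreal (1 / c) * (ennreal c * (\<Sum>i. R i))"
  using c(1) by (simp add: mult.assoc[symmetric] ennreal_mult[symmetric])
 also have "... <= ennreal (1 / c) * emeasure G V" using cR by (rule mult_left_mono) simp
 finally show ?thesis .
 qed
 define u where "u i = ennreal (om * 5 ^ n1) * R i" for i
 have "(\<Sum>i. u i) = ennreal (om * 5 ^ n1) * (\<Sum>i. R i)" unfolding u_def by (rule ennreal_suminf_cmult)
 also have "... < \<infinity>" using Rle by (auto simp: ennreal_mult_less_top emeasure_eq_measure intro: le_less_trans)
 finally have ufin: "(\<Sum>i. u i) < \<infinity>" .
 have "hausdorff_pre n1 de B <= ennreal om * (\<Sum>i. R i) + ennreal e" if e: "0 < e" for e
 proof -
 obtain N where N: "(\<Sum>i. u (i + N)) <= ennreal e" using suminf_tail_ennreal[OF ufin e] by blast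
 define Y where "Y i = (if i < N then X i else if i : S then ball (fst (f i)) (5 * snd (f i)) else {})" for i
 have "delta_cover de B Y"
  unfolding delta_cover_def
 proof (intro conjI allI)
  show "bounded (Y i)" for i by (auto simp: Y_def X_def)
  show "diameter (Y i) <= de" for i using fK(1,2)[of i] de by (auto simp: Y_def X_def)
  show "B <= (\<Union>i. Y i)"
  proof
  fix x assume x: "x : B"
  define Z where "Z = (\<Union>i<N. X i)"
  show "x : (\<Union>i. Y i)"
  proof (cases "x : Z")
   case True
   thus ?thesis by (auto simp: Z_def Y_def)
  next
   case False
   \<comment> \<open>A point off the first \<open>N\<close> closed balls has an admissible ball that
     misses all of them. The selected ball which that one meets has an index of at least
     \<open>N\<close>, and its enlargement contains the point.\<close>
   have "closed Z" unfolding Z_def by (intro closed_UN) (auto simp: X_def)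
   hence "open (V - Z)" using V(1) by (rule open_Diff[rotated])
   moreover have "x : V - Z" using x V(2) False by auto
   ultimately obtain r1 where r1: "0 < r1" "cball x r1 <= V - Z" using open_contains_cball_eq by metis
   have fr: "x : frontier E" "x : b" using x B(2) by auto
   have "\<forall>\<^sub>F r in at_right 0. c * r ^ n1 <= measure G (cball x r) & cball x r <= b"
   unfolding n1_def by (rule lower_density[OF fr c(2)])
   moreover have "\<forall>\<^sub>F r in at_right 0. r : {0<..<min r1 (de/10)}" using r1(1) de by (intro eventually_at_right_real) auto
   ultimately have "\<forall>\<^sub>F r in at_right 0. c * r ^ n1 <= measure G (cball x r) & r : {0<..<min r1 (de/10)}"
   by eventually_elim auto
   then obtain r where r: "c * r ^ n1 <= measure G (cball x r)" "0 < r" "r < r1" "r < de/10"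
   using eventually_happens[of _ "at_right (0::real)"] by (auto simp: trivial_limit_at_right_real)
   have rV: "cball x r <= V - Z" using r1(2) r(3) by (meson cball_subset_cball_iff less_imp_le order_trans subset_cball)
   hence "(x, r) : K" using x r by (auto simp: K_def)
   from C(4)[OF this] obtain j where j: "j : C" "\<not> disjnt (cball x r) (cball (fst j) (snd j))" "cball x r <= ball (fst j) (5 * snd j)" by auto
   define i where "i = to_nat_on C j"
   have i: "i : S" "f i = j" using j(1) C(1) by (auto simp: i_def S_def f_def)
   have "\<not> i < N"
   proof
   assume "i < N"
   hence "cball (fst j) (snd j) <= Z" using i by (auto simp: Z_def X_def)
   thus False using j(2) rV by (auto simp: disjnt_def)
   qed
   hence "x : Y i" using i subsetD[OF j(3), of x] r(2) by (auto simp: Y_def)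
   thus ?thesis by blast
  qed
  qed
 qed
 hence "hausdorff_pre n1 de B <= (\<Sum>i. hausdorff_cost n1 (Y i))" by (rule hausdorff_pre_le)
 also have "... = (\<Sum>i. hausdorff_cost n1 (Y (i + N))) + (\<Sum>i<N. hausdorff_cost n1 (Y i))"
  by (rule suminf_offset) auto
 also have "... <= (\<Sum>i. u (i + N)) + (\<Sum>i<N. ennreal om * R i)"
 proof (intro add_mono suminf_le sum_mono)
  fix i show "hausdorff_cost n1 (Y (i + N)) <= u (i + N)"
  using fK(1)[of "i + N"] om
  by (auto simp: Y_def u_def R_def hausdorff_cost_def om_def[symmetric] ennreal_mult[symmetric] power_mult_distrib intro!: ennreal_leI)
 next
  fix i assume "i : {..<N}"
  thus "hausdorff_cost n1 (Y i) <= ennreal om * R i"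
  using fK(1)[of i] om
  by (auto simp: Y_def X_def R_def hausdorff_cost_def om_def[symmetric] ennreal_mult[symmetric] intro!: ennreal_leI)
 qed auto
 also have "... <= ennreal e + ennreal om * (\<Sum>i. R i)"
 proof (rule add_mono[OF N])
  have "(\<Sum>i<N. ennreal om * R i) <= (\<Sum>i. ennreal om * R i)" by (intro sum_le_suminf) auto
  thus "(\<Sum>i<N. ennreal om * R i) <= ennreal om * (\<Sum>i. R i)" by (simp add: ennreal_suminf_cmult)
 qed
 finally show ?thesis by (simp add: add.commute)
 qed
 hence "hausdorff_pre n1 de B <= ennreal om * (\<Sum>i. R i)" by (rule ennreal_le_epsilon)
 also have "... <= ennreal om * (ennreal (1 / c) * emeasure G V)" using Rle by (rule mult_left_mono) simp
 also have "... = ennreal (om / c) * emeasure G V"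
 using c(1) om by (simp add: mult.assoc[symmetric] ennreal_mult[symmetric])
 finally show ?thesis by (simp add: om_def n1_def)
qed

text \<open>In \<open>vitali_bound\<close>, outer regularity brings the mass of \<open>V\<close>
  within \<open>t\<close> of that of \<open>B\<close>, and \<open>c\<close> is the ball constant
  divided by \<open>1 + t\<close>; then \<open>t\<close> tends to 0.\<close>

lemma hausdorff_le_G:
 assumes B: "B : sets borel" "B <= frontier E Int b"
 shows "hausdorff_outer (DIM('a) - 1) B <= emeasure G B"
proof -
 define om where "om = unit_ball_vol (real (DIM('a) - 1))"
 have om: "0 < om" by (simp add: om_def)
 have "hausdorff_pre (DIM('a) - 1) de B <= emeasure G B" if de: "0 < de" for de
 proof -
 have 1: "hausdorff_pre (DIM('a) - 1) de B <= ennreal ((1 + t) * (measure G B + t))" if t: "0 < t" for t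
 proof -
  have "emeasure G B = (INF U\<in>{U. B <= U & open U}. emeasure G U)"
  by (rule outer_regular[OF G_sets _ B(1)]) (simp add: emeasure_eq_measure)
  moreover have "emeasure G B < ennreal (measure G B + t)" using t by (simp add: emeasure_eq_measure ennreal_lessI)
  ultimately obtain U where U: "B <= U" "open U" "emeasure G U < ennreal (measure G B + t)" by (auto simp: INF_less_iff)
  have "hausdorff_pre (DIM('a) - 1) de B <= ennreal (om / (om / (1 + t))) * emeasure G U"
  unfolding om_def by (rule vitali_bound[OF B _ _ de U(2,1)]) (use t om in \<open>auto simp: om_def field_simps\<close>)
  also have "... <= ennreal (1 + t) * ennreal (measure G B + t)" using t om U(3) by (intro mult_mono) auto
  also have "... = ennreal ((1 + t) * (measure G B + t))" using t by (intro ennreal_mult[symmetric]) auto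
  finally show ?thesis .
 qed
 have "((%t. ennreal ((1 + t) * (measure G B + t))) \<longlongrightarrow> ennreal ((1 + 0) * (measure G B + 0))) (at_right 0)"
  by (intro tendsto_ennrealI tendsto_intros)
 hence "hausdorff_pre (DIM('a) - 1) de B <= ennreal ((1 + 0) * (measure G B + 0))"
  by (rule tendsto_lowerbound) (use eventually_at_right_less[of 0] 1 in \<open>auto elim: eventually_mono\<close>)
 thus ?thesis by (simp add: emeasure_eq_measure)
 qed
 thus ?thesis unfolding hausdorff_outer_def by (intro SUP_least) auto
qed

end

text \<open>The mollified field is built component by component, which yields its derivative and a
  formula for the divergence in terms of \<open>rho'\<close>. Rewriting it as one vector-valued
  average preserves the bound 1 on the norm.\<close>

lemma mollify_field:
 fixes psi :: "'a::euclidean_space => 'a"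
 assumes c: "continuous_on UNIV psi" and Om: "open Om" and K: "compact K" "K <= Om" "!!x. x ~: K ==> psi x = 0"
 and psi1: "!!x. norm (psi x) <= 1" and e: "0 < e"
 obtains ph rho rho' and S :: "'a set" where "test_field Om ph" "!!x. norm (ph x) <= 1" "!!x. norm (ph x - psi x) <= e"
 "c1_deriv rho rho'" "!!x. 0 <= rho x" "integrable lborel rho" "(LBINT x. rho x) = 1" "compact S" "!!x. x ~: S ==> rho x = 0"
 "!!x. divergence ph x = (\<Sum>b\<in>Basis. LBINT y. rho' (x - y) b * (psi y \<bullet> b))"
proof -
 obtain d where d: "0 < d" "!!x y. dist x y < d ==> norm (psi x - psi y) < e"
 by (rule uniform_compact_support[OF c K(1,3) e]) (assumption, rule that)
 obtain d' where d': "0 < d'" "(\<Union>x\<in>K. cball x d') <= Om"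
 by (rule compact_subset_open_imp_cball_epsilon_subset[OF K(1) Om K(2)]) (rule that)
 define m where "m = min d d'"
 have m: "0 < m" "m <= d" "m <= d'" using d(1) d'(1) by (auto simp: m_def)
 obtain rho :: "'a => real" and rho' where rho: "c1_deriv rho rho'" "!!x. 0 <= rho x" "!!x. x ~: ball 0 m ==> rho x = 0"
 "(LBINT x. rho x) = 1" "integrable lborel rho"
 by (rule mollifier_exists[OF m(1)]) (rule that)
 have rho0: "x ~: cball 0 m ==> rho x = 0" for x using rho(3)[of x] by (auto simp del: mem_ball)
 have [measurable]: "rho : borel_measurable borel" using rho(5) by simp
 have [measurable]: "psi : borel_measurable borel" by (rule borel_measurable_continuous_onI[OF c])
 have psii: "integrable lborel (%y. psi y \<bullet> b)" for b
 by (rule integrable_compact_support[OF _ K(1)]) (use c K(3) in \<open>auto intro!: continuous_intros\<close>)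
 define ph where "ph x = (\<Sum>b\<in>Basis. (LBINT y. rho (x - y) * (psi y \<bullet> b)) *\<^sub>R b)" for x
 have iv: "integrable lborel (%y. rho (x - y) *\<^sub>R psi y)" for x by (rule mollify_uniform(1)[OF rho(2,3,5,4) c psi1])
 have ph: "ph x = (LBINT y. rho (x - y) *\<^sub>R psi y)" for x
 unfolding ph_def by (subst (2) euclidean_representation[symmetric]) (simp add: integral_inner_left[OF iv, symmetric])
 have "c1_deriv ph (%x h. \<Sum>b\<in>Basis. (LBINT y. rho (x - y) * (psi y \<bullet> b)) *\<^sub>R 0 + (LBINT y. rho' (x - y) h * (psi y \<bullet> b)) *\<^sub>R b)"
 unfolding ph_def[abs_def]
 by (rule c1_deriv_sum[OF finite_Basis c1_deriv_scaleR[OF convolution_c1_deriv[OF rho(1) compact_cball rho0 psii] c1_deriv_const]])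
 hence c1: "c1_deriv ph (%x h. \<Sum>b\<in>Basis. (LBINT y. rho' (x - y) h * (psi y \<bullet> b)) *\<^sub>R b)" by simp
 define C where "C = {x + y | x y. x : K & y : cball 0 m}"
 have C: "compact C" unfolding C_def by (rule compact_sums[OF K(1) compact_cball])
 have COm: "C <= Om"
 proof
 fix z assume "z : C"
 then obtain x y where "z = x + y" "x : K" "norm y <= m" by (auto simp: C_def)
 hence "x : K" "z : cball x d'" using m(3) by (auto simp: dist_norm)
 thus "z : Om" using d'(2) by blast
 qed
 have off: "ph x = 0" if x: "x ~: C" for x
 proof -
 have "rho (x - y) *\<^sub>R psi y = 0" for y
 proof (cases "y : K")
  case True
  hence "x - y ~: cball 0 m" using x unfolding C_def by (force intro: exI[of _ y] exI[of _ "x - y"])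
  thus ?thesis using rho0 by simp
 qed (simp add: K(3))
 hence "(%y. rho (x - y) *\<^sub>R psi y) = (%_. 0)" by (rule ext)
 thus ?thesis by (simp only: ph integral_zero)
 qed
 show ?thesis
 proof (rule that[OF test_fieldI[OF c1 C COm off] _ _ rho(1,2,5,4) compact_cball rho0])
 fix x
 show "norm (ph x) <= 1" unfolding ph by (rule mollify_uniform(2)[OF rho(2,3,5,4) c psi1])
 show "norm (ph x - psi x) <= e" unfolding ph by (rule mollify_uniform(3)[OF rho(2,3,5,4) c psi1], assumption, rule less_imp_le, rule d(2)) (use m(2) in linarith)
 show "divergence ph x = (\<Sum>b\<in>Basis. LBINT y. rho' (x - y) b * (psi y \<bullet> b))"
  unfolding divergence_c1_deriv[OF c1] by (intro sum.cong) (auto simp: inner_sum_left_Basis)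
 qed
qed

context perim begin

lemma divergence_gauss_green:
 assumes "test_field b ph"
 shows "(LBINT x. indicat_real (E Int b) x * divergence ph x) = - (LINT z|G. ph z \<bullet> n z)"
proof -
 obtain ph' S where ph: "c1_deriv ph ph'" "compact S" "S <= b" "!!x. x ~: S ==> ph x = 0"
 by (rule test_fieldE[OF assms]) (rule that)
 have c: "c1_deriv (%x. ph x \<bullet> i) (%x h. ph' x h \<bullet> i)" for i by (rule c1_deriv_inner_const[OF ph(1)])
 have z: "ph' x h = 0" if "x ~: S" for x h by (rule c1_deriv_zero_off_closed[OF ph(1) compact_imp_closed[OF ph(2)] ph(4) that])
 have z': "ph' x h = 0" if "x ~: b" for x h using that z ph(3) by (metis subsetD)
 have i: "integrable lborel (%x. ph' x i \<bullet> i)" for i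
 by (rule integrable_compact_support[OF _ ph(2)]) (use z c1_deriv_continuous_deriv[OF ph(1)] in \<open>auto intro!: continuous_intros\<close>)
 obtain B where B: "!!x. norm (ph x) <= B"
 using bounded_compact_support[OF c1_deriv_continuous[OF ph(1)] ph(2,4)] by blast
 have m: "(%x. ph x \<bullet> i) : borel_measurable borel" for i
 by (rule c1_deriv_measurable[OF c])
 have le: "\<bar>ph x \<bullet> i\<bar> <= B" if "i : Basis" for x i using Basis_le_norm[OF that, of "ph x"] B[of x] by simp
 have "(LBINT x. indicat_real (E Int b) x * divergence ph x) = (LBINT x. (\<Sum>i\<in>Basis. indicat_real E x * (ph' x i \<bullet> i)))"
 unfolding divergence_c1_deriv[OF ph(1)]
 by (intro Bochner_Integration.integral_cong refl) (use z' in \<open>auto simp: indicator_def intro!: sum.neutral\<close>)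
 also have "... = (\<Sum>i\<in>Basis. \<integral>x. indicat_real E x * (ph' x i \<bullet> i) \<partial>lborel)"
 using integrable_mult_indicator[OF _ i] E_sets by (intro Bochner_Integration.integral_sum) auto
 also have "... = (\<Sum>i\<in>Basis. - (LINT z|G. (ph z \<bullet> i) * (n z \<bullet> i)))"
 by (intro sum.cong refl gauss_green[OF c ph(2,3)]) (simp add: ph(4))
 also have "... = - (LINT z|G. (\<Sum>i\<in>Basis. (ph z \<bullet> i) * (n z \<bullet> i)))"
 unfolding sum_negf by (subst Bochner_Integration.integral_sum) (auto intro!: integrable_G_bounded[OF m le])
 finally show ?thesis by (simp add: euclidean_inner[symmetric])
qed

lemma bv_rep_indicator:
 assumes "emeasure lborel (E Int b) < \<infinity>"
 shows "bv_rep b (indicat_real (E Int b)) G (%x. indicator b x *\<^sub>R n x)"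
proof (rule bv_rep.intro)
 show "integrable lborel (indicat_real (E Int b))" using assms E_sets b_open by auto
 show "emeasure G (- b) = 0" using emeasure_mono[of "- b" "- (frontier E Int b)" G] G_off borel_comp[OF frontier_sets] by (simp add: G_sets del: Compl_Int)
 show "(%x. indicator b x *\<^sub>R n x) : borel_measurable borel" using n_meas b_open by (intro borel_measurable_scaleR borel_measurable_indicator) auto
 show "AE x in G. norm (indicator b x *\<^sub>R n x) = 1" using AE_frontier by eventually_elim (auto simp: n_norm)
 fix ph assume t: "test_field b ph"
 obtain ph' S where ph: "c1_deriv ph ph'" "compact S" "S <= b" "!!x. x ~: S ==> ph x = 0"
 by (rule test_fieldE[OF t]) (rule that)
 have "ph z \<bullet> n z = ph z \<bullet> (indicator b z *\<^sub>R n z)" for z using subsetD[OF ph(3), of z] ph(4)[of z] by (cases "z : S") auto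
 hence "(%z. ph z \<bullet> n z) = (%z. ph z \<bullet> (indicator b z *\<^sub>R n z))" by (rule ext)
 thus "(LBINT x. indicat_real (E Int b) x * divergence ph x) = - (LINT x|G. ph x \<bullet> (indicator b x *\<^sub>R n x))"
 unfolding divergence_gauss_green[OF t] by (simp only:)
qed (use b_open G_fin G_sets in auto)

text \<open>The derivative of the indicator lives on the frontier, a null set, so its absolutely
  continuous part has density 0.\<close>

lemma decomp_indicator:
 assumes "emeasure lborel (E Int b) < \<infinity>" "frontier E Int b : null_sets lborel"
 shows "bv_rep.decomp G (frontier E Int b) (%_. 0)"
proof -
 interpret R: bv_rep b "indicat_real (E Int b)" G "%x. indicator b x *\<^sub>R n x" by (rule bv_rep_indicator[OF assms(1)])
 have "density G (indicator (- (frontier E Int b))) = density lborel (%x. ennreal 0)"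
 proof (rule measure_eqI)
 fix A assume "A : sets (density G (indicator (- (frontier E Int b))))"
 hence A: "A : sets G" by simp
 have c: "- (frontier E Int b) : sets G" unfolding G_sets by (rule borel_comp[OF frontier_sets])
 have "emeasure (density G (indicator (- (frontier E Int b)))) A <= emeasure G (- (frontier E Int b))"
  unfolding emeasure_restricted[OF c A] using c by (intro emeasure_mono) auto
 thus "emeasure (density G (indicator (- (frontier E Int b)))) A = emeasure (density lborel (%x. ennreal 0)) A"
  using G_off A by (simp add: emeasure_density G_sets del: Compl_Int)
 qed (simp add: G_sets)
 thus ?thesis unfolding R.decomp_def using assms(2) by simp
qed

text \<open>The calibration inequality is applied to the indicator itself. The gradient term
  vanishes, and a field close to the normal on a large compact part of the frontier turns the left
  side into almost all of the mass of \<open>G\<close>.\<close>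

lemma G_le_hausdorff:
 assumes f: "emeasure lborel (E Int b) < \<infinity>" "frontier E Int b : null_sets lborel" and n1: "!!x. norm (n x) <= 1"
 shows "measure G (frontier E Int b) <= enn2real (hausdorff_outer (DIM('a) - 1) (frontier E Int b))"
proof -
 interpret R: bv_rep b "indicat_real (E Int b)" G "%x. indicator b x *\<^sub>R n x" by (rule bv_rep_indicator[OF f(1)])
 define N where "N = frontier E Int b"
 define h where "h = enn2real (hausdorff_outer (DIM('a) - 1) N)"
 have hfin: "hausdorff_outer (DIM('a) - 1) N < \<infinity>"
 using hausdorff_le_G[OF frontier_sets order_refl] by (auto simp: N_def emeasure_eq_measure intro: le_less_trans)
 have Nb: "N : sets borel" unfolding N_def by (rule frontier_sets)
 have main: "measure G N <= h + e * (1 + measure G UNIV)" if e: "0 < e" for e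
 proof -
 obtain K where K: "compact K" "K <= N" "measure G (N - K) < e"
  by (rule inner_regular_finite[OF G_fin G_sets Nb e]) (rule that)
 have Kb: "K <= b" using K(2) by (auto simp: N_def)
 obtain th th' V C where th: "c1_deriv th th'" "!!x. 0 <= th x" "!!x. th x <= (1::real)" "open V" "K <= V" "!!x. x : V ==> th x = 1"
  "compact C" "C <= b" "!!x. x ~: C ==> th x = 0"
  by (rule c1_cutoff[OF K(1) b_open Kb]) (rule that)
 have tn: "continuous_on UNIV (%x. th x *\<^sub>R n x)" by (intro continuous_intros n_cont c1_deriv_continuous[OF th(1)])
 have tn1: "norm (th x *\<^sub>R n x) <= 1" for x using th(2,3)[of x] n1[of x] by (auto intro: mult_le_one)
 have tn0: "x ~: C ==> th x *\<^sub>R n x = 0" for x by (simp add: th(9))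
 obtain ph where ph: "test_field b ph" "!!x. norm (ph x) <= 1" "!!x. norm (ph x - th x *\<^sub>R n x) <= e"
  by (rule mollify_field[OF tn b_open th(7,8) tn0 tn1 e]) (assumption, rule that)
 \<comment> \<open>The step fixes 0 and 1, hence every indicator.\<close>
 have "smoothstep (indicat_real A x) = indicat_real A x" for A and x :: 'a by (simp add: smoothstep_def indicator_def)
 hence cal: "(LINT z|G. ph z \<bullet> n z) <= h"
  using R.calibration_inequality[OF decomp_indicator[OF f] frontier_sets _ _ hfin[unfolded N_def] ph(1,2)] divergence_gauss_green[OF ph(1)]
  by (simp add: h_def N_def)
 have phm: "ph : borel_measurable borel"
  by (rule test_fieldE[OF ph(1)]) (rule borel_measurable_continuous_onI[OF c1_deriv_continuous])
 have i: "integrable G (%z. ph z \<bullet> n z)"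
 proof (rule integrable_const_bound[of _ 1])
  show "AE z in G. norm (ph z \<bullet> n z) <= 1"
  by (rule AE_I2) (use ph(2) n1 Cauchy_Schwarz_ineq2 in \<open>auto intro!: order_trans[OF Cauchy_Schwarz_ineq2] mult_le_one\<close>)
 qed (use phm n_meas in \<open>intro measurable_G borel_measurable_inner\<close>)
 have Ks: "K : sets G" using K(1) by (simp add: G_sets borel_compact)
 have "measure G K - e * measure G UNIV = (LINT z|G. indicator K z - e)"
  using Ks by (simp add: space_G emeasure_eq_measure)
 also have "... <= (LINT z|G. ph z \<bullet> n z)"
 proof (rule integral_mono_AE[OF _ i])
  show "integrable G (%z. indicator K z - e)" using Ks by (auto simp: emeasure_eq_measure)
  show "AE z in G. indicator K z - e <= ph z \<bullet> n z"
  using AE_n_norm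
  proof eventually_elim
  case (elim z)
  have "ph z \<bullet> n z = th z * (n z \<bullet> n z) + (ph z - th z *\<^sub>R n z) \<bullet> n z" by (simp add: inner_diff_left)
  moreover have "\<bar>(ph z - th z *\<^sub>R n z) \<bullet> n z\<bar> <= e" using Cauchy_Schwarz_ineq2[of "ph z - th z *\<^sub>R n z" "n z"] ph(3)[of z] elim by simp
  moreover have "n z \<bullet> n z = 1" using elim by (simp add: norm_eq_1)
  moreover have "indicator K z <= th z" using th(2,6)[of z] th(5) by (auto simp: indicator_def)
  ultimately show ?case by simp
  qed
 qed
 finally have "measure G K - e * measure G UNIV <= h" using cal by linarith
 moreover have "measure G N = measure G K + measure G (N - K)" using K(2) Ks Nb by (subst finite_measure_Diff) (auto simp: G_sets)
 ultimately show ?thesis using K(3) by (simp add: algebra_simps)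
 qed
 have "((%e. h + e * (1 + measure G UNIV)) \<longlongrightarrow> h + 0 * (1 + measure G UNIV)) (at_right 0)" by (intro tendsto_intros)
 hence "measure G N <= h + 0 * (1 + measure G UNIV)"
 by (rule tendsto_lowerbound) (use eventually_at_right_less[of "0::real"] main in \<open>auto elim: eventually_mono\<close>)
 thus ?thesis by (simp add: h_def N_def)
qed

text \<open>Hausdorff measure is at most \<open>G\<close> on every Borel subset of the frontier,
  while the converse is known only for the whole frontier in \<open>b\<close>. A strict inequality
  on some subset could not be compensated on the complement, all masses being finite.\<close>

lemma G_eq_hausdorff:
 assumes f: "emeasure lborel (E Int b) < \<infinity>" "frontier E Int b : null_sets lborel" and n1: "!!x. norm (n x) <= 1"
 shows "G = density (hausdorff_measure (DIM('a) - 1)) (indicator (frontier E Int b))"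
proof (rule measure_eqI)
 define N where "N = frontier E Int b"
 note Nb = frontier_sets[folded N_def]
 let ?h = "hausdorff_outer (DIM('a) - 1) :: 'a set => ennreal"
 have le: "?h B <= ennreal (measure G B)" if "B : sets borel" "B <= N" for B
 using hausdorff_le_G[OF that[unfolded N_def]] by (simp add: emeasure_eq_measure)
 have "?h N < \<infinity>" using le[OF Nb order_refl] by (auto intro: le_less_trans)
 hence hN: "ennreal (measure G N) <= ?h N"
 using ennreal_leI[OF G_le_hausdorff[OF f n1]] by (simp add: N_def)
 fix A assume "A : sets G"
 hence A: "A : sets borel" "N Int A : sets borel" "N - A : sets borel" using Nb by (auto simp: G_sets)
 have "measure G N = measure G (N Int A) + measure G (N - A)"
 using A Nb by (subst finite_measure_Union[symmetric]) (auto simp: G_sets Int_Diff_Un)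
 hence "ennreal (measure G (N Int A)) + ennreal (measure G (N - A)) <= ?h N" using hN by simp
 also have "... <= ?h (N Int A) + ?h (N - A)" using hausdorff_outer_Un[of "DIM('a) - 1" "N Int A" "N - A"] by (simp add: Int_Diff_Un)
 also have "... <= ?h (N Int A) + ennreal (measure G (N - A))" using le[OF A(3)] by (intro add_left_mono) auto
 finally have "ennreal (measure G (N Int A)) <= ?h (N Int A)" by (simp add: add.commute[of _ "ennreal (measure G (N - A))"] ennreal_add_left_cancel_le)
 hence 1: "?h (N Int A) = emeasure G (N Int A)" using le[OF A(2)] by (simp add: emeasure_eq_measure antisym)
 have "emeasure G (N Int A) = emeasure G A"
 using AE_frontier A by (intro emeasure_eq_AE) (auto simp: G_sets N_def)
 thus "emeasure G A = emeasure (density (hausdorff_measure (DIM('a) - 1)) (indicator (frontier E Int b))) A"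
 using 1 A Nb by (simp add: emeasure_restricted emeasure_hausdorff_measure N_def)
qed (simp add: G_sets)

end

section \<open>From charts to the whole boundary\<close>

context chart begin

text \<open>The volume-preserving shear carries a hyperplane onto the graph.\<close>

lemma frontier_null: "frontier E Int ball p r : null_sets lborel"
proof (rule null_sets_subset)
 have [measurable]: "ga : borel_measurable borel" by (rule gamma_meas)
 define Z where "Z = {x. x \<bullet> nu = ga x}"
 have Z: "Z : sets borel" unfolding Z_def by measurable
 have sh: "distr lborel borel (%x. x + ga x *\<^sub>R nu) = lborel" by (rule lborel_shear[OF nu1 gamma_meas gamma_inv])
 have "emeasure lborel Z = emeasure (distr lborel borel (%x. x + ga x *\<^sub>R nu)) Z" by (simp only: sh)
 also have "... = emeasure lborel ((%x. x + ga x *\<^sub>R nu) -` Z Int space lborel)" using Z by (intro emeasure_distr) auto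
 also have "(%x. x + ga x *\<^sub>R nu) -` Z Int space lborel = {x. x \<bullet> nu = 0}"
 using nu1 by (auto simp: Z_def inner_add_left gamma_inv norm_eq_1)
 also have "emeasure lborel ... = 0"
 using AE_off_hyperplane[OF nu1] AE_iff_null[of lborel "%x. x \<bullet> nu ~= 0"] by auto
 finally show "Z : null_sets lborel" using Z by auto
 show "frontier E Int ball p r <= Z" using frontier_ball by (auto simp: Z_def)
qed auto

lemma perim_chart:
 assumes "E : sets borel"
 shows "perim (ball p r) E bdry_measure normal"
proof (rule perim.intro)
 show "continuous_on UNIV normal"
 proof -
 have "norm (D x - nu) ~= 0" for x using nu_minus_D_nonzero[of x] by simp
 thus ?thesis unfolding normal_def[abs_def] sgn_div_norm by (intro continuous_intros D_cont) blast
 qed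
qed (use assms finite_bdry_measure bdry_measure_off blowup_normal bdry_gauss_green in auto)

lemma bdry_measure_eq:
 assumes "E : sets borel"
 shows "bdry_measure = density (hausdorff_measure (DIM('a) - 1)) (indicator (frontier E Int ball p r))"
proof (rule perim.G_eq_hausdorff[OF perim_chart[OF assms] _ frontier_null])
 have "emeasure lborel (E Int ball p r) <= emeasure lborel (ball p r)" using assms by (intro emeasure_mono) auto
 also have "... < \<infinity>" using emeasure_bounded_finite[OF bounded_ball] by simp
 finally show "emeasure lborel (E Int ball p r) < \<infinity>" .
 show "norm (normal x) <= 1" for x by (simp add: normal_def norm_sgn)
qed

end

lemma integral_restricted:
 fixes f :: "'a => 'b::{banach, second_countable_topology}"
 assumes "A : sets M" "f : borel_measurable M"
 shows "(LINT z|density M (indicator A). f z) = (LINT z|M. indicator A z *\<^sub>R f z)"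
proof -
 have "density M (indicator A) = density M (%x. ennreal (indicat_real A x))" by (simp add: ennreal_indicator)
 thus ?thesis using assms by (simp add: integral_density)
qed

lemma c1_deriv_local:
 assumes "!!x. EX U g g'. open U & x : U & c1_deriv g g' & (ALL y:U. f y = g y & f' y = g' y)"
 shows "c1_deriv f f'"
 unfolding c1_deriv_def continuous_on_eq_continuous_at[OF open_UNIV]
proof (intro conjI allI ballI)
 fix x h
 obtain U g g' where U: "open U" "x : U" "c1_deriv g g'" "!!y. y : U ==> f y = g y" "!!y. y : U ==> f' y = g' y" using assms[of x] by blast
 show "(f has_derivative f' x) (at x)"
 unfolding U(5)[OF U(2)] by (rule has_derivative_transform_within_open[OF c1_deriv_has_derivative[OF U(3)] U(1,2)]) (simp add: U(4))
 have "\<forall>\<^sub>F y in nhds x. f' y h = g' y h" using U(1,2,5) by (auto simp: eventually_nhds)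
 moreover have "isCont (%y. g' y h) x" using c1_deriv_continuous_deriv[OF U(3), of UNIV h] by (simp add: continuous_on_eq_continuous_at)
 ultimately show "isCont (%y. f' y h) x" by (rule isCont_cong[THEN iffD2])
qed

text \<open>The chart measures fit together because each of them is Hausdorff measure restricted to
  the frontier, and the chart normals because blow-ups are unique. Gauss-Green is then proved by
  induction on the number of half balls that cover the part of the frontier in the support of
  \<open>eta\<close>, splitting off one chart at a time with a cut-off.\<close>

lemma C11_boundary_perim:
 fixes E :: "'a::euclidean_space set"
 assumes E: "compact E" "C11_boundary E" and n: "continuous_on UNIV n" "!!z. z : frontier E ==> blowup E z (n z)"
 defines "H \<equiv> density (hausdorff_measure (DIM('a) - 1)) (indicator (frontier E))"
 shows "perim UNIV E H n" "frontier E : null_sets lborel"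
proof -
 define Hm where "Hm = (hausdorff_measure (DIM('a) - 1) :: 'a measure)"
 have Eb: "E : sets borel" using E(1) by (rule borel_compact)
 have F: "frontier E : sets Hm" "compact (frontier E)" using E(1) by (auto simp: Hm_def compact_frontier)
 have Hs: "sets Hm = sets borel" by (simp add: Hm_def)
 have nm: "n : borel_measurable borel" by (rule borel_measurable_continuous_onI[OF n(1)])
 have n1: "norm (n z) = 1" if "z : frontier E" for z using n(2)[OF that] by (simp add: blowup_def)
 define Q where "Q p r \<longleftrightarrow> 0 < r & frontier E Int ball p r : null_sets lborel & emeasure Hm (frontier E Int ball p r) < \<infinity> &
  (ALL (eta :: 'a => real) eta' S c. c1_deriv eta eta' --> compact S --> S <= ball p r --> (ALL x. x ~: S --> eta x = 0) -->
  (LBINT x. indicator E x * eta' x c) = - (LINT z|H. eta z * (n z \<bullet> c)))" for p r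
 have "EX r. Q p r" if pF: "p : frontier E" for p
 proof -
 obtain r nu ga where "C11_chart E p r nu ga" using E(2) pF unfolding C11_boundary_def by blast
 then obtain D where "chart E p r nu ga D" by (rule C11_chart_chart)
 then interpret chart E p r nu ga D .
 define N where "N = frontier E Int ball p r"
 have N: "N : sets Hm" by (auto simp: N_def Hs)
 have G: "bdry_measure = density Hm (indicator N)" unfolding Hm_def N_def by (rule bdry_measure_eq[OF Eb])
 \<comment> \<open>The chart normal and the given field are both blow-up directions of
   \<open>E\<close>.\<close>
 have nn: "normal z = n z" if "z : N" for z using that by (intro blowup_unique[OF blowup_normal n(2)]) (auto simp: N_def)
 have gm: "normal : borel_measurable borel"
  using perim.n_meas[OF perim_chart[OF Eb]] .
 have fin: "emeasure Hm N < \<infinity>"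
 proof -
  have "emeasure Hm N = emeasure bdry_measure UNIV" unfolding G using N by (simp add: emeasure_restricted Hs)
  thus ?thesis using finite_measure.emeasure_finite[OF finite_bdry_measure, of UNIV] by (simp add: less_top)
 qed
 have "(LBINT x. indicator E x * eta' x c) = - (LINT z|H. eta z * (n z \<bullet> c))"
  if eta: "c1_deriv eta eta'" "compact S" "S <= ball p r" "ALL x. x ~: S --> eta x = 0" for eta :: "'a => real" and eta' S c
 proof -
  have etam: "eta : borel_measurable borel" by (rule c1_deriv_measurable[OF eta(1)])
  have m: "(%z. eta z * (normal z \<bullet> c)) : borel_measurable Hm" "(%z. eta z * (n z \<bullet> c)) : borel_measurable Hm"
  unfolding measurable_cong_sets[OF Hs refl] using etam nm gm by measurable
  have eta0: "z ~: ball p r ==> eta z = 0" for z using eta(3,4) by (metis subsetD)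
  have "(LBINT x. indicator E x * eta' x c) = - (LINT z|bdry_measure. eta z * (normal z \<bullet> c))"
  using eta(4) by (intro bdry_gauss_green[OF eta(1-3)]) auto
  also have "... = - (LINT z|Hm. indicator N z * (eta z * (normal z \<bullet> c)))"
  unfolding G by (subst integral_restricted[OF N m(1)]) simp
  also have "(%z. indicator N z * (eta z * (normal z \<bullet> c))) = (%z. indicator (frontier E) z * (eta z * (n z \<bullet> c)))"
  proof
  fix z show "indicator N z * (eta z * (normal z \<bullet> c)) = indicator (frontier E) z * (eta z * (n z \<bullet> c))"
   using nn[of z] eta0[of z] by (cases "z : ball p r") (auto simp: N_def indicator_def)
  qed
  also have "- (LINT z|Hm. indicator (frontier E) z * (eta z * (n z \<bullet> c))) = - (LINT z|H. eta z * (n z \<bullet> c))"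
  unfolding H_def Hm_def[symmetric] by (subst integral_restricted[OF F(1) m(2)]) simp
  finally show ?thesis .
 qed
 hence "Q p r" unfolding Q_def using r_pos frontier_null fin by (simp add: N_def)
 thus ?thesis ..
 qed
 then obtain r where Qr: "!!p. p : frontier E ==> Q p (r p)" by metis
 \<comment> \<open>With half radii, a cut-off can be 1 on the covering ball and still have its
   support in the ball where the chart formula holds.\<close>
 have "frontier E <= (\<Union>p\<in>frontier E. ball p (r p / 2))" using Qr unfolding Q_def by force
 then obtain I where I: "I <= frontier E" "finite I" "frontier E <= (\<Union>p\<in>I. ball p (r p / 2))"
 by (rule compactE_image[OF F(2), rotated]) auto
 have rp: "0 < r p" if "p : I" for p using that I(1) Qr unfolding Q_def by blast
 have cov: "frontier E = (\<Union>p\<in>I. frontier E Int ball p (r p))"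
 proof
 show "frontier E <= (\<Union>p\<in>I. frontier E Int ball p (r p))"
 proof
  fix z assume z: "z : frontier E"
  then obtain p where p: "p : I" "dist p z < r p / 2" using I(3) by auto
  thus "z : (\<Union>p\<in>I. frontier E Int ball p (r p))" using z rp[OF p(1)] by (intro UN_I[OF p(1)]) auto
 qed
 qed auto
 have Q: "frontier E Int ball p (r p) : null_sets lborel" "emeasure Hm (frontier E Int ball p (r p)) < \<infinity>" if "p : I" for p
 using that I(1) Qr unfolding Q_def by blast+
 show null: "frontier E : null_sets lborel" by (subst cov) (intro null_sets_UN' Q(1) countable_finite I(2))
 have "emeasure Hm (frontier E) <= (\<Sum>p\<in>I. emeasure Hm (frontier E Int ball p (r p)))"
 by (subst cov) (intro emeasure_subadditive_finite I(2), auto simp: Hs)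
 also have "... < \<infinity>" using Q(2) I(2) by simp
 finally have Hfin: "emeasure Hm (frontier E) < \<infinity>" .
 have H_finite: "finite_measure H"
 unfolding H_def Hm_def[symmetric] by (rule finite_measureI) (use Hfin F(1) in \<open>simp add: emeasure_restricted Hs sets_eq_imp_space_eq[OF Hs]\<close>)
 have H_sets: "sets H = sets borel" by (simp add: H_def)
 have H_off: "emeasure H (- (frontier E Int UNIV)) = 0"
 unfolding H_def Hm_def[symmetric] using F(1) borel_comp[of "frontier E"] by (simp add: emeasure_restricted Hs)
 have AE1: "AE z in H. norm (n z) = 1"
 using H_off by (intro AE_I[of _ _ "- frontier E"]) (use n1 in \<open>auto simp: H_sets intro: borel_comp\<close>)
 interpret H: finite_measure H by fact
 have gg: "(LBINT x. indicator E x * eta' x c) = - (LINT z|H. eta z * (n z \<bullet> c))"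
 if "finite J" "J <= I" "c1_deriv eta eta'" "compact S" "S Int frontier E <= (\<Union>p\<in>J. ball p (r p / 2))" "!!x. x ~: S ==> eta x = 0"
 for J S and eta :: "'a => real" and eta' c
 using that
 proof (induction J arbitrary: S eta eta' rule: finite_induct)
 case empty
 have d0: "eta' x h = 0" if "x ~: S" for x h
  by (rule c1_deriv_zero_off_closed[OF empty.prems(2) compact_imp_closed[OF empty.prems(3)] empty.prems(5) that])
 \<comment> \<open>The support of \<open>eta\<close> misses the frontier, near which alone the
   indicator is not locally constant. So the product is continuously differentiable, and its
   directional derivative integrates to zero.\<close>
 have "c1_deriv (%x. indicat_real E x * eta x) (%x h. indicat_real E x * eta' x h)"
 proof (rule c1_deriv_local)
  fix x
  consider "x : - S" | "x : interior E" | "x : - closure E" using empty.prems(4) by (auto simp: frontier_def)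
  thus "EX U g g'. open U & x : U & c1_deriv g g' & (ALL y:U. indicat_real E y * eta y = g y & (%h. indicat_real E y * eta' y h) = g' y)"
  proof cases
  case 1
  thus ?thesis using compact_imp_closed[OF empty.prems(3)] empty.prems(5) d0 c1_deriv_const[of "0::real"]
   by (intro exI[of _ "- S"] exI[of _ "%_. 0"] exI[of _ "%_ _. 0"]) auto
  next
  case 2
  thus ?thesis using interior_subset[of E] empty.prems(2)
   by (intro exI[of _ "interior E"] exI[of _ eta] exI[of _ eta']) (auto simp: subset_iff)
  next
  case 3
  thus ?thesis using closure_subset[of E] c1_deriv_const[of "0::real"]
   by (intro exI[of _ "- closure E"] exI[of _ "%_. 0"] exI[of _ "%_ _. 0"]) (auto simp: subset_iff indicator_def)
  qed
 qed
 hence "(LBINT x. indicator UNIV x * (indicat_real E x * eta' x c)) = 0"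
  by (rule integral_directional_deriv_zero[OF _ empty.prems(3)]) (use empty.prems(5) in auto)
 moreover have "(LINT z|H. eta z * (n z \<bullet> c)) = (LINT z|H. 0)"
 proof (rule integral_cong_AE)
  show "AE z in H. eta z * (n z \<bullet> c) = 0"
  using H_off by (intro AE_I[of _ _ "- frontier E"]) (use empty.prems(4,5) in \<open>auto simp: H_sets intro: borel_comp\<close>)
  show "(%z. eta z * (n z \<bullet> c)) : borel_measurable H"
  unfolding measurable_cong_sets[OF H_sets refl] using nm c1_deriv_measurable[OF empty.prems(2)] by measurable
 qed auto
 ultimately show ?case by simp
 next
 case (insert p J)
 have pI: "p : I" and JI: "J <= I" using insert.prems(1) by auto
 have r0: "0 < r p" by (rule rp[OF pI])
 obtain th :: "'a => real" and th' where th: "c1_deriv th th'" "!!x. 0 <= th x" "!!x. th x <= 1"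
  "!!x. x : cball p (r p / 2) ==> th x = 1" "!!x. x ~: ball p (3 / 4 * r p) ==> th x = 0"
  by (rule c1_bump_ball[of "r p / 2" "3/4 * r p" p]) (use r0 in simp, use r0 in simp, rule that)
 define eta1 where "eta1 x = th x * eta x" for x
 define eta2 where "eta2 x = eta x - eta1 x" for x
 have c1: "c1_deriv eta1 (%x h. th x * eta' x h + th' x h * eta x)" unfolding eta1_def[abs_def] by (rule c1_deriv_mult[OF th(1) insert.prems(2)])
 have c2: "c1_deriv eta2 (%x h. eta' x h - (th x * eta' x h + th' x h * eta x))"
  unfolding eta2_def[abs_def] by (rule c1_deriv_diff[OF insert.prems(2) c1])
 have sub: "cball p (3 / 4 * r p) <= ball p (r p)" using r0 by auto
 have th0: "x ~: cball p (3 / 4 * r p) ==> eta1 x = 0" for x using th(5)[of x] by (simp add: eta1_def)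
 have g1: "(LBINT x. indicator E x * (th x * eta' x c + th' x c * eta x)) = - (LINT z|H. eta1 z * (n z \<bullet> c))"
  using Qr[of p] pI I(1) c1 sub th0 compact_cball[of p "3/4 * r p"] unfolding Q_def by blast
 \<comment> \<open>The remainder vanishes on the half ball of \<open>p\<close>, so one covering ball
   fewer is needed.\<close>
 have g2: "(LBINT x. indicator E x * (eta' x c - (th x * eta' x c + th' x c * eta x))) = - (LINT z|H. eta2 z * (n z \<bullet> c))"
 proof (rule insert.IH[OF JI c2, of "S - ball p (r p / 2)"])
  show "compact (S - ball p (r p / 2))" using insert.prems(3) by (intro compact_diff) auto
  show "(S - ball p (r p / 2)) Int frontier E <= (\<Union>p\<in>J. ball p (r p / 2))" using insert.prems(4) by auto
  fix x assume "x ~: S - ball p (r p / 2)"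
  thus "eta2 x = 0" using insert.prems(5)[of x] th(4)[of x] by (auto simp: eta2_def eta1_def)
 qed
 have bd: "EX B. ALL x. \<bar>f x\<bar> <= B" "f : borel_measurable borel" if "c1_deriv f f'" "compact C" "!!x. x ~: C ==> f x = 0" for f :: "'a => real" and f' C
  using bounded_compact_support[OF c1_deriv_continuous[OF that(1)] that(2,3)]
  c1_deriv_measurable[OF that(1)] by auto
 have iH: "integrable H (%z. f z * (n z \<bullet> c))" if f: "c1_deriv f f'" "compact C" "!!x. x ~: C ==> f x = 0" for f :: "'a => real" and f' C
  using bd[OF f] integrable_times_unit_inner[OF H_finite H_sets nm AE1] by blast
 have iE: "integrable lborel (%x. indicat_real E x * f' x c)" if f: "c1_deriv f f'" "compact C" "!!x. x ~: C ==> f x = 0" for f :: "'a => real" and f' C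
  using integrable_mult_indicator[OF _ integrable_compact_support[OF c1_deriv_continuous_deriv[OF f(1)] f(2)
  c1_deriv_zero_off_closed[OF f(1) compact_imp_closed[OF f(2)] f(3)]], of E] Eb by simp
 have s1: "!!x. x ~: S ==> eta1 x = 0" "!!x. x ~: S ==> eta2 x = 0" using insert.prems(5) by (auto simp: eta1_def eta2_def)
 have "(LBINT x. indicator E x * eta' x c) = (LBINT x. indicator E x * (th x * eta' x c + th' x c * eta x) + indicator E x * (eta' x c - (th x * eta' x c + th' x c * eta x)))"
  by (simp add: algebra_simps)
 also have "... = - (LINT z|H. eta1 z * (n z \<bullet> c)) + - (LINT z|H. eta2 z * (n z \<bullet> c))"
  unfolding g1[symmetric] g2[symmetric]
  by (rule Bochner_Integration.integral_add[OF iE[OF c1 insert.prems(3) s1(1)] iE[OF c2 insert.prems(3) s1(2)]])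
 also have "... = - (LINT z|H. eta1 z * (n z \<bullet> c) + eta2 z * (n z \<bullet> c))"
  by (subst Bochner_Integration.integral_add[OF iH[OF c1 insert.prems(3) s1(1)] iH[OF c2 insert.prems(3) s1(2)]]) simp_all
 also have "... = - (LINT z|H. eta z * (n z \<bullet> c))" by (simp add: eta2_def algebra_simps)
 finally show ?case .
 qed
 show "perim UNIV E H n"
 proof (rule perim.intro)
 fix eta :: "'a => real" and eta' S c assume "c1_deriv eta eta'" "compact S" "!!x. x ~: S ==> eta x = 0"
 thus "(LBINT x. indicator E x * eta' x c) = - (LINT z|H. eta z * (n z \<bullet> c))"
  using I(3) by (intro gg[OF I(2) order_refl]) auto
 qed (use Eb H_finite H_sets H_off n in auto)
qed

section \<open>Approximate gradient and singular part of SBV functions\<close>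

text \<open>\<open>approx_gradient\<close> is picked by a choice operator, so it can only be
  identified almost everywhere. The two densities may come with different null sets; removing both
  does not change Lebesgue integrals and makes the two values of \<open>D\<close>
  comparable.\<close>

lemma abs_cont_density_unique:
 fixes w1 w2 :: "'a::euclidean_space => 'a"
 assumes Om: "open Om" and 1: "abs_cont_density Om D w1" and 2: "abs_cont_density Om D w2"
 shows "AE x in lebesgue_on Om. w1 x = w2 x"
proof (rule sigma_finite_measure.density_unique_banach)
 show "sigma_finite_measure (lebesgue_on Om)" 
 proof (rule sigma_finite_measure_restrict_space)
 obtain A :: "'a set set" where A: "countable A" "A <= sets lborel" "\<Union>A = space lborel" "ALL a:A. emeasure lborel a ~= \<infinity>"
  using lborel.sigma_finite_countable by blast
 show "sigma_finite_measure (lebesgue :: 'a measure)" by standard (use A in \<open>auto intro!: exI[of _ A] simp: subset_iff\<close>)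
 qed (use Om in simp)
 show i: "integrable (lebesgue_on Om) w1" "integrable (lebesgue_on Om) w2" using 1 2 by (auto simp: abs_cont_density_def)
 obtain N1 where N1: "N1 : null_sets lborel" "!!B. B : sets borel ==> B <= Om ==> D (B - N1) = (LINT x:B|lebesgue. w1 x)"
 using 1 by (auto simp: abs_cont_density_def)
 obtain N2 where N2: "N2 : null_sets lborel" "!!B. B : sets borel ==> B <= Om ==> D (B - N2) = (LINT x:B|lebesgue. w2 x)"
 using 2 by (auto simp: abs_cont_density_def)
 have Oms: "Om : sets lebesgue" "Om Int space lebesgue : sets lebesgue" using Om by auto
 have m: "(%x. indicator A x *\<^sub>R w x) : borel_measurable lebesgue"
 if "integrable (lebesgue_on Om) w" "A : sets lebesgue" "A <= Om" for w :: "'a => 'a" and A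
 proof -
 have "integrable lebesgue (%x. indicator Om x *\<^sub>R w x)" using that(1) Oms by (simp add: integrable_restrict_space)
 hence "(%x. indicator A x *\<^sub>R (indicator Om x *\<^sub>R w x)) : borel_measurable lebesgue" using that(2) by measurable
 moreover have "(%x. indicator A x *\<^sub>R (indicator Om x *\<^sub>R w x)) = (%x. indicat_real A x *\<^sub>R w x)" using that(3) by (auto simp: indicator_def fun_eq_iff)
 ultimately show ?thesis by simp
 qed
 have ae: "(LINT x:A|lebesgue. w x) = (LINT x:B|lebesgue. w x)"
 if "integrable (lebesgue_on Om) w" "A : sets lebesgue" "A <= Om" "B : sets lebesgue" "B <= Om" "N : null_sets lborel" "A - N = B - N"
 for w :: "'a => 'a" and A B N
 unfolding set_lebesgue_integral_def
 proof (rule integral_cong_AE[OF m[OF that(1-3)] m[OF that(1,4,5)]])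
 have "AE x in lebesgue. x ~: N" using AE_completion[OF AE_not_in[OF that(6)]] by simp
 thus "AE x in lebesgue. indicat_real A x *\<^sub>R w x = indicat_real B x *\<^sub>R w x"
  by eventually_elim (use that(7) in \<open>auto simp: indicator_def\<close>)
 qed
 fix A assume "A : sets (lebesgue_on Om)"
 hence A: "A : sets lebesgue" "A <= Om" using Oms by (auto simp: sets_restrict_space_iff)
 obtain S N N' where S: "A = S Un N" "N <= N'" "N' : null_sets lborel" "S : sets lborel" using A(1) by (rule sets_completionE)
 have SO: "S : sets borel" "S <= Om" "S : sets lebesgue" using S A(2) by auto
 have NS: "N1 : sets borel" "N2 : sets borel" using N1(1) N2(1) by (auto simp: null_sets_def)
 have SN: "S - N1 : sets borel" "S - N2 : sets borel" "S - N1 <= Om" "S - N2 <= Om" using SO NS by auto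
 have r: "(LINT x:A|lebesgue_on Om. w x) = (LINT x:A|lebesgue. w x)" for w :: "'a => 'a"
 unfolding set_lebesgue_integral_def using Oms A(2)
 by (subst integral_restrict_space) (auto intro!: Bochner_Integration.integral_cong simp: indicator_def)
 have "(LINT x:A|lebesgue. w1 x) = (LINT x:(S - N2)|lebesgue. w1 x)"
 by (rule ae[OF i(1) A, of _ "N' Un N2"]) (use S SN N2(1) in auto)
 also have "... = D (S - N2 - N1)" using N1(2)[OF SN(2,4)] by simp
 \<comment> \<open>The one set to which both representations of \<open>D\<close> apply.\<close>
 also have "S - N2 - N1 = S - N1 - N2" by auto
 also have "D ... = (LINT x:(S - N1)|lebesgue. w2 x)" using N2(2)[OF SN(1,3)] by simp
 also have "... = (LINT x:A|lebesgue. w2 x)"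
 by (rule ae[OF i(2) _ _ A, of _ "N' Un N1"]) (use S SN N1(1) in auto)
 finally show "(LINT x:A|lebesgue_on Om. w1 x) = (LINT x:A|lebesgue_on Om. w2 x)" by (simp only: r)
qed

lemma BV_bv_rep:
 assumes Om: "open Om" and v: "v : BV Om"
 obtains v0 M s where "bv_rep Om v0 M s" "AE x in lebesgue_on Om. v x = v0 x"
 "!!B. B : sets borel ==> B <= Om ==> distr_deriv Om v B = (LINT x|M. indicator B x *\<^sub>R s x)"
proof -
 obtain mu sg where vi: "integrable (lebesgue_on Om) v" and p: "polar_derivative Om v mu sg" using v by (auto simp: BV_def)
 obtain v0 where v0: "integrable lborel v0" "!!x. x ~: Om ==> v0 x = 0" "AE x in lebesgue_on Om. v x = v0 x"
 by (rule lborel_representative[OF _ vi]) (use Om in simp, rule that)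
 note vm = borel_measurable_integrable[OF vi]
 show ?thesis
 by (rule that[OF polar_derivative_bv_rep(1)[OF Om p v0 vm] v0(3) distr_deriv_eq[OF Om p v0 vm]]) assumption+
qed

context bv_rep begin

lemma approx_gradient_eq:
 assumes dd: "!!B. B : sets borel ==> B <= Om ==> distr_deriv Om u B = (LINT x|M. indicator B x *\<^sub>R s x)" and d: "decomp N k"
 shows "abs_cont_density Om (distr_deriv Om u) (approx_gradient Om u)"
 and "AE x in lebesgue_on Om. approx_gradient Om u x = k x *\<^sub>R s x"
proof -
 have N: "N : null_sets lborel" "N : sets borel" using d by (auto simp: decomp_def null_sets_def)
 have w: "integrable lborel (%x. k x *\<^sub>R s x)" by (rule decomp_density_integrable[OF d])
 have ac: "abs_cont_density Om (distr_deriv Om u) (%x. k x *\<^sub>R s x)"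
 unfolding abs_cont_density_def
 proof (intro conjI bexI[OF _ N(1)] ballI impI)
 have "integrable lebesgue (%x. k x *\<^sub>R s x)" using w by (subst integrable_completion) auto
 thus "integrable (lebesgue_on Om) (%x. k x *\<^sub>R s x)" using open_dom integrable_mult_indicator[of Om lebesgue "%x. k x *\<^sub>R s x"]
  by (simp add: integrable_restrict_space)
 fix B assume B: "B : sets borel" "B <= Om"
 have g: "(%x. indicator B x *\<^sub>R s x) : borel_measurable borel" using s_meas B by (intro borel_measurable_scaleR borel_measurable_indicator) auto
 have gi: "integrable M (%x. indicat_real B x *\<^sub>R s x)"
  using integrable_scale_s[of "indicat_real B" 1] B(1) by (auto simp: indicator_def)
 have "distr_deriv Om u (B - N) = (LINT x|M. indicator (B - N) x *\<^sub>R s x)" using B N by (intro dd) auto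
 also have "... = (LINT x|M. indicator (- N) x *\<^sub>R (indicator B x *\<^sub>R s x))"
  by (intro Bochner_Integration.integral_cong) (auto simp: indicator_def)
 also have "... = (LBINT x. k x *\<^sub>R (indicator B x *\<^sub>R s x))" by (rule decomp_integral(2)[OF d g gi])
 also have "... = (LINT x|lebesgue. indicator B x *\<^sub>R (k x *\<^sub>R s x))"
  using borel_measurable_integrable[OF w] B unfolding scaleR_left_commute[of "k _"]
  by (intro integral_completion[symmetric] borel_measurable_scaleR[OF borel_measurable_indicator]) auto
 finally show "distr_deriv Om u (B - N) = (LINT x:B|lebesgue. k x *\<^sub>R s x)" by (simp add: set_lebesgue_integral_def)
 qed
 show 1: "abs_cont_density Om (distr_deriv Om u) (approx_gradient Om u)"
 unfolding approx_gradient_def by (rule someI[of "abs_cont_density Om (distr_deriv Om u)", OF ac])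
 show "AE x in lebesgue_on Om. approx_gradient Om u x = k x *\<^sub>R s x" by (rule abs_cont_density_unique[OF open_dom 1 ac])
qed

text \<open>Restriction to nonzero jump vectors yields a Borel set, because the jump vector times
  the indicator of the singular set is integrable; measurability of the singular set is not assumed.
  On Borel subsets of \<open>N - S0\<close> inside \<open>Om\<close> both terms of the SBV formula
  vanish, hence \<open>Dv\<close> does, and so does \<open>M\<close> since \<open>s\<close> has norm
  one.\<close>

lemma SBV_singular_part:
 fixes u :: "'a => real"
 assumes dd: "!!B. B : sets borel ==> B <= Om ==> distr_deriv Om u B = (LINT x|M. indicator B x *\<^sub>R s x)" and d: "decomp N k"
 and u: "u : SBV Om"
 defines "S0 \<equiv> {x : singular_set Om u. jump_vector u x ~= 0}"
 shows "S0 : sets borel" "emeasure M (N - S0) = 0"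
proof -
 have N: "N : null_sets lborel" "N : sets borel" using d by (auto simp: decomp_def null_sets_def)
 define J where "J x = indicat_real (singular_set Om u) x *\<^sub>R jump_vector u x" for x
 have "integrable (hausdorff_measure (DIM('a) - 1)) J"
 using u unfolding SBV_def J_def[abs_def] set_integrable_def by simp
 hence "J : borel_measurable (hausdorff_measure (DIM('a) - 1))" by (rule borel_measurable_integrable)
 hence Jm: "J : borel_measurable borel" by (simp cong: measurable_cong_sets)
 have S0: "S0 = J -` (- {0})" by (auto simp: S0_def J_def indicator_def)
 show S0b: "S0 : sets borel" unfolding S0 using measurable_sets[OF Jm, of "- {0}"] by simp
 define A where "A = (N - S0) Int Om"
 have A: "A : sets borel" "A <= Om" "A : null_sets lebesgue"
 using N S0b open_dom by (auto simp: A_def intro!: null_sets_completionI null_set_Int2 null_set_Diff)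
 have z: "(LINT x|M. indicator B x *\<^sub>R s x) = 0" if B: "B : sets borel" "B <= A" for B
 proof -
 have BOm: "B <= Om" using B(2) A(2) by auto
 have "(LINT x:B|lebesgue. approx_gradient Om u x) = 0"
 proof -
  have "B : null_sets lebesgue" by (rule null_sets_subset[OF A(3) _ B(2)]) (use B in auto)
  hence "AE x in lebesgue. x ~: B" by (rule AE_not_in)
  thus ?thesis unfolding set_lebesgue_integral_def by (intro integral_eq_zero_AE) (auto elim: eventually_mono)
 qed
 moreover have "(LINT x:(B Int singular_set Om u)|hausdorff_measure (DIM('a) - 1). jump_vector u x) = 0"
 proof -
  have "(%x. indicat_real (B Int singular_set Om u) x *\<^sub>R jump_vector u x) = (%_. 0)"
  using B(2) by (auto simp: A_def S0_def indicator_def fun_eq_iff)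
  thus ?thesis unfolding set_lebesgue_integral_def by (simp only: integral_zero)
 qed
 ultimately show ?thesis using u B(1) BOm unfolding SBV_def dd[OF B(1) BOm, symmetric] by simp
 qed
 have si: "integrable M (%x. indicat_real A x *\<^sub>R s x)"
 using integrable_scale_s[of "indicat_real A" 1] A(1) by (auto simp: indicator_def)
 have "AE x in M. indicat_real A x *\<^sub>R s x = 0"
 proof (rule density_unique_banach[OF si])
 fix B assume "B : sets M"
 hence "(LINT x|M. indicator (B Int A) x *\<^sub>R s x) = 0" using A(1) by (intro z) (auto simp: M_sets)
 thus "(LINT x:B|M. indicat_real A x *\<^sub>R s x) = (LINT x:B|M. 0)"
  by (simp add: set_lebesgue_integral_def indicator_inter_arith)
 qed simp
 with s_unit have "AE x in M. x ~: A"
 proof eventually_elim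
 case (elim x)
 thus ?case by (auto simp: indicator_def split: if_splits)
 qed
 moreover have "AE x in M. x ~: - Om" using M_off open_dom by (intro AE_not_in) (auto simp: null_sets_def M_sets)
 ultimately have "AE x in M. x ~: N - S0" by eventually_elim (auto simp: A_def)
 thus "emeasure M (N - S0) = 0" using AE_iff_measurable[of "N - S0" M "%x. x ~: N - S0"] N(2) S0b by (auto simp: M_sets space_M set_diff_eq)
qed

end

lemma (in perim) perim_subset:
 assumes "open Om" "Om <= b" "frontier E <= Om"
 shows "perim Om E G n"
proof (rule perim.intro)
 show "emeasure G (- (frontier E Int Om)) = 0" using G_off assms(2,3) by (metis Int_absorb2 order_trans)
 show "(LBINT x. indicator E x * eta' x c) = - (LINT z|G. eta z * (n z \<bullet> c))"
 if "c1_deriv eta eta'" "compact S" "S <= Om" "!!x. x ~: S ==> eta x = 0" for eta :: "'a => real" and eta' S c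
 using that assms(2) by (intro gauss_green[OF that(1,2)]) auto
qed (use assms E_sets G_fin G_sets n_cont n_blowup in auto)

text \<open>The jump vector of the indicator at a frontier point is the blow-up direction
  \<open>n\<close>. The derivative, \<open>n\<close> times Hausdorff measure on the frontier, is
  therefore the jump term of the SBV formula, and nothing is left for the gradient.\<close>

lemma indicator_SBV:
 fixes E :: "'a::euclidean_space set"
 assumes Om: "open Om" and E: "compact E" "E <= Om" and null: "frontier E : null_sets lborel"
 and P: "perim Om E (density (hausdorff_measure (DIM('a) - 1)) (indicator (frontier E))) n"
 shows "indicat_real E : SBV Om" "AE x in lebesgue_on Om. approx_gradient Om (indicat_real E) x = 0"
 "singular_set Om (indicat_real E) = frontier E"
proof -
 define Hm where "Hm = (hausdorff_measure (DIM('a) - 1) :: 'a measure)"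
 define H where "H = density Hm (indicator (frontier E))"
 interpret perim Om E H n unfolding H_def Hm_def by (rule P)
 have Hs: "sets Hm = sets borel" by (simp add: Hm_def)
 have F: "frontier E : sets Hm" "frontier E <= Om" "frontier E Int Om = frontier E" "E Int Om = E"
 using E frontier_subset_compact[OF E(1)] by (auto simp: Hs)
 show sing: "singular_set Om (indicat_real E) = frontier E"
 by (rule singular_set_indicator[OF F(2) E_sets n_blowup]) (use F(2) in auto)
 have jump: "jump_vector (indicat_real E) z = n z" if "z : frontier E" for z
 using that F(2) by (intro blowup_jump_vector[OF n_blowup E_sets]) auto
 have Efin: "emeasure lborel (E Int Om) < \<infinity>" using emeasure_compact_finite[OF E(1)] F(4) by simp
 have bv: "bv_rep Om (indicat_real E) H (%x. indicator Om x *\<^sub>R n x)" using bv_rep_indicator[OF Efin] F(4) by simp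
 then interpret R: bv_rep Om "indicat_real E" H "%x. indicator Om x *\<^sub>R n x" .
 have dec: "R.decomp (frontier E) (%_. 0)" using decomp_indicator[OF Efin] null F(3) by simp
 have OmH: "Om : sets H" "Om Int space H : sets H" using Om by (auto simp: G_sets space_G)
 have p: "polar_derivative Om (indicat_real E) (restrict_space H Om) n"
 unfolding polar_derivative_def
 proof (intro conjI allI impI)
 show "finite_measure (restrict_space H Om)" by (rule finite_measure_restrict_space[OF G_fin OmH(1)])
 show "space (restrict_space H Om) = Om" by (simp add: space_restrict_space space_G)
 show "sets (restrict_space H Om) = sets (restrict_space borel Om)" by (rule sets_restrict_space_cong[OF G_sets])
 show "n : borel_measurable (restrict_space H Om)" by (intro measurable_restrict_space1 measurable_G n_meas)
 show "AE x in restrict_space H Om. norm (n x) = 1"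
  using AE_n_norm by (subst AE_restrict_space_iff[OF OmH(2)]) (auto elim: eventually_mono)
 fix ph assume t: "test_field Om ph"
 obtain ph' S where ph: "c1_deriv ph ph'" "compact S" "S <= Om" "!!x. x ~: S ==> ph x = 0"
  by (rule test_fieldE[OF t]) (rule that)
 have "(LINT x|lebesgue_on Om. indicat_real E x * divergence ph x) = (LBINT x. indicat_real E x * divergence ph x)"
 proof (rule integral_lebesgue_on_lborel)
  show "(%x. indicat_real E x * divergence ph x) : borel_measurable borel"
  using E_sets borel_measurable_continuous_onI[OF continuous_divergence[OF ph(1)]] by measurable
 qed (use Om E(2) in \<open>auto simp: indicator_def\<close>)
 also have "... = - (LINT x|H. ph x \<bullet> (indicator Om x *\<^sub>R n x))" by (rule R.by_parts[OF t])
 also have "... = - (LINT x|restrict_space H Om. ph x \<bullet> n x)" using OmH by (subst integral_restrict_space) auto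
 finally show "(LINT x|lebesgue_on Om. indicat_real E x * divergence ph x) = - (LINT x|restrict_space H Om. ph x \<bullet> n x)" .
 qed
 have v0: "integrable lborel (indicat_real E)" "!!x. x ~: Om ==> indicat_real E x = 0" "AE x in lebesgue_on Om. indicat_real E x = indicat_real E x"
 using R.v_int E(2) by (auto simp: indicator_def)
 have vi: "integrable (lebesgue_on Om) (indicat_real E)"
 proof -
 have "integrable lebesgue (%x. indicat_real Om x *\<^sub>R indicat_real E x)"
  using v0(1) Om by (intro integrable_mult_indicator) (auto simp: integrable_completion)
 thus ?thesis using Om by (simp add: integrable_restrict_space)
 qed
 have dd: "distr_deriv Om (indicat_real E) B = (LINT x|H. indicator B x *\<^sub>R (indicator Om x *\<^sub>R n x))" if "B : sets borel" "B <= Om" for B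
 by (rule trans[OF distr_deriv_eq[OF Om p v0 borel_measurable_integrable[OF vi] that]
  bv_rep_unique[OF polar_derivative_bv_rep(1)[OF Om p v0 borel_measurable_integrable[OF vi]] bv that]]) assumption+
 show grad: "AE x in lebesgue_on Om. approx_gradient Om (indicat_real E) x = 0"
 using R.approx_gradient_eq(2)[OF dd dec] by simp
 have nm: "(%x. indicat_real B x *\<^sub>R n x) : borel_measurable Hm" if "B : sets borel" for B
 unfolding measurable_cong_sets[OF Hs refl] using that n_meas by (intro borel_measurable_scaleR borel_measurable_indicator)
 show "indicat_real E : SBV Om"
 unfolding SBV_def mem_Collect_eq sing Hm_def[symmetric]
 proof (intro conjI ballI impI)
 show "indicat_real E : BV Om" unfolding BV_def using vi p by blast
 have "emeasure Hm (frontier E) = emeasure H UNIV" unfolding H_def using F(1) by (simp add: emeasure_restricted Hs)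
 hence fin: "emeasure Hm (frontier E) < \<infinity>" using emeasure_finite[of UNIV] by (metis infinity_ennreal_def less_top)
 show "set_integrable Hm (frontier E) (jump_vector (indicat_real E))"
 proof -
  have "integrable Hm (%z. indicat_real (frontier E) z *\<^sub>R n z)"
  proof (rule Bochner_Integration.integrable_bound)
  show "integrable Hm (indicat_real (frontier E))" using fin F(1) by simp
  show "AE z in Hm. norm (indicat_real (frontier E) z *\<^sub>R n z) <= norm (indicat_real (frontier E) z)"
   using n_norm F(2) by (intro AE_I2) (auto simp: indicator_def)
  qed (rule nm, simp)
  moreover have "(%z. indicat_real (frontier E) z *\<^sub>R n z) = (%z. indicat_real (frontier E) z *\<^sub>R jump_vector (indicat_real E) z)"
  using jump by (auto simp: indicator_def fun_eq_iff)
  ultimately show ?thesis unfolding set_integrable_def by simp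
 qed
 fix B assume B: "B : sets borel" "B <= Om"
 have "(LINT x:B|lebesgue. approx_gradient Om (indicat_real E) x) = 0"
  unfolding set_lebesgue_integral_def
 proof (rule integral_eq_zero_AE)
  have "AE x in lebesgue. x : Om --> approx_gradient Om (indicat_real E) x = 0"
  using grad Om by (subst (asm) AE_restrict_space_iff) auto
  thus "AE x in lebesgue. indicat_real B x *\<^sub>R approx_gradient Om (indicat_real E) x = 0"
  by eventually_elim (use B(2) in \<open>auto simp: indicator_def\<close>)
 qed
 moreover have "(LINT x:(B Int frontier E)|Hm. jump_vector (indicat_real E) x) = (LINT x|H. indicator B x *\<^sub>R n x)"
  unfolding set_lebesgue_integral_def H_def integral_restricted[OF F(1) nm[OF B(1)]]
  by (intro Bochner_Integration.integral_cong) (auto simp: indicator_def jump)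
 moreover have "(LINT x|H. indicator B x *\<^sub>R n x) = distr_deriv Om (indicat_real E) B"
  unfolding dd[OF B] by (intro Bochner_Integration.integral_cong) (use B(2) in \<open>auto simp: indicator_def\<close>)
 ultimately show "distr_deriv Om (indicat_real E) B = (LINT x:B|lebesgue. approx_gradient Om (indicat_real E) x) +
  (LINT x:(B Int frontier E)|Hm. jump_vector (indicat_real E) x)" by simp
 qed
qed

section \<open>Rademacher's theorem\<close>

text \<open>Adding a linear function makes \<open>f\<close> an increasing bi-Lipschitz bijection
  \<open>F\<close>. The image of Lebesgue measure under its inverse gives each interval the
  increment of \<open>F\<close>. It is absolutely continuous, since Lipschitz maps send null sets to
  null sets, and its Radon-Nikodym density, minus \<open>L + 1\<close>, is the wanted
  \<open>w\<close>.\<close>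

lemma lipschitz_density:
 fixes f :: "real => real"
 assumes L: "L-lipschitz_on UNIV f"
 obtains w where "!!a b. a <= b ==> (w has_integral (f b - f a)) {a..b}"
proof -
 have L0: "0 <= L" by (rule lipschitz_on_nonneg[OF L])
 have fl: "\<bar>f y - f x\<bar> <= L * \<bar>y - x\<bar>" for x y using lipschitz_onD[OF L, of y x] by (simp add: dist_real_def)
 \<comment> \<open>The slope \<open>L + 1\<close> guarantees growth at rate at least 1.\<close>
 define F where "F x = f x + (L + 1) * x" for x
 have F1: "y - x <= F y - F x" if "x <= y" for x y using fl[of y x] that by (simp add: F_def algebra_simps)
 have F2: "\<bar>F y - F x\<bar> <= (2 * L + 1) * \<bar>y - x\<bar>" for x y
 proof -
 have "\<bar>F y - F x\<bar> = \<bar>(f y - f x) + (L + 1) * (y - x)\<bar>" by (simp add: F_def algebra_simps)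
 also have "... <= \<bar>f y - f x\<bar> + \<bar>(L + 1) * (y - x)\<bar>" by (rule abs_triangle_ineq)
 also have "\<bar>(L + 1) * (y - x)\<bar> = (L + 1) * \<bar>y - x\<bar>" using L0 by (simp add: abs_mult)
 finally show ?thesis using fl[of y x] by (simp add: algebra_simps)
 qed
 have mono: "F x < F y \<longleftrightarrow> x < y" "F x <= F y \<longleftrightarrow> x <= y" for x y using F1[of x y] F1[of y x] by linarith+
 have cont: "continuous_on UNIV F" unfolding F_def[abs_def] by (intro continuous_intros lipschitz_on_continuous_on[OF L])
 have "EX x. F x = y" for y
 proof -
 define R where "R = \<bar>y - F 0\<bar>"
 have "F (- R) <= y" "y <= F R" using F1[of 0 R] F1[of "- R" 0] by (auto simp: R_def)
 thus ?thesis using IVT'[of F "- R" y R] continuous_on_subset[OF cont] by (force simp: R_def)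
 qed
 then obtain G where FG: "!!y. F (G y) = y" by metis
 have GF: "G (F x) = x" for x using FG[of "F x"] mono[of x "G (F x)"] mono[of "G (F x)" x] by linarith
 have Gle: "G y <= c \<longleftrightarrow> y <= F c" "c <= G y \<longleftrightarrow> F c <= y" for y c using mono(2)[of "G y" c] mono(2)[of c "G y"] by (simp_all add: FG)
 have "mono G" by (auto simp: mono_def Gle FG)
 hence [measurable]: "G : borel_measurable borel" by (rule borel_measurable_mono)
 define M where "M = distr lborel borel G"
 have Mab: "emeasure M {a..b} = ennreal (F b - F a)" if "a <= b" for a b
 proof -
 have "G -` {a..b} = {F a..F b}" by (auto simp: Gle)
 thus ?thesis using that mono(2)[of a b] by (simp add: M_def emeasure_distr)
 qed
 have "absolutely_continuous lborel M"
 unfolding absolutely_continuous_def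
 proof
 fix N :: "real set" assume N: "N : null_sets lborel"
 hence Nb: "N : sets borel" by auto
 have "negligible (F ` N)"
 proof (rule negligible_locally_Lipschitz_image)
  show "negligible N" using N by (simp add: negligible_iff_null_sets null_sets_completionI)
  fix x show "EX T B. open T & x : T & (ALL y:N Int T. norm (F y - F x) <= B * norm (y - x))"
  using F2 by (intro exI[of _ UNIV] exI[of _ "2 * L + 1"]) auto
 qed simp
 moreover have "F ` N = G -` N" using FG GF by (auto simp: image_iff) metis
 ultimately have "G -` N : null_sets lebesgue" by (simp add: negligible_iff_null_sets)
 moreover have "G -` N : sets lborel" using measurable_sets[OF \<open>G : borel_measurable borel\<close> Nb] by simp
 ultimately have "emeasure lborel (G -` N) = 0" by (simp add: null_sets_def)
 thus "N : null_sets M" using Nb by (simp add: M_def null_sets_def emeasure_distr)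
 qed
 then obtain q where q: "q : borel_measurable lborel" "density lborel q = M"
 using sigma_finite_measure.Radon_Nikodym[OF sigma_finite_lborel, of M] by (auto simp: M_def)
 have [measurable]: "q : borel_measurable borel" using q(1) by simp
 have "((%x. enn2real (q x)) has_integral (F b - F a)) {a..b}" if ab: "a <= b" for a b
 proof -
 have e: "(\<integral>\<^sup>+x. q x * indicator {a..b} x \<partial>lborel) = ennreal (F b - F a)"
  using Mab[OF ab] by (simp add: q(2)[symmetric] emeasure_density)
 have "AE x in lborel. q x * indicator {a..b} x ~= \<infinity>" by (rule nn_integral_PInf_AE) (auto simp: e)
 hence "AE x in lborel. ennreal (indicator {a..b} x * enn2real (q x)) = q x * indicator {a..b} x"
 proof eventually_elim
  case (elim x)
  thus ?case by (auto simp: indicator_def less_top split: if_splits)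
 qed
 hence "(\<integral>\<^sup>+x. ennreal (indicator {a..b} x * enn2real (q x)) \<partial>lborel) = ennreal (F b - F a)"
  unfolding e[symmetric] by (rule nn_integral_cong_AE)
 hence "((%x. indicator {a..b} x * enn2real (q x)) has_integral (F b - F a)) UNIV"
  using mono(2)[of a b] ab by (intro nn_integral_has_integral) auto
 moreover have "(%x. indicator {a..b} x * enn2real (q x)) = (%x. if x : {a..b} then enn2real (q x) else 0)" by (auto simp: indicator_def)
 ultimately show ?thesis by (simp only: has_integral_restrict_UNIV)
 qed
 from has_integral_diff[OF this has_integral_const_real[of "L + 1"]]
 have "((%x. enn2real (q x) - (L + 1)) has_integral (f b - f a)) {a..b}" if "a <= b" for a b
 using that by (simp add: F_def algebra_simps)
 thus ?thesis by (rule that)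
qed

text \<open>Lebesgue's differentiation theorem for the density \<open>w\<close>: the difference
  quotients of \<open>f\<close> are averages of \<open>w\<close>.\<close>

lemma lipschitz_real_derivative_AE:
 fixes f :: "real => real"
 assumes L: "L-lipschitz_on UNIV f"
 shows "AE x in lborel. EX d. ((%t. (f (x + t) - f x) / t) \<longlongrightarrow> d) (at 0)"
proof -
 obtain w where w: "!!a b. a <= b ==> (w has_integral (f b - f a)) {a..b}" by (rule lipschitz_density[OF L]) (rule that)
 \<comment> \<open>The differentiation theorem in use averages over intervals to the right of a
   point; the reflected function supplies those to the left.\<close>
 have w': "((%x. w (- x)) has_integral (f (- a) - f (- b))) {a..b}" if "a <= b" for a b
 using w[of "- b" "- a"] that has_integral_reflect_real[of w _ "- a" "- b"] by simp
 have io: "w integrable_on cbox a b" "(%x. w (- x)) integrable_on cbox a b" for a b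
 using w[of a b] w'[of a b] by (cases "a <= b"; auto simp: integrable_on_def)+
 obtain N1 where N1: "negligible N1" "!!x e. x ~: N1 ==> 0 < e ==> EX d>0. ALL h. 0 < h & h < d -->
  norm (integral (cbox x (x + h *\<^sub>R One)) w /\<^sub>R h ^ DIM(real) - w x) < e"
 using integrable_ccontinuous_explicit[of w] io(1) by blast
 obtain N2 where N2: "negligible N2" "!!x e. x ~: N2 ==> 0 < e ==> EX d>0. ALL h. 0 < h & h < d -->
  norm (integral (cbox x (x + h *\<^sub>R One)) (%x. w (- x)) /\<^sub>R h ^ DIM(real) - w (- x)) < e"
 using integrable_ccontinuous_explicit[of "%x. w (- x)"] io(2) by blast
 have "negligible ((%x. - x) ` N2)" 
 by (rule negligible_locally_Lipschitz_image[OF _ N2(1)]) (auto intro!: exI[of _ UNIV] exI[of _ "1::real"] simp: norm_minus_commute)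
 hence "negligible (N1 Un (%x. - x) ` N2)" using N1(1) by (rule negligible_Un[rotated])
 hence "AE x in lebesgue. x ~: N1 Un (%x. - x) ` N2" by (intro AE_not_in) (simp only: negligible_iff_null_sets)
 hence "AE x in lebesgue. EX d. ((%t. (f (x + t) - f x) / t) \<longlongrightarrow> d) (at 0)"
 proof eventually_elim
 case (elim x)
 hence x: "x ~: N1" "- x ~: N2" by (auto simp: image_iff)
 have "((%t. (f (x + t) - f x) / t) \<longlongrightarrow> w x) (at 0)"
  unfolding LIM_def
 proof (intro allI impI)
  fix e :: real assume e: "0 < e"
  obtain d1 where d1: "0 < d1" "!!h. 0 < h ==> h < d1 ==> norm (integral (cbox x (x + h *\<^sub>R One)) w /\<^sub>R h ^ DIM(real) - w x) < e"
  using N1(2)[OF x(1) e] by blast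
  obtain d2 where d2: "0 < d2" "!!h. 0 < h ==> h < d2 ==> norm (integral (cbox (- x) (- x + h *\<^sub>R One)) (%x. w (- x)) /\<^sub>R h ^ DIM(real) - w (- (- x))) < e"
  using N2(2)[OF x(2) e] by blast
  have "dist ((f (x + t) - f x) / t) (w x) < e" if t: "t ~= 0" "\<bar>t\<bar> < min d1 d2" for t
  proof (cases "0 < t")
  case True
  have "integral {x..x + t} w = f (x + t) - f x" using w[of x "x + t"] True by (simp add: integral_unique)
  thus ?thesis using d1(2)[of t] True t by (simp add: dist_real_def divide_inverse mult.commute)
  next
  case False
  have "integral {- x..- x - t} (%x. w (- x)) = f x - f (x + t)" using w'[of "- x" "- x - t"] False by (simp add: integral_unique add.commute)
  moreover have "(f x - f (x + t)) / (- t) = (f (x + t) - f x) / t" using t(1) by (simp add: field_simps)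
  ultimately show ?thesis using d2(2)[of "- t"] False t by (simp add: dist_real_def divide_inverse mult.commute)
  qed
  thus "EX s>0. ALL t. t ~= 0 & dist t 0 < s --> dist ((f (x + t) - f x) / t) (w x) < e"
  using d1(1) d2(1) by (intro exI[of _ "min d1 d2"]) auto
 qed
 thus ?case ..
 qed
 thus ?thesis by (simp add: AE_completion_iff)
qed

text \<open>Defined along one fixed sequence, so that it is total and Borel measurable even where
  the derivative fails to exist.\<close>

definition dir_deriv :: "('a::euclidean_space => real) => 'a => 'a => real" where
 "dir_deriv u e x = lim (%n. (u (x + (1 / real (Suc n)) *\<^sub>R e) - u x) / (1 / real (Suc n)))"

lemma dir_deriv_measurable:
 assumes "continuous_on UNIV u"
 shows "dir_deriv u e : borel_measurable borel"
proof -
 have [measurable]: "u : borel_measurable borel" by (rule borel_measurable_continuous_onI[OF assms])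
 show ?thesis unfolding dir_deriv_def[abs_def] by measurable
qed

lemma dir_deriv_eq:
 assumes "((%t. (u (x + t *\<^sub>R e) - u x) / t) \<longlongrightarrow> d) (at 0)"
 shows "dir_deriv u e x = d" "(%n. (u (x + (1 / real (Suc n)) *\<^sub>R e) - u x) / (1 / real (Suc n))) \<longlonglongrightarrow> d"
proof -
 show l: "(%n. (u (x + (1 / real (Suc n)) *\<^sub>R e) - u x) / (1 / real (Suc n))) \<longlonglongrightarrow> d"
 by (rule filterlim_compose[OF assms inverse_Suc_at_0])
 show "dir_deriv u e x = d" unfolding dir_deriv_def by (rule limI[OF l])
qed

text \<open>On every line parallel to \<open>e\<close> the one-dimensional theorem applies. To
  conclude with Fubini the set of good points must be Borel, so \<open>P\<close> expresses
  convergence with countably many quantifiers over rational increments.\<close>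

lemma dir_deriv_AE:
 fixes u :: "'a::euclidean_space => real"
 assumes L: "L-lipschitz_on UNIV u" and e: "norm e = 1"
 shows "AE x in lborel. ((%t. (u (x + t *\<^sub>R e) - u x) / t) \<longlongrightarrow> dir_deriv u e x) (at 0)"
proof -
 have uc: "continuous_on UNIV u" by (rule lipschitz_on_continuous_on[OF L])
 have [measurable]: "u : borel_measurable borel" "dir_deriv u e : borel_measurable borel"
 by (rule borel_measurable_continuous_onI[OF uc]) (rule dir_deriv_measurable[OF uc])
 define P where "P x \<longleftrightarrow> (ALL k::nat. EX m::nat. ALL t::rat. t ~= 0 & \<bar>real_of_rat t\<bar> < 1 / real (Suc m) -->
 \<bar>(u (x + real_of_rat t *\<^sub>R e) - u x) / real_of_rat t - dir_deriv u e x\<bar> <= 1 / real (Suc k))" for x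
 have Pm: "{x. \<not> P x} : sets borel" unfolding P_def by measurable
 have P1: "P x" if l: "((%t. (u (x + t *\<^sub>R e) - u x) / t) \<longlongrightarrow> d) (at 0)" for x d
 unfolding P_def dir_deriv_eq(1)[OF l]
 proof
 fix k :: nat
 obtain s where s: "0 < s" "!!t. t ~= 0 ==> \<bar>t\<bar> < s ==> \<bar>(u (x + t *\<^sub>R e) - u x) / t - d\<bar> < 1 / real (Suc k)"
  using l[unfolded LIM_def, rule_format, of "1 / real (Suc k)"] by (auto simp: dist_real_def)
 obtain m where "1 / real (Suc m) < s" using reals_Archimedean[OF s(1)] by (auto simp: inverse_eq_divide)
 thus "EX m. ALL t. t ~= 0 & \<bar>real_of_rat t\<bar> < 1 / real (Suc m) --> \<bar>(u (x + real_of_rat t *\<^sub>R e) - u x) / real_of_rat t - d\<bar> <= 1 / real (Suc k)"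
  using s(2) by (intro exI[of _ m] allI impI less_imp_le) auto
 qed
 have P2: "((%t. (u (x + t *\<^sub>R e) - u x) / t) \<longlongrightarrow> dir_deriv u e x) (at 0)" if P: "P x" for x
 unfolding LIM_def
 proof (intro allI impI)
 fix r :: real assume r: "0 < r"
 obtain k where k: "1 / real (Suc k) < r" using reals_Archimedean[OF r] by (auto simp: inverse_eq_divide)
 obtain m where m: "!!t. t ~= 0 ==> \<bar>real_of_rat t\<bar> < 1 / real (Suc m) ==>
  \<bar>(u (x + real_of_rat t *\<^sub>R e) - u x) / real_of_rat t - dir_deriv u e x\<bar> <= 1 / real (Suc k)" using P unfolding P_def by blast
 have "\<bar>(u (x + t *\<^sub>R e) - u x) / t - dir_deriv u e x\<bar> <= 1 / real (Suc k)" if t: "t ~= 0" "\<bar>t\<bar> < 1 / real (Suc m)" for t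
 proof -
  define V where "V = {t. t ~= 0 & \<bar>t\<bar> < 1 / real (Suc m)}"
  define h where "h t = \<bar>(u (x + t *\<^sub>R e) - u x) / t - dir_deriv u e x\<bar>" for t
  have V: "open V" unfolding V_def by (intro open_Collect_conj open_Collect_neq open_Collect_less continuous_intros)
  have hc: "continuous_on V h" unfolding h_def[abs_def]
  by (intro continuous_intros continuous_on_compose2[OF uc]) (auto simp: V_def)
  \<comment> \<open>The quotient is continuous in \<open>t\<close> off 0, so a violation would
    persist at nearby rational increments.\<close>
  have "h t <= 1 / real (Suc k)"
  proof (rule ccontr)
  assume "\<not> ?thesis"
  hence "t : V Int h -` {1 / real (Suc k)<..}" using t by (auto simp: V_def)
  moreover have "open (V Int h -` {1 / real (Suc k)<..})" using continuous_open_preimage[OF hc V] by auto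
  ultimately obtain s where s: "0 < s" "ball t s <= V Int h -` {1 / real (Suc k)<..}" by (meson open_contains_ball)
  obtain q where q: "t < real_of_rat q" "real_of_rat q < t + s" using of_rat_dense[of t "t + s"] s(1) by auto
  hence "real_of_rat q : V" "1 / real (Suc k) < h (real_of_rat q)" using s(2) by (auto simp: dist_real_def subset_iff)
  thus False using m[of q] by (auto simp: V_def h_def)
  qed
  thus ?thesis by (simp add: h_def)
 qed
 thus "EX s>0. ALL t. t ~= 0 & dist t 0 < s --> dist ((u (x + t *\<^sub>R e) - u x) / t) (dir_deriv u e x) < r"
  using k by (intro exI[of _ "1 / real (Suc m)"]) (auto simp: dist_real_def intro: le_less_trans)
 qed
 have "(\<integral>\<^sup>+t. indicator {x. \<not> P x} (y + t *\<^sub>R e) \<partial>lborel) = 0" for y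
 proof -
 have "L-lipschitz_on UNIV (%t. u (y + t *\<^sub>R e))"
 proof (rule lipschitz_onI)
  fix s t
  have "dist (u (y + s *\<^sub>R e)) (u (y + t *\<^sub>R e)) <= L * dist (y + s *\<^sub>R e) (y + t *\<^sub>R e)" by (rule lipschitz_onD[OF L]) auto
  also have "dist (y + s *\<^sub>R e) (y + t *\<^sub>R e) = dist s t" using e by (simp add: dist_norm scaleR_diff_left[symmetric])
  finally show "dist (u (y + s *\<^sub>R e)) (u (y + t *\<^sub>R e)) <= L * dist s t" .
 qed (rule lipschitz_on_nonneg[OF L])
 from lipschitz_real_derivative_AE[OF this] have "AE t in lborel. P (y + t *\<^sub>R e)"
 proof eventually_elim
  case (elim t)
  then obtain d where "((%s. (u (y + (t + s) *\<^sub>R e) - u (y + t *\<^sub>R e)) / s) \<longlongrightarrow> d) (at 0)" by blast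
  thus ?case by (intro P1[of _ d]) (simp add: algebra_simps)
 qed
 hence "AE t in lborel. indicator {x. \<not> P x} (y + t *\<^sub>R e) = (0::ennreal)" by eventually_elim (simp add: indicator_def)
 thus ?thesis by (simp add: nn_integral_cong_AE[where v = "%_. 0"])
 qed
 hence "emeasure lborel {x. \<not> P x} = 0"
 using nn_integral_slab_fubini[OF e, of "indicator {x. \<not> P x}"] Pm by simp
 hence "AE x in lborel. P x" by (intro AE_I[of _ _ "{x. \<not> P x}"]) (use Pm in auto)
 thus ?thesis by eventually_elim (rule P2)
qed

lemma c1_deriv_reflect:
 assumes "c1_deriv f f'"
 shows "c1_deriv (%y. f (x - y)) (%y h. - f' (x - y) h)"
proof -
 have "c1_deriv (%y. x - y) (%_ h. - h)" unfolding c1_deriv_def by (auto intro!: derivative_eq_intros continuous_intros)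
 from c1_deriv_compose[OF this assms] show ?thesis by (simp add: linear_neg[OF c1_deriv_linear[OF assms]])
qed

locale lipschitz_compact =
 fixes u :: "'a::euclidean_space => real" and L :: real and K :: "'a set"
 assumes lip: "L-lipschitz_on UNIV u" and K: "compact K" and off: "!!x. x ~: K ==> u x = 0"
begin

lemma cont: "continuous_on UNIV u" by (rule lipschitz_on_continuous_on[OF lip])

lemma u_int: "integrable lborel u" by (rule integrable_compact_support[OF cont K off])

lemma dir_deriv_meas: "dir_deriv u e : borel_measurable borel" by (rule dir_deriv_measurable[OF cont])

lemma quotient_bound:
 assumes "norm e = 1" "t ~= 0"
 shows "\<bar>(u (x + t *\<^sub>R e) - u x) / t\<bar> <= L"
 using lipschitz_onD[OF lip, of "x + t *\<^sub>R e" x] assms by (simp add: dist_norm divide_simps abs_if split: if_splits)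

lemma dir_deriv_bound_AE:
 assumes e: "norm e = 1"
 shows "AE x in lborel. \<bar>dir_deriv u e x\<bar> <= L * indicator K x"
 using dir_deriv_AE[OF lip e]
proof eventually_elim
 case (elim x)
 show ?case
 proof (cases "x : K")
 case True
 have "((%t. \<bar>(u (x + t *\<^sub>R e) - u x) / t\<bar>) \<longlongrightarrow> \<bar>dir_deriv u e x\<bar>) (at 0)" by (intro tendsto_intros elim)
 hence "\<bar>dir_deriv u e x\<bar> <= L"
  by (rule tendsto_upperbound) (use quotient_bound[OF e] in \<open>auto simp: eventually_at_filter\<close>)
 thus ?thesis using True by simp
 next
 case False
 have "open (- K)" using compact_imp_closed[OF K] by auto
 moreover have "((%t. x + t *\<^sub>R e) \<longlongrightarrow> x + 0 *\<^sub>R e) (at 0)" by (intro tendsto_intros)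
 ultimately have "\<forall>\<^sub>F t in at 0. x + t *\<^sub>R e : - K" using False by (intro topological_tendstoD) auto
 hence "\<forall>\<^sub>F t in at 0. (u (x + t *\<^sub>R e) - u x) / t = 0" by eventually_elim (use False off in auto)
 hence "((%t. (u (x + t *\<^sub>R e) - u x) / t) \<longlongrightarrow> 0) (at 0)" by (rule tendsto_eventually)
 thus ?thesis using dir_deriv_eq(1) False by fastforce
 qed
qed

lemma dir_deriv_int:
 assumes e: "norm e = 1"
 shows "integrable lborel (dir_deriv u e)"
proof (rule Bochner_Integration.integrable_bound)
 show "integrable lborel (%x. L * indicator K x)" using borel_compact[OF K] emeasure_compact_finite[OF K] by simp
 show "AE x in lborel. norm (dir_deriv u e x) <= norm (L * indicator K x)" using dir_deriv_bound_AE[OF e] by eventually_elim auto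
qed (simp add: dir_deriv_meas)

text \<open>Translation invariance moves the difference quotient from \<open>u\<close> to
  \<open>eta\<close>. On one side the quotients are dominated through the Lipschitz constant, on the
  other \<open>difference_quotient_tendsto\<close> applies.\<close>

lemma weak_dir_deriv:
 assumes e: "norm e = 1" and eta: "c1_deriv eta eta'" "compact S" "!!x. x ~: S ==> eta x = (0::real)"
 shows "(LBINT x. u x * eta' x e) = - (LBINT x. dir_deriv u e x * eta x)" "integrable lborel (%x. dir_deriv u e x * eta x)"
proof -
 have etac: "continuous_on UNIV eta" by (rule c1_deriv_continuous[OF eta(1)])
 obtain B where B: "!!x. \<bar>eta x\<bar> <= B" using bounded_compact_support[OF etac eta(2,3)] by auto
 have [measurable]: "eta : borel_measurable borel" "u : borel_measurable borel" "dir_deriv u e : borel_measurable borel"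
 by (auto intro!: borel_measurable_continuous_onI etac cont c1_deriv_continuous_deriv[OF eta(1)] dir_deriv_meas)
 define h where "h n = 1 / real (Suc n)" for n
 have h: "0 < h n" for n by (simp add: h_def)
 have ui: "integrable lborel (%x. u (x + c) * eta x)" "integrable lborel (%x. u x * eta (x + c))" for c
 using integrable_bounded_times[OF integrable_lborel_shift[OF u_int], of eta B c] integrable_bounded_times[OF u_int, of "%x. eta (x + c)" B] B
 by (auto simp: mult.commute)
 have eq: "(LBINT x. (u (x + h n *\<^sub>R e) - u x) / h n * eta x) = (LBINT x. u x * ((eta (x - h n *\<^sub>R e) - eta x) / h n))" for n
 proof -
 have "(LBINT x. u (x + h n *\<^sub>R e) * eta x) = (LBINT x. u x * eta (x - h n *\<^sub>R e))"
  using integral_lborel_shift[of "%x. u x * eta (x - h n *\<^sub>R e)" "h n *\<^sub>R e"] by simp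
 hence "(LBINT x. (u (x + h n *\<^sub>R e) * eta x - u x * eta x) / h n) = (LBINT x. (u x * eta (x - h n *\<^sub>R e) - u x * eta x) / h n)"
  using ui(1)[of "h n *\<^sub>R e"] ui(2)[of "- h n *\<^sub>R e"] ui(1)[of 0] by simp
 thus ?thesis by (simp add: left_diff_distrib right_diff_distrib)
 qed
 have etai: "integrable lborel eta" by (rule integrable_compact_support[OF etac eta(2,3)])
 have "(%n. LBINT x. (u (x + h n *\<^sub>R e) - u x) / h n * eta x) \<longlonglongrightarrow> (LBINT x. dir_deriv u e x * eta x)"
 proof (rule integral_dominated_convergence)
 show "integrable lborel (%x. L * \<bar>eta x\<bar>)" using etai by simp
 show "AE x in lborel. (%n. (u (x + h n *\<^sub>R e) - u x) / h n * eta x) \<longlonglongrightarrow> dir_deriv u e x * eta x"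
  using dir_deriv_AE[OF lip e] by eventually_elim (unfold h_def, intro tendsto_mult_right dir_deriv_eq(2))
 show "AE x in lborel. norm ((u (x + h n *\<^sub>R e) - u x) / h n * eta x) <= L * \<bar>eta x\<bar>" for n
  using quotient_bound[OF e, of "h n"] h[of n] by (intro AE_I2) (simp only: real_norm_def abs_mult, intro mult_right_mono, auto)
 qed measurable
 moreover have "(%n. LBINT x. u x * ((eta (x - h n *\<^sub>R e) - eta x) / h n)) \<longlonglongrightarrow> (LBINT x. u x * - eta' x e)"
 proof -
 obtain C where C: "!!x. \<bar>u x\<bar> <= C" using bounded_compact_support[OF cont K off] by auto
 have um: "u : borel_measurable borel" by measurable
 have "(%n. LBINT x. u x * ((eta (x + h n *\<^sub>R - e) - eta x) / h n)) \<longlonglongrightarrow> (LBINT x. u x * eta' x (- e))"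
  unfolding h_def by (rule difference_quotient_tendsto[OF eta um C])
 thus ?thesis by (simp add: linear_neg[OF c1_deriv_linear[OF eta(1)]])
 qed
 ultimately have "(LBINT x. dir_deriv u e x * eta x) = (LBINT x. u x * - eta' x e)" unfolding eq by (rule LIMSEQ_unique)
 thus "(LBINT x. u x * eta' x e) = - (LBINT x. dir_deriv u e x * eta x)" by simp
 show "integrable lborel (%x. dir_deriv u e x * eta x)"
 using integrable_bounded_times[OF dir_deriv_int[OF e], of eta B] B by (simp add: mult.commute)
qed

text \<open>Linearity in the direction is clear after testing, since the derivative then falls on a
  smooth function. With mollifiers as test functions, all mollifications of the defect
  \<open>w\<close> vanish; they converge to \<open>w\<close> in L1, so \<open>w\<close> is zero
  almost everywhere.\<close>

lemma dir_deriv_linear_AE: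
 assumes e: "norm e = 1"
 shows "AE x in lborel. dir_deriv u e x = (\<Sum>b\<in>Basis. (e \<bullet> b) * dir_deriv u b x)"
proof -
 define w where "w x = dir_deriv u e x - (\<Sum>b\<in>Basis. (e \<bullet> b) * dir_deriv u b x)" for x
 have w: "integrable lborel w" unfolding w_def[abs_def]
 by (intro Bochner_Integration.integrable_diff Bochner_Integration.integrable_sum integrable_mult_right dir_deriv_int e) simp
 obtain rho :: "nat => 'a => real" and rho' where m: "mollifiers rho rho'" by (rule mollifiers_exist)
 have z: "(LBINT y. rho j (x - y) *\<^sub>R w y) = 0" for j x
 proof -
 define eta where "eta y = rho j (x - y)" for y
 define S where "S = (%z. x - z) ` cball 0 (1 / real (Suc j))"
 have c1: "c1_deriv eta (%y h. - rho' j (x - y) h)" unfolding eta_def[abs_def] using m by (intro c1_deriv_reflect) (auto simp: mollifiers_def)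
 have S: "compact S" unfolding S_def by (intro compact_continuous_image continuous_intros compact_cball)
 have eta0: "eta y = 0" if "y ~: S" for y
  unfolding eta_def
 proof (rule mollifiers_compact_support[OF m])
  show "x - y ~: cball 0 (1 / real (Suc j))" using that unfolding S_def by (metis diff_diff_eq2 add_diff_cancel_left' imageI)
 qed
 have W: "(LBINT x. u x * - rho' j (x' - x) e') = - (LBINT x. dir_deriv u e' x * eta x)" "integrable lborel (%x. dir_deriv u e' x * eta x)"
  if "norm e' = 1" "x' = x" for e' x' using weak_dir_deriv[OF that(1) c1 S eta0] that(2) by auto
 have lin: "linear (rho' j y)" for y using m c1_deriv_linear by (metis mollifiers_def)
 have ui: "integrable lborel (%y. u y * rho' j (x - y) b)" for b
 proof (rule integrable_compact_support[OF _ K])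
  show "continuous_on UNIV (%y. u y * rho' j (x - y) b)"
  using continuous_on_mult[OF cont continuous_on_minus[OF c1_deriv_continuous_deriv[OF c1, of UNIV b]]] by simp
 qed (simp add: off)
 have "(LBINT y. rho j (x - y) *\<^sub>R w y) = (LBINT y. dir_deriv u e y * eta y - (\<Sum>b\<in>Basis. (e \<bullet> b) * (dir_deriv u b y * eta y)))"
  by (intro Bochner_Integration.integral_cong refl) (simp add: w_def eta_def algebra_simps sum_distrib_left)
 also have "... = (LBINT y. dir_deriv u e y * eta y) - (\<Sum>b\<in>Basis. (e \<bullet> b) * (LBINT y. dir_deriv u b y * eta y))"
  using W(2)[OF e refl] W(2)[OF _ refl] by (subst Bochner_Integration.integral_diff) (auto simp: Bochner_Integration.integral_sum)
 also have "... = (LBINT y. u y * rho' j (x - y) e) - (\<Sum>b\<in>Basis. (e \<bullet> b) * (LBINT y. u y * rho' j (x - y) b))"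
  using W(1)[OF e refl] W(1)[OF _ refl] by simp
 also have "(\<Sum>b\<in>Basis. (e \<bullet> b) * (LBINT y. u y * rho' j (x - y) b)) = (LBINT y. (\<Sum>b\<in>Basis. (e \<bullet> b) * (u y * rho' j (x - y) b)))"
  using ui by (subst Bochner_Integration.integral_sum) auto
 also have "(%y. \<Sum>b\<in>Basis. (e \<bullet> b) * (u y * rho' j (x - y) b)) = (%y. u y * rho' j (x - y) e)"
 proof
  fix y
  have "rho' j (x - y) e = (\<Sum>b\<in>Basis. (e \<bullet> b) * rho' j (x - y) b)"
  using linear_sum[OF lin, of "x - y" "%b. (e \<bullet> b) *\<^sub>R b" Basis] linear_cmul[OF lin] by (simp add: euclidean_representation)
  thus "(\<Sum>b\<in>Basis. (e \<bullet> b) * (u y * rho' j (x - y) b)) = u y * rho' j (x - y) e" by (simp add: sum_distrib_left algebra_simps)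
 qed
 finally show ?thesis by simp
 qed
 have "(%j::nat. LBINT x. norm (w x)) \<longlonglongrightarrow> 0" using mollifiers_L1(2)[OF m w] by (simp add: z[unfolded real_scaleR_def])
 hence "(LBINT x. norm (w x)) = 0" by (simp add: LIMSEQ_const_iff)
 hence "AE x in lborel. w x = 0" using integral_nonneg_eq_0_iff_AE[OF integrable_norm[OF w]] by simp
 thus ?thesis by eventually_elim (simp add: w_def)
qed

text \<open>Off one null set the directional derivatives exist and are linear for all directions of
  a countable dense set \<open>T\<close>. A finite net in \<open>T\<close> and the Lipschitz bound
  make the convergence uniform over the whole sphere, which is total differentiability.\<close>

theorem rademacher: "AE x in lborel. (u has_derivative (%h. \<Sum>b\<in>Basis. (h \<bullet> b) * dir_deriv u b x)) (at x)"
proof -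
 obtain T where T: "countable T" "T <= sphere (0::'a) 1" "sphere 0 1 <= closure T" by (rule separable)
 have "AE x in lborel. ALL e:T. ((%t. (u (x + t *\<^sub>R e) - u x) / t) \<longlongrightarrow> (\<Sum>b\<in>Basis. (e \<bullet> b) * dir_deriv u b x)) (at 0)"
 unfolding AE_ball_countable[OF T(1)]
 proof
 fix e assume "e : T"
 hence e: "norm e = 1" using T(2) by auto
 show "AE x in lborel. ((%t. (u (x + t *\<^sub>R e) - u x) / t) \<longlongrightarrow> (\<Sum>b\<in>Basis. (e \<bullet> b) * dir_deriv u b x)) (at 0)"
  using dir_deriv_AE[OF lip e] dir_deriv_linear_AE[OF e] by eventually_elim simp
 qed
 thus ?thesis
 proof eventually_elim
 case (elim x)
 define g where "g = (\<Sum>b\<in>Basis. dir_deriv u b x *\<^sub>R b)"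
 have gi: "(\<Sum>b\<in>Basis. (h \<bullet> b) * dir_deriv u b x) = g \<bullet> h" for h by (simp add: g_def inner_sum_left inner_commute[of h] mult.commute)
 have L0: "0 <= L" by (rule lipschitz_on_nonneg[OF lip])
 show ?case unfolding gi has_derivative_at_alt
 proof (intro conjI allI impI bounded_linear_inner_right)
  fix ep :: real assume ep: "0 < ep"
  \<comment> \<open>The mesh of the net: replacing a direction by a net point changes
    \<open>u\<close> by at most \<open>L * ep'\<close> and the linear part by at most
    \<open>norm g * ep'\<close>, per unit length, together at most half of
    \<open>ep\<close>.\<close>
  define ep' where "ep' = ep / (2 * (L + norm g + 1))"
  have pos: "0 < L + norm g + 1" using L0 by (simp add: add_nonneg_pos)
  have ep': "0 < ep'" "(L + norm g) * ep' <= ep / 2"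
  using ep pos by (simp_all add: ep'_def divide_simps)
  have "sphere 0 1 <= (\<Union>e\<in>T. ball e ep')"
  proof
  fix y :: 'a assume "y : sphere 0 1"
  then obtain e where "e : T" "dist e y < ep'" using T(3) ep'(1) closure_approachable[of y T] by blast
  thus "y : (\<Union>e\<in>T. ball e ep')" by auto
  qed
  then obtain T0 where T0: "T0 <= T" "finite T0" "sphere 0 1 <= (\<Union>e\<in>T0. ball e ep')"
  by (rule compactE_image[OF compact_sphere, rotated]) auto
  have "ALL e:T0. \<forall>\<^sub>F t in at 0. \<bar>(u (x + t *\<^sub>R e) - u x) / t - g \<bullet> e\<bar> < ep / 2"
  proof
  fix e assume "e : T0"
  hence "((%t. (u (x + t *\<^sub>R e) - u x) / t) \<longlongrightarrow> g \<bullet> e) (at 0)" using elim T0(1) by (auto simp: gi)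
  thus "\<forall>\<^sub>F t in at 0. \<bar>(u (x + t *\<^sub>R e) - u x) / t - g \<bullet> e\<bar> < ep / 2"
   using ep by (auto dest!: tendstoD[of _ _ _ "ep / 2"] simp: dist_real_def)
  qed
  hence "\<forall>\<^sub>F t in at 0. ALL e:T0. \<bar>(u (x + t *\<^sub>R e) - u x) / t - g \<bullet> e\<bar> < ep / 2" by (rule eventually_ball_finite[OF T0(2)])
  then obtain de where de: "0 < de" "!!t e. t ~= 0 ==> \<bar>t\<bar> < de ==> e : T0 ==> \<bar>(u (x + t *\<^sub>R e) - u x) / t - g \<bullet> e\<bar> < ep / 2"
  by (auto simp: eventually_at dist_real_def)
  have "norm (u y - u x - g \<bullet> (y - x)) <= ep * norm (y - x)" if y: "norm (y - x) < de" for y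
  proof (cases "y = x")
  case False
  define t where "t = norm (y - x)"
  define z where "z = (1 / t) *\<^sub>R (y - x)"
  have t: "0 < t" "t < de" using False y by (auto simp: t_def)
  have yz: "y = x + t *\<^sub>R z" "norm z = 1" using t(1) by (auto simp: z_def t_def)
  obtain e where e: "e : T0" "dist e z < ep'" using T0(3) yz(2) by (force simp: subset_iff)
  have "\<bar>u (x + t *\<^sub>R z) - u (x + t *\<^sub>R e)\<bar> <= L * (t * dist e z)"
   using lipschitz_onD[OF lip, of "x + t *\<^sub>R z" "x + t *\<^sub>R e"] t(1) by (simp add: dist_norm scaleR_diff_right[symmetric] norm_minus_commute)
  also have "... <= L * (t * ep')" using e(2) t(1) L0 by (intro mult_left_mono) auto
  finally have 1: "\<bar>u (x + t *\<^sub>R z) - u (x + t *\<^sub>R e)\<bar> <= L * (t * ep')" .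
  have "\<bar>(u (x + t *\<^sub>R e) - u x) / t - g \<bullet> e\<bar> < ep / 2" using t by (intro de(2) e) auto
  hence "t * \<bar>(u (x + t *\<^sub>R e) - u x) / t - g \<bullet> e\<bar> <= t * (ep / 2)" using t(1) by simp
  moreover have "t * \<bar>(u (x + t *\<^sub>R e) - u x) / t - g \<bullet> e\<bar> = \<bar>u (x + t *\<^sub>R e) - u x - t * (g \<bullet> e)\<bar>"
   proof -
   have "t * (a / t - c) = a - t * c" for a c using t(1) by (simp add: field_simps)
   thus ?thesis using t(1) abs_mult[of t] by (metis abs_of_pos)
  qed
  ultimately have 2: "\<bar>u (x + t *\<^sub>R e) - u x - t * (g \<bullet> e)\<bar> <= t * (ep / 2)" by simp
  have "\<bar>g \<bullet> (e - z)\<bar> <= norm g * ep'"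
   using order_trans[OF Cauchy_Schwarz_ineq2[of g "e - z"] mult_left_mono[of _ ep' "norm g"]] e(2) by (simp add: dist_norm)
  hence "t * \<bar>g \<bullet> (e - z)\<bar> <= t * (norm g * ep')" using t(1) by simp
  hence 3: "\<bar>t * (g \<bullet> e) - t * (g \<bullet> z)\<bar> <= t * (norm g * ep')"
   using t(1) by (simp add: inner_diff_right right_diff_distrib[symmetric] abs_mult)
  have "u y - u x - g \<bullet> (y - x) = u (x + t *\<^sub>R z) - u x - t * (g \<bullet> z)" using yz(1) by simp
  hence "\<bar>u y - u x - g \<bullet> (y - x)\<bar> <= L * (t * ep') + t * (ep / 2) + t * (norm g * ep')" using 1 2 3 by linarith
  also have "... = t * ((L + norm g) * ep' + ep / 2)" by (simp add: algebra_simps)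
  also have "... <= t * ep" using ep'(2) t(1) by (intro mult_left_mono) auto
  finally show ?thesis by (simp add: t_def mult.commute)
  qed simp
  thus "EX de>0. ALL y. norm (y - x) < de --> norm (u y - u x - g \<bullet> (y - x)) <= ep * norm (y - x)" using de(1) by blast
 qed
 qed
qed

end

section \<open>Divergence of the field and the energy estimate\<close>

lemma lipschitz_divergence_AE:
 fixes psi :: "'a::euclidean_space => 'a"
 assumes "!!b. b : Basis ==> lipschitz_compact (%x. psi x \<bullet> b) L K"
 shows "AE x in lborel. psi differentiable at x & divergence psi x = (\<Sum>b\<in>Basis. dir_deriv (%x. psi x \<bullet> b) b x)"
proof -
 have "AE x in lborel. ALL b:Basis. ((%x. psi x \<bullet> b) has_derivative (%h. \<Sum>c\<in>Basis. (h \<bullet> c) * dir_deriv (%x. psi x \<bullet> b) c x)) (at x)"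
 unfolding AE_ball_countable[OF countable_finite[OF finite_Basis]] using lipschitz_compact.rademacher[OF assms] by blast
 thus ?thesis
 proof eventually_elim
 case (elim x)
 hence d: "(psi has_derivative (%h. \<Sum>b\<in>Basis. (\<Sum>c\<in>Basis. (h \<bullet> c) * dir_deriv (%x. psi x \<bullet> b) c x) *\<^sub>R b)) (at x)"
  by (subst has_derivative_componentwise_within) simp
 have "(\<Sum>c\<in>Basis. (b \<bullet> c) * dir_deriv (%x. psi x \<bullet> b) c x) = dir_deriv (%x. psi x \<bullet> b) b x" if "b : Basis" for b
  using that by (simp add: inner_Basis if_distrib[of "%t. t * _"] cong: if_cong)
 thus ?case using d by (auto simp: differentiable_def divergence_def frechet_derivative_at[OF d, symmetric] inner_sum_left_Basis)
 qed
qed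

text \<open>By the weak formula the divergence of the mollified field is an average of the
  divergence of \<open>psi\<close>, weighted by a nonnegative kernel of integral one, and so obeys
  the same bound everywhere.\<close>

lemma mollified_divergence_bound:
 fixes psi :: "'a::euclidean_space => 'a"
 assumes psi: "!!b. b : Basis ==> lipschitz_compact (%x. psi x \<bullet> b) L K" and d: "AE x in lborel. \<bar>divergence psi x\<bar> <= d"
 and rho: "c1_deriv rho rho'" "!!x. 0 <= rho x" "integrable lborel rho" "(LBINT x. rho x) = 1" "compact S" "!!x. x ~: S ==> rho x = 0"
 shows "\<bar>\<Sum>b\<in>Basis. \<integral>y. rho' (x - y) b * (psi y \<bullet> b) \<partial>lborel\<bar> <= d"
proof -
 have D: "AE x in lborel. psi differentiable at x & divergence psi x = (\<Sum>b\<in>Basis. dir_deriv (%x. psi x \<bullet> b) b x)"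
 by (rule lipschitz_divergence_AE[OF psi])
 define eta where "eta y = rho (x - y)" for y
 define S' where "S' = (%z. x - z) ` S"
 have c1: "c1_deriv eta (%y h. - rho' (x - y) h)" unfolding eta_def[abs_def] by (rule c1_deriv_reflect[OF rho(1)])
 have S': "compact S'" unfolding S'_def by (intro compact_continuous_image continuous_intros rho(5))
 have eta0: "eta y = 0" if "y ~: S'" for y
 unfolding eta_def by (rule rho(6)) (use that in \<open>force simp: S'_def image_iff\<close>)
 have etai: "integrable lborel eta" by (rule integrable_compact_support[OF c1_deriv_continuous[OF c1] S' eta0])
 have eta1: "(LBINT y. eta y) = 1" unfolding eta_def using lborel_reflect(1)[of rho x] rho(3,4) by simp
 have W: "(LBINT y. rho' (x - y) b * (psi y \<bullet> b)) = (LBINT y. dir_deriv (%x. psi x \<bullet> b) b y * eta y)"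
 "integrable lborel (%y. dir_deriv (%x. psi x \<bullet> b) b y * eta y)" if "b : Basis" for b
 using lipschitz_compact.weak_dir_deriv[OF psi[OF that] norm_Basis[OF that] c1 S' eta0] by (simp_all add: mult.commute)
 have "(\<Sum>b\<in>Basis. LBINT y. rho' (x - y) b * (psi y \<bullet> b)) = (LBINT y. (\<Sum>b\<in>Basis. dir_deriv (%x. psi x \<bullet> b) b y * eta y))"
 using W by (subst Bochner_Integration.integral_sum) auto
 also have "\<bar>...\<bar> <= (LBINT y. d * eta y)"
 unfolding real_norm_def[symmetric]
 proof (rule order_trans[OF integral_norm_bound integral_mono_AE])
 show "AE y in lborel. norm (\<Sum>b\<in>Basis. dir_deriv (%x. psi x \<bullet> b) b y * eta y) <= d * eta y"
  using d D
 proof eventually_elim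
  case (elim y)
  thus ?case using rho(2)[of "x - y"] by (simp add: sum_distrib_right[symmetric] abs_mult eta_def mult_right_mono)
 qed
 qed (use W(2) etai in auto)
 finally show ?thesis using eta1 by simp
qed

lemma nn_integral_lebesgue_on_lborel:
 assumes "Om : sets borel" "f : borel_measurable borel" "!!x. x ~: Om ==> f x = 0"
 shows "(\<integral>\<^sup>+x. f x \<partial>lebesgue_on Om) = (\<integral>\<^sup>+x. f x \<partial>lborel)"
proof -
 have "(\<integral>\<^sup>+x. f x \<partial>lebesgue_on Om) = (\<integral>\<^sup>+x. f x * indicator Om x \<partial>lebesgue)"
 using assms(1) by (subst nn_integral_restrict_space) auto
 also have "(%x. f x * indicator Om x) = f" using assms(3) by (auto simp: indicator_def fun_eq_iff)
 finally show ?thesis using assms(2) by (simp add: nn_integral_completion)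
qed

lemma smoothstep_indicator_bounds:
 assumes "g : {0, 1}"
 shows "\<bar>smoothstep t - g\<bar> <= 3 * (t - g)\<^sup>2" "(smoothstep_deriv t)\<^sup>2 <= 36 * (t - g)\<^sup>2"
proof -
 have "\<bar>smoothstep t - g\<bar> <= 3 * (t - g)\<^sup>2 & (smoothstep_deriv t)\<^sup>2 <= 36 * (t - g)\<^sup>2"
 proof (cases "g = 0")
 case True
 thus ?thesis using smoothstep_le_square[of t] smoothstep_nonneg[of t] smoothstep_deriv_le_square[of t] by simp
 next
 case False
 hence "g = 1" using assms by simp
 thus ?thesis using smoothstep_le_square[of "1 - t"] smoothstep_nonneg[of "1 - t"] smoothstep_deriv_le_square[of "1 - t"]
  by (simp add: smoothstep_reflect smoothstep_deriv_reflect power2_commute[of 1])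
 qed
 thus "\<bar>smoothstep t - g\<bar> <= 3 * (t - g)\<^sup>2" "(smoothstep_deriv t)\<^sup>2 <= 36 * (t - g)\<^sup>2" by auto
qed

text \<open>The calibration inequality for \<open>u\<close> and Gauss-Green for \<open>E\<close>,
  both for the same field, are combined with factor \<open>al\<close>. Replacing the composed
  function by the indicator in the divergence term costs \<open>3 * al * d\<close>, and the gradient
  term costs \<open>9 * al\<^sup>2\<close> after AM-GM, each times the fidelity integral.\<close>

lemma calibrated_energy_bound:
 fixes Om E :: "'a::euclidean_space set"
 assumes Om: "open Om" and u: "u : SBV Om" and P: "perim Om E G n" and E: "E <= Om" and al: "0 < al" and d: "0 <= d"
 and n: "!!b. b : Basis ==> lipschitz_compact (%x. n x \<bullet> b) L K" "compact K" "K <= Om" "!!x. x ~: K ==> n x = 0" "!!x. norm (n x) <= 1"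
  "AE x in lborel. \<bar>divergence n x\<bar> <= d"
 defines "A \<equiv> (\<integral>\<^sup>+x. ennreal ((norm (approx_gradient Om u x))\<^sup>2) \<partial>lebesgue_on Om)"
 and "S \<equiv> hausdorff_outer (DIM('a) - 1) (singular_set Om u)"
 and "Q \<equiv> (\<integral>\<^sup>+x. ennreal ((u x - indicat_real E x)\<^sup>2) \<partial>lebesgue_on Om)"
 assumes fin: "A < \<infinity>" "S < \<infinity>" "Q < \<infinity>"
 shows "ennreal (al * measure G UNIV) <= A + ennreal al * S + ennreal (3 * al * d + 9 * al\<^sup>2) * Q"
proof -
 interpret perim Om E G n by (rule P)
 have uB: "u : BV Om" using u by (simp add: SBV_def)
 obtain v M s where R: "bv_rep Om v M s" and uv: "AE x in lebesgue_on Om. u x = v x"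
 and dd: "!!B. B : sets borel ==> B <= Om ==> distr_deriv Om u B = (LINT x|M. indicator B x *\<^sub>R s x)"
 by (rule BV_bv_rep[OF Om uB]) (rule that)
 interpret R: bv_rep Om v M s by (rule R)
 obtain N k where dec: "R.decomp N k" by (rule R.decomp_exists)
 define w where "w x = k x *\<^sub>R s x" for x
 have w: "integrable lborel w" unfolding w_def by (rule R.decomp_density_integrable[OF dec])
 have grad: "AE x in lebesgue_on Om. approx_gradient Om u x = w x" unfolding w_def by (rule R.approx_gradient_eq(2)[OF dd dec])
 have wm[measurable]: "w : borel_measurable borel" "v : borel_measurable borel" "E : sets borel"
 using w R.v_int E_sets by auto
 have Omb: "Om : sets borel" using Om by simp
 define g where "g = indicat_real E"
 have gm[measurable]: "g : borel_measurable borel" unfolding g_def by measurable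
 have A: "A = (\<integral>\<^sup>+x. ennreal ((norm (w x))\<^sup>2) \<partial>lborel)"
 proof -
 have "A = (\<integral>\<^sup>+x. ennreal ((norm (w x))\<^sup>2) \<partial>lebesgue_on Om)" unfolding A_def using grad by (intro nn_integral_cong_AE) (auto elim: eventually_mono)
 also have "... = (\<integral>\<^sup>+x. ennreal ((norm (w x))\<^sup>2) \<partial>lborel)"
  by (rule nn_integral_lebesgue_on_lborel[OF Omb]) (measurable, simp add: w_def R.s_off)
 finally show ?thesis .
 qed
 have Q: "Q = (\<integral>\<^sup>+x. ennreal ((v x - g x)\<^sup>2) \<partial>lborel)"
 proof -
 have "Q = (\<integral>\<^sup>+x. ennreal ((v x - g x)\<^sup>2) \<partial>lebesgue_on Om)" unfolding Q_def g_def using uv by (intro nn_integral_cong_AE) (auto elim: eventually_mono)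
 also have "... = (\<integral>\<^sup>+x. ennreal ((v x - g x)\<^sup>2) \<partial>lborel)"
 proof (rule nn_integral_lebesgue_on_lborel[OF Omb])
  show "ennreal ((v x - g x)\<^sup>2) = 0" if "x ~: Om" for x using that E R.v_off by (auto simp: g_def indicator_def)
 qed simp
 finally show ?thesis .
 qed
 have wi: "integrable lborel (%x. (norm (w x))\<^sup>2)" and vi: "integrable lborel (%x. (v x - g x)\<^sup>2)"
 using fin(1,3) A Q by (auto intro!: integrableI_nonneg)
 define a where "a = (LBINT x. (norm (w x))\<^sup>2)"
 define q where "q = (LBINT x. (v x - g x)\<^sup>2)"
 have Aa: "A = ennreal a" and Qq: "Q = ennreal q" unfolding a_def q_def A Q using wi vi by (auto intro!: nn_integral_eq_integral)
 have aq: "0 <= a" "0 <= q" by (auto simp: a_def q_def)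
 define S0 where "S0 = {x : singular_set Om u. jump_vector u x ~= 0}"
 note S0 = R.SBV_singular_part[OF dd dec u, folded S0_def]
 have S0Om: "S0 <= Om" by (auto simp: S0_def singular_set_def)
 have S0S: "hausdorff_outer (DIM('a) - 1) S0 <= S" unfolding S_def by (rule hausdorff_outer_mono) (auto simp: S0_def)
 hence S0f: "hausdorff_outer (DIM('a) - 1) S0 < \<infinity>" using fin(2) by (rule le_less_trans)
 define h where "h = measure G UNIV"
 have main: "al * ((1 - e) * h) <= a + al * enn2real S + (3 * al * d + 9 * al\<^sup>2) * q" if e: "0 < e" for e
 proof -
 obtain ph rho rho' and C :: "'a set" where ph: "test_field Om ph" "!!x. norm (ph x) <= 1" "!!x. norm (ph x - n x) <= e"
  and rho: "c1_deriv rho rho'" "!!x. 0 <= rho x" "integrable lborel rho" "(LBINT x. rho x) = 1" "compact C" "!!x. x ~: C ==> rho x = 0"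
  and div: "!!x. divergence ph x = (\<Sum>b\<in>Basis. LBINT y. rho' (x - y) b * (n y \<bullet> b))"
  by (rule mollify_field[OF n_cont Om n(2,3,4,5) e]) (assumption, rule that)
 have dle: "\<bar>divergence ph x\<bar> <= d" for x unfolding div by (rule mollified_divergence_bound[OF n(1,6) rho]) assumption+
 have phm: "ph : borel_measurable borel"
  by (rule test_fieldE[OF ph(1)]) (rule borel_measurable_continuous_onI[OF c1_deriv_continuous])
 note di = integrable_smoothstep_divergence[OF ph(1)]
 have si: "integrable lborel (%x. smoothstep (v x) * divergence ph x)" "integrable lborel (%x. g x * divergence ph x)"
  by (rule di(2)[OF wm(2)]) (rule integrable_bounded_times[OF di(1) gm, of 1], simp add: g_def indicator_def)
 have cal: "- (LBINT x. smoothstep (v x) * divergence ph x) <= (LBINT x. smoothstep_deriv (v x) * (ph x \<bullet> w x)) + enn2real S"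
 proof -
  have "enn2real (hausdorff_outer (DIM('a) - 1) S0) <= enn2real S" by (rule enn2real_mono[OF S0S]) (use fin(2) in simp)
  thus ?thesis using R.calibration_inequality[OF dec S0(1) S0Om S0(2) S0f ph(1,2), folded w_def] by linarith
 qed
 \<comment> \<open>On the frontier \<open>n\<close> is the unit normal and \<open>ph\<close> differs
   from it by at most \<open>e\<close>.\<close>
 have gg: "(1 - e) * h <= - (LBINT x. g x * divergence ph x)"
 proof -
  have "(LINT z|G. 1 - e) <= (LINT z|G. ph z \<bullet> n z)"
  proof (rule integral_mono_AE)
  show "integrable G (%z. ph z \<bullet> n z)"
  proof (rule integrable_const_bound[of _ 1])
   show "AE z in G. norm (ph z \<bullet> n z) <= 1"
   by (rule AE_I2) (use ph(2) n(5) in \<open>auto intro!: order_trans[OF Cauchy_Schwarz_ineq2] mult_le_one\<close>)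
  qed (use n_meas phm in \<open>intro measurable_G borel_measurable_inner\<close>)
  show "AE z in G. 1 - e <= ph z \<bullet> n z"
   using AE_n_norm
  proof eventually_elim
   case (elim z)
   have "ph z \<bullet> n z = n z \<bullet> n z + (ph z - n z) \<bullet> n z" by (simp add: inner_diff_left)
   moreover have "\<bar>(ph z - n z) \<bullet> n z\<bar> <= e" using Cauchy_Schwarz_ineq2[of "ph z - n z" "n z"] ph(3)[of z] elim by simp
   moreover have "n z \<bullet> n z = 1" using elim by (simp add: norm_eq_1)
   ultimately show ?case by simp
  qed
  qed simp
  moreover have "E Int Om = E" using E by auto
  ultimately show ?thesis using divergence_gauss_green[OF ph(1)] by (simp add: g_def h_def space_G mult.commute)
 qed
 have fi: "integrable lborel (%x. smoothstep_deriv (v x) * (ph x \<bullet> w x))" by (rule integrable_smoothstep_deriv_inner[OF wm(2) phm ph(2) w])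
 have gd: "integrable lborel (%x. (smoothstep (v x) - g x) * divergence ph x)" using si by (simp add: left_diff_distrib)
 have "(1 - e) * h <= (LBINT x. smoothstep_deriv (v x) * (ph x \<bullet> w x)) + enn2real S + (LBINT x. (smoothstep (v x) - g x) * divergence ph x)"
  using cal gg si by (simp add: left_diff_distrib)
 hence "al * ((1 - e) * h) <= al * ((LBINT x. smoothstep_deriv (v x) * (ph x \<bullet> w x)) + enn2real S + (LBINT x. (smoothstep (v x) - g x) * divergence ph x))"
  using al by (intro mult_left_mono) auto
 also have "... = (LBINT x. al * (smoothstep_deriv (v x) * (ph x \<bullet> w x)) + al * ((smoothstep (v x) - g x) * divergence ph x)) + al * enn2real S"
  using fi gd by (simp add: distrib_left)
 also have "... <= (LBINT x. (norm (w x))\<^sup>2 + (3 * al * d + 9 * al\<^sup>2) * (v x - g x)\<^sup>2) + al * enn2real S"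
 proof (intro add_right_mono integral_mono)
  fix x
  let ?f = "smoothstep_deriv (v x)" and ?t = "(v x - g x)\<^sup>2"
  have "g x : {0, 1}" by (auto simp: g_def indicator_def)
  note b = smoothstep_indicator_bounds[OF this, of "v x"]
  have "ph x \<bullet> w x <= norm (w x)" using order_trans[OF norm_cauchy_schwarz[of "ph x" "w x"] mult_right_mono[OF ph(2)[of x], of "norm (w x)"]] by simp
  hence "al * (?f * (ph x \<bullet> w x)) <= al * (?f * norm (w x))" using al smoothstep_deriv_nonneg[of "v x"] by (intro mult_left_mono) auto
  \<comment> \<open>AM-GM weighted so that the squared gradient has coefficient 1, as in the
    functional; with the bound 36 for the squared derivative the rest becomes 36/4 = 9.\<close>
  also have "... <= (norm (w x))\<^sup>2 + al\<^sup>2 * ?f\<^sup>2 / 4"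
  using zero_le_power2[of "norm (w x) - al * ?f / 2"] by (simp add: power2_eq_square algebra_simps)
  also have "al\<^sup>2 * ?f\<^sup>2 <= al\<^sup>2 * (36 * ?t)" using b(2) by (intro mult_left_mono) auto
  finally have 1: "al * (?f * (ph x \<bullet> w x)) <= (norm (w x))\<^sup>2 + 9 * al\<^sup>2 * ?t" by simp
  have "(smoothstep (v x) - g x) * divergence ph x <= \<bar>smoothstep (v x) - g x\<bar> * \<bar>divergence ph x\<bar>" by (simp add: abs_mult[symmetric])
  also have "... <= (3 * ?t) * d" using b(1) dle[of x] by (intro mult_mono) auto
  finally have "al * ((smoothstep (v x) - g x) * divergence ph x) <= al * ((3 * ?t) * d)" using al by (intro mult_left_mono) auto
  thus "al * (?f * (ph x \<bullet> w x)) + al * ((smoothstep (v x) - g x) * divergence ph x) <= (norm (w x))\<^sup>2 + (3 * al * d + 9 * al\<^sup>2) * ?t"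
  using 1 by (simp add: algebra_simps)
 qed (use fi gd wi vi in auto)
 also have "... = a + al * enn2real S + (3 * al * d + 9 * al\<^sup>2) * q" using wi vi by (simp add: a_def q_def)
 finally show ?thesis .
 qed
 have "((%e. al * ((1 - e) * h)) \<longlongrightarrow> al * ((1 - 0) * h)) (at_right 0)" by (intro tendsto_intros)
 hence le: "al * ((1 - 0) * h) <= a + al * enn2real S + (3 * al * d + 9 * al\<^sup>2) * q"
 by (rule tendsto_upperbound) (use eventually_at_right_less[of "0::real"] main in \<open>auto elim: eventually_mono\<close>)
 have "ennreal (al * h) <= ennreal (a + al * enn2real S + (3 * al * d + 9 * al\<^sup>2) * q)" using le by (intro ennreal_leI) simp
 also have "... = A + ennreal al * S + ennreal (3 * al * d + 9 * al\<^sup>2) * Q"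
 using aq al d fin(2) by (simp add: Aa Qq ennreal_mult ennreal_plus less_top)
 finally show ?thesis by (simp add: h_def)
qed

section \<open>Extension of the field and conclusion\<close>

text \<open>\<open>Om\<close> need not be convex, and only pairs of points on different sides of its
  boundary require an argument: the segment joining them crosses the frontier, where
  \<open>psi\<close> vanishes, at a point no farther away than the outer one.\<close>

lemma extend_compactly_supported_field:
 fixes psi :: "'a::euclidean_space => 'a"
 assumes Om: "open Om" and L: "L-lipschitz_on (closure Om) psi" and K: "compact K" "K <= Om" and off: "!!x. x : closure Om - K ==> psi x = 0"
 defines "psi0 \<equiv> %x. if x : Om then psi x else 0"
 shows "L-lipschitz_on UNIV psi0" "!!x. x ~: K ==> psi0 x = 0"
 "!!x. x : Om ==> divergence psi0 x = divergence psi x" "!!x. x ~: Om ==> divergence psi0 x = 0"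
proof -
 have L0: "0 <= L" by (rule lipschitz_on_nonneg[OF L])
 show z: "x ~: K ==> psi0 x = 0" for x using off[of x] closure_subset[of Om] by (auto simp: psi0_def)
 have cross: "dist (psi x) 0 <= L * dist x y" if "x : Om" "y ~: Om" for x y
 proof -
 have "closed_segment x y Int frontier Om ~= {}"
  using that by (intro connected_Int_frontier convex_connected convex_closed_segment) auto
 then obtain p where p: "p : closed_segment x y" "p : frontier Om" by blast
 have pc: "p : closure Om - K" using p(2) K(2) Om by (auto simp: frontier_def interior_open)
 have "dist (psi x) (psi p) <= L * dist x p" using that(1) pc closure_subset[of Om] by (intro lipschitz_onD[OF L]) auto
 also have "... <= L * dist x y" using dist_in_closed_segment[OF p(1)] L0 by (intro mult_left_mono) (auto simp: dist_commute)
 finally show ?thesis using off[OF pc] by simp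
 qed
 show "L-lipschitz_on UNIV psi0"
 proof (rule lipschitz_onI[OF _ L0])
 fix x y
 show "dist (psi0 x) (psi0 y) <= L * dist x y"
  using lipschitz_onD[OF L, of x y] cross[of x y] cross[of y x] closure_subset[of Om] L0
  by (cases "x : Om"; cases "y : Om") (auto simp: psi0_def dist_commute)
 qed
 show "divergence psi0 x = divergence psi x" if x: "x : Om" for x
 proof -
 have "(psi0 has_derivative D) (at x) \<longleftrightarrow> (psi has_derivative D) (at x)" for D
  using has_derivative_transform_within_open[OF _ Om x, of psi0 D UNIV psi] has_derivative_transform_within_open[OF _ Om x, of psi D UNIV psi0]
  by (auto simp: psi0_def)
 thus ?thesis by (simp add: divergence_def frechet_derivative_def)
 qed
 show "divergence psi0 x = 0" if x: "x ~: Om" for x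
 proof -
 have "open (- K)" "x : - K" using compact_imp_closed[OF K(1)] K(2) x by auto
 hence "(psi0 has_derivative (%_. 0)) (at x)"
  by (intro has_derivative_transform_within_open[OF has_derivative_const[of 0]]) (use z in auto)
 thus ?thesis unfolding divergence_def by (simp add: frechet_derivative_at[symmetric])
 qed
qed

theorem mainTheorem9:
  fixes \<Omega> E :: "(real ^ 'n) set"
    and \<alpha> \<beta> :: real
    and \<psi> :: "real ^ 'n \<Rightarrow> real ^ 'n"
  assumes "open \<Omega>" and "bounded \<Omega>" and "lipschitz_boundary \<Omega>"
    and "\<alpha> > 0"
    and "compact E" and "E \<subseteq> \<Omega>" and "C11_boundary E"
    and "\<exists>L. L-lipschitz_on (closure \<Omega>) \<psi>"
    and "\<forall>x\<in>frontier E. inner_unit_normal E x (\<psi> x)"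
    and "\<exists>W. open W \<and> frontier E \<subseteq> W \<and> compact (closure W) \<and> closure W \<subseteq> \<Omega> \<and>
           (\<forall>x\<in>closure \<Omega> - W. \<psi> x = 0)"
    and "\<forall>x\<in>closure \<Omega>. norm (\<psi> x) \<le> 1"
    and "ennreal \<beta> >
           max (ennreal (1 / 16) * Linf_norm (lebesgue_on \<Omega>) (divergence \<psi>) + ennreal (1 / 128))
               (ennreal (16 * \<alpha>) * Linf_norm (lebesgue_on \<Omega>) (divergence \<psi>) + ennreal (64 * \<alpha>\<^sup>2))"
  shows "absolute_minimizer (SBV \<Omega>) (mumford_shah \<Omega> \<alpha> \<beta> (indicat_real E)) (indicat_real E) \<and>
         (\<forall>u. absolute_minimizer (SBV \<Omega>) (mumford_shah \<Omega> \<alpha> \<beta> (indicat_real E)) u \<longrightarrow>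
            (AE x in lebesgue_on \<Omega>. u x = indicat_real E x))"
proof -
 note \<Omega> = assms(1) and \<alpha> = assms(4) and E = assms(5,6)
 obtain L where L: "L-lipschitz_on (closure \<Omega>) \<psi>" using assms(8) by blast
 obtain W where W: "compact (closure W)" "closure W <= \<Omega>" "!!x. x : closure \<Omega> - W ==> \<psi> x = 0" using assms(10) by blast
 define K where "K = closure W"
 have K: "compact K" "K <= \<Omega>" using W by (auto simp: K_def)
 have off: "x : closure \<Omega> - K ==> \<psi> x = 0" for x using W(3)[of x] closure_subset[of W] by (auto simp: K_def)
 define \<psi>0 where "\<psi>0 x = (if x : \<Omega> then \<psi> x else 0)" for x
 note ext = extend_compactly_supported_field[OF \<Omega> L K off, folded \<psi>0_def[abs_def]]
 have ext2: "x ~: K ==> \<psi>0 x = 0" for x using ext(2)[of x] by (simp add: \<psi>0_def)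
 have FE: "frontier E <= \<Omega>" using frontier_subset_compact[OF E(1)] E(2) by auto
 have n1: "norm (\<psi>0 x) <= 1" for x using assms(11) closure_subset[of \<Omega>] by (auto simp: \<psi>0_def)
 have nc: "continuous_on UNIV \<psi>0" by (rule lipschitz_on_continuous_on[OF ext(1)])
 have nb: "blowup E z (\<psi>0 z)" if "z : frontier E" for z
 proof -
 have "inner_unit_normal E z (\<psi> z)" using assms(9) that by blast
 moreover have "\<psi>0 z = \<psi> z" using that FE by (auto simp: \<psi>0_def)
 ultimately show ?thesis using inner_unit_normal_blowup by simp
 qed
 define H where "H = density (hausdorff_measure (DIM(real ^ 'n) - 1)) (indicator (frontier E))"
 note pu = C11_boundary_perim[OF E(1) assms(7) nc nb, folded H_def]
 have null: "frontier E : null_sets lborel" by (rule pu(2))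
 have P: "perim \<Omega> E H \<psi>0" by (rule perim.perim_subset[OF pu(1) \<Omega> subset_UNIV FE])
 note sbv = indicator_SBV[OF \<Omega> E null P[unfolded H_def]]
 have Hh: "emeasure H UNIV = hausdorff_outer (DIM(real ^ 'n) - 1) (frontier E)"
 unfolding H_def by (simp add: emeasure_restricted emeasure_hausdorff_measure)
 interpret perim \<Omega> E H \<psi>0 by (rule P)
 define D where "D = Linf_norm (lebesgue_on \<Omega>) (divergence \<psi>)"
 have \<beta>: "ennreal (16 * \<alpha>) * D + ennreal (64 * \<alpha>\<^sup>2) < ennreal \<beta>" using assms(12) by (simp add: D_def)
 \<comment> \<open>An infinite norm would make the lower bound for \<beta> infinite, as \<alpha> is
   positive.\<close>
 have Df: "D < top"
 proof (rule ccontr)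
 assume "\<not> D < top"
 hence "D = top" by (simp add: not_less top_unique)
 thus False using \<beta> \<alpha> by (simp add: ennreal_mult_top)
 qed
 define d where "d = enn2real D"
 have d: "0 <= d" "D = ennreal d" using Df by (auto simp: d_def)
 have \<beta>0: "16 * \<alpha> * d + 64 * \<alpha>\<^sup>2 < \<beta>"
 proof -
 have "ennreal (16 * \<alpha> * d + 64 * \<alpha>\<^sup>2) < ennreal \<beta>" using \<beta> \<alpha> d by (simp add: ennreal_mult ennreal_plus)
 thus ?thesis using \<alpha> d by (subst (asm) ennreal_less_iff) auto
 qed
 have "AE x in lebesgue_on \<Omega>. ennreal \<bar>divergence \<psi> x\<bar> <= D" unfolding D_def Linf_norm_def by (rule esssup_AE)
 hence "AE x in lebesgue. x : \<Omega> --> ennreal \<bar>divergence \<psi> x\<bar> <= D" using \<Omega> by (subst (asm) AE_restrict_space_iff) auto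
 hence "AE x in lborel. x : \<Omega> --> ennreal \<bar>divergence \<psi> x\<bar> <= D" by (simp add: AE_completion_iff)
 hence div: "AE x in lborel. \<bar>divergence \<psi>0 x\<bar> <= d"
 proof eventually_elim
 case (elim x)
 thus ?case using d ext(3,4)[of x] by (cases "x : \<Omega>") auto
 qed
 have lc: "lipschitz_compact (%x. \<psi>0 x \<bullet> b) L K" if b: "b : Basis" for b
 proof (rule lipschitz_compact.intro)
 show "L-lipschitz_on UNIV (%x. \<psi>0 x \<bullet> b)"
 proof (rule lipschitz_onI[OF _ lipschitz_on_nonneg[OF L]])
  fix x y
  have "dist (\<psi>0 x \<bullet> b) (\<psi>0 y \<bullet> b) <= dist (\<psi>0 x) (\<psi>0 y)"
  using Basis_le_norm[OF b, of "\<psi>0 x - \<psi>0 y"] by (simp add: dist_norm inner_diff_left)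
  also have "... <= L * dist x y" by (rule lipschitz_onD[OF ext(1)]) auto
  finally show "dist (\<psi>0 x \<bullet> b) (\<psi>0 y \<bullet> b) <= L * dist x y" .
 qed
 qed (use K ext2 in auto)
 \<comment> \<open>This constant of \<open>calibrated_energy_bound\<close> lies strictly below
   \<beta>, since 3 \<alpha> d + 9 \<alpha>^2 is smaller than 16 \<alpha> d + 64 \<alpha>^2. The
   excess \<kappa> in front of the fidelity integral yields uniqueness.\<close>
 define c where "c = 3 * \<alpha> * d + 9 * \<alpha>\<^sup>2"
 define \<kappa> where "\<kappa> = \<beta> - c"
 have pos: "0 <= \<alpha> * d" "0 < \<alpha>\<^sup>2" using \<alpha> d by auto
 have c: "0 <= c" "0 < \<kappa>" unfolding c_def \<kappa>_def mult.assoc using pos \<beta>0[unfolded mult.assoc] by linarith+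
 let ?F = "mumford_shah \<Omega> \<alpha> \<beta> (indicat_real E)"
 let ?h = "ennreal (\<alpha> * measure H UNIV)"
 define Q where "Q u = (\<integral>\<^sup>+x. ennreal ((u x - indicat_real E x)\<^sup>2) \<partial>lebesgue_on \<Omega>)" for u
 have Fg: "?F (indicat_real E) = ?h"
 proof -
 have "(\<integral>\<^sup>+x. ennreal ((norm (approx_gradient \<Omega> (indicat_real E) x))\<^sup>2) \<partial>lebesgue_on \<Omega>) = (\<integral>\<^sup>+x. 0 \<partial>lebesgue_on \<Omega>)"
  using sbv(2) by (intro nn_integral_cong_AE) (auto elim: eventually_mono)
 thus ?thesis unfolding mumford_shah_def sbv(3) Hh[symmetric] using \<alpha> by (simp add: emeasure_eq_measure ennreal_mult)
 qed
 have lower: "?h + ennreal \<kappa> * Q u <= ?F u" if u: "u : SBV \<Omega>" for u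
 proof -
 define A where "A = (\<integral>\<^sup>+x. ennreal ((norm (approx_gradient \<Omega> u x))\<^sup>2) \<partial>lebesgue_on \<Omega>)"
 define S where "S = hausdorff_outer (DIM(real ^ 'n) - 1) (singular_set \<Omega> u)"
 have F: "?F u = A + ennreal \<alpha> * S + ennreal \<beta> * Q u" by (simp only: mumford_shah_def A_def S_def Q_def)
 show ?thesis
 proof (cases "A < \<infinity> & S < \<infinity> & Q u < \<infinity>")
  case True
  have "?h <= A + ennreal \<alpha> * S + ennreal c * Q u"
  unfolding A_def S_def Q_def c_def
  by (rule calibrated_energy_bound[OF \<Omega> u P E(2) \<alpha> d(1) lc K ext2 n1 div]) (use True[unfolded A_def S_def Q_def] in blast)+
  hence "?h + ennreal \<kappa> * Q u <= (A + ennreal \<alpha> * S + ennreal c * Q u) + ennreal \<kappa> * Q u" by (rule add_right_mono)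
  also have "... = A + ennreal \<alpha> * S + (ennreal c + ennreal \<kappa>) * Q u" by (simp add: distrib_right add.assoc)
  also have "ennreal c + ennreal \<kappa> = ennreal \<beta>" using c by (simp add: ennreal_plus[symmetric] \<kappa>_def)
  finally show ?thesis by (simp only: F)
 next
  \<comment> \<open>One term of the functional is infinite then, and its coefficient is
    positive.\<close>
  case False
  hence "A = top \<or> S = top \<or> Q u = top" by (simp add: not_less top_unique)
  moreover have "0 < \<beta>" using c by (simp add: \<kappa>_def)
  ultimately have "?F u = top" using \<alpha> by (auto simp: F ennreal_mult_top)
  thus ?thesis by simp
 qed
 qed
 have min: "absolute_minimizer (SBV \<Omega>) ?F (indicat_real E)"
 unfolding absolute_minimizer_def Fg
 proof (intro conjI ballI sbv(1))
 fix v assume "v : SBV \<Omega>"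
 thus "?h <= ?F v" by (intro order_trans[OF _ lower]) auto
 qed
 have "AE x in lebesgue_on \<Omega>. u x = indicat_real E x" if u: "absolute_minimizer (SBV \<Omega>) ?F u" for u
 proof -
 have us: "u : SBV \<Omega>" "?F u <= ?h" using u sbv(1) unfolding absolute_minimizer_def Fg[symmetric] by auto
 \<comment> \<open>The energy \<open>?h\<close> of the indicator is finite and can be
   cancelled.\<close>
 have "?h + ennreal \<kappa> * Q u <= ?h + 0" using order_trans[OF lower[OF us(1)] us(2)] by simp
 hence "ennreal \<kappa> * Q u = 0" by (subst (asm) ennreal_add_left_cancel_le) auto
 hence "Q u = 0" using c(2) by simp
 moreover have "u : borel_measurable (lebesgue_on \<Omega>)" using us(1) by (auto simp: SBV_def BV_def)
 moreover have "indicat_real E : borel_measurable (lebesgue_on \<Omega>)" using E_sets by (intro measurable_restrict_space1 measurable_completion) simp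
 ultimately have "AE x in lebesgue_on \<Omega>. ennreal ((u x - indicat_real E x)\<^sup>2) = 0" unfolding Q_def by (subst (asm) nn_integral_0_iff_AE) auto
 thus ?thesis by eventually_elim simp
 qed
 thus ?thesis using min by blast
qed

end
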